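(* Let $p$ be an odd prime and $A$ a complete discrete valuation ring with maximal ideal generated by $p$ and residue field $\mathbb F=A/pA$ algebraic over $\mathbb F_p$. Let $a_1,a_2,a_3\in A$ with $(a_1-a_2)(a_2-a_3)(a_3-a_1)\in A^\times$, and let $X$, $\overline X=X\otimes_A\mathbb F$, $\overline\delta^{cl}$ and the notion of arithmetic Euler flow on $\widehat X$ be as defined in the context. Assume $\mathbb F$ is infinite. Then the quotient set $$\frac{\{\text{arithmetic Euler flows on }\widehat X\}}{\{\text{congruence mod } p\}}$$ is a principal homogeneous space for the $\mathbb F$-linear space $$\{\overline K\in\mathcal O(\overline X)\ ;\ \overline\delta^{cl}\overline K=0\},$$ where $\overline K$ acts by sending the class of an arithmetic Euler flow $\delta^X$ to the class of arithmetic Euler flows $\tilde\delta^X$ with $\tilde\delta^Xx_3\equiv \delta^Xx_3+K \bmod p$, for $K\in\mathcal O(\widehat X)$ any lift of $\overline K$.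
   Context: Hats denote $p$-adic completion of rings or schemes; for affine $X=\mathrm{Spec}\,B$, $\mathcal O(\widehat X)=\widehat B=\varprojlim B/p^nB$. A Frobenius lift on a ring $B$ is a ring endomorphism $\phi$ of $B$ with $\phi(b)\equiv b^p \bmod pB$. If $p$ is a non-zero divisor in $B$, a $p$-derivation on $B$ is a map of sets $\delta:B\to B$ such that $\phi(b):=b^p+p\,\delta b$ is a ring homomorphism; $\phi$ is then the Frobenius lift attached to $\delta$. The ring $A$ has a unique $p$-derivation, also denoted $\delta$, and a unique Frobenius lift; all $p$-derivations and Frobenius lifts on $A$-algebras are assumed compatible with those on $A$. Polynomials: $H_1=\sum_{i=1}^3a_ix_i^2$, $H_2=\sum_{i=1}^3x_i^2$ in $A[x_1,x_2,x_3]$; $N(z_1,z_2)=\prod_{i=1}^3(z_1-a_iz_2)$. Put $$F=\big((a_2-a_3)x^2+z_1-a_2z_2\big)\big((a_3-a_1)x^2-z_1+a_1z_2\big)\in A[z_1,z_2][x],$$ and let $A_{p-1}=A_{p-1}(z_1,z_2)\in A[z_1,z_2]$ (the Hasse invariant of $F$) be the coefficient of $x^{p-1}$ in $F^{(p-1)/2}$. Set $Q=x_1x_2\cdot N(H_1,H_2)\cdot A_{p-1}(H_1,H_2)$ and $X=\mathrm{Spec}\,A[x_1,x_2,x_3][1/Q]$. Level sets: for $c=(c_1,c_2)\in A^2$, $E_c=\mathrm{Spec}\,A[x_1,x_2,x_3]/(H_1-c_1,H_2-c_2)$ with inclusion $i_c:E_c\to\mathbb A^3$, and $E_c^0:=E_c\cap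 X$. When $N(c_1,c_2)\in A^\times$, $E_c$ is smooth over $A$ and carries the canonical $1$-form $$\omega_c=i_c^*\frac{dx_1}{(a_2-a_3)x_2x_3}=i_c^*\frac{dx_2}{(a_3-a_1)x_3x_1}=i_c^*\frac{dx_3}{(a_1-a_2)x_1x_2},$$ whose restriction to $E_c^0$ is still denoted $\omega_c$. The Frobenius lift $\phi_c$: if $\delta^X$ is a $p$-derivation on $\mathcal O(\widehat X)$ with $\delta^XH_1=\delta^XH_2=0$ and $\delta c_1=\delta c_2=0$, the attached Frobenius lift $\phi^X$ satisfies $\phi^X(H_i)=H_i^p$ and $\phi(c_i)=c_i^p$, so it induces a Frobenius lift $\phi_c$ on $\mathcal O(\widehat{E_c^0})$. It acts on ($p$-adically completed) $1$-forms by $\phi_c^*(f\,dg)=\phi_c(f)\,d(\phi_c(g))$; $\phi_c^*$ of any $1$-form is divisible by $p$, and $\frac{\phi_c^*}{p}$ denotes the result of dividing by $p$. An arithmetic Euler flow on $\widehat X$ (attached to $H_1,H_2$) is a $p$-derivation $\delta^X$ on $\mathcal O(\widehat X)$ such that: (1) $\delta^XH_1=\delta^XH_2=0$ in $\mathcal O(\widehat X)$; (2) for every $c=(c_1,c_2)\in A^2$ with $\delta c_1=\delta c_2=0$ and $N(c_1,c_2)A_{p-1}(c_1,c_2)\not\equiv0\bmod p$, one has $\frac{\phi_c^*}{p}\omega_c\equiv A_{p-1}(c_1,c_2)^{-1}\omega_c \bmod p$ on $\widehat{E_c^0}$. Two $p$-derivations $\delta^X,\tilde\delta^X$ on $\mathcal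 O(\widehat X)$ are congruent mod $p$ if $\delta^XK\equiv\tilde\delta^XK\bmod p$ for all $K\in\mathcal O(\widehat X)$. $\overline\delta^{cl}$ is the $\mathbb F$-linear derivation on $\mathcal O(\overline X)$ given by (with $a_i$ reduced mod $p$) $\overline\delta^{cl}x_1=(a_2-a_3)x_2x_3$, $\overline\delta^{cl}x_2=(a_3-a_1)x_3x_1$, $\overline\delta^{cl}x_3=(a_1-a_2)x_1x_2$. A set is a principal homogeneous space for a group if it has a simply transitive action of that group (the group here is the additive group of the $\mathbb F$-linear space). *)

theory Defs
  imports "HOL-Algebra.Algebra" "HOL-Algebra.Algebraic_Closure_Type"
begin

section \<open>$p$-adic completions\<close>

definition multiples :: "('r, 'x) ring_scheme \<Rightarrow> nat \<Rightarrow> 'r set"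
  where "multiples M m = {[m] \<cdot>\<^bsub>M\<^esub> x | x. x \<in> carrier M}"

definition cong_mod :: "nat \<Rightarrow> ('r, 'x) ring_scheme \<Rightarrow> 'r \<Rightarrow> 'r \<Rightarrow> bool"
  where "cong_mod p M x y \<longleftrightarrow> x \<ominus>\<^bsub>M\<^esub> y \<in> multiples M p"

text \<open>The inverse limit of the rings $R/p^nR$: an element is a sequence of cosets, and
  compatibility with the transition maps says that the coset modulo $p^{n+1}$ is contained in the
  coset modulo $p^n$.\<close>

definition padic_completion :: "nat \<Rightarrow> ('r, 'x) ring_scheme \<Rightarrow> (nat \<Rightarrow> 'r set) ring"
  where "padic_completion p R =
    \<lparr>carrier = {f. \<forall>n. f n \<in> carrier (R Quot multiples R (p ^ n)) \<and> f (Suc n) \<subseteq> f n},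
     monoid.mult = (\<lambda>f g n. f n \<otimes>\<^bsub>R Quot multiples R (p ^ n)\<^esub> g n),
     one = (\<lambda>n. \<one>\<^bsub>R Quot multiples R (p ^ n)\<^esub>),
     ring.zero = (\<lambda>n. \<zero>\<^bsub>R Quot multiples R (p ^ n)\<^esub>),
     add = (\<lambda>f g n. f n \<oplus>\<^bsub>R Quot multiples R (p ^ n)\<^esub> g n)\<rparr>"

text \<open>The next two maps only use the additive structure, so they serve for rings and for modules:
  the canonical map to the completion, and the map of completions induced by an additive map
  \<open>h\<close> into \<open>M'\<close>.\<close>

definition to_completion :: "nat \<Rightarrow> ('r, 'x) ring_scheme \<Rightarrow> 'r \<Rightarrow> nat \<Rightarrow> 'r set"
  where "to_completion p M r = (\<lambda>n. multiples M (p ^ n) +>\<^bsub>M\<^esub> r)"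

definition completion_map ::
    "nat \<Rightarrow> ('s, 'x) ring_scheme \<Rightarrow> ('r \<Rightarrow> 's) \<Rightarrow> (nat \<Rightarrow> 'r set) \<Rightarrow> nat \<Rightarrow> 's set"
  where "completion_map p M' h f =
    (\<lambda>n. the_elem ((\<lambda>r. multiples M' (p ^ n) +>\<^bsub>M'\<^esub> h r) ` f n))"


section \<open>Complete discrete valuation rings with uniformizer $p$\<close>

definition complete_dvr :: "nat \<Rightarrow> ('r, 'x) ring_scheme \<Rightarrow> bool"
  where "complete_dvr p R \<longleftrightarrow>
    principal_domain R \<and> [p] \<cdot>\<^bsub>R\<^esub> \<one>\<^bsub>R\<^esub> \<noteq> \<zero>\<^bsub>R\<^esub> \<and>
    (\<forall>M. maximalideal M R \<longleftrightarrow> M = PIdl\<^bsub>R\<^esub> ([p] \<cdot>\<^bsub>R\<^esub> \<one>\<^bsub>R\<^esub>)) \<and>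
    bij_betw (to_completion p R) (carrier R) (carrier (padic_completion p R))"

abbreviation residue_field :: "nat \<Rightarrow> ('r, 'x) ring_scheme \<Rightarrow> 'r set ring"
  where "residue_field p R \<equiv> R Quot PIdl\<^bsub>R\<^esub> ([p] \<cdot>\<^bsub>R\<^esub> \<one>\<^bsub>R\<^esub>)"

text \<open>In positive characteristic the integer multiples of the identity are the prime field.\<close>

definition algebraic_over_prime_field :: "('r, 'x) ring_scheme \<Rightarrow> bool"
  where "algebraic_over_prime_field F \<longleftrightarrow>
    (\<forall>x \<in> carrier F. (ring.algebraic F over range (\<lambda>n::int. [n] \<cdot>\<^bsub>F\<^esub> \<one>\<^bsub>F\<^esub>)) x)"


section \<open>$p$-derivations\<close>

definition frob :: "nat \<Rightarrow> ('r, 'x) ring_scheme \<Rightarrow> ('r \<Rightarrow> 'r) \<Rightarrow> 'r \<Rightarrow> 'r"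
  where "frob p R \<delta> b = b [^]\<^bsub>R\<^esub> p \<oplus>\<^bsub>R\<^esub> [p] \<cdot>\<^bsub>R\<^esub> \<delta> b"

definition p_derivation :: "nat \<Rightarrow> ('r, 'x) ring_scheme \<Rightarrow> ('r \<Rightarrow> 'r) \<Rightarrow> bool"
  where "p_derivation p R \<delta> \<longleftrightarrow>
    \<delta> \<in> carrier R \<rightarrow>\<^sub>E carrier R \<and> frob p R \<delta> \<in> ring_hom R R"

definition the_p_derivation :: "nat \<Rightarrow> 'a::idom \<Rightarrow> 'a"
  where "the_p_derivation p = (THE \<delta>. p_derivation p ring_of_type_algebra \<delta>)"


section \<open>Completed modules of differentials\<close>

text \<open>Modules reuse the ring record; their fields \<open>mult\<close> and \<open>one\<close> are irrelevant.\<close>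

definition quot_module :: "('r, 'm, 'x) module_scheme \<Rightarrow> 'm set \<Rightarrow> ('r, 'm set) module"
  where "quot_module M N =
    \<lparr>carrier = a_rcosets\<^bsub>M\<^esub> N, monoid.mult = undefined, one = undefined,
     ring.zero = N, add = set_add M,
     module.smult = (\<lambda>r U. \<Union>x\<in>U. N +>\<^bsub>M\<^esub> (r \<odot>\<^bsub>M\<^esub> x))\<rparr>"

definition padic_completion_module ::
    "nat \<Rightarrow> ('r, 'm, 'x) module_scheme \<Rightarrow> ('r, nat \<Rightarrow> 'm set) module"
  where "padic_completion_module p M =
    \<lparr>carrier = {f. \<forall>n. f n \<in> carrier (quot_module M (multiples M (p ^ n))) \<and> f (Suc n) \<subseteq> f n},
     monoid.mult = undefined, one = undefined,
     ring.zero = (\<lambda>n. \<zero>\<^bsub>quot_module M (multiples M (p ^ n))\<^esub>),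
     add = (\<lambda>f g n. f n \<oplus>\<^bsub>quot_module M (multiples M (p ^ n))\<^esub> g n),
     module.smult = (\<lambda>r f n. r \<odot>\<^bsub>quot_module M (multiples M (p ^ n))\<^esub> f n)\<rparr>"

text \<open>The module of differentials of \<open>R\<close> over a subset \<open>S\<close> (the image of the base ring): the free
  module on symbols $[dg]$, $g \in R$, modulo additivity, the Leibniz rule and $ds = 0$ for
  \<open>s \<in> S\<close>.\<close>

definition free_module :: "('r, 'x) ring_scheme \<Rightarrow> ('r, 'r \<Rightarrow> 'r) module"
  where "free_module R =
    \<lparr>carrier = {u. (\<forall>x. u x \<in> carrier R) \<and> (\<forall>x. x \<notin> carrier R \<longrightarrow> u x = \<zero>\<^bsub>R\<^esub>) \<and>
                  finite {x. u x \<noteq> \<zero>\<^bsub>R\<^esub>}},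
     monoid.mult = undefined, one = undefined,
     ring.zero = (\<lambda>x. \<zero>\<^bsub>R\<^esub>), add = (\<lambda>u v x. u x \<oplus>\<^bsub>R\<^esub> v x),
     module.smult = (\<lambda>r u x. r \<otimes>\<^bsub>R\<^esub> u x)\<rparr>"

definition free_gen :: "('r, 'x) ring_scheme \<Rightarrow> 'r \<Rightarrow> 'r \<Rightarrow> 'r"
  where "free_gen R g = (\<lambda>x. if x = g then \<one>\<^bsub>R\<^esub> else \<zero>\<^bsub>R\<^esub>)"

definition kahler_relators :: "('r, 'x) ring_scheme \<Rightarrow> 'r set \<Rightarrow> ('r \<Rightarrow> 'r) set"
  where "kahler_relators R S =
    {free_gen R (g \<oplus>\<^bsub>R\<^esub> h) \<ominus>\<^bsub>free_module R\<^esub> free_gen R g \<ominus>\<^bsub>free_module R\<^esub> free_gen R h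
      | g h. g \<in> carrier R \<and> h \<in> carrier R} \<union>
    {free_gen R (g \<otimes>\<^bsub>R\<^esub> h) \<ominus>\<^bsub>free_module R\<^esub> g \<odot>\<^bsub>free_module R\<^esub> free_gen R h
        \<ominus>\<^bsub>free_module R\<^esub> h \<odot>\<^bsub>free_module R\<^esub> free_gen R g
      | g h. g \<in> carrier R \<and> h \<in> carrier R} \<union>
    free_gen R ` S"

definition kahler_relations :: "('r, 'x) ring_scheme \<Rightarrow> 'r set \<Rightarrow> ('r \<Rightarrow> 'r) set"
  where "kahler_relations R S =
    \<Inter>{N. submodule N R (free_module R) \<and> kahler_relators R S \<subseteq> N}"

definition kahler :: "('r, 'x) ring_scheme \<Rightarrow> 'r set \<Rightarrow> ('r, ('r \<Rightarrow> 'r) set) module"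
  where "kahler R S = quot_module (free_module R) (kahler_relations R S)"

definition kahler_d :: "('r, 'x) ring_scheme \<Rightarrow> 'r set \<Rightarrow> 'r \<Rightarrow> ('r \<Rightarrow> 'r) set"
  where "kahler_d R S g = kahler_relations R S +>\<^bsub>free_module R\<^esub> free_gen R g"

text \<open>The pullback $\sum f_i\,dg_i \mapsto \sum \phi(f_i)\,d\phi(g_i)$ along an endomorphism
  \<open>\<phi>\<close> of \<open>R\<close> that preserves \<open>S\<close>; a class is given by its representatives in the free
  module.\<close>

definition kahler_pullback ::
    "('r, 'x) ring_scheme \<Rightarrow> 'r set \<Rightarrow> ('r \<Rightarrow> 'r) \<Rightarrow> ('r \<Rightarrow> 'r) set \<Rightarrow> ('r \<Rightarrow> 'r) set"
  where "kahler_pullback R S \<phi> U =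
    the_elem ((\<lambda>u. \<Oplus>\<^bsub>kahler R S\<^esub>g\<in>{g. u g \<noteq> \<zero>\<^bsub>R\<^esub>}.
                 \<phi> (u g) \<odot>\<^bsub>kahler R S\<^esub> kahler_d R S (\<phi> g)) ` U)"


section \<open>Polynomials\<close>

text \<open>The ring $A[x_1,x_2,x_3]$ is \<open>'a poly poly poly\<close>, with $x_3$ the outermost variable; only
  the indices 1, 2, 3 of \<open>var\<close>, and of the coefficient family \<open>a\<close> below, matter.\<close>

definition cst :: "'a::comm_ring_1 \<Rightarrow> 'a poly poly poly"
  where "cst c = [:[:[:c:]:]:]"

definition var :: "nat \<Rightarrow> 'a::comm_ring_1 poly poly poly"
  where "var i = (if i = 1 then [:[:[:0, 1:]:]:] else if i = 2 then [:[:0, 1:]:] else [:0, 1:])"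

definition H1 :: "(nat \<Rightarrow> 'a::comm_ring_1) \<Rightarrow> 'a poly poly poly"
  where "H1 a = (\<Sum>i = 1..3. cst (a i) * var i ^ 2)"

definition H2 :: "'a::comm_ring_1 poly poly poly"
  where "H2 = (\<Sum>i = 1..3. var i ^ 2)"

text \<open>The ring $A[z_1,z_2]$ is \<open>'a poly poly\<close> with $z_2$ the outer variable; \<open>eval2 \<iota> f b1 b2\<close>
  is $f(b_1,b_2)$ in an $A$-algebra with structure map \<open>\<iota>\<close>.\<close>

definition eval2 :: "('a::comm_ring_1 \<Rightarrow> 'b::comm_ring_1) \<Rightarrow> 'a poly poly \<Rightarrow> 'b \<Rightarrow> 'b \<Rightarrow> 'b"
  where "eval2 \<iota> f b1 b2 = poly (map_poly (\<lambda>g. poly (map_poly \<iota> g) b1) f) b2"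

definition N_poly :: "(nat \<Rightarrow> 'a::comm_ring_1) \<Rightarrow> 'a poly poly"
  where "N_poly a = (\<Prod>i = 1..3. [:[:0, 1:]:] - [:[:a i:]:] * [:0, 1:])"

text \<open>In $A[z_1,z_2][x]$ the variables $z_1, z_2, x$ are \<open>var 1\<close>, \<open>var 2\<close>, \<open>var 3\<close>.\<close>

definition F_poly :: "(nat \<Rightarrow> 'a::comm_ring_1) \<Rightarrow> 'a poly poly poly"
  where "F_poly a =
    (cst (a 2 - a 3) * var 3 ^ 2 + var 1 - cst (a 2) * var 2) *
    (cst (a 3 - a 1) * var 3 ^ 2 - var 1 + cst (a 1) * var 2)"

definition hasse :: "nat \<Rightarrow> (nat \<Rightarrow> 'a::comm_ring_1) \<Rightarrow> 'a poly poly"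
  where "hasse p a = Polynomial.coeff (F_poly a ^ ((p - 1) div 2)) (p - 1)"

definition Q_poly :: "nat \<Rightarrow> (nat \<Rightarrow> 'a::comm_ring_1) \<Rightarrow> 'a poly poly poly"
  where "Q_poly p a =
    var 1 * var 2 * eval2 cst (N_poly a) (H1 a) H2 * eval2 cst (hasse p a) (H1 a) H2"


section \<open>The scheme $X$, its completion and its reduction\<close>

definition O_X :: "nat \<Rightarrow> (nat \<Rightarrow> 'a::idom) \<Rightarrow> 'a poly poly poly fract ring"
  where "O_X p a = ring_of_type_algebra \<lparr>carrier := {Fract f (Q_poly p a ^ n) | f n. True}\<rparr>"

type_synonym 'a X_hat = "nat \<Rightarrow> 'a poly poly poly fract set"

definition O_Xhat :: "nat \<Rightarrow> (nat \<Rightarrow> 'a::idom) \<Rightarrow> 'a X_hat ring"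
  where "O_Xhat p a = padic_completion p (O_X p a)"

definition in_Xhat :: "nat \<Rightarrow> (nat \<Rightarrow> 'a::idom) \<Rightarrow> 'a poly poly poly \<Rightarrow> 'a X_hat"
  where "in_Xhat p a f = to_completion p (O_X p a) (Fract f 1)"

definition O_Xbar :: "nat \<Rightarrow> (nat \<Rightarrow> 'a::idom) \<Rightarrow> 'a poly poly poly fract set ring"
  where "O_Xbar p a = O_X p a Quot multiples (O_X p a) p"

definition in_Xbar :: "nat \<Rightarrow> (nat \<Rightarrow> 'a::idom) \<Rightarrow> 'a poly poly poly \<Rightarrow> 'a poly poly poly fract set"
  where "in_Xbar p a f = multiples (O_X p a) p +>\<^bsub>O_X p a\<^esub> Fract f 1"

text \<open>The reduction $\mathcal{O}(\widehat X) \to \mathcal{O}(\overline X)$ reads off the coset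
  modulo $p^1$.\<close>

definition reduction :: "'a::idom X_hat \<Rightarrow> 'a poly poly poly fract set"
  where "reduction K = K 1"

definition is_delta_cl ::
    "nat \<Rightarrow> (nat \<Rightarrow> 'a::idom) \<Rightarrow>
      ('a poly poly poly fract set \<Rightarrow> 'a poly poly poly fract set) \<Rightarrow> bool"
  where "is_delta_cl p a D \<longleftrightarrow>
    (let R = O_Xbar p a; x = (\<lambda>i. in_Xbar p a (var i)); \<iota> = (\<lambda>c. in_Xbar p a (cst c)) in
     D \<in> carrier R \<rightarrow>\<^sub>E carrier R \<and>
     (\<forall>u \<in> carrier R. \<forall>v \<in> carrier R. D (u \<oplus>\<^bsub>R\<^esub> v) = D u \<oplus>\<^bsub>R\<^esub> D v) \<and>
     (\<forall>c. \<forall>u \<in> carrier R. D (\<iota> c \<otimes>\<^bsub>R\<^esub> u) = \<iota> c \<otimes>\<^bsub>R\<^esub> D u) \<and>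
     (\<forall>u \<in> carrier R. \<forall>v \<in> carrier R. D (u \<otimes>\<^bsub>R\<^esub> v) = u \<otimes>\<^bsub>R\<^esub> D v \<oplus>\<^bsub>R\<^esub> v \<otimes>\<^bsub>R\<^esub> D u) \<and>
     D (x 1) = \<iota> (a 2 - a 3) \<otimes>\<^bsub>R\<^esub> (x 2 \<otimes>\<^bsub>R\<^esub> x 3) \<and>
     D (x 2) = \<iota> (a 3 - a 1) \<otimes>\<^bsub>R\<^esub> (x 3 \<otimes>\<^bsub>R\<^esub> x 1) \<and>
     D (x 3) = \<iota> (a 1 - a 2) \<otimes>\<^bsub>R\<^esub> (x 1 \<otimes>\<^bsub>R\<^esub> x 2))"

definition delta_cl ::
    "nat \<Rightarrow> (nat \<Rightarrow> 'a::idom) \<Rightarrow> 'a poly poly poly fract set \<Rightarrow> 'a poly poly poly fract set"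
  where "delta_cl p a = (THE D. is_delta_cl p a D)"


section \<open>The level sets $E_c^0 = E_c \cap X$\<close>

definition level_ideal ::
    "nat \<Rightarrow> (nat \<Rightarrow> 'a::idom) \<Rightarrow> 'a \<Rightarrow> 'a \<Rightarrow> 'a poly poly poly fract set"
  where "level_ideal p a c1 c2 =
    Idl\<^bsub>O_X p a\<^esub> {Fract (H1 a - cst c1) 1, Fract (H2 - cst c2) 1}"

definition O_E :: "nat \<Rightarrow> (nat \<Rightarrow> 'a::idom) \<Rightarrow> 'a \<Rightarrow> 'a \<Rightarrow> 'a poly poly poly fract set ring"
  where "O_E p a c1 c2 = O_X p a Quot level_ideal p a c1 c2"

type_synonym 'a E_hat = "nat \<Rightarrow> 'a poly poly poly fract set set"

definition O_Ehat :: "nat \<Rightarrow> (nat \<Rightarrow> 'a::idom) \<Rightarrow> 'a \<Rightarrow> 'a \<Rightarrow> 'a E_hat ring"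
  where "O_Ehat p a c1 c2 = padic_completion p (O_E p a c1 c2)"

definition res_E :: "nat \<Rightarrow> (nat \<Rightarrow> 'a::idom) \<Rightarrow> 'a \<Rightarrow> 'a \<Rightarrow> 'a X_hat \<Rightarrow> 'a E_hat"
  where "res_E p a c1 c2 =
    completion_map p (O_E p a c1 c2) (\<lambda>b. level_ideal p a c1 c2 +>\<^bsub>O_X p a\<^esub> b)"

definition in_Ehat :: "nat \<Rightarrow> (nat \<Rightarrow> 'a::idom) \<Rightarrow> 'a \<Rightarrow> 'a \<Rightarrow> 'a poly poly poly \<Rightarrow> 'a E_hat"
  where "in_Ehat p a c1 c2 f = res_E p a c1 c2 (in_Xhat p a f)"

text \<open>The endomorphism of $\mathcal{O}(\widehat{E_c^0})$ induced by \<open>\<phi>\<close> through the surjection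
  \<open>res_E\<close>.\<close>

definition phi_E ::
    "nat \<Rightarrow> (nat \<Rightarrow> 'a::idom) \<Rightarrow> 'a \<Rightarrow> 'a \<Rightarrow> ('a X_hat \<Rightarrow> 'a X_hat) \<Rightarrow> 'a E_hat \<Rightarrow> 'a E_hat"
  where "phi_E p a c1 c2 \<phi> y =
    the_elem ((\<lambda>b. res_E p a c1 c2 (\<phi> b)) ` {b \<in> carrier (O_Xhat p a). res_E p a c1 c2 b = y})"

text \<open>$p$-adically completed 1-forms over $A$ on $\widehat{E_c^0}$.\<close>

definition base_E :: "nat \<Rightarrow> (nat \<Rightarrow> 'a::idom) \<Rightarrow> 'a \<Rightarrow> 'a \<Rightarrow> 'a E_hat set"
  where "base_E p a c1 c2 = range (\<lambda>s. in_Ehat p a c1 c2 (cst s))"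

definition Omega_E ::
    "nat \<Rightarrow> (nat \<Rightarrow> 'a::idom) \<Rightarrow> 'a \<Rightarrow> 'a \<Rightarrow>
      ('a E_hat, nat \<Rightarrow> ('a E_hat \<Rightarrow> 'a E_hat) set set) module"
  where "Omega_E p a c1 c2 =
    padic_completion_module p (kahler (O_Ehat p a c1 c2) (base_E p a c1 c2))"

definition d_E ::
    "nat \<Rightarrow> (nat \<Rightarrow> 'a::idom) \<Rightarrow> 'a \<Rightarrow> 'a \<Rightarrow> 'a E_hat \<Rightarrow> nat \<Rightarrow> ('a E_hat \<Rightarrow> 'a E_hat) set set"
  where "d_E p a c1 c2 g =
    to_completion p (kahler (O_Ehat p a c1 c2) (base_E p a c1 c2))
      (kahler_d (O_Ehat p a c1 c2) (base_E p a c1 c2) g)"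

definition pullback_E ::
    "nat \<Rightarrow> (nat \<Rightarrow> 'a::idom) \<Rightarrow> 'a \<Rightarrow> 'a \<Rightarrow> ('a E_hat \<Rightarrow> 'a E_hat) \<Rightarrow>
      (nat \<Rightarrow> ('a E_hat \<Rightarrow> 'a E_hat) set set) \<Rightarrow> nat \<Rightarrow> ('a E_hat \<Rightarrow> 'a E_hat) set set"
  where "pullback_E p a c1 c2 \<phi> =
    completion_map p (kahler (O_Ehat p a c1 c2) (base_E p a c1 c2))
      (kahler_pullback (O_Ehat p a c1 c2) (base_E p a c1 c2) \<phi>)"

text \<open>Of the three expressions for the canonical form, the one with $dx_3$ is used, because
  $x_1x_2$ (but not $x_3$) is invertible on all of $E_c^0$.\<close>

definition omega_E ::
    "nat \<Rightarrow> (nat \<Rightarrow> 'a::idom) \<Rightarrow> 'a \<Rightarrow> 'a \<Rightarrow> nat \<Rightarrow> ('a E_hat \<Rightarrow> 'a E_hat) set set"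
  where "omega_E p a c1 c2 =
    (inv\<^bsub>O_Ehat p a c1 c2\<^esub> in_Ehat p a c1 c2 (cst (a 1 - a 2) * var 1 * var 2))
      \<odot>\<^bsub>Omega_E p a c1 c2\<^esub> d_E p a c1 c2 (in_Ehat p a c1 c2 (var 3))"


section \<open>Arithmetic Euler flows\<close>

definition compatible_p_derivation ::
    "nat \<Rightarrow> (nat \<Rightarrow> 'a::idom) \<Rightarrow> ('a X_hat \<Rightarrow> 'a X_hat) \<Rightarrow> bool"
  where "compatible_p_derivation p a \<delta> \<longleftrightarrow>
    p_derivation p (O_Xhat p a) \<delta> \<and>
    (\<forall>s. \<delta> (in_Xhat p a (cst s)) = in_Xhat p a (cst (the_p_derivation p s)))"

text \<open>The form \<open>\<eta>\<close> is $\frac{\phi_c^*}{p}\omega_c$.\<close>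

definition arithmetic_euler_flow ::
    "nat \<Rightarrow> (nat \<Rightarrow> 'a::idom) \<Rightarrow> ('a X_hat \<Rightarrow> 'a X_hat) \<Rightarrow> bool"
  where "arithmetic_euler_flow p a \<delta> \<longleftrightarrow>
    compatible_p_derivation p a \<delta> \<and>
    \<delta> (in_Xhat p a (H1 a)) = \<zero>\<^bsub>O_Xhat p a\<^esub> \<and>
    \<delta> (in_Xhat p a H2) = \<zero>\<^bsub>O_Xhat p a\<^esub> \<and>
    (\<forall>c1 c2.
      the_p_derivation p c1 = 0 \<and> the_p_derivation p c2 = 0 \<and>
      \<not> of_nat p dvd eval2 id (N_poly a) c1 c2 * eval2 id (hasse p a) c1 c2 \<longrightarrow>
      (\<exists>\<eta> \<in> carrier (Omega_E p a c1 c2).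
        [p] \<cdot>\<^bsub>Omega_E p a c1 c2\<^esub> \<eta> =
          pullback_E p a c1 c2 (phi_E p a c1 c2 (frob p (O_Xhat p a) \<delta>)) (omega_E p a c1 c2) \<and>
        cong_mod p (Omega_E p a c1 c2) \<eta>
          (in_Ehat p a c1 c2 (cst (inv\<^bsub>ring_of_type_algebra\<^esub> eval2 id (hasse p a) c1 c2))
             \<odot>\<^bsub>Omega_E p a c1 c2\<^esub> omega_E p a c1 c2)))"

definition euler_flows :: "nat \<Rightarrow> (nat \<Rightarrow> 'a::idom) \<Rightarrow> ('a X_hat \<Rightarrow> 'a X_hat) set"
  where "euler_flows p a = Collect (arithmetic_euler_flow p a)"

definition flow_cong ::
    "nat \<Rightarrow> (nat \<Rightarrow> 'a::idom) \<Rightarrow> (('a X_hat \<Rightarrow> 'a X_hat) \<times> ('a X_hat \<Rightarrow> 'a X_hat)) set"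
  where "flow_cong p a =
    {(\<delta>, \<delta>'). \<delta> \<in> euler_flows p a \<and> \<delta>' \<in> euler_flows p a \<and>
      (\<forall>K \<in> carrier (O_Xhat p a). cong_mod p (O_Xhat p a) (\<delta> K) (\<delta>' K))}"

definition flow_classes :: "nat \<Rightarrow> (nat \<Rightarrow> 'a::idom) \<Rightarrow> ('a X_hat \<Rightarrow> 'a X_hat) set set"
  where "flow_classes p a = euler_flows p a // flow_cong p a"

definition delta_cl_kernel :: "nat \<Rightarrow> (nat \<Rightarrow> 'a::idom) \<Rightarrow> 'a poly poly poly fract set monoid"
  where "delta_cl_kernel p a =
    add_monoid (O_Xbar p a)
      \<lparr>carrier := {K \<in> carrier (O_Xbar p a). delta_cl p a K = \<zero>\<^bsub>O_Xbar p a\<^esub>}\<rparr>"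

definition flow_action ::
    "nat \<Rightarrow> (nat \<Rightarrow> 'a::idom) \<Rightarrow> 'a poly poly poly fract set \<Rightarrow>
      ('a X_hat \<Rightarrow> 'a X_hat) set \<Rightarrow> ('a X_hat \<Rightarrow> 'a X_hat) set"
  where "flow_action p a Kbar = (\<lambda>C \<in> flow_classes p a.
    {\<delta>' \<in> euler_flows p a. \<exists>\<delta> \<in> C. \<exists>K \<in> carrier (O_Xhat p a). reduction K = Kbar \<and>
      cong_mod p (O_Xhat p a) (\<delta>' (in_Xhat p a (var 3)))
        (\<delta> (in_Xhat p a (var 3)) \<oplus>\<^bsub>O_Xhat p a\<^esub> K)})"

definition principal_homogeneous_space ::
    "('g, 'x) monoid_scheme \<Rightarrow> 'e set \<Rightarrow> ('g \<Rightarrow> 'e \<Rightarrow> 'e) \<Rightarrow> bool"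
  where "principal_homogeneous_space G E act \<longleftrightarrow>
    group_action G E act \<and> E \<noteq> {} \<and>
    (\<forall>x \<in> E. \<forall>y \<in> E. \<exists>!g. g \<in> carrier G \<and> act g x = y)"

end

theory Submission
  imports Defs
begin

text \<open>
  A \<open>p\<close>-derivation with $\delta H_1 = \delta H_2 = 0$ is determined by $\delta x_3$, which is
  arbitrary: $\phi(x_1)^2$ and $\phi(x_2)^2$ solve a linear system, and as $2 x_1 x_2$ is
  invertible Hensel's lemma gives the square roots congruent to $x_1^p$ and $x_2^p$. Modulo $p$
  the flow depends only on the reduction \<open>f\<close> of $\delta x_3$.

  On a level set every differential is $du = \delta^{cl}(u)\,\omega$, so condition (2) says that
  $\delta^{cl} f = A_{p-1}^{-1} b^p - x_3^{p-1} b$ with $b = \delta^{cl} x_3$, evaluated on the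
  level sets of all \<open>p\<close>-constants. These pass through every residue point of $X$, and as the
  residue field is infinite the equation holds on $\overline X$. It is an inhomogeneous linear
  equation for \<open>f\<close>, so the solutions form a torsor under the kernel of $\delta^{cl}$ as soon as one
  exists. Now $b^2$ is $F(H_1, H_2, x_3)$, so $b^{p-1}$ is a polynomial in $x_3$ with
  $\delta^{cl}$-constant coefficients, in which $x_3^{p-1}$ has coefficient $A_{p-1}$. Hence
  $A_{p-1}^{-1} b^{p-1} - x_3^{p-1}$ has no term of degree $p - 1$ and can be integrated up to degree
  $2(p-1)$ without dividing by \<open>p\<close>.
\<close>

section \<open>Completions of abelian groups and rings\<close>

text \<open>Three points shape the formal argument. \<open>the_p_derivation\<close> is a definite
  description, so existence and uniqueness of the Frobenius lift of A have to be proved. As residues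
  are only known to be algebraic over the prime field, this rests on Teichmueller representatives,
  and the p-constants of condition (2) are found among them.

  Next, the completed module of forms on a level set is not determined: neither that \<omega>
  generates it nor that it has no p-torsion is established. The identity du = \<delta>^cl(u)
  \<omega> is shown for functions u before completion only, and a form \<eta> with p \<eta> =
  \<phi>* \<omega> is not known to be unique. Hence the two directions of the equivalence with the
  equation for f are proved differently. If the equation holds, an explicit \<eta> is written down.
  Conversely, a point of the level set gives a functional on forms with values in the torsion-free
  completion of A, where division by p has one result, and the equation is read off point by point.

  Finally, \<delta>^cl is lifted to characteristic zero, so that the equation is solved exactly and
  reduced afterwards.\<close>

context abelian_group
begin

lemma multiples_additive_subgroup: "additive_subgroup (multiples G m) G"
proof (rule additive_subgroup.intro, rule add.subgroupI)
  show "multiples G m \<subseteq> carrier G" by (auto simp: multiples_def)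
  show "multiples G m \<noteq> {}" by (auto simp: multiples_def intro: exI[of _ \<zero>])
  fix x assume "x \<in> multiples G m"
  then obtain y where y: "y \<in> carrier G" "x = [m] \<cdot> y" by (auto simp: multiples_def)
  then have "\<ominus> x = [m] \<cdot> (\<ominus> y)" by (simp add: add.nat_pow_inv)
  with y show "\<ominus> x \<in> multiples G m" by (auto simp: multiples_def)
next
  fix x x' assume "x \<in> multiples G m" "x' \<in> multiples G m"
  then obtain y y' where y: "y \<in> carrier G" "x = [m] \<cdot> y" "y' \<in> carrier G" "x' = [m] \<cdot> y'"
    by (auto simp: multiples_def)
  then have "x \<oplus> x' = [m] \<cdot> (y \<oplus> y')" by (simp add: add.nat_pow_distrib)
  with y show "x \<oplus> x' \<in> multiples G m" by (auto simp: multiples_def)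
qed

lemma multiples_abelian_subgroup: "abelian_subgroup (multiples G m) G"
  using multiples_additive_subgroup by (intro abelian_subgroupI3 abelian_group_axioms)

lemma multiplesI [intro]: "x \<in> carrier G \<Longrightarrow> [m] \<cdot> x \<in> multiples G m"
  by (auto simp: multiples_def)

lemma multiples_carrier: "x \<in> multiples G m \<Longrightarrow> x \<in> carrier G"
  by (auto simp: multiples_def)

lemma multiples_zero [simp]: "\<zero> \<in> multiples G m"
  by (rule additive_subgroup.zero_closed[OF multiples_additive_subgroup])

lemma multiples_add: "x \<in> multiples G m \<Longrightarrow> y \<in> multiples G m \<Longrightarrow> x \<oplus> y \<in> multiples G m"
  by (rule additive_subgroup.a_closed[OF multiples_additive_subgroup])

lemma multiples_neg: "x \<in> multiples G m \<Longrightarrow> \<ominus> x \<in> multiples G m"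
  using additive_subgroup.a_inv_closed[OF multiples_additive_subgroup] by auto

lemma multiples_minus: "x \<in> multiples G m \<Longrightarrow> y \<in> multiples G m \<Longrightarrow> x \<ominus> y \<in> multiples G m"
  by (simp add: a_minus_def multiples_add multiples_neg)

lemma multiples_dvd: "m dvd k \<Longrightarrow> multiples G k \<subseteq> multiples G m"
proof
  fix x assume "m dvd k" "x \<in> multiples G k"
  then obtain j y where "k = m * j" "y \<in> carrier G" "x = [k] \<cdot> y"
    by (auto simp: multiples_def dvd_def)
  then show "x \<in> multiples G m"
    by (auto simp: multiples_def add.nat_pow_pow mult.commute intro!: exI[of _ "[j] \<cdot> y"])
qed

lemma multiples_power_le: "i \<le> j \<Longrightarrow> x \<in> multiples G (p ^ j) \<Longrightarrow> x \<in> multiples G (p ^ i)"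
  using multiples_dvd[of "p ^ i" "p ^ j"] le_imp_power_dvd by blast

lemma multiples_one [simp]: "multiples G (Suc 0) = carrier G" "multiples G 1 = carrier G"
  by (auto simp: multiples_def intro!: exI)

lemma a_minus_self [simp]: "x \<in> carrier G \<Longrightarrow> x \<ominus> x = \<zero>"
  by (simp add: a_minus_def r_neg)

lemma a_minus_zero_iff: "x \<in> carrier G \<Longrightarrow> y \<in> carrier G \<Longrightarrow> x \<ominus> y = \<zero> \<longleftrightarrow> x = y"
  by (metis a_inv_closed a_minus_def minus_equality minus_minus r_neg)

lemma multiples_minus_trans:
  assumes "x \<ominus> y \<in> multiples G m" "y \<ominus> z \<in> multiples G m"
    and [simp]: "x \<in> carrier G" "y \<in> carrier G" "z \<in> carrier G"
  shows "x \<ominus> z \<in> multiples G m"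
proof -
  have "x \<ominus> z = (x \<ominus> y) \<oplus> (y \<ominus> z)"
    by (simp add: a_minus_def a_assoc r_neg1)
  then show ?thesis using multiples_add[OF assms(1,2)] by simp
qed

lemma multiples_minus_commute:
  assumes "x \<ominus> y \<in> multiples G m" and [simp]: "x \<in> carrier G" "y \<in> carrier G"
  shows "y \<ominus> x \<in> multiples G m"
proof -
  have "y \<ominus> x = \<ominus> (x \<ominus> y)"
    by (simp add: a_minus_def minus_add a_comm)
  then show ?thesis using multiples_neg[OF assms(1)] by simp
qed

lemma minus_add_cancel [simp]: "x \<in> carrier G \<Longrightarrow> y \<in> carrier G \<Longrightarrow> (x \<ominus> y) \<oplus> y = x"
  by (simp add: a_minus_def a_assoc l_neg)

lemma add_minus_cancel [simp]: "x \<in> carrier G \<Longrightarrow> y \<in> carrier G \<Longrightarrow> x \<oplus> (y \<ominus> x) = y"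
  by (metis a_comm minus_add_cancel minus_closed)

lemma minus_minus_cancel [simp]: "x \<in> carrier G \<Longrightarrow> y \<in> carrier G \<Longrightarrow> x \<ominus> (x \<ominus> y) = y"
  by (simp add: a_minus_def minus_add r_neg2)

lemma minus_zero_right [simp]: "x \<in> carrier G \<Longrightarrow> x \<ominus> \<zero> = x"
  by (simp add: a_minus_def)

lemma multiples_minus_iff:
  assumes "x \<ominus> y \<in> multiples G m" and [simp]: "x \<in> carrier G" "y \<in> carrier G"
  shows "x \<in> multiples G m \<longleftrightarrow> y \<in> multiples G m"
proof -
  have "x \<in> multiples G m" if "y \<in> multiples G m"
    using multiples_add[OF assms(1) that] by simp
  moreover have "y \<in> multiples G m" if "x \<in> multiples G m"
    using multiples_minus[OF that assms(1)] by simp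
  ultimately show ?thesis by blast
qed

lemma multiples_coset_iff:
  assumes "x \<in> carrier G" "y \<in> carrier G"
  shows "multiples G m +> x = multiples G m +> y \<longleftrightarrow> x \<ominus> y \<in> multiples G m"
proof -
  interpret N: abelian_subgroup "multiples G m" G by (rule multiples_abelian_subgroup)
  show ?thesis
    using assms N.a_rcos_module[of y x] N.a_rcos_self[of x] N.a_repr_independence'[of x y]
    unfolding a_minus_def by auto
qed

lemma multiples_coset_mem:
  assumes "x \<in> carrier G"
  shows "y \<in> multiples G m +> x \<longleftrightarrow> y \<in> carrier G \<and> y \<ominus> x \<in> multiples G m"
proof -
  interpret N: abelian_subgroup "multiples G m" G by (rule multiples_abelian_subgroup)
  show ?thesis
    using assms N.a_rcos_module[of x y] N.a_elemrcos_carrier[of x y] unfolding a_minus_def by blast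
qed

lemma minus_plus_minus:
  assumes "x \<in> carrier G" "y \<in> carrier G" "z \<in> carrier G" "w \<in> carrier G"
  shows "(x \<oplus> y) \<ominus> (z \<oplus> w) = (x \<ominus> z) \<oplus> (y \<ominus> w)"
  using assms by (simp add: a_minus_def minus_add a_ac)

lemma neg_minus_neg:
  assumes "x \<in> carrier G" "z \<in> carrier G"
  shows "(\<ominus> x) \<ominus> (\<ominus> z) = \<ominus> (x \<ominus> z)"
  using assms by (simp add: a_minus_def minus_add a_ac)

lemma add_pow_minus:
  assumes "x \<in> carrier G" "z \<in> carrier G"
  shows "[(k::nat)] \<cdot> x \<ominus> [k] \<cdot> z = [k] \<cdot> (x \<ominus> z)"
  using assms by (simp add: a_minus_def add.nat_pow_distrib add.nat_pow_inv)

end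

text \<open>The rate of convergence is part of the notion: the n-th term counts modulo p^n. So level
  n of the limit is the coset of \<open>r n\<close> itself, and no modulus of convergence has to be
  carried along.\<close>

definition cauchy :: "nat \<Rightarrow> ('r, 'x) ring_scheme \<Rightarrow> (nat \<Rightarrow> 'r) \<Rightarrow> bool"
  where "cauchy p M r \<longleftrightarrow> range r \<subseteq> carrier M \<and> (\<forall>n. r (Suc n) \<ominus>\<^bsub>M\<^esub> r n \<in> multiples M (p ^ n))"

definition padic_lim :: "nat \<Rightarrow> ('r, 'x) ring_scheme \<Rightarrow> (nat \<Rightarrow> 'r) \<Rightarrow> nat \<Rightarrow> 'r set"
  where "padic_lim p M r = (\<lambda>n. multiples M (p ^ n) +>\<^bsub>M\<^esub> r n)"

text \<open>Limits are asked for with the same fixed rate, and in terms of elements rather than as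
  bijectivity onto the inverse limit. In this form the property can be shown for a completion and
  also used in rings whose elements are not coset sequences, such as A.\<close>

definition padically_complete :: "nat \<Rightarrow> ('r, 'x) ring_scheme \<Rightarrow> bool"
  where "padically_complete p M \<longleftrightarrow>
    (\<forall>r. cauchy p M r \<longrightarrow> (\<exists>l \<in> carrier M. \<forall>n. l \<ominus>\<^bsub>M\<^esub> r n \<in> multiples M (p ^ n))) \<and>
    (\<forall>x \<in> carrier M. (\<forall>n. x \<in> multiples M (p ^ n)) \<longrightarrow> x = \<zero>\<^bsub>M\<^esub>)"

context abelian_group
begin

lemma cauchyD: "cauchy p G r \<Longrightarrow> r n \<in> carrier G"
  by (auto simp: cauchy_def)

lemma cauchy_diff:
  assumes "cauchy p G r" "m \<le> n"
  shows "r n \<ominus> r m \<in> multiples G (p ^ m)"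
  using assms(2)
proof (induction n rule: dec_induct)
  case base
  then show ?case using assms(1) by (simp add: cauchyD)
next
  case (step n)
  have "r (Suc n) \<ominus> r n \<in> multiples G (p ^ m)"
    using assms(1) step.hyps by (auto simp: cauchy_def intro: multiples_power_le)
  then show ?case using step.IH assms(1) cauchyD multiples_minus_trans by metis
qed

lemma cauchy_const [simp]: "x \<in> carrier G \<Longrightarrow> cauchy p G (\<lambda>_. x)"
  by (auto simp: cauchy_def)

lemma cauchy_add: "cauchy p G r \<Longrightarrow> cauchy p G s \<Longrightarrow> cauchy p G (\<lambda>n. r n \<oplus> s n)"
  unfolding cauchy_def
  by (auto simp: minus_plus_minus image_subset_iff intro!: multiples_add)

lemma cauchy_neg: "cauchy p G r \<Longrightarrow> cauchy p G (\<lambda>n. \<ominus> r n)"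
  unfolding cauchy_def
  by (auto simp: neg_minus_neg image_subset_iff intro!: multiples_neg)

lemma cauchy_minus: "cauchy p G r \<Longrightarrow> cauchy p G s \<Longrightarrow> cauchy p G (\<lambda>n. r n \<ominus> s n)"
  unfolding a_minus_def by (intro cauchy_add cauchy_neg)

lemma multiples_add_pow:
  assumes "x \<in> multiples G m" shows "[(k::nat)] \<cdot> x \<in> multiples G m"
proof -
  obtain y where "y \<in> carrier G" "x = [m] \<cdot> y" using assms by (auto simp: multiples_def)
  then have "[k] \<cdot> x = [m] \<cdot> ([k] \<cdot> y)" by (simp add: add.nat_pow_pow mult.commute)
  with \<open>y \<in> carrier G\<close> show ?thesis by auto
qed

lemma cauchy_add_pow: "cauchy p G r \<Longrightarrow> cauchy p G (\<lambda>n. [(k::nat)] \<cdot> r n)"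
  unfolding cauchy_def
  by (auto simp: add_pow_minus image_subset_iff intro!: multiples_add_pow)

lemma padic_lim_eq_iff:
  assumes "cauchy p G r" "cauchy p G s"
  shows "padic_lim p G r = padic_lim p G s \<longleftrightarrow> (\<forall>n. r n \<ominus> s n \<in> multiples G (p ^ n))"
  using assms by (auto simp: padic_lim_def fun_eq_iff multiples_coset_iff cauchyD)

lemma padic_lim_add:
  assumes "cauchy p G r" "cauchy p G s"
  shows "set_add G (padic_lim p G r n) (padic_lim p G s n) = padic_lim p G (\<lambda>n. r n \<oplus> s n) n"
  using assms by (simp add: padic_lim_def cauchyD
    abelian_subgroup.a_rcos_sum[OF multiples_abelian_subgroup])

lemma padic_lim_zero: "padic_lim p G (\<lambda>_. \<zero>) = (\<lambda>n. multiples G (p ^ n))"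
  by (simp add: padic_lim_def fun_eq_iff abelian_subgroup.a_rcos_const[OF multiples_abelian_subgroup])

text \<open>Choosing a representative in every coset gives a sequence, and the inclusions between
  consecutive cosets say exactly that it is Cauchy. All later work on completions is done with such
  sequences.\<close>

lemma padic_lim_range:
  "{f. \<forall>n. f n \<in> a_rcosets (multiples G (p ^ n)) \<and> f (Suc n) \<subseteq> f n} =
   padic_lim p G ` Collect (cauchy p G)" (is "?L = ?R")
proof (intro equalityI subsetI)
  fix f assume "f \<in> ?L"
  then have "\<exists>r. \<forall>n. r n \<in> carrier G \<and> f n = multiples G (p ^ n) +> r n"
    by (intro choice) (simp add: A_RCOSETS_def' Bex_def)
  then obtain r where r: "\<And>n. r n \<in> carrier G" "\<And>n. f n = multiples G (p ^ n) +> r n"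
    by auto
  have "r (Suc n) \<in> f (Suc n)" for n
    using r by (simp add: multiples_coset_mem)
  then have "r (Suc n) \<in> f n" for n
    using \<open>f \<in> ?L\<close> by blast
  then have "cauchy p G r"
    using r by (auto simp: multiples_coset_mem cauchy_def)
  moreover have "f = padic_lim p G r" using r by (auto simp: padic_lim_def)
  ultimately show "f \<in> ?R" by auto
next
  fix f assume "f \<in> ?R"
  then obtain r where r: "cauchy p G r" "f = padic_lim p G r" by auto
  have "f (Suc n) \<subseteq> f n" for n
  proof
    fix y assume "y \<in> f (Suc n)"
    then have "y \<in> carrier G" "y \<ominus> r (Suc n) \<in> multiples G (p ^ n)"
      using r by (auto simp: padic_lim_def multiples_coset_mem cauchyD
        intro: multiples_power_le[of n "Suc n"])
    moreover have "r (Suc n) \<ominus> r n \<in> multiples G (p ^ n)" using r by (simp add: cauchy_def)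
    ultimately have "y \<ominus> r n \<in> multiples G (p ^ n)"
      using r cauchyD multiples_minus_trans by metis
    then show "y \<in> f n"
      using r \<open>y \<in> carrier G\<close> by (simp add: padic_lim_def multiples_coset_mem cauchyD)
  qed
  then show "f \<in> ?L"
    using r by (auto simp: padic_lim_def A_RCOSETS_def' cauchyD)
qed

end

text \<open>Only carrier, addition and zero are fixed, since these are shared by the completion of a
  ring and the completion of a module. The additive theory is thus developed once for both.\<close>

locale additive_completion = abelian_group M for M :: "('a, 'm) ring_scheme" (structure) and p :: nat
    and C :: "(nat \<Rightarrow> 'a set, 'x) ring_scheme" +
  assumes carrier_C: "carrier C = {f. \<forall>n. f n \<in> a_rcosets (multiples M (p ^ n)) \<and> f (Suc n) \<subseteq> f n}"
    and add_C: "\<And>f g. f \<oplus>\<^bsub>C\<^esub> g = (\<lambda>n. set_add M (f n) (g n))"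
    and zero_C: "\<zero>\<^bsub>C\<^esub> = (\<lambda>n. multiples M (p ^ n))"
begin

abbreviation "Pl \<equiv> padic_lim p M"
abbreviation "Cy \<equiv> cauchy p M"

lemma Lim_closed [simp, intro]: "Cy r \<Longrightarrow> Pl r \<in> carrier C"
  by (simp add: carrier_C padic_lim_range)

lemma Lim_cases:
  assumes "x \<in> carrier C" obtains r where "Cy r" "x = Pl r"
  using assms by (auto simp: carrier_C padic_lim_range)

lemma Lim_add: "Cy r \<Longrightarrow> Cy s \<Longrightarrow> Pl r \<oplus>\<^bsub>C\<^esub> Pl s = Pl (\<lambda>n. r n \<oplus> s n)"
  by (simp add: add_C padic_lim_add)

lemma Lim_zero: "\<zero>\<^bsub>C\<^esub> = Pl (\<lambda>_. \<zero>)"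
  by (simp add: zero_C padic_lim_zero)

lemma completion_abelian_group: "abelian_group C"
proof (rule abelian_groupI)
  fix x y z
  assume "x \<in> carrier C" "y \<in> carrier C" "z \<in> carrier C"
  then obtain r s t where "Cy r" "Cy s" "Cy t" "x = Pl r" "y = Pl s" "z = Pl t"
    by (metis Lim_cases)
  then show "x \<oplus>\<^bsub>C\<^esub> y \<oplus>\<^bsub>C\<^esub> z = x \<oplus>\<^bsub>C\<^esub> (y \<oplus>\<^bsub>C\<^esub> z)"
    by (simp add: Lim_add cauchy_add cauchyD a_assoc)
next
  fix x y
  assume "x \<in> carrier C" "y \<in> carrier C"
  then obtain r s where "Cy r" "Cy s" "x = Pl r" "y = Pl s"
    by (metis Lim_cases)
  then show "x \<oplus>\<^bsub>C\<^esub> y \<in> carrier C" "x \<oplus>\<^bsub>C\<^esub> y = y \<oplus>\<^bsub>C\<^esub> x"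
    by (simp_all add: Lim_add cauchy_add cauchyD a_comm)
next
  fix x
  assume "x \<in> carrier C"
  then obtain r where r: "Cy r" "x = Pl r"
    by (metis Lim_cases)
  then show "\<zero>\<^bsub>C\<^esub> \<oplus>\<^bsub>C\<^esub> x = x"
    by (simp add: Lim_zero Lim_add cauchyD)
  have "Pl (\<lambda>n. \<ominus> r n) \<oplus>\<^bsub>C\<^esub> x = \<zero>\<^bsub>C\<^esub>"
    using r by (simp add: Lim_zero Lim_add cauchyD cauchy_neg l_neg)
  then show "\<exists>y\<in>carrier C. y \<oplus>\<^bsub>C\<^esub> x = \<zero>\<^bsub>C\<^esub>"
    using r cauchy_neg by blast
qed (simp add: Lim_zero)

sublocale C: abelian_group C
  by (rule completion_abelian_group)

lemma Lim_neg:
  assumes "Cy r" shows "\<ominus>\<^bsub>C\<^esub> Pl r = Pl (\<lambda>n. \<ominus> r n)"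
proof (rule C.minus_equality)
  show "Pl (\<lambda>n. \<ominus> r n) \<oplus>\<^bsub>C\<^esub> Pl r = \<zero>\<^bsub>C\<^esub>"
    using assms by (simp add: Lim_zero Lim_add cauchyD cauchy_neg l_neg)
qed (use assms cauchy_neg in auto)

lemma Lim_minus: "Cy r \<Longrightarrow> Cy s \<Longrightarrow> Pl r \<ominus>\<^bsub>C\<^esub> Pl s = Pl (\<lambda>n. r n \<ominus> s n)"
  by (simp add: a_minus_def Lim_neg Lim_add cauchy_neg)

lemma Lim_add_pow: "Cy r \<Longrightarrow> [(k::nat)] \<cdot>\<^bsub>C\<^esub> Pl r = Pl (\<lambda>n. [k] \<cdot> r n)"
  by (induction k) (simp_all add: Lim_zero Lim_add cauchy_add_pow)

text \<open>Beyond level n all steps of the sequence are multiples of p^n, so once the n-th term is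
  divisible the tail can be divided term by term, and the quotients again form a Cauchy sequence.
  The quotients are chosen step by step, since M may have torsion.\<close>

lemma Lim_multiples_iff:
  assumes "Cy t"
  shows "Pl t \<in> multiples C (p ^ n) \<longleftrightarrow> t n \<in> multiples M (p ^ n)"
proof
  assume "Pl t \<in> multiples C (p ^ n)"
  then obtain s where s: "Cy s" "Pl t = [(p ^ n)] \<cdot>\<^bsub>C\<^esub> Pl s"
    by (auto simp: multiples_def elim: Lim_cases)
  then have "Pl t = Pl (\<lambda>k. [(p ^ n)] \<cdot> s k)" by (simp add: Lim_add_pow)
  then have "t n \<ominus> [(p ^ n)] \<cdot> s n \<in> multiples M (p ^ n)"
    using s assms by (simp add: padic_lim_eq_iff cauchy_add_pow)
  moreover have "[(p ^ n)] \<cdot> s n \<in> multiples M (p ^ n)" using s cauchyD by auto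
  ultimately show "t n \<in> multiples M (p ^ n)"
    using s assms cauchyD multiples_minus_iff multiples_carrier by blast
next
  assume "t n \<in> multiples M (p ^ n)"
  then obtain v where v: "v \<in> carrier M" "t n = [(p ^ n)] \<cdot> v" by (auto simp: multiples_def)
  have "\<forall>k. \<exists>w. w \<in> carrier M \<and> t (Suc (n + k)) \<ominus> t (n + k) = [(p ^ (n + k))] \<cdot> w"
    using assms by (auto simp: cauchy_def multiples_def)
  then obtain w where w: "\<And>k. w k \<in> carrier M"
      "\<And>k. t (Suc (n + k)) \<ominus> t (n + k) = [(p ^ (n + k))] \<cdot> w k"
    by metis
  \<comment> \<open>\<open>u\<close> is the tail of \<open>t\<close> divided by p^n: the step from
    t_{n+k} to t_{n+k+1} is p^{n+k} w_k, so its quotient is p^k w_k.\<close>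
  define u where "u = rec_nat v (\<lambda>k a. a \<oplus> [(p ^ k)] \<cdot> w k)"
  have u0: "u 0 = v" and uS: "\<And>k. u (Suc k) = u k \<oplus> [(p ^ k)] \<cdot> w k"
    by (simp_all add: u_def)
  have uc: "u k \<in> carrier M" for k
    by (induction k) (simp_all add: u0 uS v w)
  have "u (Suc k) \<ominus> u k = [(p ^ k)] \<cdot> w k" for k
    using uc[of k] w(1)[of k] by (simp add: uS a_minus_def a_ac r_neg2)
  then have cu: "Cy u" using uc w by (auto simp: cauchy_def)
  have pu: "[(p ^ n)] \<cdot> u k = t (n + k)" for k
  proof (induction k)
    case 0 then show ?case using v by (simp add: u0)
  next
    case (Suc k)
    have "[(p ^ n)] \<cdot> u (Suc k) = [(p ^ n)] \<cdot> u k \<oplus> [(p ^ (n + k))] \<cdot> w k"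
      using uc w by (simp add: uS add.nat_pow_distrib add.nat_pow_pow power_add mult.commute)
    also have "\<dots> = t (n + k) \<oplus> (t (Suc (n + k)) \<ominus> t (n + k))"
      using Suc w by simp
    also have "\<dots> = t (Suc (n + k))"
      using cauchyD[OF assms, of "n + k"] cauchyD[OF assms, of "Suc (n + k)"]
      by simp
    finally show ?case by simp
  qed
  have "Pl t = Pl (\<lambda>k. [(p ^ n)] \<cdot> u k)"
  proof (subst padic_lim_eq_iff)
    show "\<forall>k. t k \<ominus> [(p ^ n)] \<cdot> u k \<in> multiples M (p ^ k)"
    proof
      fix k
      have "t (n + k) \<ominus> t k \<in> multiples M (p ^ k)" using assms by (rule cauchy_diff) simp
      then show "t k \<ominus> [(p ^ n)] \<cdot> u k \<in> multiples M (p ^ k)"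
        using assms by (simp add: pu multiples_minus_commute cauchyD)
    qed
  qed (use assms cu cauchy_add_pow in auto)
  then have "Pl t = [(p ^ n)] \<cdot>\<^bsub>C\<^esub> Pl u" using cu by (simp add: Lim_add_pow)
  then show "Pl t \<in> multiples C (p ^ n)" using cu by (auto simp: multiples_def)
qed

lemma completion_complete: "padically_complete p C"
  unfolding padically_complete_def
proof (intro conjI allI impI ballI)
  fix x assume "x \<in> carrier C" "\<forall>n. x \<in> multiples C (p ^ n)"
  then show "x = \<zero>\<^bsub>C\<^esub>"
    by (auto elim!: Lim_cases simp: Lim_multiples_iff Lim_zero padic_lim_eq_iff cauchyD)
next
  fix f assume f: "cauchy p C f"
  then have "\<forall>k. \<exists>r. Cy r \<and> f k = Pl r" by (metis C.cauchyD Lim_cases)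
  then obtain r where r: "\<And>k. Cy (r k)" "\<And>k. f k = Pl (r k)" by metis
  have step: "r (Suc k) k \<ominus> r k k \<in> multiples M (p ^ k)" for k
  proof -
    have "Pl (\<lambda>n. r (Suc k) n \<ominus> r k n) \<in> multiples C (p ^ k)"
      using f r by (simp add: cauchy_def Lim_minus[symmetric])
    then show ?thesis using r by (simp add: Lim_multiples_iff cauchy_minus)
  qed
  \<comment> \<open>The diagonal: the k-th term of the k-th sequence is already correct modulo
    p^k.\<close>
  define d where "d = (\<lambda>k. r k k)"
  have "d (Suc k) \<ominus> d k \<in> multiples M (p ^ k)" for k
    unfolding d_def using step[of k] cauchy_diff[OF r(1), of k "Suc k" "Suc k"] r
    by (meson cauchyD multiples_minus_trans le_SucI order_refl)
  then have cd: "Cy d" using r by (auto simp: cauchy_def d_def)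
  have "Pl d \<ominus>\<^bsub>C\<^esub> f n \<in> multiples C (p ^ n)" for n
  proof -
    have "d n \<ominus> r n n \<in> multiples M (p ^ n)"
      using cauchyD[OF r(1), of n n] by (simp add: d_def)
    then show ?thesis using r cd by (simp add: Lim_minus Lim_multiples_iff cauchy_minus)
  qed
  then show "\<exists>l\<in>carrier C. \<forall>n. l \<ominus>\<^bsub>C\<^esub> f n \<in> multiples C (p ^ n)"
    using cd by blast
qed

text \<open>If p times the limit vanishes, then p r_{n+1} is a multiple of p^{n+1}, and cancelling p
  in M puts r_{n+1} into p^n M. The loss of one power is absorbed by passing from level n+1 to level
  n.\<close>

lemma completion_torsion_free:
  assumes tf: "\<And>y. y \<in> carrier M \<Longrightarrow> [p] \<cdot> y = \<zero> \<Longrightarrow> y = \<zero>"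
    and x: "x \<in> carrier C" "[p] \<cdot>\<^bsub>C\<^esub> x = \<zero>\<^bsub>C\<^esub>"
  shows "x = \<zero>\<^bsub>C\<^esub>"
proof -
  obtain r where r: "Cy r" "x = Pl r" using x(1) by (rule Lim_cases)
  have "[p] \<cdot> r (Suc n) \<in> multiples M (p ^ Suc n)" for n
  proof -
    have "Pl (\<lambda>n. [p] \<cdot> r n) = Pl (\<lambda>n. \<zero>)"
      using x(2) r by (simp add: Lim_add_pow Lim_zero)
    then show ?thesis
      using r by (simp add: padic_lim_eq_iff cauchy_add_pow cauchyD del: power_Suc)
  qed
  have "r n \<in> multiples M (p ^ n)" for n
  proof -
    obtain w where w: "w \<in> carrier M" "[p] \<cdot> r (Suc n) = [p] \<cdot> ([(p ^ n)] \<cdot> w)"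
      using \<open>[p] \<cdot> r (Suc n) \<in> multiples M (p ^ Suc n)\<close>
      by (auto simp: multiples_def add.nat_pow_pow mult.commute)
    then have "[p] \<cdot> (r (Suc n) \<ominus> [(p ^ n)] \<cdot> w) = \<zero>"
      using r by (simp add: add_pow_minus[symmetric] cauchyD)
    then have "r (Suc n) = [(p ^ n)] \<cdot> w"
      using tf r w by (metis a_minus_zero_iff add.nat_pow_closed cauchyD minus_closed)
    then have "r (Suc n) \<in> multiples M (p ^ n)" using w by auto
    moreover have "r (Suc n) \<ominus> r n \<in> multiples M (p ^ n)" using r by (simp add: cauchy_def)
    ultimately show ?thesis using r cauchyD multiples_minus_iff by metis
  qed
  then show ?thesis using r by (simp add: Lim_zero padic_lim_eq_iff cauchyD)
qed

end

section \<open>Congruences modulo m and p-adically complete rings\<close>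

context cring
begin

lemma multiples_mult_right: "x \<in> multiples R m \<Longrightarrow> y \<in> carrier R \<Longrightarrow> x \<otimes> y \<in> multiples R m"
  by (auto simp: multiples_def add_pow_ldistr)

lemma multiples_mult_left: "x \<in> multiples R m \<Longrightarrow> y \<in> carrier R \<Longrightarrow> y \<otimes> x \<in> multiples R m"
  using multiples_mult_right[of x m y] multiples_carrier by (simp add: m_comm)

lemma multiples_ideal: "ideal (multiples R m) R"
  by (intro ideal.intro multiples_additive_subgroup ideal_axioms.intro ring_axioms)
    (auto intro: multiples_mult_right multiples_mult_left)

lemma multiples_mult:
  assumes "x \<in> multiples R m" "y \<in> multiples R k"
  shows "x \<otimes> y \<in> multiples R (m * k)"
proof -
  obtain u v where "u \<in> carrier R" "x = [m] \<cdot> u" "v \<in> carrier R" "y = [k] \<cdot> v"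
    using assms by (auto simp: multiples_def)
  then have "x \<otimes> y = [(m * k)] \<cdot> (u \<otimes> v)"
    by (simp add: add_pow_ldistr add_pow_rdistr add.nat_pow_pow mult.commute)
  then show ?thesis using \<open>u \<in> carrier R\<close> \<open>v \<in> carrier R\<close> by auto
qed

lemma multiples_pow: "x \<in> multiples R p \<Longrightarrow> x [^] (n::nat) \<in> multiples R (p ^ n)"
proof (induction n)
  case (Suc n)
  then show ?case using multiples_mult[of "x [^] n" "p ^ n" x p] by (simp add: mult.commute)
qed simp

lemma minus_mult_minus:
  assumes "x \<in> carrier R" "y \<in> carrier R" "x' \<in> carrier R" "y' \<in> carrier R"
  shows "x \<otimes> y \<ominus> x' \<otimes> y' = (x \<ominus> x') \<otimes> y \<oplus> x' \<otimes> (y \<ominus> y')"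
  using assms by algebra

lemma multiples_cong_mult:
  assumes "x \<ominus> x' \<in> multiples R m" "y \<ominus> y' \<in> multiples R m"
    and "x \<in> carrier R" "y \<in> carrier R" "x' \<in> carrier R" "y' \<in> carrier R"
  shows "x \<otimes> y \<ominus> x' \<otimes> y' \<in> multiples R m"
  using assms by (simp add: minus_mult_minus multiples_add multiples_mult_left multiples_mult_right)

lemma multiples_cong_add:
  assumes "x \<ominus> x' \<in> multiples R m" "y \<ominus> y' \<in> multiples R m"
    and "x \<in> carrier R" "y \<in> carrier R" "x' \<in> carrier R" "y' \<in> carrier R"
  shows "(x \<oplus> y) \<ominus> (x' \<oplus> y') \<in> multiples R m"
  using assms by (auto simp: minus_plus_minus intro!: multiples_add)

lemma multiples_cong_minus:
  assumes "x \<ominus> x' \<in> multiples R m" "y \<ominus> y' \<in> multiples R m"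
    and "x \<in> carrier R" "y \<in> carrier R" "x' \<in> carrier R" "y' \<in> carrier R"
  shows "(x \<ominus> y) \<ominus> (x' \<ominus> y') \<in> multiples R m"
proof -
  have "(x \<ominus> y) \<ominus> (x' \<ominus> y') = (x \<ominus> x') \<ominus> (y \<ominus> y')" using assms(3-) by algebra
  then show ?thesis using assms(1,2) by (simp add: multiples_minus)
qed

lemma multiples_cong_pow:
  assumes "x \<ominus> x' \<in> multiples R m" "x \<in> carrier R" "x' \<in> carrier R"
  shows "x [^] (n::nat) \<ominus> x' [^] n \<in> multiples R m"
  by (induction n) (use assms in \<open>auto intro!: multiples_cong_mult\<close>)

end

locale padic_ring = cring R for R (structure) and p :: nat +
  assumes complete: "padically_complete p R"
begin

lemma padic_zero: "x \<in> carrier R \<Longrightarrow> (\<And>n. x \<in> multiples R (p ^ n)) \<Longrightarrow> x = \<zero>"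
  using complete by (auto simp: padically_complete_def)

lemma padic_eqI:
  assumes "x \<in> carrier R" "y \<in> carrier R" "\<And>n. x \<ominus> y \<in> multiples R (p ^ n)"
  shows "x = y"
  using padic_zero[of "x \<ominus> y"] assms by (simp add: a_minus_zero_iff)

lemma padic_limit:
  assumes "cauchy p R r"
  shows "\<exists>l\<in>carrier R. \<forall>n. l \<ominus> r n \<in> multiples R (p ^ n)"
  using complete assms by (auto simp: padically_complete_def)

text \<open>Two facts about a partial sum s of the geometric series with remainder q: the recursion
  s -> 1 + t s preserves the product formula, and a limit l fails to invert 1 - t only by an error
  that tends to zero.\<close>

lemma geometric_identity:
  assumes "t \<in> carrier R" "s \<in> carrier R" "q \<in> carrier R" "l \<in> carrier R"
    and "(\<one> \<ominus> t) \<otimes> s = \<one> \<ominus> q"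
  shows "(\<one> \<ominus> t) \<otimes> (\<one> \<oplus> t \<otimes> s) = \<one> \<ominus> t \<otimes> q"
    and "(\<one> \<ominus> t) \<otimes> l \<ominus> \<one> = (\<one> \<ominus> t) \<otimes> (l \<ominus> s) \<ominus> q"
proof -
  have "(\<one> \<ominus> t) \<otimes> (\<one> \<oplus> t \<otimes> s) = \<one> \<ominus> t \<oplus> t \<otimes> ((\<one> \<ominus> t) \<otimes> s)" using assms(1-4) by algebra
  also have "\<dots> = \<one> \<ominus> t \<oplus> t \<otimes> (\<one> \<ominus> q)" using assms(5) by simp
  also have "\<dots> = \<one> \<ominus> t \<otimes> q" using assms(1-4) by algebra
  finally show "(\<one> \<ominus> t) \<otimes> (\<one> \<oplus> t \<otimes> s) = \<one> \<ominus> t \<otimes> q" .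
  have "(\<one> \<ominus> t) \<otimes> l \<ominus> \<one> = (\<one> \<ominus> t) \<otimes> (l \<ominus> s) \<oplus> (\<one> \<ominus> t) \<otimes> s \<ominus> \<one>" using assms(1-4) by algebra
  also have "\<dots> = (\<one> \<ominus> t) \<otimes> (l \<ominus> s) \<oplus> (\<one> \<ominus> q) \<ominus> \<one>" using assms(5) by simp
  also have "\<dots> = (\<one> \<ominus> t) \<otimes> (l \<ominus> s) \<ominus> q" using assms(1-4) by algebra
  finally show "(\<one> \<ominus> t) \<otimes> l \<ominus> \<one> = (\<one> \<ominus> t) \<otimes> (l \<ominus> s) \<ominus> q" .
qed

text \<open>If u v = 1 - t with t in p R, the geometric series in t converges and inverts 1 -
  t.\<close>

lemma Units_lift:
  assumes u: "u \<in> carrier R" "v \<in> carrier R" and uv: "u \<otimes> v \<ominus> \<one> \<in> multiples R p"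
  shows "u \<in> Units R"
proof -
  define t where "t = \<one> \<ominus> u \<otimes> v"
  have t: "t \<in> carrier R" "t \<in> multiples R p"
    using u uv multiples_minus_commute[OF uv] by (auto simp: t_def)
  \<comment> \<open>Horner form: \<open>s n\<close> is 1 + t + ... + t^{n-1}.\<close>
  define s where "s = rec_nat \<zero> (\<lambda>_ a. \<one> \<oplus> t \<otimes> a)"
  have s0: "s 0 = \<zero>" and sS: "\<And>n. s (Suc n) = \<one> \<oplus> t \<otimes> s n" by (simp_all add: s_def)
  have sc: "s n \<in> carrier R" for n by (induction n) (simp_all add: s0 sS t)
  have tn: "t [^] n \<in> multiples R (p ^ n)" for n :: nat by (rule multiples_pow[OF t(2)])
  have eq: "(\<one> \<ominus> t) \<otimes> s n = \<one> \<ominus> t [^] n" for n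
  proof (induction n)
    case 0 then show ?case using t by (simp add: s0)
  next
    case (Suc n)
    show ?case using geometric_identity(1)[OF t(1) sc[of n] _ _ Suc] t by (simp add: sS m_comm)
  qed
  have diff: "s (Suc n) \<ominus> s n = t [^] n" for n
  proof (induction n)
    case 0 then show ?case using t by (simp add: s0 sS)
  next
    case (Suc n)
    have "s (Suc (Suc n)) \<ominus> s (Suc n) = t \<otimes> (s (Suc n) \<ominus> s n)"
      unfolding sS[of "Suc n"] sS[of n] using sc[of n] t(1) by algebra
    then show ?case using Suc t by (simp add: m_comm)
  qed
  have "cauchy p R s" using sc tn by (auto simp: cauchy_def diff)
  then obtain l where l: "l \<in> carrier R" "\<And>n. l \<ominus> s n \<in> multiples R (p ^ n)"
    using padic_limit by blast
  have "(\<one> \<ominus> t) \<otimes> l \<ominus> \<one> \<in> multiples R (p ^ n)" for n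
    using geometric_identity(2)[OF t(1) sc[of n] _ l(1) eq[of n]] t l tn[of n]
    by (simp add: multiples_minus multiples_mult_left)
  then have "(\<one> \<ominus> t) \<otimes> l = \<one>" using t l by (intro padic_eqI) auto
  moreover have "\<one> \<ominus> t = u \<otimes> v" using u by (simp add: t_def)
  ultimately have "u \<otimes> (v \<otimes> l) = \<one>" using u l by (simp add: m_assoc)
  then show ?thesis using u l by (auto simp: Units_def m_comm intro!: bexI[of _ "v \<otimes> l"])
qed

text \<open>One Newton step for z^2 = Y with the derivative frozen at y, where w is the inverse of
  2y. The new error is the old error E times 2(y - s)w plus a multiple of E^2; both terms gain a
  factor p when s is congruent to y and E is divisible by p.\<close>

lemma sqrt_identity:
  assumes "s \<in> carrier R" "w \<in> carrier R" "Y \<in> carrier R" "E \<in> carrier R" "y \<in> carrier R"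
    and "E = s \<otimes> s \<ominus> Y" "(y \<oplus> y) \<otimes> w = \<one>"
  shows "(s \<ominus> w \<otimes> E) \<otimes> (s \<ominus> w \<otimes> E) \<ominus> Y =
    E \<otimes> (((y \<ominus> s) \<oplus> (y \<ominus> s)) \<otimes> w) \<oplus> w \<otimes> w \<otimes> (E \<otimes> E)"
proof -
  have "(s \<ominus> w \<otimes> E) \<otimes> (s \<ominus> w \<otimes> E) \<ominus> Y =
    (s \<otimes> s \<ominus> Y) \<ominus> E \<otimes> ((s \<oplus> s) \<otimes> w) \<oplus> w \<otimes> w \<otimes> (E \<otimes> E)" using assms(1-5) by algebra
  also have "\<dots> = E \<otimes> \<one> \<ominus> E \<otimes> ((s \<oplus> s) \<otimes> w) \<oplus> w \<otimes> w \<otimes> (E \<otimes> E)"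
    using assms(4) by (simp add: assms(6)[symmetric])
  also have "\<dots> = E \<otimes> ((y \<oplus> y) \<otimes> w) \<ominus> E \<otimes> ((s \<oplus> s) \<otimes> w) \<oplus> w \<otimes> w \<otimes> (E \<otimes> E)"
    by (simp add: assms(7))
  also have "\<dots> = E \<otimes> (((y \<ominus> s) \<oplus> (y \<ominus> s)) \<otimes> w) \<oplus> w \<otimes> w \<otimes> (E \<otimes> E)"
    using assms(1-5) by algebra
  finally show ?thesis .
qed

text \<open>Newton iteration with the fixed slope 2y gains one power of p per step. Convergence is
  only linear, but no inverse other than that of 2y has to be tracked.\<close>

lemma sqrt_lift:
  assumes y: "y \<in> carrier R" "Y \<in> carrier R" "y \<oplus> y \<in> Units R"
    and yY: "y \<otimes> y \<ominus> Y \<in> multiples R p"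
  obtains z where "z \<in> carrier R" "z \<otimes> z = Y" "z \<ominus> y \<in> multiples R p"
proof -
  define w where "w = inv (y \<oplus> y)"
  have w: "w \<in> carrier R" "(y \<oplus> y) \<otimes> w = \<one>" using y by (simp_all add: w_def)
  define s where "s = rec_nat y (\<lambda>_ a. a \<ominus> w \<otimes> (a \<otimes> a \<ominus> Y))"
  have s0: "s 0 = y" and sS: "\<And>n. s (Suc n) = s n \<ominus> w \<otimes> (s n \<otimes> s n \<ominus> Y)"
    by (simp_all add: s_def)
  have sc: "s n \<in> carrier R" for n by (induction n) (use y w in \<open>simp_all add: s0 sS\<close>)
  have inv: "s n \<ominus> y \<in> multiples R p \<and> s n \<otimes> s n \<ominus> Y \<in> multiples R (p ^ Suc n)" for n
  proof (induction n)
    case 0 then show ?case using y yY by (simp add: s0)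
  next
    case (Suc n)
    define E where "E = s n \<otimes> s n \<ominus> Y"
    have E: "E \<in> carrier R" "E \<in> multiples R (p ^ Suc n)"
      using Suc y sc by (auto simp: E_def)
    then have E1: "E \<in> multiples R p" using multiples_power_le[of 1 "Suc n" E p] by simp
    have ys: "y \<ominus> s n \<in> multiples R p" using Suc sc y multiples_minus_commute by blast
    have "s (Suc n) \<ominus> y = (s n \<ominus> y) \<ominus> w \<otimes> E"
      unfolding sS E_def[symmetric] using sc[of n] y w E by algebra
    then have 1: "s (Suc n) \<ominus> y \<in> multiples R p"
      using Suc E1 w by (simp add: multiples_minus multiples_mult_left)
    have 2: "s (Suc n) \<otimes> s (Suc n) \<ominus> Y =
        E \<otimes> (((y \<ominus> s n) \<oplus> (y \<ominus> s n)) \<otimes> w) \<oplus> w \<otimes> w \<otimes> (E \<otimes> E)"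
      unfolding sS E_def[symmetric]
      using sqrt_identity[OF sc[of n] w(1) y(2) E(1) y(1) E_def w(2)] .
    have "E \<otimes> (((y \<ominus> s n) \<oplus> (y \<ominus> s n)) \<otimes> w) \<in> multiples R (p ^ Suc n * p)"
      using ys E w by (intro multiples_mult multiples_mult_right multiples_add) auto
    moreover have "E \<otimes> E \<in> multiples R (p ^ Suc n * p)"
      using E E1 by (intro multiples_mult)
    ultimately have "s (Suc n) \<otimes> s (Suc n) \<ominus> Y \<in> multiples R (p ^ Suc n * p)"
      unfolding 2 using w by (simp add: multiples_add multiples_mult_left del: power_Suc)
    with 1 show ?case by (simp add: mult.commute)
  qed
  have "cauchy p R s"
    unfolding cauchy_def
  proof (intro conjI allI)
    fix n
    have "s (Suc n) \<ominus> s n = \<ominus> (w \<otimes> (s n \<otimes> s n \<ominus> Y))"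
      unfolding sS using sc[of n] y w by algebra
    moreover have "s n \<otimes> s n \<ominus> Y \<in> multiples R (p ^ n)"
      using inv[of n] multiples_power_le[of n "Suc n" _ p] by simp
    ultimately show "s (Suc n) \<ominus> s n \<in> multiples R (p ^ n)"
      using w by (simp add: multiples_neg multiples_mult_left)
  qed (use sc in auto)
  then obtain l where l: "l \<in> carrier R" "\<And>n. l \<ominus> s n \<in> multiples R (p ^ n)"
    using padic_limit by blast
  have "l \<otimes> l \<ominus> Y \<in> multiples R (p ^ n)" for n
  proof -
    have "l \<otimes> l \<ominus> s n \<otimes> s n \<in> multiples R (p ^ n)"
      using l sc by (intro multiples_cong_mult) auto
    moreover have "s n \<otimes> s n \<ominus> Y \<in> multiples R (p ^ n)"
      using inv[of n] multiples_power_le[of n "Suc n" _ p] by simp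
    ultimately show ?thesis
      using l sc y by (meson multiples_minus_trans m_closed)
  qed
  then have "l \<otimes> l = Y" using l y by (intro padic_eqI) auto
  moreover have "l \<ominus> y \<in> multiples R p"
    using l(2)[of 1] inv[of 1] l sc y multiples_minus_trans[of l "s 1" p y] by simp
  ultimately show ?thesis using that l by blast
qed

end

section \<open>The completion of a ring\<close>

locale ring_completion = cring R for R :: "('a, 'm) ring_scheme" (structure) and p :: nat

sublocale ring_completion \<subseteq> additive_completion R p "padic_completion p R"
  by unfold_locales (simp_all add: padic_completion_def FactRing_def)

context ring_completion
begin

abbreviation "C \<equiv> padic_completion p R"

lemma cauchy_mult: "Cy r \<Longrightarrow> Cy s \<Longrightarrow> Cy (\<lambda>n. r n \<otimes> s n)"
  unfolding cauchy_def by (auto simp: image_subset_iff intro!: multiples_cong_mult)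

lemma Lim_mult: "Cy r \<Longrightarrow> Cy s \<Longrightarrow> Pl r \<otimes>\<^bsub>C\<^esub> Pl s = Pl (\<lambda>n. r n \<otimes> s n)"
  by (simp add: padic_completion_def FactRing_def padic_lim_def cauchyD
      ideal.rcoset_mult_add[OF multiples_ideal])

lemma Lim_one: "\<one>\<^bsub>C\<^esub> = Pl (\<lambda>_. \<one>)"
  by (simp add: padic_completion_def FactRing_def padic_lim_def)

lemma completion_cring: "cring C"
proof (rule cringI)
  show "abelian_group C" by (rule completion_abelian_group)
  show "comm_monoid C"
  proof (rule comm_monoidI)
    fix x y z
    assume "x \<in> carrier C" "y \<in> carrier C" "z \<in> carrier C"
    then obtain r s t where "Cy r" "Cy s" "Cy t" "x = Pl r" "y = Pl s" "z = Pl t"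
      by (metis Lim_cases)
    then show "x \<otimes>\<^bsub>C\<^esub> y \<otimes>\<^bsub>C\<^esub> z = x \<otimes>\<^bsub>C\<^esub> (y \<otimes>\<^bsub>C\<^esub> z)"
      by (simp add: Lim_mult cauchy_mult cauchyD m_assoc)
  next
    fix x y
    assume "x \<in> carrier C" "y \<in> carrier C"
    then obtain r s where "Cy r" "Cy s" "x = Pl r" "y = Pl s"
      by (metis Lim_cases)
    then show "x \<otimes>\<^bsub>C\<^esub> y \<in> carrier C" "x \<otimes>\<^bsub>C\<^esub> y = y \<otimes>\<^bsub>C\<^esub> x"
      by (simp_all add: Lim_mult cauchy_mult cauchyD m_comm)
  next
    fix x
    assume "x \<in> carrier C"
    then obtain r where r: "Cy r" "x = Pl r"
      by (metis Lim_cases)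
    then show "\<one>\<^bsub>C\<^esub> \<otimes>\<^bsub>C\<^esub> x = x"
      by (simp add: Lim_one Lim_mult cauchyD)
  qed (simp add: Lim_one)
  fix x y z
  assume "x \<in> carrier C" "y \<in> carrier C" "z \<in> carrier C"
  then obtain r s t where "Cy r" "Cy s" "Cy t" "x = Pl r" "y = Pl s" "z = Pl t"
    by (metis Lim_cases)
  then show "(x \<oplus>\<^bsub>C\<^esub> y) \<otimes>\<^bsub>C\<^esub> z = x \<otimes>\<^bsub>C\<^esub> z \<oplus>\<^bsub>C\<^esub> y \<otimes>\<^bsub>C\<^esub> z"
    by (simp add: Lim_mult Lim_add cauchy_add cauchy_mult cauchyD l_distr)
qed

sublocale C: padic_ring C p
  using completion_cring completion_complete
  by (intro padic_ring.intro padic_ring_axioms.intro)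

lemma to_completion_lim: "to_completion p R r = Pl (\<lambda>_. r)"
  by (simp add: to_completion_def padic_lim_def)

lemma to_completion_hom: "to_completion p R \<in> ring_hom R C"
  by (rule ring_hom_memI) (simp_all add: to_completion_lim Lim_mult Lim_add Lim_one)

text \<open>By \<open>Lim_multiples_iff\<close> divisibility of a difference by p^n is visible at
  level n. In particular \<open>reduction\<close>, which looks at level 1, is reduction modulo
  p.\<close>

lemma completion_level_iff:
  assumes "x \<in> carrier C" "y \<in> carrier C"
  shows "x \<ominus>\<^bsub>C\<^esub> y \<in> multiples C (p ^ n) \<longleftrightarrow> x n = y n"
proof -
  obtain r s where "Cy r" "Cy s" "x = Pl r" "y = Pl s" using assms by (metis Lim_cases)
  then show ?thesis
    by (simp add: Lim_minus Lim_multiples_iff cauchy_minus)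
      (simp add: padic_lim_def multiples_coset_iff cauchyD)
qed

lemma completion_approx:
  assumes "x \<in> carrier C"
  obtains r where "r \<in> carrier R" "x \<ominus>\<^bsub>C\<^esub> to_completion p R r \<in> multiples C (p ^ n)"
    "x n = multiples R (p ^ n) +> r"
proof -
  obtain r where r: "Cy r" "x = Pl r" using assms by (metis Lim_cases)
  then have "x n = to_completion p R (r n) n"
    by (simp add: to_completion_lim padic_lim_def)
  then have "x \<ominus>\<^bsub>C\<^esub> to_completion p R (r n) \<in> multiples C (p ^ n)"
    using r completion_level_iff[of x "to_completion p R (r n)"]
    by (simp add: to_completion_lim cauchyD)
  with r that[of "r n"] show ?thesis by (simp add: padic_lim_def cauchyD)
qed

end

section \<open>Functoriality and universal property of the completion\<close>

lemma additive_hom_add_pow: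
  assumes "abelian_group G" "abelian_group H"
    and h: "h \<in> hom (add_monoid G) (add_monoid H)" and x: "x \<in> carrier G"
  shows "h ([(k::nat)] \<cdot>\<^bsub>G\<^esub> x) = [k] \<cdot>\<^bsub>H\<^esub> h x"
proof -
  interpret abelian_group_hom G H h
    using assms by (intro abelian_group_homI) (auto simp: group_hom_def group_hom_axioms_def
      abelian_group.a_group)
  show ?thesis by (induction k) (use x in simp_all)
qed

lemma additive_hom_minus:
  assumes "abelian_group G" "abelian_group H"
    and h: "h \<in> hom (add_monoid G) (add_monoid H)" and x: "x \<in> carrier G" "y \<in> carrier G"
  shows "h (x \<ominus>\<^bsub>G\<^esub> y) = h x \<ominus>\<^bsub>H\<^esub> h y"
proof -
  interpret abelian_group_hom G H h
    using assms by (intro abelian_group_homI) (auto simp: group_hom_def group_hom_axioms_def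
      abelian_group.a_group)
  show ?thesis using x by (simp add: a_minus_def)
qed

lemma additive_hom_multiples:
  assumes "abelian_group G" "abelian_group H"
    and h: "h \<in> hom (add_monoid G) (add_monoid H)" and x: "x \<in> multiples G m"
  shows "h x \<in> multiples H m"
proof -
  obtain y where y: "y \<in> carrier G" "x = [m] \<cdot>\<^bsub>G\<^esub> y" using x by (auto simp: multiples_def)
  then have "h x = [m] \<cdot>\<^bsub>H\<^esub> h y" by (simp add: additive_hom_add_pow[OF assms(1-3)])
  moreover have "h y \<in> carrier H" using h y by (auto simp: hom_def)
  ultimately show ?thesis by (auto simp: multiples_def)
qed

lemma additive_hom_cauchy:
  assumes "abelian_group G" "abelian_group H"
    and h: "h \<in> hom (add_monoid G) (add_monoid H)" and r: "cauchy p G r"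
  shows "cauchy p H (\<lambda>n. h (r n))"
  unfolding cauchy_def
proof (intro conjI allI)
  fix n
  have "h (r (Suc n) \<ominus>\<^bsub>G\<^esub> r n) \<in> multiples H (p ^ n)"
    using r by (intro additive_hom_multiples[OF assms(1-3)]) (simp add: cauchy_def)
  then show "h (r (Suc n)) \<ominus>\<^bsub>H\<^esub> h (r n) \<in> multiples H (p ^ n)"
    using r by (simp add: additive_hom_minus[OF assms(1-3)] abelian_group.cauchyD[OF assms(1)])
qed (use r h in \<open>auto simp: hom_def cauchy_def\<close>)

text \<open>An additive map sends multiples of p^n to multiples of p^n, so every representative of a
  coset yields the same image coset and \<open>the_elem\<close> is applied to a singleton.\<close>

lemma completion_map_lim:
  assumes G: "abelian_group G" and H: "abelian_group H"
    and h: "h \<in> hom (add_monoid G) (add_monoid H)" and r: "cauchy p G r"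
  shows "completion_map p H h (padic_lim p G r) = padic_lim p H (\<lambda>n. h (r n))"
proof
  fix n
  interpret G: abelian_group G by fact
  interpret H: abelian_group H by fact
  have rn: "r n \<in> carrier G" using r by (rule G.cauchyD)
  have "multiples H (p ^ n) +>\<^bsub>H\<^esub> h x = multiples H (p ^ n) +>\<^bsub>H\<^esub> h (r n)"
    if "x \<in> padic_lim p G r n" for x
  proof -
    have x: "x \<in> carrier G" "x \<ominus>\<^bsub>G\<^esub> r n \<in> multiples G (p ^ n)"
      using that rn by (auto simp: padic_lim_def G.multiples_coset_mem)
    then have "h x \<ominus>\<^bsub>H\<^esub> h (r n) \<in> multiples H (p ^ n)"
      using additive_hom_multiples[OF G H h x(2)] rn by (simp add: additive_hom_minus[OF G H h])
    then show ?thesis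
      using x rn h H.multiples_coset_iff[of "h x" "h (r n)"] by (auto simp: hom_def)
  qed
  moreover have "r n \<in> padic_lim p G r n"
    using rn by (simp add: padic_lim_def G.multiples_coset_mem)
  ultimately have "(\<lambda>x. multiples H (p ^ n) +>\<^bsub>H\<^esub> h x) ` padic_lim p G r n =
      {multiples H (p ^ n) +>\<^bsub>H\<^esub> h (r n)}" by blast
  then show "completion_map p H h (padic_lim p G r) n = padic_lim p H (\<lambda>n. h (r n)) n"
    by (simp add: completion_map_def padic_lim_def)
qed

lemma completion_map_hom:
  assumes R: "cring R" and S: "cring S" and h: "h \<in> ring_hom R S"
  shows "completion_map p S h \<in> ring_hom (padic_completion p R) (padic_completion p S)"
proof -
  interpret R: ring_completion R p using R by (rule ring_completion.intro)
  interpret S: ring_completion S p using S by (rule ring_completion.intro)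
  note h' = ring_hom_in_hom(2)[OF h]
  note map = completion_map_lim[OF R.abelian_group_axioms S.abelian_group_axioms h']
  note cauchy = additive_hom_cauchy[OF R.abelian_group_axioms S.abelian_group_axioms h']
  show ?thesis
  proof (rule ring_hom_memI)
    fix x y assume "x \<in> carrier (padic_completion p R)" "y \<in> carrier (padic_completion p R)"
    then obtain r s where "R.Cy r" "R.Cy s" "x = R.Pl r" "y = R.Pl s" by (metis R.Lim_cases)
    then show "completion_map p S h x \<in> carrier (padic_completion p S)"
      "completion_map p S h (x \<otimes>\<^bsub>R.C\<^esub> y) = completion_map p S h x \<otimes>\<^bsub>S.C\<^esub> completion_map p S h y"
      "completion_map p S h (x \<oplus>\<^bsub>R.C\<^esub> y) = completion_map p S h x \<oplus>\<^bsub>S.C\<^esub> completion_map p S h y"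
      by (simp_all add: map cauchy R.Lim_mult R.Lim_add R.cauchy_mult R.cauchy_add
          S.Lim_mult S.Lim_add R.cauchyD ring_hom_mult[OF h] ring_hom_add[OF h])
  next
    show "completion_map p S h \<one>\<^bsub>R.C\<^esub> = \<one>\<^bsub>S.C\<^esub>"
      using ring_hom_one[OF h] by (simp add: R.Lim_one S.Lim_one map)
  qed
qed

text \<open>Universal property: in a p-adically complete ring the images of a representing sequence
  have a limit, and it does not depend on the sequence.\<close>

lemma completion_extend:
  assumes R: "cring R" and T: "padic_ring T p" and h: "h \<in> ring_hom R T"
  obtains \<phi> where "\<phi> \<in> ring_hom (padic_completion p R) T"
    "\<And>r. r \<in> carrier R \<Longrightarrow> \<phi> (to_completion p R r) = h r"
proof -
  interpret R: ring_completion R p using R by (rule ring_completion.intro)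
  interpret T: padic_ring T p by fact
  have h_add: "h \<in> hom (add_monoid R) (add_monoid T)" by (rule ring_hom_in_hom(2)[OF h])
  note ag = R.abelian_group_axioms T.abelian_group_axioms h_add
  note cauchy = additive_hom_cauchy[OF ag]
  have hc: "h x \<in> carrier T" if "x \<in> carrier R" for x using ring_hom_closed[OF h that] .
  have ex: "\<exists>v. v \<in> carrier T \<and> (\<forall>r. R.Cy r \<and> x = R.Pl r \<longrightarrow> (\<forall>n. v \<ominus>\<^bsub>T\<^esub> h (r n) \<in> multiples T (p ^ n)))"
    if xC: "x \<in> carrier R.C" for x
  proof -
    obtain r where r: "R.Cy r" "x = R.Pl r" using xC by (rule R.Lim_cases)
    obtain l where l: "l \<in> carrier T" "\<And>n. l \<ominus>\<^bsub>T\<^esub> h (r n) \<in> multiples T (p ^ n)"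
      using T.padic_limit[OF cauchy[OF r(1)]] by auto
    have "l \<ominus>\<^bsub>T\<^esub> h (s n) \<in> multiples T (p ^ n)" if s: "R.Cy s" "x = R.Pl s" for s n
    proof -
      have "r n \<ominus>\<^bsub>R\<^esub> s n \<in> multiples R (p ^ n)"
        using r s R.padic_lim_eq_iff[of p r s] by simp
      then have "h (r n) \<ominus>\<^bsub>T\<^esub> h (s n) \<in> multiples T (p ^ n)"
        using additive_hom_multiples[OF ag, of "r n \<ominus>\<^bsub>R\<^esub> s n" "p ^ n"]
          additive_hom_minus[OF ag R.cauchyD[OF r(1), of n] R.cauchyD[OF s(1), of n]]
        by simp
      then show ?thesis
        using T.multiples_minus_trans[OF l(2) _ l(1) hc hc, of n "s n"] R.cauchyD[OF r(1)] R.cauchyD[OF s(1)]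
        by blast
    qed
    with l show ?thesis by blast
  qed
  \<comment> \<open>\<phi> is characterised by its distance to every representing sequence at once,
    not to a chosen one. The homomorphism laws then follow by applying this to the sequences of sums
    and of products.\<close>
  obtain \<phi> where \<phi>: "\<And>x. x \<in> carrier R.C \<Longrightarrow> \<phi> x \<in> carrier T"
    "\<And>r n. R.Cy r \<Longrightarrow> \<phi> (R.Pl r) \<ominus>\<^bsub>T\<^esub> h (r n) \<in> multiples T (p ^ n)"
  proof -
    have "\<exists>\<phi>. \<forall>x\<in>carrier R.C. \<phi> x \<in> carrier T \<and>
      (\<forall>r. R.Cy r \<and> x = R.Pl r \<longrightarrow> (\<forall>n. \<phi> x \<ominus>\<^bsub>T\<^esub> h (r n) \<in> multiples T (p ^ n)))"
      using ex by (intro bchoice) blast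
    then show ?thesis using that R.Lim_closed by blast
  qed
  have eqI: "\<phi> (R.Pl r) = v" if "R.Cy r" "v \<in> carrier T" "\<And>n. v \<ominus>\<^bsub>T\<^esub> h (r n) \<in> multiples T (p ^ n)" for r v
  proof (rule T.padic_eqI)
    fix n
    show "\<phi> (R.Pl r) \<ominus>\<^bsub>T\<^esub> v \<in> multiples T (p ^ n)"
      using T.multiples_minus_trans[OF \<phi>(2)[OF that(1), of n] T.multiples_minus_commute[OF that(3)[of n] that(2)]
          \<phi>(1)[OF R.Lim_closed[OF that(1)]] _ that(2)] hc R.cauchyD[OF that(1)] by blast
  qed (use that \<phi>(1) in auto)
  have "\<phi> \<in> ring_hom R.C T"
  proof (rule ring_hom_memI)
    fix x y assume "x \<in> carrier R.C" "y \<in> carrier R.C"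
    then obtain r s where rs: "R.Cy r" "R.Cy s" "x = R.Pl r" "y = R.Pl s" by (metis R.Lim_cases)
    note c = hc[OF R.cauchyD[OF rs(1)]] hc[OF R.cauchyD[OF rs(2)]] \<phi>(1)[OF R.Lim_closed[OF rs(1)]]
      \<phi>(1)[OF R.Lim_closed[OF rs(2)]]
    show "\<phi> (x \<otimes>\<^bsub>R.C\<^esub> y) = \<phi> x \<otimes>\<^bsub>T\<^esub> \<phi> y"
      unfolding rs R.Lim_mult[OF rs(1,2)]
    proof (rule eqI)
      fix n show "\<phi> (R.Pl r) \<otimes>\<^bsub>T\<^esub> \<phi> (R.Pl s) \<ominus>\<^bsub>T\<^esub> h (r n \<otimes>\<^bsub>R\<^esub> s n) \<in> multiples T (p ^ n)"
        using rs c \<phi>(2) by (simp add: ring_hom_mult[OF h] R.cauchyD T.multiples_cong_mult)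
    qed (use rs c R.cauchy_mult in auto)
    show "\<phi> (x \<oplus>\<^bsub>R.C\<^esub> y) = \<phi> x \<oplus>\<^bsub>T\<^esub> \<phi> y"
      unfolding rs R.Lim_add[OF rs(1,2)]
    proof (rule eqI)
      fix n show "\<phi> (R.Pl r) \<oplus>\<^bsub>T\<^esub> \<phi> (R.Pl s) \<ominus>\<^bsub>T\<^esub> h (r n \<oplus>\<^bsub>R\<^esub> s n) \<in> multiples T (p ^ n)"
        using rs c \<phi>(2) by (simp add: ring_hom_add[OF h] R.cauchyD T.multiples_cong_add)
    qed (use rs c R.cauchy_add in auto)
  next
    show "\<phi> \<one>\<^bsub>R.C\<^esub> = \<one>\<^bsub>T\<^esub>"
      unfolding R.Lim_one by (rule eqI) (simp_all add: ring_hom_one[OF h])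
  qed (use \<phi> in auto)
  moreover have "\<phi> (to_completion p R r) = h r" if "r \<in> carrier R" for r
    unfolding R.to_completion_lim using that hc by (intro eqI) auto
  ultimately show ?thesis using that by blast
qed

section \<open>Unramified discrete valuation rings\<close>

lemma dvd_swap: "d dvd x - y \<Longrightarrow> d dvd y - x" for d :: "'b::comm_ring_1"
  by (metis dvd_minus_iff minus_diff_eq)

lemma power_cong: "d dvd x - y \<Longrightarrow> d dvd x ^ n - y ^ (n::nat)" for x :: "'b::comm_ring_1"
  by (metis dvd_mult2 power_diff_sumr2)

lemma power_p_Suc: "x ^ p ^ Suc n = (x ^ p ^ n) ^ p" for x :: "'b::comm_ring_1"
  by (metis power_Suc2 power_mult)

text \<open>The quotient of the mixed terms by p is written out because it has to be recognised as a
  member of \<open>witt\<close> and of \<open>RR\<close>, not merely as an element that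
  exists.\<close>

lemma power_sum_expand:
  fixes x y :: "'b::comm_ring_1"
  assumes p_prime: "Factorial_Ring.prime p"
  shows "(x + y) ^ p = x ^ p + y ^ p + of_nat p * (\<Sum>k\<in>{0<..<p}. of_nat ((p choose k) div p) * x ^ k * y ^ (p - k))"
proof -
  have "(x + y) ^ p = (\<Sum>k\<le>p. of_nat (p choose k) * x ^ k * y ^ (p - k))"
    by (rule binomial_ring)
  also have "{..p} = insert 0 (insert p {0<..<p})" using prime_gt_0_nat[OF p_prime] by auto
  also have "(\<Sum>k\<in>insert 0 (insert p {0<..<p}). of_nat (p choose k) * x ^ k * y ^ (p - k)) =
      y ^ p + x ^ p + (\<Sum>k\<in>{0<..<p}. of_nat (p choose k) * x ^ k * y ^ (p - k))"
    using prime_gt_0_nat[OF p_prime] by (simp add: add.assoc)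
  also have "(\<Sum>k\<in>{0<..<p}. of_nat (p choose k) * x ^ k * y ^ (p - k)) =
      of_nat p * (\<Sum>k\<in>{0<..<p}. of_nat ((p choose k) div p) * x ^ k * y ^ (p - k))"
    unfolding sum_distrib_left
  proof (rule sum.cong)
    fix k assume "k \<in> {0<..<p}"
    then have "p dvd (p choose k)" using p_prime by (intro dvd_choose_prime) auto
    then have "p choose k = p * ((p choose k) div p)" by simp
    then have "(of_nat (p choose k) :: 'b) = of_nat p * of_nat ((p choose k) div p)"
      by (metis of_nat_mult)
    then show "of_nat (p choose k) * x ^ k * y ^ (p - k) =
        of_nat p * (of_nat ((p choose k) div p) * x ^ k * y ^ (p - k))"
      by (simp add: mult.assoc)
  qed simp
  finally show ?thesis by (simp add: algebra_simps)
qed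

lemma freshman:
  fixes x y :: "'b::comm_ring_1"
  assumes "Factorial_Ring.prime p"
  shows "of_nat p dvd (x + y) ^ p - (x ^ p + y ^ p)"
  by (simp add: power_sum_expand[OF assms])

lemma freshman_diff:
  fixes x y :: "'b::comm_ring_1"
  assumes "Factorial_Ring.prime p" "odd p"
  shows "of_nat p dvd (x - y) ^ p - (x ^ p - y ^ p)"
  using freshman[OF assms(1), of x "- y"] assms(2) by simp

lemma freshman_iterate:
  fixes x y :: "'b::comm_ring_1"
  assumes "Factorial_Ring.prime p" "odd p"
  shows "of_nat p dvd (x - y) ^ p ^ n - (x ^ p ^ n - y ^ p ^ n)"
proof (induction n)
  case (Suc n)
  from dvd_add[OF power_cong[OF Suc, of p] freshman_diff[OF assms, of "x ^ p ^ n" "y ^ p ^ n"]]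
  show ?case unfolding power_p_Suc by (simp add: algebra_simps)
qed simp

text \<open>\<open>perfect\<close> is the form in which algebraicity over the prime field enters:
  every residue lies in a finite field, so some power of the Frobenius fixes it. The other clauses
  describe a complete discrete valuation ring with uniformizer p in terms of divisibility.\<close>

locale unramified_dvr =
  fixes p :: nat and \<pi> :: "'a::idom"
  assumes \<pi>_def: "\<pi> = of_nat p"
    and p_prime: "Factorial_Ring.prime p" and p_odd: "odd p"
    and pi_nz: "\<pi> \<noteq> 0" and pi_not_unit: "\<not> \<pi> dvd 1"
    and unitI: "\<And>x. \<not> \<pi> dvd x \<Longrightarrow> x dvd 1"
    and limit: "\<And>s. (\<And>n::nat. \<pi> ^ n dvd s (Suc n) - s n) \<Longrightarrow> \<exists>l. \<forall>n. \<pi> ^ n dvd l - s n"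
    and separated: "\<And>x. (\<And>n::nat. \<pi> ^ n dvd x) \<Longrightarrow> x = 0"
    and perfect: "\<And>x. \<exists>r>0. \<pi> dvd x ^ (p ^ r) - x"
begin

lemma pi_prime: "\<pi> dvd x * y \<Longrightarrow> \<pi> dvd x \<or> \<pi> dvd y"
proof (rule disjCI)
  assume "\<pi> dvd x * y" "\<not> \<pi> dvd y"
  from unitI[OF this(2)] obtain z where "1 = y * z" by (auto simp: dvd_def)
  then have "x = x * y * z" by (simp add: mult.assoc)
  with \<open>\<pi> dvd x * y\<close> show "\<pi> dvd x" by (metis dvd_mult2)
qed

lemma pi_dvd_power: "\<pi> dvd x ^ n \<Longrightarrow> \<pi> dvd x"
  by (induction n) (use pi_not_unit pi_prime in auto)

lemma eqI: "(\<And>n::nat. \<pi> ^ n dvd x - y) \<Longrightarrow> x = y"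
  using separated[of "x - y"] by simp

lemma p_pos: "p > 0"
  using p_prime prime_gt_0_nat by blast

text \<open>The cofactor of x - y in x^p - y^p is congruent to p y^{p-1} modulo \<pi>, hence
  divisible by \<pi>; so p-th powers gain one factor.\<close>

lemma power_p_cong:
  assumes "\<pi> ^ Suc k dvd x - y" shows "\<pi> ^ Suc (Suc k) dvd x ^ p - y ^ p"
proof -
  have d: "\<pi> dvd x - y" using assms by (metis dvd_mult_left power_Suc)
  have "\<pi> dvd (\<Sum>i<p. y ^ (p - Suc i) * x ^ i)"
  proof -
    have "\<pi> dvd (\<Sum>i<p. y ^ (p - Suc i) * x ^ i - y ^ (p - 1))"
    proof (rule dvd_sum)
      fix i assume "i \<in> {..<p}"
      then have "y ^ (p - 1) = y ^ (p - Suc i) * y ^ i"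
        by (subst power_add[symmetric]) simp
      then have "y ^ (p - Suc i) * x ^ i - y ^ (p - 1) = y ^ (p - Suc i) * (x ^ i - y ^ i)"
        by (simp add: algebra_simps)
      then show "\<pi> dvd y ^ (p - Suc i) * x ^ i - y ^ (p - 1)"
        using power_cong[OF d, of i] by simp
    qed
    then show ?thesis by (simp add: sum_subtractf \<pi>_def dvd_diff_left_iff)
  qed
  with assms have "\<pi> ^ Suc k * \<pi> dvd (x - y) * (\<Sum>i<p. y ^ (p - Suc i) * x ^ i)"
    by (rule mult_dvd_mono)
  then show ?thesis by (simp add: power_diff_sumr2 mult.commute)
qed

lemma power_p_power_cong: "\<pi> dvd x - y \<Longrightarrow> \<pi> ^ Suc n dvd x ^ p ^ n - y ^ p ^ n"
proof (induction n)
  case (Suc n)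
  have "\<pi> ^ Suc (Suc n) dvd (x ^ p ^ n) ^ p - (y ^ p ^ n) ^ p"
    by (rule power_p_cong) (use Suc in simp)
  then show ?case unfolding power_p_Suc .
qed simp

section \<open>Teichmueller representatives and the Frobenius lift of A\<close>

lemma power_p_mult_Suc: "x ^ p ^ (r * Suc n) = (x ^ p ^ r) ^ p ^ (r * n)" for x :: "'b::comm_ring_1"
  using power_mult[of x "p ^ r" "p ^ (r * n)"] by (simp only: mult_Suc_right power_add)

lemma power_p_mult_Suc': "x ^ p ^ (r * Suc n) = (x ^ p ^ (r * n)) ^ p ^ r" for x :: "'b::comm_ring_1"
  using power_mult[of x "p ^ (r * n)" "p ^ r"] by (simp only: mult_Suc_right power_add mult.commute[of "p ^ r"])

lemma power_p_power_fixed: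
  fixes t :: 'a assumes "t ^ p ^ r = t" shows "t ^ p ^ (r * n) = t"
proof (induction n)
  case (Suc n)
  have "t ^ p ^ (r * Suc n) = (t ^ p ^ r) ^ p ^ (r * n)"
    by (rule power_p_mult_Suc)
  then show ?case using assms Suc by simp
qed simp

text \<open>Both elements are unchanged by raising to the power p^{rn}, and these powers sharpen
  congruences without bound.\<close>

lemma teichmueller_unique:
  assumes "u ^ p ^ r = u" "v ^ p ^ r = v" "r > 0" "\<pi> dvd u - v"
  shows "u = v"
proof (rule eqI)
  fix n
  have "u ^ p ^ (r * n) = u" "v ^ p ^ (r * n) = v"
    using assms(1,2) by (auto intro: power_p_power_fixed)
  then have "\<pi> ^ Suc (r * n) dvd u - v" using power_p_power_cong[OF assms(4), of "r * n"] by simp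
  moreover have "n \<le> Suc (r * n)" using \<open>r > 0\<close> by (cases r) auto
  ultimately show "\<pi> ^ n dvd u - v" using le_imp_power_dvd dvd_trans by blast
qed

text \<open>The powers x^{p^{rn}} form a Cauchy sequence, because raising to the power p^{rn}
  sharpens the congruence between x^{p^r} and x. The limit is fixed by the p^r-th power.\<close>

lemma teichmueller_exists:
  obtains t r where "r > 0" "t ^ p ^ r = t" "\<pi> dvd x - t"
proof -
  obtain r where r: "r > 0" "\<pi> dvd x ^ (p ^ r) - x" using perfect by blast
  define s where "s n = x ^ p ^ (r * n)" for n
  have sS: "s (Suc n) = s n ^ p ^ r" for n
    unfolding s_def by (rule power_p_mult_Suc')
  have "\<pi> ^ n dvd s (Suc n) - s n" for n
  proof -
    have "\<pi> ^ Suc (r * n) dvd (x ^ p ^ r) ^ p ^ (r * n) - x ^ p ^ (r * n)"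
      by (rule power_p_power_cong[OF r(2)])
    moreover have "(x ^ p ^ r) ^ p ^ (r * n) = s (Suc n)"
      unfolding s_def by (rule power_p_mult_Suc[symmetric])
    moreover have "n \<le> Suc (r * n)" using \<open>r > 0\<close> by (cases r) auto
    ultimately show ?thesis unfolding s_def using le_imp_power_dvd dvd_trans by metis
  qed
  then obtain t where t: "\<And>n. \<pi> ^ n dvd t - s n" using limit by blast
  have "t ^ p ^ r = t"
  proof (rule eqI)
    fix n
    have "\<pi> ^ n dvd t ^ p ^ r - s (Suc n)" unfolding sS by (rule power_cong[OF t])
    moreover have "\<pi> ^ n dvd t - s (Suc n)"
      using t[of "Suc n"] by (meson dvd_trans le_imp_power_dvd le_SucI order_refl)
    ultimately have "\<pi> ^ n dvd (t ^ p ^ r - s (Suc n)) - (t - s (Suc n))" by (rule dvd_diff)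
    then show "\<pi> ^ n dvd t ^ p ^ r - t" by simp
  qed
  moreover have "\<pi> dvd x - t"
  proof -
    have "\<pi> dvd t - x ^ p ^ r" using t[of 1] by (simp add: s_def)
    from dvd_add[OF this r(2)] have "\<pi> dvd t - x" by simp
    then show ?thesis by (rule dvd_swap)
  qed
  ultimately show ?thesis using that r by blast
qed

text \<open>A member s stands for k -> \<phi>^k(s 0), with \<phi> the Frobenius lift still to be
  constructed. On elements that \<phi> raises to the p-th power the orbit is known, which gives the
  generators; sums and negatives follow additivity. The index runs over all integers because
  \<open>witt_dvd\<close> goes back along the orbit. The construction takes the place of Witt
  vectors.\<close>

inductive_set witt :: "(int \<Rightarrow> 'a) set" where
  witt_gen: "(\<And>k. s (k + 1) = s k ^ p) \<Longrightarrow> s \<in> witt"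
| witt_add: "s \<in> witt \<Longrightarrow> t \<in> witt \<Longrightarrow> (\<lambda>k. s k + t k) \<in> witt"
| witt_neg: "s \<in> witt \<Longrightarrow> (\<lambda>k. - s k) \<in> witt"

lemma witt_zero: "(\<lambda>k. 0) \<in> witt" and witt_one: "(\<lambda>k. 1) \<in> witt"
  using p_pos by (auto intro: witt_gen)

lemma witt_diff: "s \<in> witt \<Longrightarrow> t \<in> witt \<Longrightarrow> (\<lambda>k. s k - t k) \<in> witt"
  using witt_add[OF _ witt_neg] by fastforce

lemma witt_mult:
  assumes "s \<in> witt" "t \<in> witt" shows "(\<lambda>k. s k * t k) \<in> witt"
  using assms
proof (induction arbitrary: t rule: witt.induct)
  case (witt_gen s)
  note s = this(1)
  from \<open>t \<in> witt\<close> show ?case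
  proof (induction rule: witt.induct)
    case (witt_gen t)
    then show ?case using s by (intro witt.witt_gen) (simp add: power_mult_distrib)
  next
    case (witt_add t u)
    then show ?case using witt.witt_add by (fastforce simp: distrib_left)
  next
    case (witt_neg t)
    then show ?case using witt.witt_neg by fastforce
  qed
next
  case (witt_add s u)
  have "(\<lambda>k. s k * t k + u k * t k) \<in> witt"
    by (intro witt.witt_add witt_add.IH witt_add.prems)
  then show ?case by (simp add: distrib_right)
next
  case (witt_neg s)
  have "(\<lambda>k. - (s k * t k)) \<in> witt"
    by (intro witt.witt_neg witt_neg.IH witt_neg.prems)
  then show ?case by simp
qed

lemma witt_power: "s \<in> witt \<Longrightarrow> (\<lambda>k. s k ^ n) \<in> witt"
  by (induction n) (use witt_one witt_mult in auto)

lemma witt_sum: "(\<And>i. i \<in> I \<Longrightarrow> f i \<in> witt) \<Longrightarrow> (\<lambda>k. \<Sum>i\<in>I. f i k) \<in> witt"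
  by (induction I rule: infinite_finite_induct) (use witt_zero witt_add in auto)

lemma witt_of_nat: "(\<lambda>k. of_nat n) \<in> witt"
  by (induction n) (use witt_zero witt_add[OF witt_one] in auto)

lemma witt_shift: "s \<in> witt \<Longrightarrow> (\<lambda>k. s (k + j)) \<in> witt"
proof (induction rule: witt.induct)
  case (witt_gen s)
  have "s (k + 1 + j) = s (k + j) ^ p" for k
    using witt_gen[of "k + j"] by (simp add: ac_simps)
  then show ?case by (rule witt.witt_gen)
qed (auto intro: witt.intros)

text \<open>The correction term has to be a member again, as it is fed into the induction of
  \<open>witt_dvd\<close>. For a sum it involves the explicit polynomial from
  \<open>power_sum_expand\<close>, a member because members form a ring.\<close>

lemma witt_frobenius:
  assumes "s \<in> witt" shows "\<exists>v\<in>witt. \<forall>k. s (k + 1) = s k ^ p + \<pi> * v k"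
  using assms
proof (induction rule: witt.induct)
  case (witt_gen s)
  then show ?case by (intro bexI[OF _ witt_zero]) simp
next
  case (witt_add s t)
  then obtain v w where vw: "v \<in> witt" "w \<in> witt" "\<And>k. s (k + 1) = s k ^ p + \<pi> * v k"
    "\<And>k. t (k + 1) = t k ^ p + \<pi> * w k" by auto
  define c where "c k = (\<Sum>i\<in>{0<..<p}. of_nat ((p choose i) div p) * s k ^ i * t k ^ (p - i))" for k
  have "c \<in> witt"
    unfolding c_def by (intro witt_sum witt_mult witt_of_nat witt_power witt_add.hyps)
  moreover have "s (k + 1) + t (k + 1) = (s k + t k) ^ p + \<pi> * (v k + w k - c k)" for k
    unfolding power_sum_expand[OF p_prime] vw c_def \<pi>_def by (simp add: algebra_simps)
  ultimately show ?case
    using vw by (intro bexI[of _ "\<lambda>k. v k + w k - c k"] allI) (auto intro: witt.intros witt_diff)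
next
  case (witt_neg s)
  then obtain v where "v \<in> witt" "\<And>k. s (k + 1) = s k ^ p + \<pi> * v k" by auto
  then show ?case
    using p_odd by (intro bexI[of _ "\<lambda>k. - v k"]) (auto intro: witt.intros)
qed

lemma witt_frobenius_iterate:
  assumes "s \<in> witt" shows "\<exists>v\<in>witt. \<forall>k. s (k + int n) = s k ^ p ^ n + \<pi> * v k"
proof (induction n)
  case 0
  then show ?case by (intro bexI[OF _ witt_zero]) simp
next
  case (Suc n)
  then obtain v where v: "v \<in> witt" "\<And>k. s (k + int n) = s k ^ p ^ n + \<pi> * v k" by auto
  obtain w where w: "w \<in> witt" "\<And>k. s (k + 1 + int n) = s (k + int n) ^ p + \<pi> * w k"
    using witt_frobenius[OF witt_shift[OF assms, of "int n"]] by auto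
  define a where "a k = s k ^ p ^ n" for k
  define b where "b k = s (k + int n)" for k
  define c where "c k = (\<Sum>i<p. a k ^ (p - Suc i) * b k ^ i)" for k
  have ab: "a \<in> witt" "b \<in> witt"
    unfolding a_def b_def by (intro witt_power witt_shift assms)+
  have "(\<lambda>k. v k * c k + w k) \<in> witt"
    unfolding c_def by (intro witt.witt_add witt_mult witt_sum witt_power ab v w)
  moreover have "s (k + int (Suc n)) = s k ^ p ^ Suc n + \<pi> * (v k * c k + w k)" for k
  proof -
    have "b k ^ p - a k ^ p = (b k - a k) * c k" unfolding c_def by (rule power_diff_sumr2)
    moreover have "b k - a k = \<pi> * v k" by (simp add: a_def b_def v)
    ultimately have "b k ^ p = a k ^ p + \<pi> * v k * c k" by (simp add: algebra_simps)
    moreover have "a k ^ p = s k ^ p ^ Suc n"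
      unfolding a_def power_p_Suc ..
    moreover have "s (k + int (Suc n)) = b k ^ p + \<pi> * w k"
      using w(2)[of k] by (simp add: b_def ac_simps)
    ultimately show ?thesis by (simp add: algebra_simps)
  qed
  ultimately show ?case by (intro bexI[of _ "\<lambda>k. v k * c k + w k"] allI)
qed

text \<open>Modulo \<pi> the shift is the p-th power, and \<pi> is prime, so divisibility passes to
  the next index as well as to the previous one.\<close>

lemma witt_residue:
  assumes "s \<in> witt" "\<pi> dvd s 0" shows "\<pi> dvd s k"
proof -
  obtain v where v: "\<And>k. s (k + 1) = s k ^ p + \<pi> * v k" using witt_frobenius[OF assms(1)] by auto
  have step: "\<pi> dvd s (k + 1) \<longleftrightarrow> \<pi> dvd s k" for k
    using pi_dvd_power[of "s k" p] p_pos dvd_power_le[of \<pi> "s k" p] unfolding v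
    by (auto simp: dvd_add_left_iff dvd_power_iff_le intro: dvd_trans[OF _ dvd_power[of p "s k"]])
  show ?thesis
  proof (induction k rule: int_induct[where k = 0])
    case (step2 i)
    then show ?case using step[of "i - 1"] by simp
  qed (use assms step in auto)
qed

text \<open>This makes s 1 a continuous function of s 0. Going back n + 1 indices shows each s k as
  a p^{n+1}-th power plus \<pi> v k, with v a member. The base of the power is divisible by \<pi>,
  hence the power by \<pi>^{n+1}. What remains is v, whose value at 0 is divisible by \<pi>^n, and
  the induction hypothesis applies to it.\<close>

lemma witt_dvd:
  assumes "s \<in> witt" "\<pi> ^ n dvd s 0" shows "\<pi> ^ n dvd s k"
  using assms
proof (induction n arbitrary: s k)
  case (Suc n)
  define y where "y k = s (k + - int (Suc n))" for k
  have y: "y \<in> witt" unfolding y_def by (rule witt_shift[OF Suc.prems(1)])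
  obtain v where v: "v \<in> witt" "\<And>k. y (k + int (Suc n)) = y k ^ p ^ Suc n + \<pi> * v k"
    using witt_frobenius_iterate[OF y, of "Suc n"] by auto
  have s: "s k = y k ^ p ^ Suc n + \<pi> * v k" for k
    using v(2)[of k] by (simp add: y_def)
  have "\<pi> dvd s 0" using Suc.prems(2) by (metis dvd_mult_left power_Suc)
  then have "\<pi> dvd y k" for k unfolding y_def by (rule witt_residue[OF Suc.prems(1)])
  then have "\<pi> ^ p ^ Suc n dvd y k ^ p ^ Suc n" for k by (rule dvd_power_same)
  moreover have "Suc n \<le> p ^ Suc n"
    using power_gt_expt[of p "Suc n"] prime_gt_1_nat[OF p_prime] by simp
  ultimately have yk: "\<pi> ^ Suc n dvd y k ^ p ^ Suc n" for k
    using le_imp_power_dvd dvd_trans by blast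
  have "\<pi> ^ Suc n dvd \<pi> * v 0"
    using Suc.prems(2) yk[of 0] unfolding s[of 0] by (simp add: dvd_add_right_iff)
  then have "\<pi> ^ n dvd v 0" using pi_nz by simp
  then have "\<pi> ^ n dvd v k" by (rule Suc.IH[OF v(1)])
  then have "\<pi> ^ Suc n dvd \<pi> * v k" by simp
  with yk[of k] show ?case unfolding s[of k] by (rule dvd_add)
qed simp

lemma witt_teichmueller:
  assumes "r > 0" "t ^ p ^ r = t"
  obtains s where "s \<in> witt" "s 0 = t" "s 1 = t ^ p"
proof -
  \<comment> \<open>The orbit of t is periodic with period r; the wrap from exponent r - 1 back to 0
    is the equation t^{p^r} = t.\<close>
  define s where "s k = t ^ p ^ nat (k mod int r)" for k
  have eq: "s (k + 1) = s k ^ p" for k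
  proof (cases "k mod int r = int r - 1")
    case True
    have "(k + 1) mod int r = (k mod int r + 1) mod int r" by (simp add: mod_add_left_eq)
    also have "\<dots> = 0" by (simp add: True)
    finally have "s (k + 1) = t" by (simp add: s_def)
    moreover have "s k ^ p = t ^ p ^ Suc (r - 1)"
      using assms(1) unfolding power_p_Suc by (simp add: s_def True nat_diff_distrib)
    ultimately show ?thesis using assms by simp
  next
    case False
    have b: "0 \<le> k mod int r" "k mod int r < int r" using assms(1) by simp_all
    have "(k + 1) mod int r = (k mod int r + 1) mod int r" by (simp add: mod_add_left_eq)
    also have "\<dots> = k mod int r + 1" using b False by simp
    finally have "nat ((k + 1) mod int r) = Suc (nat (k mod int r))" using b by simp
    then show ?thesis unfolding s_def by (simp only: power_p_Suc)
  qed
  moreover have "s 0 = t" by (simp add: s_def)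
  moreover have "s 1 = t ^ p" using eq[of 0] \<open>s 0 = t\<close> by simp
  ultimately show ?thesis using that witt_gen by metis
qed

text \<open>Teichmueller expansion: once a representative is split off, the rest is divisible by p,
  and p itself is a constant member.\<close>

lemma witt_dense: "\<exists>s\<in>witt. \<pi> ^ n dvd x - s 0"
proof (induction n arbitrary: x)
  case 0
  then show ?case using witt_zero by auto
next
  case (Suc n)
  obtain t r where t: "r > 0" "t ^ p ^ r = t" "\<pi> dvd x - t" by (rule teichmueller_exists)
  obtain s where s: "s \<in> witt" "s 0 = t" using witt_teichmueller[OF t(1,2)] by metis
  obtain y where y: "x - t = \<pi> * y" using t(3) by (auto simp: dvd_def)
  obtain u where u: "u \<in> witt" "\<pi> ^ n dvd y - u 0" using Suc by blast
  have "(\<lambda>k. s k + of_nat p * u k) \<in> witt" by (intro witt_add witt_mult witt_of_nat s u)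
  moreover have "x - (s 0 + of_nat p * u 0) = \<pi> * (y - u 0)"
    using y by (simp add: s \<pi>_def algebra_simps)
  ultimately show ?case using u(2) by (intro bexI) auto
qed

theorem frobenius_exists:
  "\<exists>\<phi>. (\<forall>x y. \<phi> (x + y) = \<phi> x + \<phi> y) \<and> (\<forall>x y. \<phi> (x * y) = \<phi> x * \<phi> y) \<and> \<phi> 1 = 1 \<and>
    (\<forall>x. \<pi> dvd \<phi> x - x ^ p) \<and> (\<forall>s\<in>witt. \<phi> (s 0) = s 1)"
proof -
  \<comment> \<open>\<phi> x is the limit of s_n 1 for members s_n with s_n 0 close to x. By
    \<open>witt_dvd\<close> every other approximating member is compatible with this limit, which is
    what the laws below use.\<close>
  have "\<exists>y. \<forall>n. \<forall>s\<in>witt. \<pi> ^ n dvd x - s 0 \<longrightarrow> \<pi> ^ n dvd y - s 1" for x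
  proof -
    obtain s where s: "\<And>n. s n \<in> witt" "\<And>n. \<pi> ^ n dvd x - s n 0" using witt_dense[of _ x] by metis
    have transfer: "\<pi> ^ n dvd u 1 - v 1" if "u \<in> witt" "v \<in> witt" "\<pi> ^ n dvd x - u 0" "\<pi> ^ n dvd x - v 0"
      for u v n
    proof -
      have "\<pi> ^ n dvd (x - v 0) - (x - u 0)" by (rule dvd_diff[OF that(4,3)])
      then show ?thesis using witt_dvd[OF witt_diff[OF that(1,2)], of n 1] by simp
    qed
    have "\<pi> ^ n dvd s (Suc n) 1 - s n 1" for n
      by (rule transfer[OF s(1) s(1) dvd_trans[OF le_imp_power_dvd s(2)] s(2)]) simp
    then obtain l where l: "\<And>n. \<pi> ^ n dvd l - s n 1" using limit[of "\<lambda>n. s n 1"] by blast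
    have "\<pi> ^ n dvd l - u 1" if "u \<in> witt" "\<pi> ^ n dvd x - u 0" for u n
      using dvd_add[OF l[of n] transfer[OF s(1) that(1) s(2) that(2)]] by simp
    then show ?thesis by (intro exI[of _ l] allI ballI impI)
  qed
  then obtain \<phi> where \<phi>: "\<And>x n s. s \<in> witt \<Longrightarrow> \<pi> ^ n dvd x - s 0 \<Longrightarrow> \<pi> ^ n dvd \<phi> x - s 1"
    by metis
  have witt: "\<phi> (s 0) = s 1" if "s \<in> witt" for s
    using \<phi>[OF that, of _ "s 0"] by (intro eqI) simp
  have add: "\<phi> (x + y) = \<phi> x + \<phi> y" for x y
  proof (rule eqI)
    fix n
    obtain s t where st: "s \<in> witt" "t \<in> witt" "\<pi> ^ n dvd x - s 0" "\<pi> ^ n dvd y - t 0"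
      using witt_dense by meson
    have "\<pi> ^ n dvd \<phi> (x + y) - (s 1 + t 1)"
      using \<phi>[OF witt_add[OF st(1,2)], of n "x + y"] dvd_add[OF st(3,4)] by (simp add: algebra_simps)
    from dvd_diff[OF this dvd_add[OF \<phi>[OF st(1,3)] \<phi>[OF st(2,4)]]]
    show "\<pi> ^ n dvd \<phi> (x + y) - (\<phi> x + \<phi> y)" by (simp add: algebra_simps)
  qed
  have mult_cong: "d dvd a * b - a' * b'" if "d dvd a - a'" "d dvd b - b'" for a b a' b' d :: 'a
    using dvd_add[OF dvd_mult[OF that(2), of a] dvd_mult[OF that(1), of b']] by (simp add: algebra_simps)
  have mult: "\<phi> (x * y) = \<phi> x * \<phi> y" for x y
  proof (rule eqI)
    fix n
    obtain s t where st: "s \<in> witt" "t \<in> witt" "\<pi> ^ n dvd x - s 0" "\<pi> ^ n dvd y - t 0"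
      using witt_dense by meson
    have "\<pi> ^ n dvd \<phi> (x * y) - (s 1 * t 1)"
      using \<phi>[OF witt_mult[OF st(1,2)], of n "x * y"] mult_cong[OF st(3,4)] by simp
    from dvd_diff[OF this mult_cong[OF \<phi>[OF st(1,3)] \<phi>[OF st(2,4)]]]
    show "\<pi> ^ n dvd \<phi> (x * y) - (\<phi> x * \<phi> y)" by simp
  qed
  have frob: "\<pi> dvd \<phi> x - x ^ p" for x
  proof -
    obtain s where s: "s \<in> witt" "\<pi> ^ 1 dvd x - s 0" using witt_dense by meson
    obtain v where "\<And>k. s (k + 1) = s k ^ p + \<pi> * v k" using witt_frobenius[OF s(1)] by auto
    from this[of 0] have "\<pi> dvd s 1 - s 0 ^ p" by simp
    moreover have "\<pi> dvd s 0 ^ p - x ^ p"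
      by (rule dvd_swap, rule power_cong) (use s(2) in simp)
    moreover have "\<pi> dvd \<phi> x - s 1" using \<phi>[OF s] by simp
    ultimately have "\<pi> dvd (\<phi> x - s 1) + ((s 1 - s 0 ^ p) + (s 0 ^ p - x ^ p))" by (intro dvd_add)
    then show ?thesis by simp
  qed
  show ?thesis using add mult frob witt witt[OF witt_one] by blast
qed

text \<open>A Frobenius lift sends a fixed point t of the p^r-th power to t^p, because its value is
  congruent to t^p and both are fixed by that power. It also fixes \<pi>. So two lifts agree on each
  digit of the Teichmueller expansion.\<close>

theorem frobenius_unique:
  assumes \<phi>: "\<And>x y. \<phi> (x + y) = \<phi> x + \<phi> y" "\<And>x y. \<phi> (x * y) = \<phi> x * \<phi> y" "\<phi> 1 = 1"
    "\<And>x. \<pi> dvd \<phi> x - x ^ p"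
    and \<psi>: "\<And>x y. \<psi> (x + y) = \<psi> x + \<psi> y" "\<And>x y. \<psi> (x * y) = \<psi> x * \<psi> y" "\<psi> 1 = 1"
    "\<And>x. \<pi> dvd \<psi> x - x ^ p"
  shows "\<phi> x = \<psi> x"
proof -
  have teich: "f t = t ^ p" if f: "\<And>x y. f (x * y) = f x * f y" "f 1 = 1" "\<And>x. \<pi> dvd f x - x ^ p"
    and t: "r > 0" "t ^ p ^ r = t" for f :: "'a \<Rightarrow> 'a" and t r
  proof (rule teichmueller_unique[OF _ _ t(1) f(3)])
    have "f (y ^ n) = f y ^ n" for y n by (induction n) (simp_all add: f)
    then show "f t ^ p ^ r = f t" using t(2) by metis
    show "(t ^ p) ^ p ^ r = t ^ p" using t(2) by (metis power_mult mult.commute)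
  qed
  have pi: "f \<pi> = \<pi>" if "\<And>x y. f (x + y) = f x + f y" "f 1 = 1" for f :: "'a \<Rightarrow> 'a"
  proof -
    have "f 0 = 0" using that(1)[of 0 0] by (metis add_0 add_cancel_right_right)
    then have "f (of_nat n) = of_nat n" for n by (induction n) (simp_all add: that)
    then show ?thesis by (simp add: \<pi>_def)
  qed
  have "\<pi> ^ n dvd \<phi> x - \<psi> x" for n
  proof (induction n arbitrary: x)
    case (Suc n)
    obtain t r where t: "r > 0" "t ^ p ^ r = t" "\<pi> dvd x - t" by (rule teichmueller_exists)
    obtain y where "x - t = \<pi> * y" using t(3) by (auto simp: dvd_def)
    then have y: "x = t + \<pi> * y" by (simp add: algebra_simps)
    have "\<phi> x - \<psi> x = \<pi> * (\<phi> y - \<psi> y)"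
      unfolding y \<phi>(1,2) \<psi>(1,2) teich[OF \<phi>(2-4) t(1,2)] teich[OF \<psi>(2-4) t(1,2)] pi[OF \<phi>(1,3)] pi[OF \<psi>(1,3)]
      by (simp add: algebra_simps)
    then show ?case using Suc[of y] by simp
  qed simp
  then show ?thesis by (rule eqI)
qed

end

section \<open>Type-class rings as ring records\<close>

lemma type_algebra_simps [simp]:
  "carrier ring_of_type_algebra = UNIV"
  "x \<otimes>\<^bsub>ring_of_type_algebra\<^esub> y = x * y" "x \<oplus>\<^bsub>ring_of_type_algebra\<^esub> y = x + y"
  "\<one>\<^bsub>ring_of_type_algebra\<^esub> = 1" "\<zero>\<^bsub>ring_of_type_algebra\<^esub> = 0"
  by (simp_all add: ring_of_type_algebra_def)

lemma type_algebra_sub_simps [simp]: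
  "x \<otimes>\<^bsub>ring_of_type_algebra\<lparr>carrier := S\<rparr>\<^esub> y = x * y"
  "x \<oplus>\<^bsub>ring_of_type_algebra\<lparr>carrier := S\<rparr>\<^esub> y = x + y"
  "\<one>\<^bsub>ring_of_type_algebra\<lparr>carrier := S\<rparr>\<^esub> = 1" "\<zero>\<^bsub>ring_of_type_algebra\<lparr>carrier := S\<rparr>\<^esub> = 0"
  by (simp_all add: ring_of_type_algebra_def)

lemma type_algebra_UNIV: "ring_of_type_algebra\<lparr>carrier := UNIV\<rparr> = ring_of_type_algebra"
  by (simp add: ring_of_type_algebra_def)

lemma type_algebra_sub_add_pow [simp]:
  "[(k::nat)] \<cdot>\<^bsub>ring_of_type_algebra\<lparr>carrier := S\<rparr>\<^esub> x = of_nat k * (x::'a::comm_ring_1)"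
  by (induction k) (simp_all add: add_pow_def nat_pow_def algebra_simps)

lemma type_algebra_sub_pow [simp]:
  "x [^]\<^bsub>ring_of_type_algebra\<lparr>carrier := S\<rparr>\<^esub> (k::nat) = (x::'a::comm_ring_1) ^ k"
  by (induction k) (simp_all add: nat_pow_def algebra_simps)

lemmas type_algebra_add_pow [simp] = type_algebra_sub_add_pow[where S = UNIV, unfolded type_algebra_UNIV]
lemmas type_algebra_pow [simp] = type_algebra_sub_pow[where S = UNIV, unfolded type_algebra_UNIV]

lemma type_algebra_sub_cring:
  fixes S :: "'a::comm_ring_1 set"
  assumes "0 \<in> S" "1 \<in> S" "\<And>x y. x \<in> S \<Longrightarrow> y \<in> S \<Longrightarrow> x + y \<in> S"
    "\<And>x y. x \<in> S \<Longrightarrow> y \<in> S \<Longrightarrow> x * y \<in> S" "\<And>x. x \<in> S \<Longrightarrow> - x \<in> S"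
  shows "cring (ring_of_type_algebra\<lparr>carrier := S\<rparr>)"
proof (rule cringI)
  show "abelian_group (ring_of_type_algebra\<lparr>carrier := S\<rparr>)"
  proof (rule abelian_groupI)
    fix x assume "x \<in> carrier (ring_of_type_algebra\<lparr>carrier := S\<rparr>)"
    then show "\<exists>y\<in>carrier (ring_of_type_algebra\<lparr>carrier := S\<rparr>).
        y \<oplus>\<^bsub>ring_of_type_algebra\<lparr>carrier := S\<rparr>\<^esub> x = \<zero>\<^bsub>ring_of_type_algebra\<lparr>carrier := S\<rparr>\<^esub>"
      using assms by (intro bexI[of _ "- x"]) auto
  qed (use assms in \<open>auto simp: algebra_simps\<close>)
  show "comm_monoid (ring_of_type_algebra\<lparr>carrier := S\<rparr>)"
    by (rule comm_monoidI) (use assms in \<open>auto simp: algebra_simps\<close>)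
qed (auto simp: algebra_simps)

lemma type_algebra_sub_neg:
  fixes S :: "'a::comm_ring_1 set"
  assumes "cring (ring_of_type_algebra\<lparr>carrier := S\<rparr>)" "x \<in> S" "- x \<in> S"
  shows "\<ominus>\<^bsub>ring_of_type_algebra\<lparr>carrier := S\<rparr>\<^esub> x = - x"
proof -
  interpret cring "ring_of_type_algebra\<lparr>carrier := S\<rparr>" by fact
  show ?thesis using assms by (intro minus_equality) auto
qed

lemma type_algebra_sub_minus:
  fixes S :: "'a::comm_ring_1 set"
  assumes "cring (ring_of_type_algebra\<lparr>carrier := S\<rparr>)" "y \<in> S" "- y \<in> S"
  shows "x \<ominus>\<^bsub>ring_of_type_algebra\<lparr>carrier := S\<rparr>\<^esub> y = x - y"
  by (simp add: a_minus_def type_algebra_sub_neg[OF assms])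

lemma type_algebra_minus [simp]: "x \<ominus>\<^bsub>ring_of_type_algebra\<^esub> y = x - (y::'a::comm_ring_1)"
  using type_algebra_sub_minus[of UNIV y x] by (simp add: type_algebra_UNIV cring_from_type_algebra)

lemma type_algebra_multiples: "multiples ring_of_type_algebra m = {x::'a::comm_ring_1. of_nat m dvd x}"
  by (auto simp: multiples_def dvd_def)

section \<open>From the hypotheses on A to the unramified setting\<close>

lemma (in cring) padically_complete_if_bij:
  assumes "bij_betw (to_completion p R) (carrier R) (carrier (padic_completion p R))"
  shows "padically_complete p R"
proof -
  interpret ring_completion R p by unfold_locales
  show ?thesis
    unfolding padically_complete_def
  proof (intro conjI allI impI ballI)
    fix r assume r: "cauchy p R r"
    then have "Pl r \<in> to_completion p R ` carrier R" using assms by (auto simp: bij_betw_def)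
    then obtain l where "l \<in> carrier R" "Pl r = Pl (\<lambda>_. l)" by (auto simp: to_completion_lim)
    then show "\<exists>l\<in>carrier R. \<forall>n. l \<ominus> r n \<in> multiples R (p ^ n)"
      using r padic_lim_eq_iff[of p "\<lambda>_. l" r] by auto
  next
    fix x assume x: "x \<in> carrier R" "\<forall>n. x \<in> multiples R (p ^ n)"
    then have "to_completion p R x = to_completion p R \<zero>"
      by (simp add: to_completion_lim padic_lim_eq_iff)
    then show "x = \<zero>" using assms x by (auto simp: bij_betw_def inj_on_def)
  qed
qed

text \<open>The main work is \<open>perfect\<close>. A residue x that is algebraic over the prime
  field satisfies a monic equation over it, so its powers run through a finite set. Hence two of the
  powers x^{p^i} coincide, and the smaller exponent can be removed because the Frobenius is
  injective on residues.\<close>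

lemma complete_dvr_unramified:
  assumes p: "Factorial_Ring.prime p" "odd p"
    and dvr: "complete_dvr p (ring_of_type_algebra :: 'a::idom ring)"
    and alg: "algebraic_over_prime_field (residue_field p (ring_of_type_algebra :: 'a ring))"
  shows "unramified_dvr p (of_nat p :: 'a)"
proof -
  define T where "T = (ring_of_type_algebra :: 'a ring)"
  define \<pi> where "\<pi> = (of_nat p :: 'a)"
  define M where "M = PIdl\<^bsub>T\<^esub> ([p] \<cdot>\<^bsub>T\<^esub> \<one>\<^bsub>T\<^esub>)"
  have T_simps: "carrier T = UNIV" "x \<otimes>\<^bsub>T\<^esub> y = x * y" "x \<oplus>\<^bsub>T\<^esub> y = x + y"
    "\<one>\<^bsub>T\<^esub> = 1" "\<zero>\<^bsub>T\<^esub> = 0" "x \<ominus>\<^bsub>T\<^esub> y = x - y"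
    "[(k::nat)] \<cdot>\<^bsub>T\<^esub> x = of_nat k * x" "x [^]\<^bsub>T\<^esub> k = x ^ k"
    "multiples T k = {x. of_nat k dvd x}" for x y :: 'a and k :: nat
    by (simp_all add: T_def type_algebra_multiples)
  note [simp] = T_simps(1-8)
  interpret T: cring T unfolding T_def by (rule cring_from_type_algebra)
  have T_neg: "\<ominus>\<^bsub>T\<^esub> y = - y" for y by (rule T.minus_equality) auto
  have M_eq: "M = multiples T p" "M = {x. \<pi> dvd x}"
    by (auto simp: M_def cgenideal_def T_simps \<pi>_def dvd_def mult.commute)
  have max: "maximalideal M T" and p_nz: "\<pi> \<noteq> 0"
    and bij: "bij_betw (to_completion p T) (carrier T) (carrier (padic_completion p T))"
    using dvr by (auto simp: complete_dvr_def M_def T_def[symmetric] \<pi>_def)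
  interpret M: maximalideal M T by fact
  interpret TP: padic_ring T p
    using T.padically_complete_if_bij[OF bij] T.is_cring
    by (intro padic_ring.intro padic_ring_axioms.intro)
  define F where "F = T Quot M"
  interpret F: field F unfolding F_def by (rule M.quotient_is_field) (rule T.is_cring)
  define q where "q = (\<lambda>x. M +>\<^bsub>T\<^esub> x)"
  have q: "q \<in> ring_hom T F" unfolding q_def F_def by (rule M.rcos_ring_hom)
  interpret q: ring_hom_ring T F q
    by (intro ring_hom_ringI2 T.ring_axioms F.ring_axioms q)
  have q_eq: "q x = q y \<longleftrightarrow> \<pi> dvd x - y" for x y
    unfolding q_def M_eq(1) using T.multiples_coset_iff[of x y p] by (simp add: T_simps \<pi>_def)
  have q_surj: "\<exists>x. y = q x" if "y \<in> carrier F" for y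
    using that by (auto simp: F_def FactRing_def A_RCOSETS_def' q_def)
  have unit: "x dvd 1" if "\<not> \<pi> dvd x" for x
  proof -
    have "q x \<noteq> \<zero>\<^bsub>F\<^esub>" using that q_eq[of x 0] q.hom_zero by simp
    then have "q x \<in> Units F" by (simp add: F.field_Units)
    then obtain v where "q x \<otimes>\<^bsub>F\<^esub> q v = \<one>\<^bsub>F\<^esub>" using q_surj by (metis F.Units_closed F.Units_inv_closed F.Units_r_inv)
    then have "q (x * v) = q 1" using q.hom_mult[of x v] q.hom_one by simp
    \<comment> \<open>An inverse in the residue field is an inverse modulo p, which completeness
      turns into an inverse in A.\<close>
    then have "x \<otimes>\<^bsub>T\<^esub> v \<ominus>\<^bsub>T\<^esub> \<one>\<^bsub>T\<^esub> \<in> multiples T p" using q_eq by (simp add: T_simps \<pi>_def)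
    then have "x \<in> Units T" by (intro TP.Units_lift[of x v]) auto
    then show ?thesis by (auto simp: Units_def dvd_def)
  qed
  have not_unit: "\<not> \<pi> dvd 1"
    using M.I_notcarr M_eq(2) by (auto intro: dvd_trans)
  have prime: "\<pi> dvd x \<or> \<pi> dvd y" if "\<pi> dvd x * y" for x y
  proof (rule ccontr)
    assume "\<not> ?thesis"
    then obtain z where "1 = x * z" "\<not> \<pi> dvd y" using unit[of x] by (auto simp: dvd_def)
    then have "y = x * y * z" by (simp add: ac_simps)
    with that \<open>\<not> \<pi> dvd y\<close> show False by (metis dvd_mult2)
  qed
  show ?thesis
    unfolding \<pi>_def[symmetric]
  proof (unfold_locales)
    show "\<pi> = of_nat p" by (rule \<pi>_def)
    show "Factorial_Ring.prime p" "odd p" "\<pi> \<noteq> 0" "\<not> \<pi> dvd 1" by fact+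
    show "\<not> \<pi> dvd x \<Longrightarrow> x dvd 1" for x by (rule unit)
  next
    fix s :: "nat \<Rightarrow> 'a" assume "\<And>n. \<pi> ^ n dvd s (Suc n) - s n"
    then have "cauchy p T s" by (simp add: cauchy_def T_simps \<pi>_def)
    then show "\<exists>l. \<forall>n. \<pi> ^ n dvd l - s n" using TP.padic_limit by (auto simp: T_simps \<pi>_def)
  next
    fix x assume "\<And>n. \<pi> ^ n dvd x"
    then show "x = 0" using TP.padic_zero[of x] by (auto simp: T_simps \<pi>_def)
  next
    fix x
    define K where "K = range (\<lambda>n::int. [n] \<cdot>\<^bsub>F\<^esub> \<one>\<^bsub>F\<^esub>)"
    have q_nat: "[n] \<cdot>\<^bsub>F\<^esub> \<one>\<^bsub>F\<^esub> = q (of_nat n)" for n :: nat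
      using additive_hom_add_pow[OF T.abelian_group_axioms F.abelian_group_axioms ring_hom_in_hom(2)[OF q], of 1 n]
        q.hom_one by simp
    have q_int: "[n] \<cdot>\<^bsub>F\<^esub> \<one>\<^bsub>F\<^esub> = q (of_int n)" for n :: int
    proof (cases "n \<ge> 0")
      case True
      then show ?thesis by (simp add: add_pow_int_ge q_nat)
    next
      case False
      have "\<ominus>\<^bsub>F\<^esub> q y = q (- y)" for y using q.hom_a_inv[of y] by (simp add: T_neg)
      then show ?thesis using False by (simp add: add_pow_int_lt q_nat)
    qed
    have K: "K = q ` range of_int" by (auto simp: K_def q_int)
    have "subring (range (of_int :: int \<Rightarrow> 'a)) T"
    proof (rule T.subringI)
      fix h :: 'a assume "h \<in> range of_int"
      then obtain n where "h = of_int n" by auto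
      then show "\<ominus>\<^bsub>T\<^esub> h \<in> range of_int" by (metis T_neg of_int_minus rangeI)
    next
      show "\<one>\<^bsub>T\<^esub> \<in> range (of_int :: int \<Rightarrow> 'a)" by (metis T_simps(4) of_int_1 rangeI)
    next
      fix h k :: 'a assume "h \<in> range of_int" "k \<in> range of_int"
      then obtain m n where mn: "h = of_int m" "k = of_int n" by auto
      show "h \<otimes>\<^bsub>T\<^esub> k \<in> range of_int" unfolding mn T_simps of_int_mult[symmetric] by (rule rangeI)
      show "h \<oplus>\<^bsub>T\<^esub> k \<in> range of_int" unfolding mn T_simps of_int_add[symmetric] by (rule rangeI)
    qed simp
    then have "subring K F" unfolding K by (rule q.img_is_subring)
    moreover have qx: "q x \<in> carrier F" by (rule q.hom_closed) simp
    moreover have "\<forall>y\<in>carrier F. (F.algebraic over K) y"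
      using alg unfolding algebraic_over_prime_field_def K_def F_def M_def T_def .
    ultimately obtain P where P: "P \<in> carrier (univ_poly F K)" "P \<noteq> []" "F.eval P (q x) = \<zero>\<^bsub>F\<^esub>"
      using F.algebraicE[of K "q x"] by blast
    \<comment> \<open>The coefficients lie in the image of the integers, so the value at x is the
      class of an integer combination of powers of x. Coefficient lists start with the leading term,
      so the head belongs to the power \<open>length cs\<close>.\<close>
    have ev: "\<exists>c::nat \<Rightarrow> int. F.eval cs (q x) = q (\<Sum>i<length cs. of_int (c i) * x ^ i)" if "set cs \<subseteq> K" for cs
      using that
    proof (induction cs)
      case Nil
      then show ?case using q.hom_zero by simp
    next
      case (Cons k cs)
      then obtain c where c: "F.eval cs (q x) = q (\<Sum>i<length cs. of_int (c i) * x ^ i)" by auto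
      obtain n where n: "k = q (of_int n)" using Cons.prems by (auto simp: K)
      have pw: "q x [^]\<^bsub>F\<^esub> j = q (x ^ j)" for j :: nat using q.hom_nat_pow[of x j] T_simps by simp
      have "F.eval (k # cs) (q x) = q (of_int n * x ^ length cs + (\<Sum>i<length cs. of_int (c i) * x ^ i))"
        using q.hom_mult[of "of_int n" "x ^ length cs"]
          q.hom_add[of "of_int n * x ^ length cs" "\<Sum>i<length cs. of_int (c i) * x ^ i"]
        by (simp add: c n pw)
      also have "\<dots> = q (\<Sum>i<length (k # cs). of_int ((c(length cs := n)) i) * x ^ i)"
        by (simp add: add.commute)
      finally show ?case by blast
    qed
    obtain k cs where kcs: "P = k # cs" "k \<noteq> \<zero>\<^bsub>F\<^esub>" "set cs \<subseteq> K" "k \<in> K"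
      using P by (cases P) (auto simp: univ_poly_carrier[symmetric] polynomial_def)
    define d where "d = length cs"
    obtain c where c: "F.eval cs (q x) = q (\<Sum>i<d. of_int (c i) * x ^ i)" using ev[OF kcs(3)] d_def by auto
    obtain n where n: "k = q (of_int n)" using kcs by (auto simp: K)
    have pw: "q x [^]\<^bsub>F\<^esub> j = q (x ^ j)" for j :: nat using q.hom_nat_pow[of x j] T_simps by simp
    have "q (of_int n * x ^ d + (\<Sum>i<d. of_int (c i) * x ^ i)) = q 0"
      using P(3) kcs(1) q.hom_mult[of "of_int n" "x ^ d"] q.hom_zero
        q.hom_add[of "of_int n * x ^ d" "\<Sum>i<d. of_int (c i) * x ^ i"]
      by (simp add: c n pw d_def)
    then have rel: "\<pi> dvd of_int n * x ^ d + (\<Sum>i<d. of_int (c i) * x ^ i)" by (simp add: q_eq)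
    have "\<not> \<pi> dvd of_int n" using kcs(2) n q_eq[of "of_int n" 0] q.hom_zero by simp
    then have "\<not> int p dvd n" unfolding \<pi>_def by (metis dvdE dvd_triv_left of_int_mult of_int_of_nat_eq)
    then have "coprime (int p) n" using p(1) by (simp add: prime_imp_coprime)
    then obtain m v where "m * n + v * int p = 1"
      using bezout_int[of n "int p"] by (auto simp: coprime_iff_gcd_eq_1 gcd.commute)
    then have j: "n * m = 1 + int p * (- v)" by (simp add: algebra_simps)
    define j where "j = - v"
    note j = j[folded j_def]
    \<comment> \<open>The leading coefficient n has the inverse m modulo p. Multiplying by m makes
      the relation monic, and the other coefficients are moved to the right-hand side and reduced to
      digits between 0 and p - 1.\<close>
    define c' where "c' i = (- c i * m) mod int p" for i
    have red: "\<pi> dvd of_int (i mod int p) - of_int i" for i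
      unfolding \<pi>_def using of_int_diff[of "i mod int p" i]
      by (metis (no_types, lifting) dvd_triv_left minus_mod_eq_mult_div of_int_diff of_int_mult of_int_of_nat_eq dvd_minus_iff minus_diff_eq)
    have xd: "\<pi> dvd x ^ d - (\<Sum>i<d. of_int (c' i) * x ^ i)"
    proof -
      have "\<pi> dvd of_int m * (of_int n * x ^ d + (\<Sum>i<d. of_int (c i) * x ^ i)) - \<pi> * of_int j * x ^ d"
        using rel by (intro dvd_diff) auto
      also have "of_int m * (of_int n * x ^ d + (\<Sum>i<d. of_int (c i) * x ^ i)) - \<pi> * of_int j * x ^ d =
          (of_int (n * m) - \<pi> * of_int j) * x ^ d - (\<Sum>i<d. of_int (- c i * m) * x ^ i)"
        by (simp add: algebra_simps sum_distrib_left sum_negf)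
      also have "of_int (n * m) - \<pi> * of_int j = 1" unfolding j by (simp add: \<pi>_def)
      finally have "\<pi> dvd x ^ d - (\<Sum>i<d. of_int (- c i * m) * x ^ i)" by simp
      moreover have "\<pi> dvd (\<Sum>i<d. (of_int (c' i) - of_int (- c i * m)) * x ^ i)"
        unfolding c'_def by (intro dvd_sum dvd_mult2 red)
      ultimately have "\<pi> dvd (x ^ d - (\<Sum>i<d. of_int (- c i * m) * x ^ i)) -
          (\<Sum>i<d. (of_int (c' i) - of_int (- c i * m)) * x ^ i)" by (rule dvd_diff)
      then show ?thesis by (simp add: algebra_simps sum.distrib sum_negf)
    qed
    \<comment> \<open>The digit vectors of length d. There are finitely many, so the powers of x
      take finitely many values modulo \<pi>.\<close>
    define B where "B = PiE {..<d} (\<lambda>_. {0..<int p})"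
    have p0: "int p > 0" using p(1) prime_gt_0_nat by simp
    have span: "\<exists>b\<in>B. \<pi> dvd x ^ e - (\<Sum>i<d. of_int (b i) * x ^ i)" for e
    proof (induction e)
      case 0
      show ?case
      proof (cases "d = 0")
        case True
        then have "\<pi> dvd 1" using xd by simp
        with not_unit show ?thesis by simp
      next
        case False
        define b where "b = (\<lambda>i\<in>{..<d}. if i = 0 then 1 else 0 :: int)"
        have "(\<Sum>i<d. of_int (b i) * x ^ i) = (\<Sum>i<d. if i = 0 then 1 else 0)"
          by (intro sum.cong) (auto simp: b_def)
        also have "\<dots> = 1" using False by simp
        finally have "x ^ 0 - (\<Sum>i<d. of_int (b i) * x ^ i) = 0" by simp
        moreover have "b \<in> B" using p0 prime_gt_1_nat[OF p(1)] by (auto simp: B_def b_def)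
        ultimately show ?thesis by (metis dvd_0_right)
      qed
    next
      case (Suc e)
      then obtain b where b: "b \<in> B" "\<pi> dvd x ^ e - (\<Sum>i<d. of_int (b i) * x ^ i)" by auto
      show ?case
      proof (cases d)
        case 0
        then have "\<pi> dvd 1" using xd by simp
        with not_unit show ?thesis by simp
      next
        case (Suc d')
        \<comment> \<open>Multiplication by x shifts the digits up; the top digit, now in degree d,
          is distributed over the lower degrees by the monic relation.\<close>
        define u where "u i = (if i = 0 then 0 else b (i - 1)) + b d' * c' i" for i
        define b' where "b' = (\<lambda>i\<in>{..<d}. u i mod int p)"
        have "\<pi> dvd x * (x ^ e - (\<Sum>i<d. of_int (b i) * x ^ i)) + of_int (b d') * (x ^ d - (\<Sum>i<d. of_int (c' i) * x ^ i))"
          using b xd by (intro dvd_add) auto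
        also have "x * (x ^ e - (\<Sum>i<d. of_int (b i) * x ^ i)) + of_int (b d') * (x ^ d - (\<Sum>i<d. of_int (c' i) * x ^ i)) =
            x ^ Suc e - (\<Sum>i<d. of_int (u i) * x ^ i)"
        proof -
          have "(\<Sum>i<d. of_int (u i) * x ^ i) =
              (\<Sum>i<d. of_int (if i = 0 then 0 else b (i - 1)) * x ^ i) + of_int (b d') * (\<Sum>i<d. of_int (c' i) * x ^ i)"
            by (simp add: u_def sum.distrib[symmetric] sum_distrib_left algebra_simps)
          also have "(\<Sum>i<d. of_int (if i = 0 then 0 else b (i - 1)) * x ^ i) = (\<Sum>i<d'. of_int (b i) * x ^ Suc i)"
            unfolding Suc by (subst sum.lessThan_Suc_shift) simp
          finally have 1: "(\<Sum>i<d. of_int (u i) * x ^ i) =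
              (\<Sum>i<d'. of_int (b i) * x ^ Suc i) + of_int (b d') * (\<Sum>i<d. of_int (c' i) * x ^ i)" .
          have 2: "x * (\<Sum>i<d. of_int (b i) * x ^ i) = (\<Sum>i<d'. of_int (b i) * x ^ Suc i) + of_int (b d') * x ^ d"
            unfolding Suc by (simp add: sum_distrib_left algebra_simps)
          show ?thesis unfolding 1 by (simp add: 2 right_diff_distrib)
        qed
        finally have "\<pi> dvd x ^ Suc e - (\<Sum>i<d. of_int (u i) * x ^ i)" .
        moreover have "\<pi> dvd (\<Sum>i<d. (of_int (b' i) - of_int (u i)) * x ^ i)"
          by (intro dvd_sum dvd_mult2) (simp add: b'_def red)
        ultimately have "\<pi> dvd (x ^ Suc e - (\<Sum>i<d. of_int (u i) * x ^ i)) -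
            (\<Sum>i<d. (of_int (b' i) - of_int (u i)) * x ^ i)" by (rule dvd_diff)
        then have "\<pi> dvd x ^ Suc e - (\<Sum>i<d. of_int (b' i) * x ^ i)"
          by (simp add: left_diff_distrib sum_subtractf)
        moreover have "b' \<in> B" using p0 by (auto simp: B_def b'_def)
        ultimately show ?thesis by blast
      qed
    qed
    then obtain b where b: "\<And>e. b e \<in> B" "\<And>e. \<pi> dvd x ^ e - (\<Sum>i<d. of_int (b e i) * x ^ i)" by metis
    have "finite B" unfolding B_def by (intro finite_PiE) auto
    \<comment> \<open>Pigeonhole on the digit vectors of the powers x^{p^e}.\<close>
    have "\<not> inj (\<lambda>e. b (p ^ e))"
    proof
      assume "inj (\<lambda>e. b (p ^ e))"
      moreover have "range (\<lambda>e. b (p ^ e)) \<subseteq> B" using b by auto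
      ultimately show False using \<open>finite B\<close> by (meson finite_imageD finite_subset infinite_UNIV_nat)
    qed
    then obtain i j where "i \<noteq> j" "b (p ^ i) = b (p ^ j)" by (auto simp: inj_def)
    then obtain i j where ij: "i < j" "b (p ^ i) = b (p ^ j)" by (metis linorder_neqE_nat)
    have "\<pi> dvd (x ^ p ^ j - (\<Sum>l<d. of_int (b (p ^ j) l) * x ^ l)) - (x ^ p ^ i - (\<Sum>l<d. of_int (b (p ^ i) l) * x ^ l))"
      by (rule dvd_diff[OF b(2) b(2)])
    then have "\<pi> dvd x ^ p ^ j - x ^ p ^ i" using ij(2) by simp
    \<comment> \<open>With y = x^{p^{j-i}} the difference is y^{p^i} - x^{p^i}, congruent to (y -
      x)^{p^i}; primality of \<pi> then removes the exponent.\<close>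
    moreover have "x ^ p ^ j = (x ^ p ^ (j - i)) ^ p ^ i"
      using ij(1) by (simp flip: power_mult power_add)
    moreover have "\<pi> dvd (u - v) ^ p ^ i - (u ^ p ^ i - v ^ p ^ i)" for u v
      unfolding \<pi>_def by (rule freshman_iterate[OF p])
    ultimately have "\<pi> dvd (x ^ p ^ (j - i) - x) ^ p ^ i"
      by (metis dvd_add diff_add_cancel)
    then have "\<pi> dvd x ^ p ^ (j - i) - x"
    proof -
      have "\<pi> dvd w ^ n \<Longrightarrow> \<pi> dvd w" for w :: 'a and n
        by (induction n) (use not_unit prime in auto)
      then show "\<pi> dvd (x ^ p ^ (j - i) - x) ^ p ^ i \<Longrightarrow> \<pi> dvd x ^ p ^ (j - i) - x" .
    qed
    then show "\<exists>r>0. \<pi> dvd x ^ p ^ r - x" using ij(1) by (intro exI[of _ "j - i"]) auto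
  qed
qed

section \<open>The Euler top and the Hasse invariant\<close>

definition is_hom :: "('b::comm_ring_1 \<Rightarrow> 'c::comm_ring_1) \<Rightarrow> bool"
  where "is_hom h \<longleftrightarrow> h 1 = 1 \<and> (\<forall>x y. h (x + y) = h x + h y) \<and> (\<forall>x y. h (x * y) = h x * h y)"

lemma is_homD:
  assumes "is_hom h"
  shows "h 1 = 1" "h (x + y) = h x + h y" "h (x * y) = h x * h y" "h 0 = 0" "h (- x) = - h x"
    "h (x - y) = h x - h y" "h (x ^ n) = h x ^ n" "h (of_nat n) = of_nat n"
proof -
  note h = assms[unfolded is_hom_def]
  show one: "h 1 = 1" and add: "\<And>x y. h (x + y) = h x + h y" and mult: "\<And>x y. h (x * y) = h x * h y"
    using h by auto
  show zero: "h 0 = 0" using add[of 0 0] by (metis add_cancel_right_right add_0)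
  have neg: "h (- x) = - h x" for x
    using add[of "- x" x] zero by (simp add: eq_neg_iff_add_eq_0)
  then show "h (- x) = - h x" .
  show "h (x - y) = h x - h y" using add[of x "- y"] neg by simp
  show "h (x ^ n) = h x ^ n" by (induction n) (simp_all add: one mult)
  show "h (of_nat n) = of_nat n" by (induction n) (simp_all add: zero one add)
qed

lemma is_hom_sum: "is_hom h \<Longrightarrow> h (sum f I) = (\<Sum>i\<in>I. h (f i))"
  by (induction I rule: infinite_finite_induct) (simp_all add: is_homD)

lemma is_hom_prod: "is_hom h \<Longrightarrow> h (prod f I) = (\<Prod>i\<in>I. h (f i))"
  by (induction I rule: infinite_finite_induct) (simp_all add: is_homD)

lemma is_hom_id [simp]: "is_hom id" "is_hom (\<lambda>x. x)"
  by (simp_all add: is_hom_def)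

lemma is_hom_poly [simp]: "is_hom (\<lambda>f. poly f x)"
  by (simp add: is_hom_def)

lemma is_hom_const [simp]: "is_hom (\<lambda>c. [:c:])"
  by (simp add: is_hom_def)

lemma is_hom_comp: "is_hom g \<Longrightarrow> is_hom h \<Longrightarrow> is_hom (\<lambda>x. g (h x))"
  by (simp add: is_hom_def)

lemma is_hom_map_poly:
  assumes "is_hom h" shows "is_hom (map_poly h)"
  unfolding is_hom_def
proof (intro conjI allI)
  note h = is_homD[OF assms]
  show "map_poly h 1 = 1" by (simp add: h map_poly_1)
  fix f g
  show "map_poly h (f + g) = map_poly h f + map_poly h g"
    by (rule poly_eqI) (simp add: coeff_map_poly h)
  show "map_poly h (f * g) = map_poly h f * map_poly h g"
    by (rule poly_eqI) (simp add: coeff_map_poly h coeff_mult is_hom_sum[OF assms])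
qed

definition eval_hom :: "('b::comm_ring_1 \<Rightarrow> 'c::comm_ring_1) \<Rightarrow> 'c \<Rightarrow> 'b poly \<Rightarrow> 'c"
  where "eval_hom h y f = poly (map_poly h f) y"

lemma is_hom_eval_hom: "is_hom h \<Longrightarrow> is_hom (eval_hom h y)"
  unfolding eval_hom_def by (intro is_hom_comp[OF is_hom_poly] is_hom_map_poly)

lemma eval_hom_pCons: "is_hom h \<Longrightarrow> eval_hom h y (pCons c f) = h c + y * eval_hom h y f"
  by (simp add: eval_hom_def map_poly_pCons is_homD)

lemma eval_hom_0 [simp]: "eval_hom h y 0 = 0"
  by (simp add: eval_hom_def)

lemma eval_hom_natural:
  assumes "is_hom g" "is_hom h"
  shows "g (eval_hom h y f) = eval_hom (\<lambda>c. g (h c)) (g y) f"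
  by (induction f)
    (simp_all add: eval_hom_pCons is_hom_comp assms is_homD[OF assms(1)])

lemma eval_hom_sum:
  assumes "is_hom h" "Polynomial.degree f \<le> n"
  shows "eval_hom h y f = (\<Sum>j\<le>n. h (Polynomial.coeff f j) * y ^ j)"
  using assms(2)
proof (induction f arbitrary: n)
  case (pCons c f)
  show ?case
  proof (cases "f = 0")
    case True
    have "(\<Sum>j\<le>n. h (Polynomial.coeff [:c:] j) * y ^ j) = (\<Sum>j\<in>{0}. h (Polynomial.coeff [:c:] j) * y ^ j)"
      by (rule sum.mono_neutral_right) (auto simp: is_homD[OF assms(1)] coeff_pCons split: nat.splits)
    then show ?thesis using True by (simp add: eval_hom_pCons assms)
  next
    case False
    then obtain m where m: "n = Suc m" "Polynomial.degree f \<le> m" using pCons.prems by (cases n) auto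
    have "(\<Sum>j\<le>n. h (Polynomial.coeff (pCons c f) j) * y ^ j) =
        h c + (\<Sum>j\<le>m. h (Polynomial.coeff f j) * y ^ Suc j)"
      unfolding m(1) by (subst sum.atMost_Suc_shift) simp
    then show ?thesis
      using pCons.IH[OF m(2)] by (simp add: eval_hom_pCons assms sum_distrib_left algebra_simps)
  qed
qed (simp add: is_homD[OF assms(1)])

lemma eval2_eval_hom: "eval2 h f b1 b2 = eval_hom (eval_hom h b1) b2 f"
  by (simp add: eval2_def eval_hom_def[abs_def])

lemma is_hom_eval2: "is_hom h \<Longrightarrow> is_hom (\<lambda>f. eval2 h f b1 b2)"
  unfolding eval2_eval_hom by (intro is_hom_eval_hom)

lemma eval2_natural:
  assumes "is_hom g" "is_hom h"
  shows "g (eval2 h f b1 b2) = eval2 (\<lambda>c. g (h c)) f (g b1) (g b2)"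
  unfolding eval2_eval_hom
  by (simp add: eval_hom_natural assms is_hom_eval_hom)

lemma is_hom_cst [simp]: "is_hom cst"
  by (simp add: is_hom_def cst_def one_pCons)

lemma eval2_simps:
  assumes "is_hom h"
  shows "eval2 h [:[:c:]:] b1 b2 = h c" "eval2 h [:[:0, 1:]:] b1 b2 = b1" "eval2 h [:0, 1:] b1 b2 = b2"
  by (simp_all add: eval2_eval_hom eval_hom_pCons is_hom_eval_hom assms is_homD[OF assms]
      is_homD[OF is_hom_eval_hom[OF assms]])

lemma eval2_N_poly:
  assumes "is_hom h"
  shows "eval2 h (N_poly a) b1 b2 = (\<Prod>i = 1..3. b1 - h (a i) * b2)"
  unfolding N_poly_def is_hom_prod[OF is_hom_eval2[OF assms]]
  by (simp only: is_homD(3,6)[OF is_hom_eval2[OF assms]] eval2_simps[OF assms])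

definition poly3_eval :: "(nat \<Rightarrow> 'a::comm_ring_1) \<Rightarrow> 'a poly poly poly \<Rightarrow> 'a"
  where "poly3_eval x = eval_hom (eval_hom (eval_hom id (x 1)) (x 2)) (x 3)"

lemma is_hom_poly3_eval [simp]: "is_hom (poly3_eval x)"
  unfolding poly3_eval_def by (intro is_hom_eval_hom is_hom_id)

lemma poly3_eval_cst [simp]: "poly3_eval x (cst c) = c"
  by (simp add: poly3_eval_def cst_def eval_hom_pCons is_hom_eval_hom)

lemma poly3_eval_var [simp]: "i \<in> {1, 2, 3} \<Longrightarrow> poly3_eval x (var i) = x i"
  by (auto simp: poly3_eval_def var_def eval_hom_pCons is_hom_eval_hom is_homD[OF is_hom_eval_hom])

lemma poly3_induct [case_names cst var add mult]:
  fixes f :: "'a::comm_ring_1 poly poly poly"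
  assumes cst: "\<And>c. P (cst c)" and var: "\<And>i. i \<in> {1, 2, 3} \<Longrightarrow> P (var i)"
    and add: "\<And>f g. P f \<Longrightarrow> P g \<Longrightarrow> P (f + g)" and mult: "\<And>f g. P f \<Longrightarrow> P g \<Longrightarrow> P (f * g)"
  shows "P f"
proof -
  have zero: "P 0" using cst[of 0] by (simp add: cst_def)
  have 1: "P [:[:h:]:]" for h :: "'a poly"
  proof (induction h)
    case (pCons c h)
    have "[:[:pCons c h:]:] = cst c + var 1 * [:[:h:]:]" by (simp add: cst_def var_def)
    moreover have "P (cst c + var 1 * [:[:h:]:])" by (intro add mult cst var pCons.IH) simp
    ultimately show ?case by (simp only:)
  qed (simp add: zero)
  have 2: "P [:g:]" for g :: "'a poly poly"
  proof (induction g)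
    case (pCons h g)
    have "[:pCons h g:] = [:[:h:]:] + var 2 * [:g:]" by (simp add: var_def)
    moreover have "P ([:[:h:]:] + var 2 * [:g:])" by (intro add mult 1 var pCons.IH) simp
    ultimately show ?case by (simp only:)
  qed (simp add: zero)
  show ?thesis
  proof (induction f)
    case (pCons g f)
    have "pCons g f = [:g:] + var 3 * f" by (simp add: var_def)
    moreover have "P ([:g:] + var 3 * f)" by (intro add mult 2 var pCons.IH) simp
    ultimately show ?case by (simp only:)
  qed (simp add: zero)
qed

section \<open>Derivations and the Euler vector field\<close>

definition is_derivation :: "('b::comm_ring_1 \<Rightarrow> 'b) \<Rightarrow> bool"
  where "is_derivation d \<longleftrightarrow> (\<forall>x y. d (x + y) = d x + d y) \<and> (\<forall>x y. d (x * y) = x * d y + y * d x)"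

lemma is_derivationD:
  assumes "is_derivation d"
  shows "d (x + y) = d x + d y" "d (x * y) = x * d y + y * d x" "d 0 = 0" "d 1 = 0" "d (- x) = - d x"
    "d (x - y) = d x - d y" "d (x ^ n) = of_nat n * x ^ (n - 1) * d x" "d (sum f I) = (\<Sum>i\<in>I. d (f i))"
proof -
  show add: "\<And>x y. d (x + y) = d x + d y" and mult: "\<And>x y. d (x * y) = x * d y + y * d x"
    using assms by (auto simp: is_derivation_def)
  show zero: "d 0 = 0" using add[of 0 0] by (metis add_cancel_right_right add_0)
  show one: "d 1 = 0" using mult[of 1 1] by (metis add_cancel_right_right mult_1)
  have neg: "d (- x) = - d x" for x
    using add[of "- x" x] zero by (simp add: eq_neg_iff_add_eq_0)
  then show "d (- x) = - d x" .
  show "d (x - y) = d x - d y" using add[of x "- y"] neg by simp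
  show "d (x ^ n) = of_nat n * x ^ (n - 1) * d x"
  proof (induction n)
    case (Suc n)
    have "x * (of_nat n * x ^ (n - 1) * d x) = of_nat n * x ^ n * d x"
      by (cases n) (simp_all add: algebra_simps)
    then show ?case using Suc by (simp add: mult algebra_simps)
  qed (simp add: one)
  show "d (sum f I) = (\<Sum>i\<in>I. d (f i))"
    by (induction I rule: infinite_finite_induct) (simp_all add: add zero)
qed

lemma is_derivation_map_poly:
  assumes "is_derivation d" shows "is_derivation (map_poly d)"
  unfolding is_derivation_def
proof (intro conjI allI poly_eqI)
  note d = is_derivationD[OF assms]
  fix f g and n
  show "Polynomial.coeff (map_poly d (f + g)) n = Polynomial.coeff (map_poly d f + map_poly d g) n"
    by (simp add: coeff_map_poly d)
  have "Polynomial.coeff (map_poly d (f * g)) n =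
      (\<Sum>i\<le>n. Polynomial.coeff f i * d (Polynomial.coeff g (n - i))) +
      (\<Sum>i\<le>n. d (Polynomial.coeff f i) * Polynomial.coeff g (n - i))"
    by (simp add: coeff_map_poly d coeff_mult sum.distrib mult.commute)
  also have "\<dots> = Polynomial.coeff (f * map_poly d g + map_poly d f * g) n"
    by (simp add: coeff_map_poly d coeff_mult)
  finally show "Polynomial.coeff (map_poly d (f * g)) n =
      Polynomial.coeff (f * map_poly d g + g * map_poly d f) n"
    by (simp add: mult.commute)
qed

lemma is_derivation_pderiv: "is_derivation (pderiv :: 'b::idom poly \<Rightarrow> _)"
  by (simp add: is_derivation_def pderiv_add pderiv_mult)

text \<open>The vector field \<delta>^cl before reduction. As x_3 is the outermost variable,
  \<open>pderiv\<close> is the partial derivative in x_3, and one or two applications of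
  \<open>map_poly\<close> reach x_2 and x_1.\<close>

definition euler_derivation :: "(nat \<Rightarrow> 'a::idom) \<Rightarrow> 'a poly poly poly \<Rightarrow> 'a poly poly poly"
  where "euler_derivation a f =
    cst (a 2 - a 3) * (var 2 * var 3) * map_poly (map_poly pderiv) f +
    cst (a 3 - a 1) * (var 3 * var 1) * map_poly pderiv f +
    cst (a 1 - a 2) * (var 1 * var 2) * pderiv f"

lemma is_derivation_euler: "is_derivation (euler_derivation a)"
proof -
  note d1 = is_derivationD[OF is_derivation_map_poly[OF is_derivation_map_poly[OF is_derivation_pderiv]]]
    and d2 = is_derivationD[OF is_derivation_map_poly[OF is_derivation_pderiv]]
    and d3 = is_derivationD[OF is_derivation_pderiv]
  show ?thesis
    unfolding is_derivation_def euler_derivation_def by (simp add: d1 d2 d3 algebra_simps)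
qed

lemma euler_derivation_cst [simp]: "euler_derivation a (cst c) = 0"
  by (simp add: euler_derivation_def cst_def map_poly_pCons pderiv_pCons)

lemma euler_derivation_var [simp]:
  fixes a :: "nat \<Rightarrow> 'a::idom"
  shows "euler_derivation a (var (Suc 0)) = cst (a 2 - a 3) * (var 2 * var 3)"
  "euler_derivation a (var 2) = cst (a 3 - a 1) * (var 3 * var 1)"
  "euler_derivation a (var 3) = cst (a 1 - a 2) * (var 1 * var 2)"
  using is_derivationD(4)[OF is_derivation_map_poly[OF is_derivation_pderiv[where 'b = 'a]]]
    is_derivationD(4)[OF is_derivation_map_poly[OF is_derivation_pderiv[where 'b = "'a poly"]]]
    is_derivationD(4)[OF is_derivation_map_poly[OF is_derivation_map_poly[OF is_derivation_pderiv[where 'b = 'a]]]]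
  by (simp_all add: euler_derivation_def var_def map_poly_pCons pderiv_pCons pCons_one)

lemma sum_1_3: "(\<Sum>i = 1..3. f i) = f 1 + f 2 + f (3::nat)" and prod_1_3: "(\<Prod>i = 1..3. g i) = g 1 * g 2 * g (3::nat)"
  by (simp_all add: numeral_3_eq_3 numeral_2_eq_2)

lemma euler_derivation_H:
  "euler_derivation a (H1 a) = 0" "euler_derivation a (H2 :: 'a::idom poly poly poly) = 0"
proof -
  note d = is_derivationD[OF is_derivation_euler[of a]]
  note c = is_homD[OF is_hom_cst[where 'a = 'a]]
  show "euler_derivation a (H1 a) = 0" "euler_derivation a H2 = 0"
    unfolding H1_def H2_def sum_1_3 by (simp_all add: d c power2_eq_square algebra_simps)
qed

text \<open>The substitution z_1 = H_1, z_2 = H_2, x = x_3 on A[z_1,z_2][x], where z_1, z_2, x are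
  stored as \<open>var 1\<close>, \<open>var 2\<close>, \<open>var 3\<close>.\<close>

definition subst_H :: "(nat \<Rightarrow> 'a::comm_ring_1) \<Rightarrow> 'a poly poly poly \<Rightarrow> 'a poly poly poly"
  where "subst_H a = eval_hom (\<lambda>c. eval2 cst c (H1 a) H2) (var 3)"

lemma is_hom_subst_H: "is_hom (subst_H a)"
  unfolding subst_H_def by (intro is_hom_eval_hom is_hom_eval2 is_hom_cst)

lemma subst_H_simps:
  "subst_H a (cst c) = cst c" "subst_H a (var (Suc 0)) = H1 a" "subst_H a (var 2) = H2" "subst_H a (var 3) = var 3"
proof -
  note h = is_hom_eval2[OF is_hom_cst[where 'a = 'a], of "H1 a" H2]
  show "subst_H a (cst c) = cst c" "subst_H a (var (Suc 0)) = H1 a" "subst_H a (var 2) = H2" "subst_H a (var 3) = var 3"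
    unfolding subst_H_def
    by (simp_all add: cst_def[of c, unfolded cst_def] var_def eval_hom_pCons[OF h] is_homD[OF h] eval2_simps)
      (simp_all add: cst_def eval_hom_pCons[OF h] eval2_simps)
qed

text \<open>The factors of F are made for this: eliminating x_2 or x_1 from H_1 and H_2 turns them
  into (a_1 - a_2) x_1^2 and (a_1 - a_2) x_2^2. So the square of \<delta>^cl x_3 is a quartic in x_3
  whose coefficients are functions of the first integrals H_1, H_2.\<close>

lemma subst_H_F_poly:
  "subst_H a (F_poly a) = (cst (a 1 - a 2) * (var 1 * var 2)) ^ 2"
proof -
  note h = is_homD[OF is_hom_subst_H[of a]] and c = is_homD[OF is_hom_cst[where 'a = 'a]]
  have "subst_H a (F_poly a) =
    (cst (a 2 - a 3) * var 3 ^ 2 + H1 a - cst (a 2) * H2) * (cst (a 3 - a 1) * var 3 ^ 2 - H1 a + cst (a 1) * H2)"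
    by (simp add: F_poly_def h subst_H_simps)
  also have "cst (a 2 - a 3) * var 3 ^ 2 + H1 a - cst (a 2) * H2 = cst (a 1 - a 2) * var 1 ^ 2"
    unfolding H1_def H2_def sum_1_3 by (simp add: c algebra_simps)
  also have "cst (a 3 - a 1) * var 3 ^ 2 - H1 a + cst (a 1) * H2 = cst (a 1 - a 2) * var 2 ^ 2"
    unfolding H1_def H2_def sum_1_3 by (simp add: c algebra_simps)
  finally show ?thesis by (simp add: power2_eq_square algebra_simps)
qed

lemma degree_F_poly: "Polynomial.degree (F_poly a) \<le> 4"
proof -
  have 1: "Polynomial.degree (cst c * var 3 ^ 2 :: 'a poly poly poly) \<le> 2" for c :: 'a
    by (intro order.trans[OF degree_mult_le]) (simp add: cst_def var_def power2_eq_square)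
  have 2: "Polynomial.degree (cst c * var 2 :: 'a poly poly poly) \<le> 2" for c :: 'a
    by (intro order.trans[OF degree_mult_le]) (simp add: cst_def var_def)
  have 3: "Polynomial.degree (var (Suc 0) :: 'a poly poly poly) \<le> 2" by (simp add: var_def)
  have "Polynomial.degree (cst (a 2 - a 3) * var 3 ^ 2 + var 1 - cst (a 2) * var 2) \<le> 2"
    "Polynomial.degree (cst (a 3 - a 1) * var 3 ^ 2 - var 1 + cst (a 1) * var 2) \<le> 2"
    using 1 2 3 by (auto intro!: degree_add_le degree_diff_le)
  then show ?thesis unfolding F_poly_def
    by (intro order.trans[OF degree_mult_le]) simp
qed

lemma degree_F_poly_power: "Polynomial.degree (F_poly a ^ n) \<le> 4 * n"
  by (rule order.trans[OF degree_power_le mult_le_mono1[OF degree_F_poly]])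

text \<open>The square in \<open>subst_H_F_poly\<close> is raised to the power (p - 1)/2. One factor
  \<delta>^cl x_3 is kept outside the sum, since it is the inner derivative when powers of x_3 are
  integrated.\<close>

lemma odd_power_euler:
  fixes a :: "nat \<Rightarrow> 'a::idom" and p :: nat
  assumes "odd p"
  defines "c \<equiv> \<lambda>j. eval2 cst (Polynomial.coeff (F_poly a ^ ((p - 1) div 2)) j) (H1 a) H2"
  shows "(cst (a 1 - a 2) * (var 1 * var 2)) ^ p = (\<Sum>j\<le>2 * (p - 1). c j * var 3 ^ j) * (cst (a 1 - a 2) * (var 1 * var 2))"
proof -
  define h where "h = (p - 1) div 2"
  have h: "p = Suc (2 * h)" "2 * (p - 1) = 4 * h" using assms(1) by (auto simp: h_def elim: oddE)
  have "subst_H a (F_poly a ^ h) = (\<Sum>j\<le>4 * h. eval2 cst (Polynomial.coeff (F_poly a ^ h) j) (H1 a) H2 * var 3 ^ j)"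
    unfolding subst_H_def
    by (rule eval_hom_sum[OF is_hom_eval2[OF is_hom_cst] degree_F_poly_power])
  moreover have "subst_H a (F_poly a ^ h) = (cst (a 1 - a 2) * (var 1 * var 2)) ^ (2 * h)"
    by (simp only: is_homD(7)[OF is_hom_subst_H] subst_H_F_poly power_mult)
  ultimately have "(\<Sum>j\<le>4 * h. eval2 cst (Polynomial.coeff (F_poly a ^ h) j) (H1 a) H2 * var 3 ^ j) =
      (cst (a 1 - a 2) * (var 1 * var 2)) ^ (2 * h)" by simp
  then have "(\<Sum>j\<le>2 * (p - 1). c j * var 3 ^ j) = (cst (a 1 - a 2) * (var 1 * var 2)) ^ (2 * h)"
    unfolding c_def h_def[symmetric] h(2) .
  then show ?thesis by (subst h(1)) (simp add: mult.commute)
qed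

text \<open>The Hasse invariant is nonzero at \<open>(z1, z2) = (a 2, 1)\<close>, where \<open>F\<close> degenerates to
  $(a_2 - a_3) x^2 ((a_3 - a_1) x^2 + a_1 - a_2)$.\<close>

lemma hasse_degenerate:
  assumes "odd p"
  shows "eval2 id (hasse p a) (a 2) 1 = ((a 2 - a 3) * (a 1 - a 2)) ^ ((p - 1) div 2)"
proof -
  define h where "h = (p - 1) div 2"
  have h: "p - 1 = 2 * h" using assms(1) by (auto simp: h_def elim: oddE)
  define e where "e = (\<lambda>c::'a poly poly. eval2 id c (a 2) 1)"
  have e: "is_hom e" unfolding e_def by (intro is_hom_eval2 is_hom_id)
  note m = is_homD[OF is_hom_map_poly[OF e]] and e' = is_homD[OF e]
  have gens: "e [:[:c:]:] = c" "e [:[:0, 1:]:] = a 2" "e [:0, 1:] = 1" for c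
    by (simp_all add: e_def eval2_simps)
  have "map_poly e (cst c) = [:c:]" for c
    by (simp add: cst_def map_poly_pCons e' gens)
  moreover have "map_poly e (var (Suc 0)) = [:a 2:]" "map_poly e (var 2) = 1" "map_poly e (var 3) = [:0, 1:]"
    by (simp_all add: var_def map_poly_pCons e' gens gens[unfolded pCons_one] pCons_one)
  ultimately have "map_poly e (F_poly a) = [:0, 0, a 2 - a 3:] * [:a 1 - a 2, 0, a 3 - a 1:]"
    by (simp add: F_poly_def m power2_eq_square)
  also have "[:0, 0, a 2 - a 3:] = Polynomial.monom (a 2 - a 3) 2"
    by (simp add: monom_altdef power2_eq_square)
  finally have eF: "map_poly e (F_poly a) = Polynomial.monom (a 2 - a 3) 2 * [:a 1 - a 2, 0, a 3 - a 1:]" .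
  \<comment> \<open>The first factor already has degree 2h = p - 1, so the wanted coefficient sees
    only the constant term of the second factor.\<close>
  have "map_poly e (F_poly a ^ h) = Polynomial.monom ((a 2 - a 3) ^ h) (2 * h) * [:a 1 - a 2, 0, a 3 - a 1:] ^ h"
    unfolding m eF power_mult_distrib by (simp add: monom_power mult.commute)
  then have "e (Polynomial.coeff (F_poly a ^ h) (2 * h)) = (a 2 - a 3) ^ h * Polynomial.coeff ([:a 1 - a 2, 0, a 3 - a 1:] ^ h) 0"
    using coeff_map_poly[of e "F_poly a ^ h" "2 * h"] by (simp add: e' coeff_monom_mult)
  then show ?thesis
    unfolding hasse_def h_def[symmetric] unfolding h by (simp add: e_def coeff_0_power power_mult_distrib)
qed

section \<open>Polynomials over A modulo p\<close>

lemma const_dvd_poly_iff: "of_nat n dvd (f :: 'b::idom poly) \<longleftrightarrow> (\<forall>k. of_nat n dvd Polynomial.coeff f k)"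
  unfolding of_nat_poly by (rule const_poly_dvd_iff)

context unramified_dvr
begin

lemma prime_elem_pi: "prime_elem \<pi>"
  using pi_nz pi_not_unit pi_prime by (auto simp: prime_elem_def)

lemma prime_elem_poly3: "prime_elem (of_nat p :: 'a poly poly poly)"
proof -
  have "prime_elem (of_nat p :: 'a poly)" unfolding of_nat_poly
    using prime_elem_pi lift_prime_elem_poly by (simp add: \<pi>_def)
  then have "prime_elem (of_nat p :: 'a poly poly)" unfolding of_nat_poly by (rule lift_prime_elem_poly)
  then show ?thesis unfolding of_nat_poly by (rule lift_prime_elem_poly)
qed

end

locale infinite_residue_dvr = unramified_dvr +
  assumes infinite_residues: "finite Z \<Longrightarrow> \<exists>x. \<forall>y\<in>Z. \<not> \<pi> dvd x - y"
begin

text \<open>Induction on the degree: a root r modulo \<pi> is split off. The quotient is known to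
  vanish only away from r, which is why a finite exceptional set \<open>Z\<close> is carried along;
  with infinitely many residues there is always a next r.\<close>

lemma vanishing_poly:
  assumes "finite Z" "\<And>x. (\<forall>y\<in>Z. \<not> \<pi> dvd x - y) \<Longrightarrow> \<pi> dvd poly f x"
  shows "of_nat p dvd f"
  using assms
proof (induction "Polynomial.degree f" arbitrary: f Z rule: less_induct)
  case less
  obtain r where r: "\<forall>y\<in>Z. \<not> \<pi> dvd r - y" using infinite_residues[OF less.prems(1)] by blast
  have fr: "\<pi> dvd poly f r" using less.prems(2) r by blast
  show ?case
  proof (cases "Polynomial.degree f = 0")
    case True
    then obtain c where "f = [:c:]" by (rule degree_eq_zeroE)
    with fr show ?thesis by (simp add: const_dvd_poly_iff \<pi>_def coeff_pCons split: nat.splits)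
  next
    case False
    define g where "g = synthetic_div f r"
    have f: "f = [:- r, 1:] * g + [:poly f r:]"
      unfolding g_def by (rule synthetic_div_correct'[symmetric])
    have "of_nat p dvd g"
    proof (rule less.hyps)
      show "Polynomial.degree g < Polynomial.degree f" using False by (simp add: g_def degree_synthetic_div)
      show "finite (insert r Z)" using less.prems by simp
      fix x assume x: "\<forall>y\<in>insert r Z. \<not> \<pi> dvd x - y"
      have "poly f x = (x - r) * poly g x + poly f r" by (subst f) (simp add: algebra_simps)
      moreover have "\<pi> dvd poly f x" using less.prems(2) x by blast
      ultimately have "\<pi> dvd (x - r) * poly g x" using fr by (simp add: dvd_add_left_iff)
      then show "\<pi> dvd poly g x" using x pi_prime by blast
    qed
    moreover have "of_nat p dvd [:poly f r:]"
      using fr by (simp add: const_dvd_poly_iff \<pi>_def coeff_pCons split: nat.splits)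
    ultimately show ?thesis by (subst f) (intro dvd_add dvd_mult)
  qed
qed

text \<open>One variable at a time: with x_1 and x_2 fixed, vanishing for all x_3 gives vanishing of
  the coefficients, which are then treated as polynomials in x_2, and finally in x_1.\<close>

lemma vanishing_poly3:
  fixes f :: "'a poly poly poly"
  assumes "\<And>x. \<pi> dvd poly3_eval x f" shows "of_nat p dvd f"
proof -
  have "of_nat p dvd Polynomial.coeff (Polynomial.coeff f k) j" for k j
  proof (rule vanishing_poly[of "{}"])
    fix x1 :: 'a
    define e1 where "e1 = eval_hom id x1"
    have e1: "is_hom e1" unfolding e1_def by (intro is_hom_eval_hom is_hom_id)
    have "of_nat p dvd map_poly e1 (Polynomial.coeff f k)"
    proof (rule vanishing_poly[of "{}"])
      fix x2 :: 'a
      define e2 where "e2 = eval_hom e1 x2"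
      have e2: "is_hom e2" unfolding e2_def by (intro is_hom_eval_hom e1)
      have "of_nat p dvd map_poly e2 f"
      proof (rule vanishing_poly[of "{}"])
        fix x3 :: 'a
        show "\<pi> dvd poly (map_poly e2 f) x3"
          using assms[of "\<lambda>i. if i = 1 then x1 else if i = 2 then x2 else x3"]
          by (simp add: poly3_eval_def e1_def e2_def eval_hom_def)
      qed simp
      then show "\<pi> dvd poly (map_poly e1 (Polynomial.coeff f k)) x2"
        unfolding const_dvd_poly_iff
        by (simp add: coeff_map_poly is_homD[OF e2] \<pi>_def) (simp add: e2_def eval_hom_def)
    qed simp
    then show "\<pi> dvd poly (Polynomial.coeff (Polynomial.coeff f k) j) x1"
      unfolding const_dvd_poly_iff
      by (simp add: coeff_map_poly is_homD[OF e1] \<pi>_def) (simp add: e1_def eval_hom_def map_poly_id)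
  qed simp
  then show ?thesis by (simp add: const_dvd_poly_iff[of p f] const_dvd_poly_iff[of p "Polynomial.coeff f _"])
qed

end

section \<open>Functions on $X$\<close>

context unramified_dvr
begin

lemma padic_ring_type_algebra: "padic_ring (ring_of_type_algebra :: 'a ring) p"
proof (intro padic_ring.intro padic_ring_axioms.intro)
  show "cring (ring_of_type_algebra :: 'a ring)" by (rule cring_from_type_algebra)
  show "padically_complete p (ring_of_type_algebra :: 'a ring)"
    using limit separated
    by (auto simp: padically_complete_def cauchy_def type_algebra_multiples \<pi>_def)
qed

lemma pi_dvd_of_nat: "\<pi> dvd of_nat n \<Longrightarrow> p dvd n"
proof (rule ccontr)
  assume "\<pi> dvd of_nat n" "\<not> p dvd n"
  then have "coprime (int n) (int p)"
    using prime_imp_coprime[OF p_prime, of n] by (simp add: coprime_commute)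
  then obtain u v where "u * int n + v * int p = 1"
    using bezout_int[of "int n" "int p"] by (auto simp: coprime_iff_gcd_eq_1)
  then have "of_int (u * int n + v * int p) = (1 :: 'a)" by simp
  then have "of_int u * of_nat n + of_int v * \<pi> = 1" by (simp add: \<pi>_def)
  moreover have "\<pi> dvd of_int u * of_nat n + of_int v * \<pi>"
    using \<open>\<pi> dvd of_nat n\<close> by (intro dvd_add) auto
  ultimately show False using pi_not_unit by simp
qed

lemma sqrt_exists:
  assumes "\<not> \<pi> dvd y" "\<pi> dvd y * y - c"
  obtains z where "z * z = c" "\<pi> dvd z - y"
proof -
  interpret T: padic_ring "ring_of_type_algebra :: 'a ring" p by (rule padic_ring_type_algebra)
  have "\<not> \<pi> dvd 2"
  proof
    assume "\<pi> dvd 2"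
    then have "p \<le> 2" using pi_dvd_of_nat[of 2] by (auto intro: dvd_imp_le)
    then have "p = 2" using prime_ge_2_nat[OF p_prime] by simp
    with p_odd show False by simp
  qed
  then have "\<not> \<pi> dvd y + y" using assms(1) pi_prime[of 2 y] by (auto simp: mult_2[symmetric] simp del: mult_2)
  then have "y + y dvd 1" by (rule unitI)
  then have "y \<oplus>\<^bsub>ring_of_type_algebra\<^esub> y \<in> Units ring_of_type_algebra"
    by (auto simp: Units_def dvd_def mult.commute)
  then obtain z where "z \<in> carrier (ring_of_type_algebra :: 'a ring)"
      "z \<otimes>\<^bsub>ring_of_type_algebra\<^esub> z = c" "z \<ominus>\<^bsub>ring_of_type_algebra\<^esub> y \<in> multiples ring_of_type_algebra p"
    using T.sqrt_lift[of y c] assms(2) by (auto simp: type_algebra_multiples \<pi>_def)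
  then show ?thesis using that by (simp add: type_algebra_multiples \<pi>_def)
qed

text \<open>The description \<open>the_p_derivation\<close> is meaningful: \<delta> and its
  Frobenius lift determine each other, as p can be cancelled, and the lift exists uniquely by
  \<open>frobenius_exists\<close> and \<open>frobenius_unique\<close>.\<close>

lemma frobenius_eq_the_p_derivation:
  "is_hom (\<lambda>x. x ^ p + \<pi> * the_p_derivation p x)"
  "s \<in> witt \<Longrightarrow> s 0 ^ p + \<pi> * the_p_derivation p (s 0) = s 1"
proof -
  obtain \<phi> where \<phi>: "\<And>x y. \<phi> (x + y) = \<phi> x + \<phi> y" "\<And>x y. \<phi> (x * y) = \<phi> x * \<phi> y" "\<phi> 1 = 1"
    "\<And>x. \<pi> dvd \<phi> x - x ^ p" "\<And>s. s \<in> witt \<Longrightarrow> \<phi> (s 0) = s 1" using frobenius_exists by metis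
  have p_der: "p_derivation p ring_of_type_algebra \<delta> \<longleftrightarrow> is_hom (\<lambda>x. x ^ p + \<pi> * \<delta> x)" for \<delta> :: "'a \<Rightarrow> 'a"
    by (auto simp: p_derivation_def frob_def[abs_def] ring_hom_def is_hom_def \<pi>_def)
  define \<delta> where "\<delta> x = (SOME y. \<phi> x - x ^ p = \<pi> * y)" for x
  have "\<phi> x - x ^ p = \<pi> * \<delta> x" for x
    unfolding \<delta>_def by (rule someI_ex) (use \<phi>(4)[of x] in \<open>auto simp: dvd_def\<close>)
  then have \<delta>: "\<phi> x = x ^ p + \<pi> * \<delta> x" for x by (metis add.commute diff_add_cancel)
  have "the_p_derivation p = \<delta>"
    unfolding the_p_derivation_def
  proof (rule the_equality)
    show "p_derivation p ring_of_type_algebra \<delta>"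
      unfolding p_der \<delta>[symmetric] by (simp add: is_hom_def \<phi>)
    fix \<delta>' :: "'a \<Rightarrow> 'a" assume "p_derivation p ring_of_type_algebra \<delta>'"
    then have h: "is_hom (\<lambda>x. x ^ p + \<pi> * \<delta>' x)" by (simp add: p_der)
    have "x ^ p + \<pi> * \<delta>' x = \<phi> x" for x
      by (rule frobenius_unique[where \<phi> = "\<lambda>x. x ^ p + \<pi> * \<delta>' x" and \<psi> = \<phi>])
        (use is_homD[OF h] \<phi> in auto)
    then show "\<delta>' = \<delta>" using \<delta> pi_nz by (auto simp: fun_eq_iff)
  qed
  then have eq: "x ^ p + \<pi> * the_p_derivation p x = \<phi> x" for x by (simp add: \<delta>)
  show "is_hom (\<lambda>x. x ^ p + \<pi> * the_p_derivation p x)" unfolding eq by (simp add: is_hom_def \<phi>)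
  show "s \<in> witt \<Longrightarrow> s 0 ^ p + \<pi> * the_p_derivation p (s 0) = s 1" unfolding eq by (rule \<phi>(5))
qed

text \<open>Teichmueller representatives satisfy \<phi> t = t^p, that is, \<delta> t = 0.\<close>

lemma p_constant_lift: obtains t where "\<pi> dvd x - t" "the_p_derivation p t = 0"
proof -
  obtain t r where t: "r > 0" "t ^ p ^ r = t" "\<pi> dvd x - t" by (rule teichmueller_exists)
  obtain s where s: "s \<in> witt" "s 0 = t" "s 1 = t ^ p" using witt_teichmueller[OF t(1,2)] by metis
  have "the_p_derivation p t = 0" using frobenius_eq_the_p_derivation(2)[OF s(1)] s pi_nz by simp
  then show ?thesis using that t(3) by blast
qed

end

section \<open>The coordinate ring of X and its A-points\<close>

locale euler_setting = infinite_residue_dvr p \<pi> for p :: nat and \<pi> :: "'a::idom" +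
  fixes a :: "nat \<Rightarrow> 'a"
  assumes a_unit: "(a 1 - a 2) * (a 2 - a 3) * (a 3 - a 1) dvd 1"
begin

abbreviation "Q \<equiv> Q_poly p a"
abbreviation "A12 \<equiv> a 1 - a 2"
abbreviation "A23 \<equiv> a 2 - a 3"
abbreviation "A31 \<equiv> a 3 - a 1"

lemma a_units: "A12 dvd 1" "A23 dvd 1" "A31 dvd 1"
  using a_unit by (metis dvd_mult_left dvd_mult_right)+

lemma not_dvd_unit: "u dvd 1 \<Longrightarrow> \<not> \<pi> dvd u"
  using pi_not_unit dvd_trans by blast

lemma not_dvd_mult: "\<not> \<pi> dvd x \<Longrightarrow> \<not> \<pi> dvd y \<Longrightarrow> \<not> \<pi> dvd x * y"
  using pi_prime by blast

lemma poly3_eval_H: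
  "poly3_eval x (H1 a) = a 1 * x 1 ^ 2 + a 2 * x 2 ^ 2 + a 3 * x 3 ^ 2"
  "poly3_eval x H2 = x 1 ^ 2 + x 2 ^ 2 + x 3 ^ 2"
  unfolding H1_def H2_def sum_1_3 by (simp_all add: is_homD[OF is_hom_poly3_eval])

lemma poly3_eval_eval2:
  "poly3_eval x (eval2 cst f (H1 a) H2) = eval2 id f (poly3_eval x (H1 a)) (poly3_eval x H2)"
  by (simp add: eval2_natural[OF is_hom_poly3_eval is_hom_cst] id_def)

lemma poly3_eval_Q:
  "poly3_eval x Q = x 1 * x 2 * eval2 id (N_poly a) (poly3_eval x (H1 a)) (poly3_eval x H2) *
     eval2 id (hasse p a) (poly3_eval x (H1 a)) (poly3_eval x H2)"
  by (simp add: Q_poly_def is_homD(3)[OF is_hom_poly3_eval] poly3_eval_eval2)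

lemma dvd_poly3_eval: "of_nat p dvd f \<Longrightarrow> \<pi> dvd poly3_eval x f"
  by (auto simp: dvd_def \<pi>_def is_homD[OF is_hom_poly3_eval])

lemma Q_not_dvd: "\<not> of_nat p dvd Q"
proof
  assume "of_nat p dvd Q"
  \<comment> \<open>Two test points suffice. At (0,1,0) the pair (H_1, H_2) is (a_2, 1), where the
    Hasse invariant is known from \<open>hasse_degenerate\<close>. The second factor of N and x_1
    vanish there; these are tested at (1,0,0), where the pair is (a_1, 1).\<close>
  define x where "x = (\<lambda>i::nat. if i = 2 then 1 else 0 :: 'a)"
  define y where "y = (\<lambda>i::nat. if i = 1 then 1 else 0 :: 'a)"
  have N_eq: "eval2 cst (N_poly a) (H1 a) H2 = (\<Prod>i = 1..3. H1 a - cst (a i) * H2)"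
    by (rule eval2_N_poly[OF is_hom_cst])
  have "\<not> of_nat p dvd (var 1 :: 'a poly poly poly)" "\<not> of_nat p dvd (var 2 :: 'a poly poly poly)"
    using dvd_poly3_eval[of "var 1" y] dvd_poly3_eval[of "var 2" x] pi_not_unit by (auto simp: x_def y_def)
  moreover have "\<not> of_nat p dvd eval2 cst (N_poly a) (H1 a) H2"
  proof -
    have "\<not> of_nat p dvd H1 a - cst (a 1) * H2"
      using dvd_poly3_eval[of "H1 a - cst (a 1) * H2" x] dvd_swap[of \<pi> "a 2" "a 1"] not_dvd_unit[OF a_units(1)]
      by (auto simp: poly3_eval_H is_homD[OF is_hom_poly3_eval] x_def)
    moreover have "\<not> of_nat p dvd H1 a - cst (a 3) * H2"
      using dvd_poly3_eval[of "H1 a - cst (a 3) * H2" x] not_dvd_unit[OF a_units(2)]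
      by (auto simp: poly3_eval_H is_homD[OF is_hom_poly3_eval] x_def)
    moreover have "\<not> of_nat p dvd H1 a - cst (a 2) * H2"
      using dvd_poly3_eval[of "H1 a - cst (a 2) * H2" y] not_dvd_unit[OF a_units(1)]
      by (auto simp: poly3_eval_H is_homD[OF is_hom_poly3_eval] y_def)
    ultimately show ?thesis
      unfolding N_eq prod_1_3 by (auto simp: prime_elem_dvd_mult_iff[OF prime_elem_poly3])
  qed
  moreover have "\<not> of_nat p dvd eval2 cst (hasse p a) (H1 a) H2"
  proof
    assume "of_nat p dvd eval2 cst (hasse p a) (H1 a) H2"
    then have "\<pi> dvd eval2 id (hasse p a) (a 2) 1"
      using dvd_poly3_eval[of _ x] by (fastforce simp: poly3_eval_eval2 poly3_eval_H x_def)
    then have "\<pi> dvd (A23 * A12) ^ ((p - 1) div 2)" by (simp add: hasse_degenerate[OF p_odd])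
    then show False using pi_dvd_power not_dvd_mult not_dvd_unit[OF a_units(1)] not_dvd_unit[OF a_units(2)] by blast
  qed
  ultimately show False
    using \<open>of_nat p dvd Q\<close> unfolding Q_poly_def
    by (simp only: prime_elem_dvd_mult_iff[OF prime_elem_poly3]) simp
qed

lemma Q_nz: "Q \<noteq> 0"
  using Q_not_dvd by auto

definition RR :: "'a poly poly poly fract set"
  where "RR = {Fract f (Q ^ n) | f n. True}"

abbreviation "R \<equiv> O_X p a"

lemma O_X_eq: "R = ring_of_type_algebra\<lparr>carrier := RR\<rparr>"
  by (simp add: O_X_def RR_def)

definition emb :: "'a poly poly poly \<Rightarrow> 'a poly poly poly fract"
  where "emb f = Fract f 1"

definition Qinv :: "'a poly poly poly fract"
  where "Qinv = Fract 1 Q"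

lemma is_hom_emb: "is_hom emb"
  by (simp add: is_hom_def emb_def One_fract_def)

lemma emb_eq_iff: "emb f = emb g \<longleftrightarrow> f = g"
  by (simp add: emb_def eq_fract)

lemma Qinv: "emb Q * Qinv = 1"
  using Q_nz by (simp add: emb_def Qinv_def One_fract_def eq_fract)

lemma Qinv_power: "Qinv ^ n = Fract 1 (Q ^ n)"
  by (induction n) (use Q_nz in \<open>simp_all add: Qinv_def One_fract_def mult.commute\<close>)

lemma Fract_Q: "Fract f (Q ^ n) = emb f * Qinv ^ n"
  by (simp add: Qinv_power emb_def)

lemma RR_eq: "RR = {emb f * Qinv ^ n | f n. True}"
  by (simp add: RR_def Fract_Q)

lemma emb_RR [simp]: "emb f \<in> RR"
  unfolding RR_eq by (metis (mono_tags, lifting) mem_Collect_eq mult.right_neutral power_0)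

lemma Qinv_RR [simp]: "Qinv \<in> RR"
  unfolding RR_eq by (auto intro!: exI[of _ 1] simp: is_homD[OF is_hom_emb])

lemma emb_Q_Qinv_power: "emb Q ^ n * Qinv ^ n = 1"
  by (metis Qinv power_mult_distrib power_one)

lemma RR_mult: "u \<in> RR \<Longrightarrow> v \<in> RR \<Longrightarrow> u * v \<in> RR"
proof -
  assume "u \<in> RR" "v \<in> RR"
  then obtain f m g n where "u = emb f * Qinv ^ m" "v = emb g * Qinv ^ n" by (auto simp: RR_eq)
  then have "u * v = emb (f * g) * Qinv ^ (m + n)"
    by (simp add: is_homD[OF is_hom_emb] power_add algebra_simps)
  then show "u * v \<in> RR" by (auto simp: RR_eq)
qed

lemma RR_add: "u \<in> RR \<Longrightarrow> v \<in> RR \<Longrightarrow> u + v \<in> RR"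
proof -
  assume "u \<in> RR" "v \<in> RR"
  then obtain f m g n where uv: "u = emb f * Qinv ^ m" "v = emb g * Qinv ^ n" by (auto simp: RR_eq)
  have "emb (f * Q ^ n + g * Q ^ m) * Qinv ^ (m + n) =
      emb f * Qinv ^ m * (emb Q ^ n * Qinv ^ n) + emb g * Qinv ^ n * (emb Q ^ m * Qinv ^ m)"
    by (simp add: is_homD[OF is_hom_emb] power_add algebra_simps)
  also have "\<dots> = u + v" by (simp add: emb_Q_Qinv_power uv)
  finally show "u + v \<in> RR" unfolding RR_eq by (metis (mono_tags, lifting) mem_Collect_eq)
qed

lemma RR_neg: "u \<in> RR \<Longrightarrow> - u \<in> RR"
  using RR_mult[OF emb_RR[of "- 1"], of u] by (simp add: is_homD[OF is_hom_emb])

lemma RR_diff: "u \<in> RR \<Longrightarrow> v \<in> RR \<Longrightarrow> u - v \<in> RR"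
  using RR_add[OF _ RR_neg, of u v] by simp

lemma RR_power: "u \<in> RR \<Longrightarrow> u ^ n \<in> RR"
  by (induction n) (use emb_RR[of 1] in \<open>auto simp: is_homD[OF is_hom_emb] intro: RR_mult\<close>)

lemma RR_0 [simp]: "0 \<in> RR" and RR_1 [simp]: "1 \<in> RR"
  using emb_RR[of 0] emb_RR[of 1] by (simp_all add: is_homD[OF is_hom_emb])

lemma RR_of_nat [simp]: "of_nat n \<in> RR"
  using emb_RR[of "of_nat n"] by (simp add: is_homD[OF is_hom_emb])

lemma RR_sum: "(\<And>i. i \<in> I \<Longrightarrow> f i \<in> RR) \<Longrightarrow> sum f I \<in> RR"
  by (induction I rule: infinite_finite_induct) (auto intro: RR_add)

text \<open>\<open>RR\<close> is generated by constants, variables and 1/Q. The case of 1/Q may use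
  the claim for Q, from which derivations and homomorphisms determine what happens to the
  inverse.\<close>

lemma RR_induct [consumes 1, case_names cst var Qinv add mult]:
  assumes "u \<in> RR"
    and cst: "\<And>c. P (emb (cst c))" and var: "\<And>i. i \<in> {1, 2, 3} \<Longrightarrow> P (emb (var i))"
    and Qinv: "P (emb Q) \<Longrightarrow> P Qinv"
    and add: "\<And>u v. u \<in> RR \<Longrightarrow> v \<in> RR \<Longrightarrow> P u \<Longrightarrow> P v \<Longrightarrow> P (u + v)"
    and mult: "\<And>u v. u \<in> RR \<Longrightarrow> v \<in> RR \<Longrightarrow> P u \<Longrightarrow> P v \<Longrightarrow> P (u * v)"
  shows "P u"
proof -
  have emb: "P (emb f)" for f
  proof (induction f rule: poly3_induct)
    case (add f g)
    then show ?case using assms(5)[of "emb f" "emb g"] by (simp add: is_homD[OF is_hom_emb])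
  next
    case (mult f g)
    then show ?case using assms(6)[of "emb f" "emb g"] by (simp add: is_homD[OF is_hom_emb])
  qed (use cst var in auto)
  have "P (Qinv ^ n)" for n
  proof (induction n)
    case 0
    then show ?case using emb[of 1] by (simp add: is_homD[OF is_hom_emb])
  next
    case (Suc n)
    then show ?case using Qinv emb mult RR_power by simp
  qed
  moreover obtain f n where "u = emb f * Qinv ^ n" using assms(1) by (auto simp: RR_eq)
  ultimately show ?thesis using mult[OF emb_RR RR_power[OF Qinv_RR] emb] by simp
qed

lemma R_cring: "cring R"
  unfolding O_X_eq by (rule type_algebra_sub_cring) (auto intro: RR_add RR_mult RR_neg)

sublocale R: cring R by (rule R_cring)

lemma R_simps [simp]:
  "carrier R = RR" "u \<otimes>\<^bsub>R\<^esub> v = u * v" "u \<oplus>\<^bsub>R\<^esub> v = u + v" "\<one>\<^bsub>R\<^esub> = 1" "\<zero>\<^bsub>R\<^esub> = 0"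
  "[(k::nat)] \<cdot>\<^bsub>R\<^esub> u = of_nat k * u" "u [^]\<^bsub>R\<^esub> k = u ^ k"
  by (simp_all add: O_X_eq)

lemma R_minus [simp]: "v \<in> RR \<Longrightarrow> u \<ominus>\<^bsub>R\<^esub> v = u - v"
  unfolding O_X_eq by (rule type_algebra_sub_minus) (use R_cring RR_neg in \<open>auto simp: O_X_eq\<close>)

lemma R_multiples: "multiples R m = (\<lambda>u. of_nat m * u) ` RR"
  by (auto simp: multiples_def)

lemma of_nat_p_nz: "(of_nat p :: 'a poly poly poly fract) \<noteq> 0"
proof -
  have "(of_nat p :: 'a poly poly poly) \<noteq> 0" using prime_elem_poly3 by auto
  then show ?thesis
    using emb_eq_iff[of "of_nat p" 0] by (simp add: is_homD[OF is_hom_emb])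
qed

lemma R_torsion_free: "u \<in> carrier R \<Longrightarrow> [p] \<cdot>\<^bsub>R\<^esub> u = \<zero>\<^bsub>R\<^esub> \<Longrightarrow> u = \<zero>\<^bsub>R\<^esub>"
  using of_nat_p_nz by simp

definition unit_poly :: "'a poly poly poly \<Rightarrow> bool"
  where "unit_poly f \<longleftrightarrow> (\<exists>v\<in>RR. emb f * v = 1)"

lemma unit_poly_dvd: "f dvd Q \<Longrightarrow> unit_poly f"
proof -
  assume "f dvd Q"
  then obtain g where "Q = f * g" by (auto simp: dvd_def)
  then have "emb f * (emb g * Qinv) = 1" using Qinv by (simp add: is_homD[OF is_hom_emb] mult.assoc)
  then show ?thesis unfolding unit_poly_def by (intro bexI[of _ "emb g * Qinv"]) (auto intro: RR_mult)
qed

lemma unit_poly_cst: "c dvd 1 \<Longrightarrow> unit_poly (cst c)"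
proof -
  assume "c dvd 1"
  then obtain d where "1 = c * d" by (auto simp: dvd_def)
  then have "emb (cst c) * emb (cst d) = 1"
    by (metis is_homD(1,3)[OF is_hom_emb] is_homD(1,3)[OF is_hom_cst])
  then show ?thesis unfolding unit_poly_def by (intro bexI[of _ "emb (cst d)"]) auto
qed

lemma unit_poly_mult: "unit_poly f \<Longrightarrow> unit_poly g \<Longrightarrow> unit_poly (f * g)"
proof -
  assume "unit_poly f" "unit_poly g"
  then obtain u v where "u \<in> RR" "v \<in> RR" "emb f * u = 1" "emb g * v = 1" by (auto simp: unit_poly_def)
  then have "emb (f * g) * (u * v) = 1"
    by (simp add: is_homD[OF is_hom_emb]) (metis mult.assoc mult.commute mult.right_neutral)
  then show ?thesis unfolding unit_poly_def using \<open>u \<in> RR\<close> \<open>v \<in> RR\<close> RR_mult by blast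
qed

abbreviation "AH \<equiv> eval2 cst (hasse p a) (H1 a) H2"

lemma unit_polys: "unit_poly (var 1)" "unit_poly (var 2)" "unit_poly AH"
  by (rule unit_poly_dvd; simp add: Q_poly_def)+

text \<open>The value at an A-point. The defining equation is free of division and is required for
  all presentations of u. It has a solution when Q does not vanish modulo \<pi> at the point, since
  the value of Q is then a unit.\<close>

definition ev :: "(nat \<Rightarrow> 'a) \<Rightarrow> 'a poly poly poly fract \<Rightarrow> 'a"
  where "ev x u = (THE c. \<forall>f n. u = emb f * Qinv ^ n \<longrightarrow> c * poly3_eval x Q ^ n = poly3_eval x f)"

lemma ev_eqI:
  assumes "\<not> \<pi> dvd poly3_eval x Q" "u = emb f * Qinv ^ n" "c * poly3_eval x Q ^ n = poly3_eval x f"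
  shows "ev x u = c"
  unfolding ev_def
proof (rule the_equality)
  have nz: "poly3_eval x Q \<noteq> 0" using assms(1) by auto
  show "\<forall>g m. u = emb g * Qinv ^ m \<longrightarrow> c * poly3_eval x Q ^ m = poly3_eval x g"
  proof (intro allI impI)
    fix g m assume u: "u = emb g * Qinv ^ m"
    have "emb (f * Q ^ m) = emb f * Qinv ^ n * emb Q ^ n * emb Q ^ m"
      using emb_Q_Qinv_power[of n] by (simp add: is_homD[OF is_hom_emb] mult.assoc mult.commute[of "Qinv ^ n"])
    also have "\<dots> = emb g * Qinv ^ m * emb Q ^ n * emb Q ^ m" using assms(2) u by simp
    also have "\<dots> = emb (g * Q ^ n)"
      using emb_Q_Qinv_power[of m] by (simp add: is_homD[OF is_hom_emb] mult.assoc mult.left_commute[of "Qinv ^ m"] mult.commute[of "Qinv ^ m"])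
    finally have "f * Q ^ m = g * Q ^ n" by (simp add: emb_eq_iff)
    then have "poly3_eval x f * poly3_eval x Q ^ m = poly3_eval x g * poly3_eval x Q ^ n"
      by (metis is_homD(3,7)[OF is_hom_poly3_eval])
    then have "(c * poly3_eval x Q ^ m) * poly3_eval x Q ^ n = poly3_eval x g * poly3_eval x Q ^ n"
      using assms(3) by (metis mult.assoc mult.commute)
    then show "c * poly3_eval x Q ^ m = poly3_eval x g" using nz by simp
  qed
  fix d assume "\<forall>g m. u = emb g * Qinv ^ m \<longrightarrow> d * poly3_eval x Q ^ m = poly3_eval x g"
  then have "d * poly3_eval x Q ^ n = c * poly3_eval x Q ^ n" using assms(2,3) by metis
  then show "d = c" using nz by simp
qed

lemma ev_exists:
  assumes "\<not> \<pi> dvd poly3_eval x Q" "u \<in> RR"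
  obtains f n where "u = emb f * Qinv ^ n" "ev x u * poly3_eval x Q ^ n = poly3_eval x f"
proof -
  obtain f n where u: "u = emb f * Qinv ^ n" using assms(2) by (auto simp: RR_eq)
  obtain w where "1 = poly3_eval x Q * w" using unitI[OF assms(1)] by (auto simp: dvd_def)
  then have "poly3_eval x f * w ^ n * poly3_eval x Q ^ n = poly3_eval x f"
    by (metis mult.assoc mult.commute mult.right_neutral power_mult_distrib power_one)
  from ev_eqI[OF assms(1) u this] this that u show ?thesis by metis
qed

lemma ev_emb: "\<not> \<pi> dvd poly3_eval x Q \<Longrightarrow> ev x (emb f) = poly3_eval x f"
  by (rule ev_eqI[of _ _ _ 0]) auto

lemma ev_hom:
  assumes "\<not> \<pi> dvd poly3_eval x Q" "u \<in> RR" "v \<in> RR"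
  shows "ev x (u + v) = ev x u + ev x v" "ev x (u * v) = ev x u * ev x v"
proof -
  note e = is_homD[OF is_hom_poly3_eval[of x]] and b = is_homD[OF is_hom_emb]
  obtain f m where u: "u = emb f * Qinv ^ m" "ev x u * poly3_eval x Q ^ m = poly3_eval x f"
    using ev_exists[OF assms(1,2)] by metis
  obtain g n where v: "v = emb g * Qinv ^ n" "ev x v * poly3_eval x Q ^ n = poly3_eval x g"
    using ev_exists[OF assms(1,3)] by metis
  show "ev x (u + v) = ev x u + ev x v"
  proof (rule ev_eqI[OF assms(1)])
    show "u + v = emb (f * Q ^ n + g * Q ^ m) * Qinv ^ (m + n)"
    proof -
      have "emb (f * Q ^ n + g * Q ^ m) * Qinv ^ (m + n) =
          emb f * Qinv ^ m * (emb Q ^ n * Qinv ^ n) + emb g * Qinv ^ n * (emb Q ^ m * Qinv ^ m)"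
        by (simp add: b power_add algebra_simps)
      then show ?thesis by (simp add: emb_Q_Qinv_power u v)
    qed
    show "(ev x u + ev x v) * poly3_eval x Q ^ (m + n) = poly3_eval x (f * Q ^ n + g * Q ^ m)"
      unfolding e u(2)[symmetric] v(2)[symmetric] by (simp add: power_add algebra_simps)
  qed
  show "ev x (u * v) = ev x u * ev x v"
  proof (rule ev_eqI[OF assms(1)])
    show "u * v = emb (f * g) * Qinv ^ (m + n)"
      unfolding u(1) v(1) by (simp add: b power_add algebra_simps)
    show "ev x u * ev x v * poly3_eval x Q ^ (m + n) = poly3_eval x (f * g)"
      unfolding e u(2)[symmetric] v(2)[symmetric] by (simp add: power_add algebra_simps)
  qed
qed

text \<open>The numerator is only controlled at points of X, so it is multiplied by Q in order to
  vanish at all points of affine space. As p is prime in the polynomial ring and does not divide Q,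
  the factor Q can be cancelled afterwards.\<close>

lemma density:
  assumes u: "u \<in> RR"
    and van: "\<And>x. \<not> \<pi> dvd poly3_eval x Q \<Longrightarrow> \<pi> dvd ev x u"
  shows "u \<in> multiples R p"
proof -
  obtain f n where fn: "u = emb f * Qinv ^ n" using u by (auto simp: RR_eq)
  have "\<pi> dvd poly3_eval x (f * Q)" for x
  proof (cases "\<pi> dvd poly3_eval x Q")
    case False
    have "ev x (emb f) = ev x (u * emb Q ^ n)"
      using emb_Q_Qinv_power[of n] by (simp add: fn mult.assoc mult.commute[of "Qinv ^ n"])
    then have "poly3_eval x f = ev x u * ev x (emb Q ^ n)"
      using ev_hom(2)[OF False u RR_power[OF emb_RR]] by (simp add: ev_emb[OF False])
    then show ?thesis using van[OF False] by (simp add: is_homD[OF is_hom_poly3_eval])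
  qed (simp add: is_homD[OF is_hom_poly3_eval])
  then have "of_nat p dvd f * Q" by (rule vanishing_poly3)
  then have "of_nat p dvd f" using Q_not_dvd prime_elem_poly3 by (simp add: prime_elem_dvd_mult_iff)
  then obtain g where "f = of_nat p * g" by (auto simp: dvd_def)
  then have "u = of_nat p * (emb g * Qinv ^ n)" by (simp add: fn is_homD[OF is_hom_emb])
  moreover have "emb g * Qinv ^ n \<in> RR" by (intro RR_mult RR_power emb_RR Qinv_RR)
  ultimately show ?thesis unfolding R_multiples by (rule image_eqI)
qed

end

section \<open>The flow equation\<close>

text \<open>The quotient rule; independence of the presentation comes from differentiating f g' = f'
  g.\<close>

lemma derivation_fract:
  assumes "is_derivation (d :: 'b::idom \<Rightarrow> 'b)"
  shows "\<exists>d' :: 'b fract \<Rightarrow> 'b fract. is_derivation d' \<and> (\<forall>f. d' (Fract f 1) = Fract (d f) 1)"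
proof -
  note d = is_derivationD[OF assms]
  define e where "e f = Fract f 1" for f :: 'b
  have e: "e 1 = 1" "e 0 = 0" "e (x + y) = e x + e y" "e (x * y) = e x * e y" "e x = 0 \<longleftrightarrow> x = 0" for x y
    by (simp_all add: e_def One_fract_def Zero_fract_def eq_fract)
  have ex: "\<exists>f g. g \<noteq> 0 \<and> u = e f / e g" for u
    by (cases u) (auto simp: e_def divide_fract)
  define q where "q f g = (e g * e (d f) - e f * e (d g)) / (e g * e g)" for f g
  have well: "q f g = q f' g'" if "g \<noteq> 0" "g' \<noteq> 0" "e f / e g = e f' / e g'" for f g f' g'
  proof -
    have nz: "e g \<noteq> 0" "e g' \<noteq> 0" using that by (simp_all add: e)
    \<comment> \<open>With f = t g the quotient rule reads (df - t dg)/g, and similarly for the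
      other presentation with the same t; in this form the two are easy to compare.\<close>
    define t where "t = e f / e g"
    have f: "e f = t * e g" "e f' = t * e g'" using nz that(3) by (simp_all add: t_def field_simps)
    have "e f * e g' = e f' * e g" using f by simp
    then have "f * g' = f' * g" by (simp add: e(4)[symmetric] e_def eq_fract)
    then have "d (f * g') = d (f' * g)" by simp
    then have "e (f * d g' + g' * d f) = e (f' * d g + g * d f')" by (simp add: d)
    then have "e f * e (d g') + e g' * e (d f) = e f' * e (d g) + e g * e (d f')" by (simp add: e)
    then have "e g' * (e (d f) - t * e (d g)) = e g * (e (d f') - t * e (d g'))"
      unfolding f by (simp add: algebra_simps)
    then have "(e (d f) - t * e (d g)) / e g = (e (d f') - t * e (d g')) / e g'"
      using nz by (simp add: field_simps)
    moreover have "q f g = (e (d f) - t * e (d g)) / e g" "q f' g' = (e (d f') - t * e (d g')) / e g'"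
      unfolding q_def f using nz by (simp_all add: field_simps)
    ultimately show ?thesis by simp
  qed
  have "\<forall>u. \<exists>v. \<forall>f g. g \<noteq> 0 \<longrightarrow> u = e f / e g \<longrightarrow> v = q f g"
    using ex well by metis
  then obtain d' where d': "\<And>f g. g \<noteq> 0 \<Longrightarrow> d' (e f / e g) = q f g" by metis
  have "is_derivation d'"
    unfolding is_derivation_def
  proof (intro conjI allI)
    fix u v
    obtain f g f' g' where uv: "g \<noteq> 0" "u = e f / e g" "g' \<noteq> 0" "v = e f' / e g'" using ex by metis
    have nz: "e g \<noteq> 0" "e g' \<noteq> 0" using uv by (simp_all add: e)
    have "u + v = e (f * g' + f' * g) / e (g * g')" using nz by (simp add: uv e field_simps)
    then have "d' (u + v) = q (f * g' + f' * g) (g * g')" using d' uv by simp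
    also have "\<dots> = q f g + q f' g'" using nz by (simp add: q_def d e field_simps)
    finally show "d' (u + v) = d' u + d' v" using d' uv by simp
    have "u * v = e (f * f') / e (g * g')" using nz by (simp add: uv e field_simps)
    then have "d' (u * v) = q (f * f') (g * g')" using d' uv by simp
    also have "\<dots> = u * q f' g' + v * q f g" using nz by (simp add: q_def d e uv field_simps)
    finally show "d' (u * v) = u * d' v + v * d' u" using d' uv by simp
  qed
  moreover have "d' (Fract f 1) = Fract (d f) 1" for f
    using d'[of 1 f] by (simp add: q_def e d e_def[symmetric])
  ultimately show ?thesis by blast
qed

lemma derivation_eval_hom:
  assumes d: "is_derivation d" and h: "is_hom h" and "\<And>c. d (h c) = 0" "d y = 0"
  shows "d (eval_hom h y f) = 0"
  by (induction f) (simp_all add: eval_hom_pCons h is_derivationD[OF d] assms(3,4))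

section \<open>The vector field on X and on its reduction\<close>

context euler_setting
begin

lemma emb_Q_Qinv: "emb Q * Qinv = 1"
  by (rule Qinv)

text \<open>A lift of \<delta>^cl to characteristic zero on the whole fraction field, where 1/Q and
  the inverse of the Hasse invariant can be differentiated directly. \<open>dd_RR\<close> and
  \<open>dd_cong\<close> bring it back to X and to the reduction.\<close>

definition dd :: "'a poly poly poly fract \<Rightarrow> 'a poly poly poly fract"
  where "dd = (SOME d'. is_derivation d' \<and> (\<forall>f. d' (Fract f 1) = Fract (euler_derivation a f) 1))"

lemma is_derivation_dd: "is_derivation dd" and dd_emb: "dd (emb f) = emb (euler_derivation a f)"
  using someI_ex[OF derivation_fract[OF is_derivation_euler[of a]]] by (simp_all add: dd_def emb_def)

lemmas dd = is_derivationD[OF is_derivation_dd]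

lemma dd_cst [simp]: "dd (emb (cst c)) = 0"
  by (simp add: dd_emb is_homD[OF is_hom_emb])

lemma dd_Qinv: "dd Qinv = - (Qinv * Qinv * dd (emb Q))"
proof -
  have "0 = dd (emb Q * Qinv)" by (simp add: Qinv dd)
  then have "Qinv * (emb Q * dd Qinv + Qinv * dd (emb Q)) = 0" by (simp add: dd)
  then have "(emb Q * Qinv) * dd Qinv + Qinv * Qinv * dd (emb Q) = 0" by (simp add: algebra_simps)
  then show ?thesis by (simp add: Qinv eq_neg_iff_add_eq_0)
qed

lemma dd_RR: "u \<in> RR \<Longrightarrow> dd u \<in> RR"
proof (induction rule: RR_induct)
  case Qinv
  then show ?case by (simp add: dd_Qinv RR_mult RR_neg)
qed (auto simp: dd_emb dd intro: RR_add RR_mult)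

lemma dd_cong:
  assumes "u \<in> multiples R m" shows "dd u \<in> multiples R m"
proof -
  obtain v where v: "v \<in> RR" "u = of_nat m * v" using assms by (auto simp: R_multiples)
  have "dd (of_nat m) = 0"
    using dd_cst[of "of_nat m"] by (simp add: is_homD[OF is_hom_emb] is_homD[OF is_hom_cst])
  then have "dd u = of_nat m * dd v" using v by (simp add: dd)
  then show ?thesis using v dd_RR by (auto simp: R_multiples)
qed

abbreviation "Xbar \<equiv> O_Xbar p a"

definition cls :: "'a poly poly poly fract \<Rightarrow> 'a poly poly poly fract set"
  where "cls u = multiples R p +>\<^bsub>R\<^esub> u"

lemma Xbar_cring: "cring Xbar"
  unfolding O_Xbar_def by (rule ideal.quotient_is_cring[OF R.multiples_ideal R_cring])

sublocale Xbar: cring Xbar by (rule Xbar_cring)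

lemma cls_hom: "cls \<in> ring_hom R Xbar"
  unfolding O_Xbar_def cls_def[abs_def] by (rule ideal.rcos_ring_hom[OF R.multiples_ideal])

lemma Xbar_carrier: "carrier Xbar = cls ` RR"
  by (auto simp: O_Xbar_def FactRing_def A_RCOSETS_def' cls_def)

lemma cls_simps:
  "u \<in> RR \<Longrightarrow> cls u \<in> carrier Xbar"
  "u \<in> RR \<Longrightarrow> v \<in> RR \<Longrightarrow> cls u \<oplus>\<^bsub>Xbar\<^esub> cls v = cls (u + v)"
  "u \<in> RR \<Longrightarrow> v \<in> RR \<Longrightarrow> cls u \<otimes>\<^bsub>Xbar\<^esub> cls v = cls (u * v)"
  "\<zero>\<^bsub>Xbar\<^esub> = cls 0" "\<one>\<^bsub>Xbar\<^esub> = cls 1"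
proof -
  interpret cls: ring_hom_ring R Xbar cls
    by (intro ring_hom_ringI2 R.ring_axioms Xbar.ring_axioms cls_hom)
  show "\<zero>\<^bsub>Xbar\<^esub> = cls 0" using cls.hom_zero by simp
  show "\<one>\<^bsub>Xbar\<^esub> = cls 1" using cls.hom_one by simp
qed (use ring_hom_add[OF cls_hom] ring_hom_mult[OF cls_hom] in \<open>auto simp: Xbar_carrier\<close>)

lemma cls_eq_iff: "u \<in> RR \<Longrightarrow> v \<in> RR \<Longrightarrow> cls u = cls v \<longleftrightarrow> u - v \<in> multiples R p"
  unfolding cls_def using R.multiples_coset_iff[of u v p] by simp

lemma in_Xbar_eq: "in_Xbar p a f = cls (emb f)"
  by (simp add: in_Xbar_def cls_def emb_def)

text \<open>A derivation is determined by its values on constants and variables; for 1/Q the value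
  follows by differentiating Q (1/Q) = 1.\<close>

lemma is_delta_cl_iff:
  "is_delta_cl p a D \<longleftrightarrow> D \<in> carrier Xbar \<rightarrow>\<^sub>E carrier Xbar \<and> (\<forall>u\<in>RR. D (cls u) = cls (dd u))"
proof (intro iffI conjI ballI)
  assume D: "is_delta_cl p a D"
  note D' = D[unfolded is_delta_cl_def Let_def in_Xbar_eq]
  show "D \<in> carrier Xbar \<rightarrow>\<^sub>E carrier Xbar" using D' by blast
  then have closed: "D (cls u) \<in> carrier Xbar" if "u \<in> RR" for u using that cls_simps(1) by auto
  have add: "D (cls u \<oplus>\<^bsub>Xbar\<^esub> cls v) = D (cls u) \<oplus>\<^bsub>Xbar\<^esub> D (cls v)" if "u \<in> RR" "v \<in> RR" for u v
    using D' that cls_simps(1) by blast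
  have mult: "D (cls u \<otimes>\<^bsub>Xbar\<^esub> cls v) = cls u \<otimes>\<^bsub>Xbar\<^esub> D (cls v) \<oplus>\<^bsub>Xbar\<^esub> cls v \<otimes>\<^bsub>Xbar\<^esub> D (cls u)"
    if "u \<in> RR" "v \<in> RR" for u v
    using D' that cls_simps(1) by blast
  have lin: "D (cls (emb (cst c)) \<otimes>\<^bsub>Xbar\<^esub> cls u) = cls (emb (cst c)) \<otimes>\<^bsub>Xbar\<^esub> D (cls u)" if "u \<in> RR" for u c
    using D' that cls_simps(1) by blast
  have one: "D (cls 1) = cls 0"
  proof -
    have "D (cls 1) = D (cls 1) \<oplus>\<^bsub>Xbar\<^esub> D (cls 1)"
      using mult[of 1 1] closed[of 1] by (simp add: cls_simps(5)[symmetric])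
    then show ?thesis using closed[of 1] Xbar.add.l_cancel_one'[of "D (cls 1)" "D (cls 1)"] cls_simps(4) by simp
  qed
  fix u assume "u \<in> RR"
  then show "D (cls u) = cls (dd u)"
  proof (induction rule: RR_induct)
    case (cst c)
    have "D (cls (emb (cst c)) \<otimes>\<^bsub>Xbar\<^esub> cls 1) = cls (emb (cst c)) \<otimes>\<^bsub>Xbar\<^esub> cls 0"
      using lin[of 1 c] one by simp
    then show ?case by (simp add: cls_simps(3))
  next
    case (var i)
    have "D (cls (emb (var 1))) = cls (emb (cst A23)) \<otimes>\<^bsub>Xbar\<^esub> (cls (emb (var 2)) \<otimes>\<^bsub>Xbar\<^esub> cls (emb (var 3)))"
      "D (cls (emb (var 2))) = cls (emb (cst A31)) \<otimes>\<^bsub>Xbar\<^esub> (cls (emb (var 3)) \<otimes>\<^bsub>Xbar\<^esub> cls (emb (var 1)))"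
      "D (cls (emb (var 3))) = cls (emb (cst A12)) \<otimes>\<^bsub>Xbar\<^esub> (cls (emb (var 1)) \<otimes>\<^bsub>Xbar\<^esub> cls (emb (var 2)))"
      using D' by blast+
    then show ?case
      using var by (auto simp: cls_simps RR_mult dd_emb is_homD[OF is_hom_emb])
  next
    case Qinv
    obtain s where s: "s \<in> RR" "D (cls Qinv) = cls s" using closed[OF Qinv_RR] by (auto simp: Xbar_carrier)
    have "cls 0 = D (cls (emb Q) \<otimes>\<^bsub>Xbar\<^esub> cls Qinv)" by (simp add: cls_simps(3) emb_Q_Qinv one)
    also have "\<dots> = cls (emb Q * s + Qinv * dd (emb Q))"
      unfolding mult[OF emb_RR Qinv_RR] s(2) Qinv by (simp add: cls_simps s RR_mult dd_RR)
    finally have "emb Q * s + Qinv * dd (emb Q) \<in> multiples R p"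
      using s cls_eq_iff[of "emb Q * s + Qinv * dd (emb Q)" 0] by (simp add: RR_add RR_mult dd_RR)
    then have "Qinv * (emb Q * s + Qinv * dd (emb Q)) \<in> multiples R p"
      using R.multiples_mult_left[OF _ , of "emb Q * s + Qinv * dd (emb Q)" p Qinv] by simp
    moreover have "Qinv * (emb Q * s + Qinv * dd (emb Q)) = s - dd Qinv"
    proof -
      have "Qinv * (emb Q * s + Qinv * dd (emb Q)) = (emb Q * Qinv) * s + Qinv * Qinv * dd (emb Q)"
        by (simp add: algebra_simps)
      then show ?thesis by (simp add: emb_Q_Qinv dd_Qinv)
    qed
    ultimately show ?case using s by (simp add: cls_eq_iff dd_RR)
  next
    case (add u v)
    then show ?case using \<open>\<And>u v. u \<in> RR \<Longrightarrow> v \<in> RR \<Longrightarrow> D (cls u \<oplus>\<^bsub>Xbar\<^esub> cls v) = _\<close>[of u v]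
      by (simp add: cls_simps dd_RR dd)
  next
    case (mult u v)
    then show ?case using \<open>\<And>u v. u \<in> RR \<Longrightarrow> v \<in> RR \<Longrightarrow> D (cls u \<otimes>\<^bsub>Xbar\<^esub> cls v) = _\<close>[of u v]
      by (simp add: cls_simps dd_RR dd RR_mult)
  qed
next
  assume D: "D \<in> carrier Xbar \<rightarrow>\<^sub>E carrier Xbar \<and> (\<forall>u\<in>RR. D (cls u) = cls (dd u))"
  then have D': "\<And>u. u \<in> RR \<Longrightarrow> D (cls u) = cls (dd u)" by blast
  show "is_delta_cl p a D"
    unfolding is_delta_cl_def Let_def in_Xbar_eq
  proof (intro conjI ballI allI)
    show "D \<in> carrier Xbar \<rightarrow>\<^sub>E carrier Xbar" using D by blast
  next
    fix u v assume "u \<in> carrier Xbar" "v \<in> carrier Xbar"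
    then show "D (u \<oplus>\<^bsub>Xbar\<^esub> v) = D u \<oplus>\<^bsub>Xbar\<^esub> D v"
      "D (u \<otimes>\<^bsub>Xbar\<^esub> v) = u \<otimes>\<^bsub>Xbar\<^esub> D v \<oplus>\<^bsub>Xbar\<^esub> v \<otimes>\<^bsub>Xbar\<^esub> D u"
      by (auto simp: Xbar_carrier cls_simps D' dd_RR dd RR_mult RR_add)
  next
    fix u c assume "u \<in> carrier Xbar"
    then show "D (cls (emb (cst c)) \<otimes>\<^bsub>Xbar\<^esub> u) = cls (emb (cst c)) \<otimes>\<^bsub>Xbar\<^esub> D u"
      by (auto simp: Xbar_carrier cls_simps D' dd_RR dd RR_mult)
  qed (simp_all add: D' cls_simps RR_mult dd_emb is_homD[OF is_hom_emb])
qed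

text \<open>The description in \<open>delta_cl\<close> is justified here: \<open>dd\<close> maps p R
  into p R and so induces a derivation of the required kind, the only one by
  \<open>is_delta_cl_iff\<close>.\<close>

lemma delta_cl_cos:
  assumes "u \<in> RR" shows "delta_cl p a (cls u) = cls (dd u)"
proof -
  define D where "D = (\<lambda>C\<in>carrier Xbar. cls (dd (SOME u. u \<in> RR \<and> C = cls u)))"
  have D: "D (cls u) = cls (dd u)" if "u \<in> RR" for u
  proof -
    have "\<exists>v. v \<in> RR \<and> cls u = cls v" using that by blast
    then obtain v where v: "v \<in> RR" "cls u = cls v" "D (cls u) = cls (dd v)"
      using someI_ex[of "\<lambda>v. v \<in> RR \<and> cls u = cls v"] that by (auto simp: D_def cls_simps(1))
    then have "v - u \<in> multiples R p" using that cls_eq_iff[of v u] by simp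
    then have "dd v - dd u \<in> multiples R p" using dd_cong by (metis dd(6))
    then show ?thesis using v that by (simp add: cls_eq_iff dd_RR)
  qed
  have "is_delta_cl p a D"
    unfolding is_delta_cl_iff
  proof (intro conjI ballI)
    show "D \<in> carrier Xbar \<rightarrow>\<^sub>E carrier Xbar"
    proof (rule PiE_I)
      fix C assume "C \<in> carrier Xbar"
      then show "D C \<in> carrier Xbar" using D cls_simps(1) dd_RR by (auto simp: Xbar_carrier)
    qed (simp add: D_def)
  qed (rule D)
  moreover have "D' = D" if "is_delta_cl p a D'" for D'
  proof (rule PiE_ext)
    show "D' \<in> carrier Xbar \<rightarrow>\<^sub>E carrier Xbar" "D \<in> carrier Xbar \<rightarrow>\<^sub>E carrier Xbar"
      using that \<open>is_delta_cl p a D\<close> by (auto simp: is_delta_cl_iff)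
    fix C assume "C \<in> carrier Xbar"
    then show "D' C = D C" using that D by (auto simp: Xbar_carrier is_delta_cl_iff)
  qed
  ultimately have "delta_cl p a = D" unfolding delta_cl_def by (intro the_equality)
  then show ?thesis using D assms by simp
qed

section \<open>The equation for \<delta> x_3 modulo p and its solution\<close>

definition AHinv :: "'a poly poly poly fract"
  where "AHinv = inverse (emb AH)"

lemma AHinv: "emb AH * AHinv = 1" "AHinv \<in> RR"
proof -
  obtain v where v: "v \<in> RR" "emb AH * v = 1" using unit_polys(3) by (auto simp: unit_poly_def)
  then have "AHinv = v" unfolding AHinv_def by (metis inverse_unique)
  with v show "emb AH * AHinv = 1" "AHinv \<in> RR" by simp_all
qed

lemma dd_eval2_H: "dd (emb (eval2 cst f (H1 a) H2)) = 0"
proof -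
  have "euler_derivation a (eval2 cst f (H1 a) H2) = 0"
    unfolding eval2_eval_hom
    by (rule derivation_eval_hom[OF is_derivation_euler is_hom_eval_hom[OF is_hom_cst]])
      (simp_all add: derivation_eval_hom[OF is_derivation_euler is_hom_cst] euler_derivation_H)
  then show ?thesis by (simp add: dd_emb is_homD[OF is_hom_emb])
qed

lemma dd_AHinv: "dd AHinv = 0"
proof -
  have "0 = dd (emb AH * AHinv)" by (simp add: AHinv dd)
  also have "\<dots> = emb AH * dd AHinv" by (simp add: dd(2) dd_eval2_H)
  finally have "AHinv * (emb AH * dd AHinv) = 0" by simp
  then have "(emb AH * AHinv) * dd AHinv = 0" by (simp add: ac_simps)
  then show ?thesis by (simp add: AHinv)
qed

abbreviation "b3 \<equiv> emb (cst A12 * (var 1 * var 2))"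
abbreviation "X3 \<equiv> emb (var 3)"

lemma dd_X3: "dd X3 = b3"
  by (simp add: dd_emb)

definition flow_rhs :: "'a poly poly poly fract"
  where "flow_rhs = AHinv * b3 ^ p - X3 ^ (p - 1) * b3"

lemma flow_rhs_RR: "flow_rhs \<in> RR"
  unfolding flow_rhs_def by (intro RR_diff RR_mult RR_power emb_RR AHinv)

text \<open>Since \<open>b3 ^ p\<close> is a polynomial in \<open>X3\<close> times \<open>dd X3\<close>, it can be integrated term by term,
  except for the degree \<open>p - 1\<close> term, whose coefficient is the Hasse invariant.\<close>

lemma flow_equation_solvable: "\<exists>f\<in>RR. dd f = flow_rhs"
proof -
  define c where "c j = eval2 cst (Polynomial.coeff (F_poly a ^ ((p - 1) div 2)) j) (H1 a) H2" for j
  have cAH: "c (p - 1) = AH" by (simp add: c_def hasse_def)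
  define J where "J = {..2 * (p - 1)} - {p - 1}"
  have "\<forall>j\<in>J. \<exists>i. of_nat (Suc j) * i = (1 :: 'a)"
  proof
    fix j assume j: "j \<in> J"
    \<comment> \<open>Since j + 1 is at most 2p - 1, it could only be the multiple p itself, and j =
      p - 1 is excluded from \<open>J\<close>.\<close>
    have "\<not> p dvd Suc j"
    proof
      assume "p dvd Suc j"
      then obtain k where k: "Suc j = p * k" by (auto simp: dvd_def)
      have "k \<noteq> 0" using k by (intro notI) simp
      moreover have "k \<noteq> 1" using k j by (auto simp: J_def)
      ultimately have "p * 2 \<le> Suc j" unfolding k by (intro mult_le_mono2) auto
      with j p_pos show False by (auto simp: J_def)
    qed
    then have "\<not> \<pi> dvd of_nat (Suc j)" using pi_dvd_of_nat by blast
    then have "of_nat (Suc j) dvd (1 :: 'a)" by (rule unitI)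
    then show "\<exists>i. of_nat (Suc j) * i = (1 :: 'a)" by (auto simp: dvd_def)
  qed
  then obtain i where i: "\<And>j. j \<in> J \<Longrightarrow> of_nat (Suc j) * i j = (1 :: 'a)" by metis
  \<comment> \<open>Antiderivative term by term: c_j x_3^j b integrates to c_j x_3^{j+1}/(j+1),
    because \<delta>^cl x_3 = b and \<delta>^cl c_j = 0. The number \<open>i j\<close> is the
    inverse of j + 1 in A.\<close>
  define f where "f = AHinv * (\<Sum>j\<in>J. emb (cst (i j)) * emb (c j) * X3 ^ Suc j)"
  have "f \<in> RR" unfolding f_def by (intro RR_mult RR_sum RR_power AHinv emb_RR)
  have term_eq: "dd (emb (cst (i j)) * emb (c j) * X3 ^ Suc j) = emb (c j) * X3 ^ j * b3" if "j \<in> J" for j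
  proof -
    have "emb (cst (of_nat (Suc j) * i j)) = 1"
      unfolding i[OF that] by (simp add: is_homD[OF is_hom_emb] is_homD[OF is_hom_cst])
    then have one: "of_nat (Suc j) * emb (cst (i j)) = 1"
      by (simp only: is_homD[OF is_hom_emb] is_homD[OF is_hom_cst])
    have "dd (emb (c j)) = 0" unfolding c_def by (rule dd_eval2_H)
    then have "dd (emb (cst (i j)) * emb (c j) * X3 ^ Suc j) = emb (cst (i j)) * emb (c j) * dd (X3 ^ Suc j)"
      by (simp add: dd(2) del: power_Suc)
    also have "dd (X3 ^ Suc j) = of_nat (Suc j) * X3 ^ j * b3"
      using dd(7)[of X3 "Suc j"] by (simp only: diff_Suc_1 dd_X3)
    also have "emb (cst (i j)) * emb (c j) * (of_nat (Suc j) * X3 ^ j * b3) =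
        (of_nat (Suc j) * emb (cst (i j))) * (emb (c j) * X3 ^ j * b3)"
      by (simp only: ac_simps)
    finally show ?thesis by (simp only: one mult_1)
  qed
  have "b3 ^ p = emb ((cst A12 * (var 1 * var 2)) ^ p)" by (simp add: is_homD[OF is_hom_emb])
  also have "\<dots> = (\<Sum>j\<le>2 * (p - 1). emb (c j) * X3 ^ j) * b3"
    unfolding odd_power_euler[OF p_odd] c_def
    by (simp only: is_homD[OF is_hom_emb] is_hom_sum[OF is_hom_emb])
  \<comment> \<open>The summand of degree p - 1 has the Hasse invariant as coefficient; multiplied
    by \<open>AHinv * b3\<close> it is the term subtracted in \<open>flow_rhs\<close>.\<close>
  also have "(\<Sum>j\<le>2 * (p - 1). emb (c j) * X3 ^ j) = emb (c (p - 1)) * X3 ^ (p - 1) + (\<Sum>j\<in>J. emb (c j) * X3 ^ j)"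
    unfolding J_def by (rule sum.remove) auto
  finally have pow: "b3 ^ p = emb AH * X3 ^ (p - 1) * b3 + (\<Sum>j\<in>J. emb (c j) * X3 ^ j * b3)"
    unfolding cAH by (simp only: distrib_right sum_distrib_right)
  have "dd f = AHinv * (\<Sum>j\<in>J. dd (emb (cst (i j)) * emb (c j) * X3 ^ Suc j))"
    unfolding f_def dd(2)[of AHinv] dd_AHinv dd(8) by simp
  also have "\<dots> = AHinv * (\<Sum>j\<in>J. emb (c j) * X3 ^ j * b3)"
    by (simp only: term_eq cong: sum.cong)
  also have "\<dots> = AHinv * (b3 ^ p - emb AH * X3 ^ (p - 1) * b3)" unfolding pow by simp
  also have "\<dots> = AHinv * b3 ^ p - (emb AH * AHinv) * (X3 ^ (p - 1) * b3)" by (simp add: algebra_simps)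
  also have "\<dots> = flow_rhs" by (simp add: AHinv flow_rhs_def)
  finally show ?thesis using \<open>f \<in> RR\<close> by blast
qed

end

section \<open>Flows and their values on $x_3$\<close>

text \<open>Evaluation of polynomials in a ring record, by folding the Horner scheme over the
  coefficients. The recursion \<open>HC\<close> also covers the zero polynomial, for which no
  coefficient is stored.\<close>

lemma poly_extend_hom:
  fixes h :: "'b::comm_ring_1 \<Rightarrow> 's"
  assumes "cring S" and h: "h \<in> ring_hom ring_of_type_algebra S" and y: "y \<in> carrier S"
  shows "\<exists>H \<in> ring_hom ring_of_type_algebra S. (\<forall>c. H [:c:] = h c) \<and> H [:0, 1:] = y"
proof -
  interpret S: cring S by fact
  have hc [simp]: "h c \<in> carrier S" for c using ring_hom_closed[OF h] by simp
  have h_add: "h (c + d) = h c \<oplus>\<^bsub>S\<^esub> h d" and h_mult: "h (c * d) = h c \<otimes>\<^bsub>S\<^esub> h d" for c d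
    using ring_hom_add[OF h, of c d] ring_hom_mult[OF h, of c d] by simp_all
  have h0: "h 0 = \<zero>\<^bsub>S\<^esub>"
    using h_add[of 0 0] S.add.l_cancel_one'[of "h 0" "h 0"] by simp
  have h1: "h 1 = \<one>\<^bsub>S\<^esub>" using ring_hom_one[OF h] by simp
  define H where "H f = foldr (\<lambda>c r. h c \<oplus>\<^bsub>S\<^esub> y \<otimes>\<^bsub>S\<^esub> r) (coeffs f) \<zero>\<^bsub>S\<^esub>" for f
  have H0: "H 0 = \<zero>\<^bsub>S\<^esub>" by (simp add: H_def)
  have HC: "H (pCons c f) = h c \<oplus>\<^bsub>S\<^esub> y \<otimes>\<^bsub>S\<^esub> H f" for c f
    using y by (cases "c = 0 \<and> f = 0") (auto simp: H_def cCons_def h0)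
  have Hc [simp]: "H f \<in> carrier S" for f
    by (induction f) (simp_all add: H0 HC y)
  have add: "H (f + g) = H f \<oplus>\<^bsub>S\<^esub> H g" for f g
  proof (induction f g rule: poly_induct2)
    case (pCons c f d g)
    have *: "u \<oplus>\<^bsub>S\<^esub> v \<oplus>\<^bsub>S\<^esub> y \<otimes>\<^bsub>S\<^esub> (F \<oplus>\<^bsub>S\<^esub> G) = u \<oplus>\<^bsub>S\<^esub> y \<otimes>\<^bsub>S\<^esub> F \<oplus>\<^bsub>S\<^esub> (v \<oplus>\<^bsub>S\<^esub> y \<otimes>\<^bsub>S\<^esub> G)"
      if "u \<in> carrier S" "v \<in> carrier S" "F \<in> carrier S" "G \<in> carrier S" for u v F G
      using that y by algebra
    show ?case using *[of "h c" "h d" "H f" "H g"] by (simp add: HC pCons h_add)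
  qed (simp add: H0)
  have smult: "H (Polynomial.smult c f) = h c \<otimes>\<^bsub>S\<^esub> H f" for c f
  proof (induction f)
    case (pCons d f)
    have *: "u \<otimes>\<^bsub>S\<^esub> v \<oplus>\<^bsub>S\<^esub> y \<otimes>\<^bsub>S\<^esub> (u \<otimes>\<^bsub>S\<^esub> F) = u \<otimes>\<^bsub>S\<^esub> (v \<oplus>\<^bsub>S\<^esub> y \<otimes>\<^bsub>S\<^esub> F)"
      if "u \<in> carrier S" "v \<in> carrier S" "F \<in> carrier S" for u v F
      using that y by algebra
    show ?case using *[of "h c" "h d" "H f"] by (simp add: HC pCons h_mult)
  qed (simp add: H0)
  have mult: "H (f * g) = H f \<otimes>\<^bsub>S\<^esub> H g" for f g
  proof (induction f)
    case (pCons c f)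
    have *: "u \<otimes>\<^bsub>S\<^esub> G \<oplus>\<^bsub>S\<^esub> (\<zero>\<^bsub>S\<^esub> \<oplus>\<^bsub>S\<^esub> y \<otimes>\<^bsub>S\<^esub> (F \<otimes>\<^bsub>S\<^esub> G)) = (u \<oplus>\<^bsub>S\<^esub> y \<otimes>\<^bsub>S\<^esub> F) \<otimes>\<^bsub>S\<^esub> G"
      if "u \<in> carrier S" "G \<in> carrier S" "F \<in> carrier S" for u G F
      using that y by algebra
    show ?case using *[of "h c" "H g" "H f"] by (simp add: HC pCons add smult h0)
  qed (simp add: H0)
  have "H \<in> ring_hom ring_of_type_algebra S"
    by (rule ring_hom_memI) (simp_all add: add mult one_pCons HC H0 h1 y)
  moreover have "H [:c:] = h c" for c by (simp add: HC H0 y)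
  moreover have "H [:0, 1:] = y" using y by (simp add: HC H0 h0 h1)
  ultimately show ?thesis by blast
qed

lemma poly3_extend_hom:
  fixes h :: "'b::comm_ring_1 \<Rightarrow> 's"
  assumes "cring S" and "h \<in> ring_hom ring_of_type_algebra S"
    and "y1 \<in> carrier S" "y2 \<in> carrier S" "y3 \<in> carrier S"
  shows "\<exists>H \<in> ring_hom ring_of_type_algebra S. (\<forall>c. H (cst c) = h c) \<and>
    H (var 1) = y1 \<and> H (var 2) = y2 \<and> H (var 3) = y3"
proof -
  obtain H1 where H1: "H1 \<in> ring_hom ring_of_type_algebra S" "\<And>c. H1 [:c:] = h c" "H1 [:0, 1:] = y1"
    using poly_extend_hom[OF assms(1,2,3)] by blast
  obtain H2 where H2: "H2 \<in> ring_hom ring_of_type_algebra S" "\<And>c. H2 [:c:] = H1 c" "H2 [:0, 1:] = y2"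
    using poly_extend_hom[OF assms(1) H1(1) assms(4)] by blast
  obtain H3 where H3: "H3 \<in> ring_hom ring_of_type_algebra S" "\<And>c. H3 [:c:] = H2 c" "H3 [:0, 1:] = y3"
    using poly_extend_hom[OF assms(1) H2(1) assms(5)] by blast
  have "H3 (cst c) = h c" for c by (simp add: cst_def H1 H2 H3)
  moreover have "H3 (var 1) = y1" "H3 (var 2) = y2" "H3 (var 3) = y3"
    by (simp_all add: var_def H1 H2 H3)
  ultimately show ?thesis using H3(1) by blast
qed

lemma ring_hom_simps:
  assumes "ring R" "ring S" "h \<in> ring_hom R S"
  shows "h \<zero>\<^bsub>R\<^esub> = \<zero>\<^bsub>S\<^esub>" "x \<in> carrier R \<Longrightarrow> y \<in> carrier R \<Longrightarrow> h (x \<ominus>\<^bsub>R\<^esub> y) = h x \<ominus>\<^bsub>S\<^esub> h y"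
    "x \<in> carrier R \<Longrightarrow> h (x [^]\<^bsub>R\<^esub> (n::nat)) = h x [^]\<^bsub>S\<^esub> n"
    "x \<in> carrier R \<Longrightarrow> h ([n] \<cdot>\<^bsub>R\<^esub> x) = [n] \<cdot>\<^bsub>S\<^esub> h x"
    "x \<in> multiples R n \<Longrightarrow> h x \<in> multiples S n"
proof -
  interpret ring_hom_ring R S h by (intro ring_hom_ringI2 assms)
  note ag = ring.is_abelian_group[OF assms(1)] ring.is_abelian_group[OF assms(2)] ring_hom_in_hom(2)[OF assms(3)]
  show "h \<zero>\<^bsub>R\<^esub> = \<zero>\<^bsub>S\<^esub>" by (rule hom_zero)
  show "x \<in> carrier R \<Longrightarrow> y \<in> carrier R \<Longrightarrow> h (x \<ominus>\<^bsub>R\<^esub> y) = h x \<ominus>\<^bsub>S\<^esub> h y"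
    by (rule additive_hom_minus[OF ag])
  show "x \<in> carrier R \<Longrightarrow> h (x [^]\<^bsub>R\<^esub> n) = h x [^]\<^bsub>S\<^esub> n" by (rule hom_nat_pow)
  show "x \<in> carrier R \<Longrightarrow> h ([n] \<cdot>\<^bsub>R\<^esub> x) = [n] \<cdot>\<^bsub>S\<^esub> h x" by (rule additive_hom_add_pow[OF ag])
  show "x \<in> multiples R n \<Longrightarrow> h x \<in> multiples S n" by (rule additive_hom_multiples[OF ag])
qed

text \<open>Cramer's rule for \<phi>(x_1)^2 and \<phi>(x_2)^2, given w = \<phi>(x_3)^2 and the
  values h_i = \<phi>(H_i), with A_i = \<phi>(a_i); e is the inverse of the determinant.\<close>

lemma (in cring) linear_system_solution:
  assumes [simp]: "A1 \<in> carrier R" "A2 \<in> carrier R" "A3 \<in> carrier R" "e \<in> carrier R"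
    "w \<in> carrier R" "h1 \<in> carrier R" "h2 \<in> carrier R"
    and e: "e \<otimes> (A1 \<ominus> A2) = \<one>"
  defines "Y1 \<equiv> e \<otimes> ((A2 \<ominus> A3) \<otimes> w \<oplus> h1 \<ominus> A2 \<otimes> h2)"
    and "Y2 \<equiv> e \<otimes> ((A3 \<ominus> A1) \<otimes> w \<ominus> h1 \<oplus> A1 \<otimes> h2)"
  shows "A1 \<otimes> Y1 \<oplus> A2 \<otimes> Y2 \<oplus> A3 \<otimes> w = h1" "Y1 \<oplus> Y2 \<oplus> w = h2"
proof -
  have "A1 \<otimes> Y1 \<oplus> A2 \<otimes> Y2 \<oplus> A3 \<otimes> w =
      (e \<otimes> (A1 \<ominus> A2)) \<otimes> (h1 \<ominus> A3 \<otimes> w) \<oplus> A3 \<otimes> w"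
    unfolding Y1_def Y2_def using assms(1-7) by algebra
  then show "A1 \<otimes> Y1 \<oplus> A2 \<otimes> Y2 \<oplus> A3 \<otimes> w = h1" by (simp add: e)
  have "Y1 \<oplus> Y2 \<oplus> w = (e \<otimes> (A1 \<ominus> A2)) \<otimes> (h2 \<ominus> w) \<oplus> w"
    unfolding Y1_def Y2_def using assms(1-7) by algebra
  then show "Y1 \<oplus> Y2 \<oplus> w = h2" by (simp add: e)
qed

lemma (in cring) linear_system_unique:
  assumes "A1 \<in> carrier R" "A2 \<in> carrier R" "A3 \<in> carrier R"
    "Y1 \<in> carrier R" "Y2 \<in> carrier R" "w \<in> carrier R" "h1 \<in> carrier R" "h2 \<in> carrier R"
    and "A1 \<otimes> Y1 \<oplus> A2 \<otimes> Y2 \<oplus> A3 \<otimes> w = h1" "Y1 \<oplus> Y2 \<oplus> w = h2"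
  shows "(A1 \<ominus> A2) \<otimes> Y1 = (A2 \<ominus> A3) \<otimes> w \<oplus> h1 \<ominus> A2 \<otimes> h2"
    "(A1 \<ominus> A2) \<otimes> Y2 = (A3 \<ominus> A1) \<otimes> w \<ominus> h1 \<oplus> A1 \<otimes> h2"
  unfolding assms(9,10)[symmetric] using assms(1-6) by algebra+

lemma (in cring) unit_multiples_cancel:
  assumes "u \<in> Units R" "x \<in> carrier R" "u \<otimes> x \<in> multiples R m" shows "x \<in> multiples R m"
proof -
  have "inv u \<otimes> (u \<otimes> x) \<in> multiples R m"
    using multiples_mult_left[OF assms(3), of "inv u"] assms(1) by simp
  moreover have "inv u \<otimes> (u \<otimes> x) = x"
    using assms(1,2) by (simp add: m_assoc[symmetric] Units_closed)
  ultimately show ?thesis by simp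
qed

section \<open>The completed coordinate ring of X\<close>

context euler_setting
begin

abbreviation "S \<equiv> O_Xhat p a"
abbreviation "\<iota> \<equiv> to_completion p R"

sublocale XC: ring_completion R p by (intro ring_completion.intro R_cring)

lemma S_eq: "padic_completion p R = S"
  by (simp add: O_Xhat_def)

lemma S_padic: "padic_ring S p"
  unfolding O_Xhat_def by (rule XC.C.padic_ring_axioms)

sublocale S: padic_ring S p by (rule S_padic)

lemma \<iota>_hom: "\<iota> \<in> ring_hom R S"
  unfolding O_Xhat_def by (rule XC.to_completion_hom)

lemma \<iota>_simps:
  "u \<in> RR \<Longrightarrow> \<iota> u \<in> carrier S"
  "u \<in> RR \<Longrightarrow> v \<in> RR \<Longrightarrow> \<iota> (u + v) = \<iota> u \<oplus>\<^bsub>S\<^esub> \<iota> v"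
  "u \<in> RR \<Longrightarrow> v \<in> RR \<Longrightarrow> \<iota> (u * v) = \<iota> u \<otimes>\<^bsub>S\<^esub> \<iota> v"
  "u \<in> RR \<Longrightarrow> v \<in> RR \<Longrightarrow> \<iota> (u - v) = \<iota> u \<ominus>\<^bsub>S\<^esub> \<iota> v"
  "u \<in> RR \<Longrightarrow> \<iota> (u ^ n) = \<iota> u [^]\<^bsub>S\<^esub> n"
  "u \<in> RR \<Longrightarrow> \<iota> (of_nat n * u) = [n] \<cdot>\<^bsub>S\<^esub> \<iota> u"
  "\<iota> 0 = \<zero>\<^bsub>S\<^esub>" "\<iota> 1 = \<one>\<^bsub>S\<^esub>"
  using ring_hom_closed[OF \<iota>_hom] ring_hom_add[OF \<iota>_hom] ring_hom_mult[OF \<iota>_hom] ring_hom_one[OF \<iota>_hom]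
    ring_hom_simps[OF R.ring_axioms S.ring_axioms \<iota>_hom] by auto

lemma \<iota>_multiples: "u \<in> multiples R n \<Longrightarrow> \<iota> u \<in> multiples S n"
  by (rule ring_hom_simps(5)[OF R.ring_axioms S.ring_axioms \<iota>_hom])

lemma S_approx:
  assumes "x \<in> carrier S"
  obtains r where "r \<in> RR" "x \<ominus>\<^bsub>S\<^esub> \<iota> r \<in> multiples S (p ^ n)"
proof -
  have "x \<in> carrier XC.C" using assms by (simp add: O_Xhat_def)
  from XC.completion_approx[OF this, of n] that show ?thesis by (auto simp: O_Xhat_def)
qed

lemma S_torsion_free: "x \<in> carrier S \<Longrightarrow> [p] \<cdot>\<^bsub>S\<^esub> x = \<zero>\<^bsub>S\<^esub> \<Longrightarrow> x = \<zero>\<^bsub>S\<^esub>"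
  unfolding O_Xhat_def by (rule XC.completion_torsion_free[OF R_torsion_free])

lemma S_cancel:
  assumes "x \<in> carrier S" "y \<in> carrier S" "[p] \<cdot>\<^bsub>S\<^esub> x = [p] \<cdot>\<^bsub>S\<^esub> y" shows "x = y"
proof -
  have "[p] \<cdot>\<^bsub>S\<^esub> (x \<ominus>\<^bsub>S\<^esub> y) = \<zero>\<^bsub>S\<^esub>"
    using assms by (simp add: S.add_pow_minus[symmetric])
  then show ?thesis using S_torsion_free[of "x \<ominus>\<^bsub>S\<^esub> y"] assms by (simp add: S.a_minus_zero_iff)
qed

lemma S_multiples_cancel:
  assumes "x \<in> carrier S" "[p] \<cdot>\<^bsub>S\<^esub> x \<in> multiples S (p ^ 2)" shows "x \<in> multiples S p"
proof -
  obtain y where y: "y \<in> carrier S" "[p] \<cdot>\<^bsub>S\<^esub> x = [(p ^ 2)] \<cdot>\<^bsub>S\<^esub> y" using assms(2) by (auto simp: multiples_def)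
  then have "[p] \<cdot>\<^bsub>S\<^esub> x = [p] \<cdot>\<^bsub>S\<^esub> ([p] \<cdot>\<^bsub>S\<^esub> y)" by (simp add: S.add.nat_pow_pow power2_eq_square)
  then have "x = [p] \<cdot>\<^bsub>S\<^esub> y" using S_cancel assms(1) y(1) by simp
  with y(1) show ?thesis by auto
qed

lemma S_level_iff:
  "x \<in> carrier S \<Longrightarrow> y \<in> carrier S \<Longrightarrow> x \<ominus>\<^bsub>S\<^esub> y \<in> multiples S (p ^ n) \<longleftrightarrow> x n = y n"
  unfolding O_Xhat_def by (rule XC.completion_level_iff)

lemma reduction_\<iota>: "reduction (\<iota> u) = cls u"
  by (simp add: reduction_def to_completion_def cls_def)

lemma reduction_eq_iff:
  "x \<in> carrier S \<Longrightarrow> y \<in> carrier S \<Longrightarrow> reduction x = reduction y \<longleftrightarrow> x \<ominus>\<^bsub>S\<^esub> y \<in> multiples S p"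
  using S_level_iff[of x y 1] by (simp add: reduction_def)

lemma in_Xhat_eq: "in_Xhat p a f = \<iota> (emb f)"
  by (simp add: in_Xhat_def emb_def)

lemma unit_poly_\<iota>: "unit_poly f \<Longrightarrow> \<iota> (emb f) \<in> Units S"
proof -
  assume "unit_poly f"
  then obtain v where "v \<in> RR" "emb f * v = 1" by (auto simp: unit_poly_def)
  then have "\<iota> (emb f) \<otimes>\<^bsub>S\<^esub> \<iota> v = \<one>\<^bsub>S\<^esub>" by (simp add: \<iota>_simps(3,8)[symmetric])
  then show ?thesis using \<open>v \<in> RR\<close>
    by (auto simp: Units_def S.m_comm \<iota>_simps(1) intro!: bexI[of _ "\<iota> v"])
qed

lemma RR_freshman:
  assumes "u \<in> RR" "v \<in> RR" shows "(u + v) ^ p - (u ^ p + v ^ p) \<in> multiples R p"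
proof -
  have "(u + v) ^ p - (u ^ p + v ^ p) =
      of_nat p * (\<Sum>k\<in>{0<..<p}. of_nat ((p choose k) div p) * u ^ k * v ^ (p - k))"
    by (simp add: power_sum_expand[OF p_prime])
  moreover have "(\<Sum>k\<in>{0<..<p}. of_nat ((p choose k) div p) * u ^ k * v ^ (p - k)) \<in> RR"
    using assms by (intro RR_sum RR_mult RR_power RR_of_nat)
  ultimately show ?thesis unfolding R_multiples by (rule image_eqI)
qed

abbreviation "fr \<equiv> \<lambda>x. x ^ p + \<pi> * the_p_derivation p x"
abbreviation "kA \<equiv> \<lambda>c. \<iota> (emb (cst c))"

lemma kA_hom: "kA \<in> ring_hom ring_of_type_algebra S"
  by (rule ring_hom_memI) (simp_all add: is_homD[OF is_hom_cst] is_homD[OF is_hom_emb] \<iota>_simps)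

lemma kA_diff: "kA (c - d) = kA c \<ominus>\<^bsub>S\<^esub> kA d"
  by (simp add: is_homD[OF is_hom_cst] is_homD[OF is_hom_emb] \<iota>_simps)

lemma fr_cong: "\<pi> dvd fr x - x ^ p"
  by simp

lemma fr_unit: assumes "x dvd 1" shows "fr x dvd 1"
proof -
  obtain y where "1 = x * y" using assms by (auto simp: dvd_def)
  have "fr x * fr y = fr (x * y)" by (rule is_homD(3)[OF frobenius_eq_the_p_derivation(1), symmetric])
  also have "\<dots> = fr 1" by (simp only: \<open>1 = x * y\<close>[symmetric])
  also have "\<dots> = 1" by (rule is_homD(1)[OF frobenius_eq_the_p_derivation(1)])
  finally show ?thesis by (metis dvdI)
qed

lemma cst_dvd: "\<pi> dvd c \<Longrightarrow> of_nat p dvd (cst c :: 'a poly poly poly)"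
  by (auto simp: dvd_def \<pi>_def is_homD[OF is_hom_cst])

lemma emb_dvd: "of_nat p dvd f \<Longrightarrow> emb f \<in> multiples R p"
  by (auto simp: dvd_def is_homD[OF is_hom_emb] R_multiples)

text \<open>Modulo p the powers x_i^{2p} solve the linear system for the squares: H_1^p is congruent
  to the sum of the \<phi>(a_i) x_i^{2p}, and H_2^p to the sum of the x_i^{2p}. So Hensel's lemma
  may start at x_1^p and x_2^p.\<close>

lemma mod_p_poly:
  "of_nat p dvd cst (fr (a 2) - fr (a 3)) * var 3 ^ (2 * p) + H1 a ^ p - cst (fr (a 2)) * H2 ^ p
    - cst (fr (a 1) - fr (a 2)) * (var 1 :: 'a poly poly poly) ^ (2 * p)" (is "_ dvd ?f1")
  "of_nat p dvd cst (fr (a 3) - fr (a 1)) * var 3 ^ (2 * p) - H1 a ^ p + cst (fr (a 1)) * H2 ^ p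
    - cst (fr (a 1) - fr (a 2)) * (var 2 :: 'a poly poly poly) ^ (2 * p)" (is "_ dvd ?f2")
proof -
  note c = is_homD[OF is_hom_cst[where 'a = 'a]]
  define P where "P = (of_nat p :: 'a poly poly poly)"
  have fresh3: "P dvd (x + y + z) ^ p - (x ^ p + y ^ p + z ^ p)" for x y z
  proof -
    have "P dvd ((x + y + z) ^ p - ((x + y) ^ p + z ^ p)) + ((x + y) ^ p - (x ^ p + y ^ p))"
      unfolding P_def by (intro dvd_add freshman p_prime)
    then show ?thesis by (simp add: algebra_simps)
  qed
  define G where "G = cst (fr (a 1)) * var 1 ^ (2 * p) + cst (fr (a 2)) * var 2 ^ (2 * p) + cst (fr (a 3)) * var 3 ^ (2 * p)"
  have pw: "(x ^ 2) ^ p = x ^ (2 * p)" for x :: "'a poly poly poly" by (simp add: power_mult)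
  have "P dvd H1 a ^ p - (cst (a 1) ^ p * var 1 ^ (2 * p) + cst (a 2) ^ p * var 2 ^ (2 * p) + cst (a 3) ^ p * var 3 ^ (2 * p))"
    using fresh3[of "cst (a 1) * var 1 ^ 2" "cst (a 2) * var 2 ^ 2" "cst (a 3) * var 3 ^ 2"]
    unfolding H1_def sum_1_3 by (simp add: power_mult_distrib pw)
  note dH = this
  have dc: "P dvd (cst (fr (a i)) - cst (a i) ^ p) * v" for i v
    using cst_dvd[OF fr_cong[of "a i"]] unfolding P_def by (intro dvd_mult2) (simp only: c)
  have "P dvd (H1 a ^ p - (cst (a 1) ^ p * var 1 ^ (2 * p) + cst (a 2) ^ p * var 2 ^ (2 * p) + cst (a 3) ^ p * var 3 ^ (2 * p)))
     - (cst (fr (a 1)) - cst (a 1) ^ p) * var 1 ^ (2 * p) - (cst (fr (a 2)) - cst (a 2) ^ p) * var 2 ^ (2 * p)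
     - (cst (fr (a 3)) - cst (a 3) ^ p) * var 3 ^ (2 * p)" by (rule dvd_diff[OF dvd_diff[OF dvd_diff[OF dH dc] dc] dc])
  then have H1: "P dvd H1 a ^ p - G" unfolding G_def by (simp add: algebra_simps del: of_nat_add)
  have H2: "P dvd H2 ^ p - (var 1 ^ (2 * p) + var 2 ^ (2 * p) + var 3 ^ (2 * p))"
    using fresh3[of "var 1 ^ 2" "var 2 ^ 2" "var 3 ^ 2"] unfolding H2_def sum_1_3 by (simp add: pw)
  have cd: "cst (x - y) = cst x - (cst y :: 'a poly poly poly)" for x y by (rule c)
  have ident: "(A2 - A3) * z + h1 - A2 * h2 - (A1 - A2) * x = (h1 - (A1 * x + A2 * y + A3 * z)) - A2 * (h2 - (x + y + z))"
    "(A3 - A1) * z - h1 + A1 * h2 - (A1 - A2) * y = A1 * (h2 - (x + y + z)) - (h1 - (A1 * x + A2 * y + A3 * z))"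
    for A1 A2 A3 x y z h1 h2 :: "'a poly poly poly"
    by (simp_all add: algebra_simps)
  have "?f1 = (H1 a ^ p - G) - cst (fr (a 2)) * (H2 ^ p - (var 1 ^ (2 * p) + var 2 ^ (2 * p) + var 3 ^ (2 * p)))"
    unfolding cd G_def by (rule ident)
  then show "of_nat p dvd ?f1"
    using dvd_diff[OF H1 dvd_mult[OF H2, of "cst (fr (a 2))"]] unfolding P_def by (simp only:)
  have "?f2 = cst (fr (a 1)) * (H2 ^ p - (var 1 ^ (2 * p) + var 2 ^ (2 * p) + var 3 ^ (2 * p))) - (H1 a ^ p - G)"
    unfolding cd G_def by (rule ident)
  then show "of_nat p dvd ?f2"
    using dvd_diff[OF dvd_mult[OF H2, of "cst (fr (a 1))"] H1] unfolding P_def by (simp only:)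
qed

end

lemma poly_hom_H:
  assumes "cring T" and \<Psi>: "\<Psi> \<in> ring_hom ring_of_type_algebra T"
  shows "\<Psi> (H1 a) = \<Psi> (cst (a 1)) \<otimes>\<^bsub>T\<^esub> (\<Psi> (var 1) \<otimes>\<^bsub>T\<^esub> \<Psi> (var 1)) \<oplus>\<^bsub>T\<^esub>
      \<Psi> (cst (a 2)) \<otimes>\<^bsub>T\<^esub> (\<Psi> (var 2) \<otimes>\<^bsub>T\<^esub> \<Psi> (var 2)) \<oplus>\<^bsub>T\<^esub> \<Psi> (cst (a 3)) \<otimes>\<^bsub>T\<^esub> (\<Psi> (var 3) \<otimes>\<^bsub>T\<^esub> \<Psi> (var 3))"
    and "\<Psi> H2 = \<Psi> (var 1) \<otimes>\<^bsub>T\<^esub> \<Psi> (var 1) \<oplus>\<^bsub>T\<^esub> \<Psi> (var 2) \<otimes>\<^bsub>T\<^esub> \<Psi> (var 2) \<oplus>\<^bsub>T\<^esub> \<Psi> (var 3) \<otimes>\<^bsub>T\<^esub> \<Psi> (var 3)"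
proof -
  interpret T: cring T by fact
  have add: "\<Psi> (f + g) = \<Psi> f \<oplus>\<^bsub>T\<^esub> \<Psi> g" and mult: "\<Psi> (f * g) = \<Psi> f \<otimes>\<^bsub>T\<^esub> \<Psi> g" for f g
    using ring_hom_add[OF \<Psi>, of f g] ring_hom_mult[OF \<Psi>, of f g] by simp_all
  show "\<Psi> (H1 a) = \<Psi> (cst (a 1)) \<otimes>\<^bsub>T\<^esub> (\<Psi> (var 1) \<otimes>\<^bsub>T\<^esub> \<Psi> (var 1)) \<oplus>\<^bsub>T\<^esub>
      \<Psi> (cst (a 2)) \<otimes>\<^bsub>T\<^esub> (\<Psi> (var 2) \<otimes>\<^bsub>T\<^esub> \<Psi> (var 2)) \<oplus>\<^bsub>T\<^esub> \<Psi> (cst (a 3)) \<otimes>\<^bsub>T\<^esub> (\<Psi> (var 3) \<otimes>\<^bsub>T\<^esub> \<Psi> (var 3))"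
    "\<Psi> H2 = \<Psi> (var 1) \<otimes>\<^bsub>T\<^esub> \<Psi> (var 1) \<oplus>\<^bsub>T\<^esub> \<Psi> (var 2) \<otimes>\<^bsub>T\<^esub> \<Psi> (var 2) \<oplus>\<^bsub>T\<^esub> \<Psi> (var 3) \<otimes>\<^bsub>T\<^esub> \<Psi> (var 3)"
    unfolding H1_def H2_def sum_1_3 by (simp_all only: add mult power2_eq_square)
qed

lemma (in abelian_group) add_minus_cancel_left:
  "x \<in> carrier G \<Longrightarrow> y \<in> carrier G \<Longrightarrow> (x \<oplus> y) \<ominus> x = y"
  by (simp add: minus_eq a_comm[of x y] a_assoc r_neg)

lemma (in cring) minus_minus_minus_cancel:
  "x \<in> carrier R \<Longrightarrow> y \<in> carrier R \<Longrightarrow> z \<in> carrier R \<Longrightarrow> (x \<ominus> z) \<ominus> (y \<ominus> z) = x \<ominus> y"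
  by algebra

lemma (in cring) inverse_mult_minus_one:
  assumes "u \<in> carrier R" "g \<in> carrier R" "v \<in> carrier R" "u \<otimes> g = \<one>"
  shows "g \<otimes> (u \<otimes> v \<ominus> \<one>) = v \<ominus> g"
proof -
  have "g \<otimes> (u \<otimes> v \<ominus> \<one>) = (u \<otimes> g) \<otimes> v \<ominus> g" using assms(1-3) by algebra
  then show ?thesis using assms by simp
qed

text \<open>Clearing denominators in an equality of two fractions gives the last hypothesis, with
  the exponents crossed over. Returning to fractions shows that a homomorphism extends to the
  localization independently of the presentation.\<close>

lemma (in cring) cancel_inverse_powers:
  assumes "x \<in> carrier R" "y \<in> carrier R" "u \<in> carrier R" "g \<in> carrier R" "u \<otimes> g = \<one>"
    and "x \<otimes> u [^] (m::nat) = y \<otimes> u [^] (n::nat)"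
  shows "x \<otimes> g [^] n = y \<otimes> g [^] m"
proof -
  have ug: "u [^] k \<otimes> g [^] k = \<one>" for k :: nat
    using assms(3-5) by (simp add: nat_pow_distrib[symmetric])
  have "x \<otimes> g [^] n = x \<otimes> (u [^] m \<otimes> g [^] m) \<otimes> g [^] n" using assms(1-4) by (simp add: ug)
  also have "\<dots> = x \<otimes> u [^] m \<otimes> g [^] m \<otimes> g [^] n" using assms(1-4) by (simp add: m_assoc)
  also have "\<dots> = y \<otimes> u [^] n \<otimes> g [^] m \<otimes> g [^] n" by (simp add: assms(6))
  also have "\<dots> = y \<otimes> g [^] m \<otimes> (u [^] n \<otimes> g [^] n)" using assms(1-4) by (simp add: m_ac)
  finally show ?thesis using assms(1-4) by (simp add: ug)
qed

lemma (in cring) r_diff_distr: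
  "x \<in> carrier R \<Longrightarrow> y \<in> carrier R \<Longrightarrow> z \<in> carrier R \<Longrightarrow> z \<otimes> (x \<ominus> y) = z \<otimes> x \<ominus> z \<otimes> y"
  by algebra

lemma (in cring) square_diff_factor:
  assumes "x \<in> carrier R" "y \<in> carrier R"
  shows "x \<otimes> x \<ominus> y \<otimes> y = (x \<oplus> y) \<otimes> (x \<ominus> y)"
  using assms by algebra

section \<open>Existence and uniqueness of p-derivations with given \<delta> x_3\<close>

context euler_setting
begin

lemma two_unit: "(2 :: 'a) dvd 1"
proof (rule unitI)
  show "\<not> \<pi> dvd 2"
  proof
    assume "\<pi> dvd 2"
    then have "p \<le> 2" using pi_dvd_of_nat[of 2] by (auto intro: dvd_imp_le)
    then have "p = 2" using prime_ge_2_nat[OF p_prime] by simp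
    with p_odd show False by simp
  qed
qed

lemma double_unit:
  assumes "u \<in> Units S" shows "u \<oplus>\<^bsub>S\<^esub> u \<in> Units S"
proof -
  have u: "u \<in> carrier S" using assms by auto
  have "kA 2 = \<one>\<^bsub>S\<^esub> \<oplus>\<^bsub>S\<^esub> \<one>\<^bsub>S\<^esub>"
    using ring_hom_add[OF kA_hom, of 1 1] ring_hom_one[OF kA_hom] by simp
  then have "u \<oplus>\<^bsub>S\<^esub> u = kA 2 \<otimes>\<^bsub>S\<^esub> u" using u by (simp add: S.l_distr)
  moreover have "kA 2 \<in> Units S" by (rule unit_poly_\<iota>[OF unit_poly_cst[OF two_unit]])
  ultimately show ?thesis using assms by simp
qed

lemma fr_hom_simps: "fr 1 = 1" "fr (x + y) = fr x + fr y" "fr (x * y) = fr x * fr y" "fr (x - y) = fr x - fr y"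
  using is_homD[OF frobenius_eq_the_p_derivation(1)] by blast+

lemma kA_fr_hom: "(\<lambda>c. kA (fr c)) \<in> ring_hom ring_of_type_algebra S"
proof -
  have "fr \<in> ring_hom ring_of_type_algebra ring_of_type_algebra"
    by (rule ring_hom_memI) (simp_all only: fr_hom_simps type_algebra_simps UNIV_I)
  from ring_hom_trans[OF this kA_hom] show ?thesis by (simp add: comp_def)
qed

lemma kA_fr: "kA (fr c) = kA c [^]\<^bsub>S\<^esub> p \<oplus>\<^bsub>S\<^esub> [p] \<cdot>\<^bsub>S\<^esub> kA (the_p_derivation p c)"
proof -
  have "emb (cst (fr c)) = emb (cst c) ^ p + of_nat p * emb (cst (the_p_derivation p c))"
    by (simp only: is_homD[OF is_hom_emb] is_homD[OF is_hom_cst] \<pi>_def)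
  then show ?thesis by (simp add: \<iota>_simps(1,2,5,6) RR_power RR_mult)
qed

lemma difference_unit:
  "\<exists>d. kA d \<otimes>\<^bsub>S\<^esub> (kA (fr (a 1)) \<ominus>\<^bsub>S\<^esub> kA (fr (a 2))) = \<one>\<^bsub>S\<^esub> \<and> d * (fr (a 1) - fr (a 2)) = 1"
proof -
  have "fr A12 dvd 1" by (rule fr_unit[OF a_units(1)])
  then obtain d where "1 = fr A12 * d" by (auto simp: dvd_def)
  then have d: "d * (fr (a 1) - fr (a 2)) = 1" by (simp only: fr_hom_simps mult.commute)
  have "kA d \<otimes>\<^bsub>S\<^esub> (kA (fr (a 1)) \<ominus>\<^bsub>S\<^esub> kA (fr (a 2))) = \<one>\<^bsub>S\<^esub>"
    unfolding kA_diff[symmetric] using ring_hom_mult[OF kA_hom, of d "fr (a 1) - fr (a 2)"]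
      ring_hom_one[OF kA_hom] by (simp only: type_algebra_simps UNIV_I d)
  with d show ?thesis by blast
qed

text \<open>The part of the notion of flow that does not mention level sets. Among these
  p-derivations the flows turn out to be cut out by an equation for \<delta> x_3 modulo p.\<close>

definition p_flow :: "('a X_hat \<Rightarrow> 'a X_hat) \<Rightarrow> bool"
  where "p_flow \<delta> \<longleftrightarrow> compatible_p_derivation p a \<delta> \<and>
    \<delta> (in_Xhat p a (H1 a)) = \<zero>\<^bsub>S\<^esub> \<and> \<delta> (in_Xhat p a H2) = \<zero>\<^bsub>S\<^esub>"

lemma p_flow_exists:
  assumes f: "f \<in> carrier S"
  shows "\<exists>\<delta>. p_flow \<delta> \<and> \<delta> (in_Xhat p a (var 3)) = f"
proof -
  define x where "x i = \<iota> (emb (var i))" for i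
  define A where "A i = kA (fr (a i))" for i
  have xc [simp]: "x i \<in> carrier S" and Ac [simp]: "A i \<in> carrier S" for i
    by (simp_all add: x_def A_def \<iota>_simps)
  \<comment> \<open>The value that \<phi>(x_3) must take.\<close>
  define y3 where "y3 = x 3 [^]\<^bsub>S\<^esub> p \<oplus>\<^bsub>S\<^esub> [p] \<cdot>\<^bsub>S\<^esub> f"
  define h1 where "h1 = \<iota> (emb (H1 a)) [^]\<^bsub>S\<^esub> p"
  define h2 where "h2 = \<iota> (emb H2) [^]\<^bsub>S\<^esub> p"
  have [simp]: "y3 \<in> carrier S" "h1 \<in> carrier S" "h2 \<in> carrier S"
    using f by (simp_all add: y3_def h1_def h2_def \<iota>_simps)
  obtain d where d: "kA d \<otimes>\<^bsub>S\<^esub> (A 1 \<ominus>\<^bsub>S\<^esub> A 2) = \<one>\<^bsub>S\<^esub>" "d * (fr (a 1) - fr (a 2)) = 1"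
    using difference_unit unfolding A_def by blast
  define e where "e = kA d"
  have "e \<in> carrier S" by (simp add: e_def \<iota>_simps)
  note e = this d(1)[folded e_def] e_def d(2)
  \<comment> \<open>\<open>w\<close> is the future \<phi>(x_3)^2 and \<open>w0\<close> is x_3^{2p},
    to which it is congruent. The solutions \<open>Y1\<close> and \<open>Y2\<close> are functions of
    this parameter because \<open>mod_p_poly\<close> only describes them at
    \<open>w0\<close>.\<close>
  define w where "w = y3 \<otimes>\<^bsub>S\<^esub> y3"
  define w0 where "w0 = x 3 [^]\<^bsub>S\<^esub> p \<otimes>\<^bsub>S\<^esub> x 3 [^]\<^bsub>S\<^esub> p"
  have [simp]: "w \<in> carrier S" "w0 \<in> carrier S" by (simp_all add: w_def w0_def)
  have y3: "y3 \<ominus>\<^bsub>S\<^esub> x 3 [^]\<^bsub>S\<^esub> p \<in> multiples S p"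
  proof -
    have "y3 \<ominus>\<^bsub>S\<^esub> x 3 [^]\<^bsub>S\<^esub> p = [p] \<cdot>\<^bsub>S\<^esub> f"
      using f by (simp add: y3_def S.add_minus_cancel_left)
    then show ?thesis using f by auto
  qed
  then have w: "w \<ominus>\<^bsub>S\<^esub> w0 \<in> multiples S p"
    unfolding w_def w0_def by (intro S.multiples_cong_mult) simp_all
  define Y1 where "Y1 = (\<lambda>w. e \<otimes>\<^bsub>S\<^esub> ((A 2 \<ominus>\<^bsub>S\<^esub> A 3) \<otimes>\<^bsub>S\<^esub> w \<oplus>\<^bsub>S\<^esub> h1 \<ominus>\<^bsub>S\<^esub> A 2 \<otimes>\<^bsub>S\<^esub> h2))"
  define Y2 where "Y2 = (\<lambda>w. e \<otimes>\<^bsub>S\<^esub> ((A 3 \<ominus>\<^bsub>S\<^esub> A 1) \<otimes>\<^bsub>S\<^esub> w \<ominus>\<^bsub>S\<^esub> h1 \<oplus>\<^bsub>S\<^esub> A 1 \<otimes>\<^bsub>S\<^esub> h2))"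
  have Yc [simp]: "Y1 u \<in> carrier S" "Y2 u \<in> carrier S" if "u \<in> carrier S" for u
    using that e(1) by (simp_all add: Y1_def Y2_def)
  have Ycong: "Y1 w \<ominus>\<^bsub>S\<^esub> Y1 w0 \<in> multiples S p" "Y2 w \<ominus>\<^bsub>S\<^esub> Y2 w0 \<in> multiples S p"
    unfolding Y1_def Y2_def using w e(1)
    by (intro S.multiples_cong_mult S.multiples_cong_add S.multiples_cong_minus; simp)+
  define P1 where "P1 = cst (fr (a 2) - fr (a 3)) * var 3 ^ (2 * p) + H1 a ^ p - cst (fr (a 2)) * H2 ^ p"
  define P2 where "P2 = cst (fr (a 3) - fr (a 1)) * var 3 ^ (2 * p) - H1 a ^ p + cst (fr (a 1)) * H2 ^ p"
  have pw: "u ^ (2 * p) = u ^ p * u ^ p" for u :: "'a poly poly poly" by (simp add: power_add[symmetric] mult_2)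
  have Y0: "Y1 w0 = \<iota> (emb (cst d * P1))" "Y2 w0 = \<iota> (emb (cst d * P2))"
    unfolding Y1_def Y2_def P1_def P2_def pw w0_def h1_def h2_def x_def A_def e(3) kA_diff[symmetric]
    by (simp_all only: is_homD[OF is_hom_emb] \<iota>_simps RR_mult RR_add RR_diff RR_power emb_RR)
  have cd: "cst d * cst (fr (a 1) - fr (a 2)) = (1 :: 'a poly poly poly)"
    by (simp only: is_homD(3)[OF is_hom_cst, symmetric] e(4) is_homD(1)[OF is_hom_cst])
  have P: "of_nat p dvd cst d * P1 - var 1 ^ p * var 1 ^ p" "of_nat p dvd cst d * P2 - var 2 ^ p * var 2 ^ p"
  proof -
    have *: "cst d * (P - cst (fr (a 1) - fr (a 2)) * u) = cst d * P - u" for P u :: "'a poly poly poly"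
      by (simp only: right_diff_distrib cd mult.assoc[symmetric] mult_1)
    show "of_nat p dvd cst d * P1 - var 1 ^ p * var 1 ^ p" "of_nat p dvd cst d * P2 - var 2 ^ p * var 2 ^ p"
      using dvd_mult[OF mod_p_poly(1), of "cst d"] dvd_mult[OF mod_p_poly(2), of "cst d"]
      unfolding * P1_def P2_def pw by blast+
  qed
  have sq: "x i [^]\<^bsub>S\<^esub> p \<otimes>\<^bsub>S\<^esub> x i [^]\<^bsub>S\<^esub> p \<ominus>\<^bsub>S\<^esub> Y \<in> multiples S p"
    if "Y \<ominus>\<^bsub>S\<^esub> \<iota> (emb P) \<in> multiples S p" "of_nat p dvd P - var i ^ p * var i ^ p" "Y \<in> carrier S" for i Y P
  proof -
    have "\<iota> (emb (P - var i ^ p * var i ^ p)) \<in> multiples S p"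
      by (intro \<iota>_multiples emb_dvd that)
    moreover have "\<iota> (emb (P - var i ^ p * var i ^ p)) = \<iota> (emb P) \<ominus>\<^bsub>S\<^esub> x i [^]\<^bsub>S\<^esub> p \<otimes>\<^bsub>S\<^esub> x i [^]\<^bsub>S\<^esub> p"
      unfolding x_def by (simp only: is_homD[OF is_hom_emb] \<iota>_simps RR_mult RR_power emb_RR)
    ultimately have "Y \<ominus>\<^bsub>S\<^esub> x i [^]\<^bsub>S\<^esub> p \<otimes>\<^bsub>S\<^esub> x i [^]\<^bsub>S\<^esub> p \<in> multiples S p"
      using that S.multiples_minus_trans[OF that(1), of "x i [^]\<^bsub>S\<^esub> p \<otimes>\<^bsub>S\<^esub> x i [^]\<^bsub>S\<^esub> p"] by (simp add: \<iota>_simps)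
    then show ?thesis by (rule S.multiples_minus_commute) (simp_all add: that)
  qed
  have unit: "x i [^]\<^bsub>S\<^esub> p \<oplus>\<^bsub>S\<^esub> x i [^]\<^bsub>S\<^esub> p \<in> Units S" if "i = 1 \<or> i = 2" for i
    using that unit_poly_\<iota>[OF unit_polys(1)] unit_poly_\<iota>[OF unit_polys(2)]
    by (intro double_unit S.Units_pow_closed) (auto simp: x_def)
  \<comment> \<open>The root congruent to x_1^p is taken, and below the one congruent to x_2^p,
    since \<phi> has to lift the Frobenius.\<close>
  obtain z1 where z1: "z1 \<in> carrier S" "z1 \<otimes>\<^bsub>S\<^esub> z1 = Y1 w" "z1 \<ominus>\<^bsub>S\<^esub> x 1 [^]\<^bsub>S\<^esub> p \<in> multiples S p"
    using S.sqrt_lift[OF _ _ unit[of 1] sq[OF Ycong(1)[unfolded Y0] P(1)]] by auto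
  obtain z2 where z2: "z2 \<in> carrier S" "z2 \<otimes>\<^bsub>S\<^esub> z2 = Y2 w" "z2 \<ominus>\<^bsub>S\<^esub> x 2 [^]\<^bsub>S\<^esub> p \<in> multiples S p"
    using S.sqrt_lift[OF _ _ unit[of 2] sq[OF Ycong(2)[unfolded Y0] P(2)]] by auto
  obtain H where H: "H \<in> ring_hom ring_of_type_algebra S" "\<And>c. H (cst c) = kA (fr c)"
      "H (var 1) = z1" "H (var 2) = z2" "H (var 3) = y3"
    using poly3_extend_hom[OF S.is_cring kA_fr_hom z1(1) z2(1), of y3] by auto
  have Hc [simp]: "H f \<in> carrier S" for f using ring_hom_closed[OF H(1)] by simp
  have H_add: "H (f + g) = H f \<oplus>\<^bsub>S\<^esub> H g" and H_mult: "H (f * g) = H f \<otimes>\<^bsub>S\<^esub> H g" for f g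
    using ring_hom_add[OF H(1), of f g] ring_hom_mult[OF H(1), of f g] by simp_all
  have H_pow: "H (f ^ n) = H f [^]\<^bsub>S\<^esub> n" for f n
    by (induction n) (use ring_hom_one[OF H(1)] H_mult in \<open>simp_all add: S.m_comm\<close>)
  have H_H: "H (H1 a) = h1" "H H2 = h2"
    using S.linear_system_solution[OF Ac Ac Ac e(1), of w h1 h2 1 2 3] e(2)
    unfolding poly_hom_H[OF S.is_cring H(1)] H z1(2) z2(2) w_def[symmetric] A_def[symmetric] Y1_def Y2_def
    by simp_all
  \<comment> \<open>The Frobenius congruence is compatible with products and, by the binomial
    theorem modulo p, with sums; so it is enough to know it on generators.\<close>
  have H_frob: "H f \<ominus>\<^bsub>S\<^esub> \<iota> (emb f) [^]\<^bsub>S\<^esub> p \<in> multiples S p" for f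
  proof (induction f rule: poly3_induct)
    case (cst c)
    have "kA (fr c) \<ominus>\<^bsub>S\<^esub> kA c [^]\<^bsub>S\<^esub> p = [p] \<cdot>\<^bsub>S\<^esub> kA (the_p_derivation p c)"
      unfolding kA_fr by (simp add: S.add_minus_cancel_left \<iota>_simps)
    then show ?case unfolding H by (auto simp: \<iota>_simps)
  next
    case (var i)
    have "H (var (Suc 0)) = z1" using H(3) by simp
    then show ?case using var z1 z2 y3 by (auto simp: H x_def)
  next
    case (add f g)
    have "\<iota> ((emb f + emb g) ^ p - (emb f ^ p + emb g ^ p)) \<in> multiples S p"
      by (intro \<iota>_multiples RR_freshman emb_RR)
    then have "\<iota> (emb (f + g)) [^]\<^bsub>S\<^esub> p \<ominus>\<^bsub>S\<^esub> (\<iota> (emb f) [^]\<^bsub>S\<^esub> p \<oplus>\<^bsub>S\<^esub> \<iota> (emb g) [^]\<^bsub>S\<^esub> p) \<in> multiples S p"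
      by (simp only: is_homD[OF is_hom_emb] \<iota>_simps RR_power RR_add emb_RR)
    then have 1: "(\<iota> (emb f) [^]\<^bsub>S\<^esub> p \<oplus>\<^bsub>S\<^esub> \<iota> (emb g) [^]\<^bsub>S\<^esub> p) \<ominus>\<^bsub>S\<^esub> \<iota> (emb (f + g)) [^]\<^bsub>S\<^esub> p \<in> multiples S p"
      by (rule S.multiples_minus_commute) (simp_all add: \<iota>_simps)
    have 2: "H (f + g) \<ominus>\<^bsub>S\<^esub> (\<iota> (emb f) [^]\<^bsub>S\<^esub> p \<oplus>\<^bsub>S\<^esub> \<iota> (emb g) [^]\<^bsub>S\<^esub> p) \<in> multiples S p"
      unfolding H_add using add by (intro S.multiples_cong_add) (simp_all add: \<iota>_simps)
    show ?case by (rule S.multiples_minus_trans[OF 2 1]) (simp_all add: \<iota>_simps)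
  next
    case (mult f g)
    have "\<iota> (emb (f * g)) [^]\<^bsub>S\<^esub> p = \<iota> (emb f) [^]\<^bsub>S\<^esub> p \<otimes>\<^bsub>S\<^esub> \<iota> (emb g) [^]\<^bsub>S\<^esub> p"
      by (simp add: is_homD[OF is_hom_emb] \<iota>_simps S.nat_pow_distrib)
    then show ?case unfolding H_mult using mult by (auto intro!: S.multiples_cong_mult simp: \<iota>_simps)
  qed
  \<comment> \<open>Modulo p the inverse of \<phi>(Q) must be (1/Q)^p; completeness then makes
    \<phi>(Q) a unit.\<close>
  define v where "v = \<iota> Qinv [^]\<^bsub>S\<^esub> p"
  have v [simp]: "v \<in> carrier S" by (simp add: v_def \<iota>_simps)
  have HQv: "H Q \<otimes>\<^bsub>S\<^esub> v \<ominus>\<^bsub>S\<^esub> \<one>\<^bsub>S\<^esub> \<in> multiples S p"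
  proof -
    have "\<iota> (emb Q) [^]\<^bsub>S\<^esub> p \<otimes>\<^bsub>S\<^esub> v = \<one>\<^bsub>S\<^esub>"
      unfolding v_def by (simp add: \<iota>_simps(3,5)[symmetric] RR_power emb_Q_Qinv_power \<iota>_simps(8))
    moreover have "H Q \<otimes>\<^bsub>S\<^esub> v \<ominus>\<^bsub>S\<^esub> \<iota> (emb Q) [^]\<^bsub>S\<^esub> p \<otimes>\<^bsub>S\<^esub> v \<in> multiples S p"
      using H_frob by (intro S.multiples_cong_mult) (simp_all add: \<iota>_simps)
    ultimately show ?thesis by simp
  qed
  then have HQ: "H Q \<in> Units S" by (intro S.Units_lift[of _ v]) simp_all
  define g where "g = inv\<^bsub>S\<^esub> H Q"
  have g [simp]: "g \<in> carrier S" "H Q \<otimes>\<^bsub>S\<^esub> g = \<one>\<^bsub>S\<^esub>" using HQ by (simp_all add: g_def)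
  have gv: "g \<ominus>\<^bsub>S\<^esub> v \<in> multiples S p"
  proof -
    have "g \<ominus>\<^bsub>S\<^esub> v = \<ominus>\<^bsub>S\<^esub> (g \<otimes>\<^bsub>S\<^esub> (H Q \<otimes>\<^bsub>S\<^esub> v \<ominus>\<^bsub>S\<^esub> \<one>\<^bsub>S\<^esub>))"
    proof -
      have "g \<otimes>\<^bsub>S\<^esub> (H Q \<otimes>\<^bsub>S\<^esub> v \<ominus>\<^bsub>S\<^esub> \<one>\<^bsub>S\<^esub>) = v \<ominus>\<^bsub>S\<^esub> g"
        by (rule S.inverse_mult_minus_one) simp_all
      then show ?thesis by (simp add: S.minus_eq S.minus_add S.a_ac)
    qed
    then show ?thesis using HQv by (simp add: S.multiples_neg S.multiples_mult_left)
  qed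
  \<comment> \<open>Extension to fractions f/Q^n, with g the inverse of \<phi>(Q).\<close>
  define \<psi> where "\<psi> r = (THE s. \<forall>f n. r = emb f * Qinv ^ n \<longrightarrow> s = H f \<otimes>\<^bsub>S\<^esub> g [^]\<^bsub>S\<^esub> n)" for r
  have \<psi>: "\<psi> (emb f * Qinv ^ n) = H f \<otimes>\<^bsub>S\<^esub> g [^]\<^bsub>S\<^esub> n" for f n
    unfolding \<psi>_def
  proof (rule the_equality)
    show "\<forall>f' m. emb f * Qinv ^ n = emb f' * Qinv ^ m \<longrightarrow> H f \<otimes>\<^bsub>S\<^esub> g [^]\<^bsub>S\<^esub> n = H f' \<otimes>\<^bsub>S\<^esub> g [^]\<^bsub>S\<^esub> m"
    proof (intro allI impI)
      fix f' m assume eq: "emb f * Qinv ^ n = emb f' * Qinv ^ m"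
      have "emb (f * Q ^ m) = (emb f * Qinv ^ n) * (emb Q ^ n * emb Q ^ m)"
      proof -
        have "(emb f * Qinv ^ n) * (emb Q ^ n * emb Q ^ m) = emb f * emb Q ^ m * (emb Q ^ n * Qinv ^ n)"
          by (simp only: ac_simps)
        then show ?thesis by (simp add: is_homD[OF is_hom_emb] emb_Q_Qinv_power)
      qed
      also have "\<dots> = (emb f' * Qinv ^ m) * (emb Q ^ n * emb Q ^ m)" by (simp add: eq)
      also have "\<dots> = emb (f' * Q ^ n)"
      proof -
        have "(emb f' * Qinv ^ m) * (emb Q ^ n * emb Q ^ m) = emb f' * emb Q ^ n * (emb Q ^ m * Qinv ^ m)"
          by (simp only: ac_simps)
        then show ?thesis by (simp add: is_homD[OF is_hom_emb] emb_Q_Qinv_power)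
      qed
      finally have "f * Q ^ m = f' * Q ^ n" by (simp add: emb_eq_iff)
      then have "H f \<otimes>\<^bsub>S\<^esub> H Q [^]\<^bsub>S\<^esub> m = H f' \<otimes>\<^bsub>S\<^esub> H Q [^]\<^bsub>S\<^esub> n" by (metis H_mult H_pow)
      then show "H f \<otimes>\<^bsub>S\<^esub> g [^]\<^bsub>S\<^esub> n = H f' \<otimes>\<^bsub>S\<^esub> g [^]\<^bsub>S\<^esub> m"
        by (rule S.cancel_inverse_powers[OF Hc Hc Hc g])
    qed
  qed blast
  have \<psi>_emb: "\<psi> (emb f) = H f" for f using \<psi>[of f 0] by simp
  have \<psi>_hom: "\<psi> \<in> ring_hom R S"
  proof (rule ring_hom_memI)
    fix r s assume "r \<in> carrier R" "s \<in> carrier R"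
    then obtain f m f' n where rs: "r = emb f * Qinv ^ m" "s = emb f' * Qinv ^ n" by (auto simp: RR_eq)
    have Qg: "H Q [^]\<^bsub>S\<^esub> k \<otimes>\<^bsub>S\<^esub> g [^]\<^bsub>S\<^esub> k = \<one>\<^bsub>S\<^esub>" for k :: nat
      by (simp add: S.nat_pow_distrib[symmetric])
    show "\<psi> r \<in> carrier S" by (simp add: rs \<psi>)
    have "r * s = emb (f * f') * Qinv ^ (m + n)"
      unfolding rs by (simp add: is_homD[OF is_hom_emb] power_add algebra_simps)
    then have "\<psi> (r * s) = H (f * f') \<otimes>\<^bsub>S\<^esub> g [^]\<^bsub>S\<^esub> (m + n)" by (simp only: \<psi>)
    then show "\<psi> (r \<otimes>\<^bsub>R\<^esub> s) = \<psi> r \<otimes>\<^bsub>S\<^esub> \<psi> s"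
      by (simp add: rs \<psi> H_mult S.nat_pow_mult[symmetric] S.m_ac)
    have "r + s = emb (f * Q ^ n + f' * Q ^ m) * Qinv ^ (m + n)"
    proof -
      have "emb (f * Q ^ n + f' * Q ^ m) * Qinv ^ (m + n) =
          emb f * Qinv ^ m * (emb Q ^ n * Qinv ^ n) + emb f' * Qinv ^ n * (emb Q ^ m * Qinv ^ m)"
        by (simp add: is_homD[OF is_hom_emb] power_add algebra_simps)
      then show ?thesis by (simp add: emb_Q_Qinv_power rs)
    qed
    then have "\<psi> (r + s) = H (f * Q ^ n + f' * Q ^ m) \<otimes>\<^bsub>S\<^esub> g [^]\<^bsub>S\<^esub> (m + n)" by (simp only: \<psi>)
    also have "\<dots> = H f \<otimes>\<^bsub>S\<^esub> g [^]\<^bsub>S\<^esub> m \<otimes>\<^bsub>S\<^esub> (H Q [^]\<^bsub>S\<^esub> n \<otimes>\<^bsub>S\<^esub> g [^]\<^bsub>S\<^esub> n) \<oplus>\<^bsub>S\<^esub>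
        H f' \<otimes>\<^bsub>S\<^esub> g [^]\<^bsub>S\<^esub> n \<otimes>\<^bsub>S\<^esub> (H Q [^]\<^bsub>S\<^esub> m \<otimes>\<^bsub>S\<^esub> g [^]\<^bsub>S\<^esub> m)"
      by (simp add: H_add H_mult H_pow S.nat_pow_mult[symmetric] S.l_distr S.r_distr S.m_ac)
    finally show "\<psi> (r \<oplus>\<^bsub>R\<^esub> s) = \<psi> r \<oplus>\<^bsub>S\<^esub> \<psi> s"
      by (simp add: Qg rs \<psi>)
  next
    show "\<psi> \<one>\<^bsub>R\<^esub> = \<one>\<^bsub>S\<^esub>"
      using \<psi>_emb[of 1] ring_hom_one[OF H(1)] by (simp add: is_homD[OF is_hom_emb])
  qed
  obtain \<phi> where \<phi>: "\<phi> \<in> ring_hom S S" "\<And>r. r \<in> RR \<Longrightarrow> \<phi> (\<iota> r) = \<psi> r"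
    using completion_extend[OF R_cring S_padic \<psi>_hom] by (auto simp: S_eq)
  have \<phi>_emb: "\<phi> (\<iota> (emb f)) = H f" for f by (simp add: \<phi> \<psi>_emb)
  have \<phi>c [simp]: "\<phi> u \<in> carrier S" if "u \<in> carrier S" for u using ring_hom_closed[OF \<phi>(1) that] .
  have frob_RR: "\<psi> r \<ominus>\<^bsub>S\<^esub> \<iota> r [^]\<^bsub>S\<^esub> p \<in> multiples S p" if "r \<in> RR" for r
  proof -
    obtain f n where r: "r = emb f * Qinv ^ n" using \<open>r \<in> RR\<close> by (auto simp: RR_eq)
    have "\<iota> r [^]\<^bsub>S\<^esub> p = \<iota> (emb f) [^]\<^bsub>S\<^esub> p \<otimes>\<^bsub>S\<^esub> v [^]\<^bsub>S\<^esub> n"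
      unfolding r v_def by (simp add: \<iota>_simps RR_power S.nat_pow_distrib S.nat_pow_pow mult.commute)
    then show ?thesis
      unfolding r \<psi> using H_frob[of f] gv
      by (simp add: r[symmetric] S.multiples_cong_mult S.multiples_cong_pow \<iota>_simps)
  qed
  have frob: "\<phi> u \<ominus>\<^bsub>S\<^esub> u [^]\<^bsub>S\<^esub> p \<in> multiples S p" if u: "u \<in> carrier S" for u
  proof -
    obtain r where r: "r \<in> RR" "u \<ominus>\<^bsub>S\<^esub> \<iota> r \<in> multiples S (p ^ 1)" using S_approx[OF u, of 1] by blast
    then have ur: "u \<ominus>\<^bsub>S\<^esub> \<iota> r \<in> multiples S p" by simp
    have rc: "\<iota> r \<in> carrier S" using r by (simp add: \<iota>_simps)
    have 1: "\<phi> u \<ominus>\<^bsub>S\<^esub> \<phi> (\<iota> r) \<in> multiples S p"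
      using ring_hom_simps(5)[OF S.ring_axioms S.ring_axioms \<phi>(1) ur]
        ring_hom_simps(2)[OF S.ring_axioms S.ring_axioms \<phi>(1) u rc] by simp
    have 2: "\<phi> (\<iota> r) \<ominus>\<^bsub>S\<^esub> \<iota> r [^]\<^bsub>S\<^esub> p \<in> multiples S p" using frob_RR r \<phi> by simp
    have "u [^]\<^bsub>S\<^esub> p \<ominus>\<^bsub>S\<^esub> \<iota> r [^]\<^bsub>S\<^esub> p \<in> multiples S p" using ur u rc by (rule S.multiples_cong_pow)
    from this have 3: "\<iota> r [^]\<^bsub>S\<^esub> p \<ominus>\<^bsub>S\<^esub> u [^]\<^bsub>S\<^esub> p \<in> multiples S p"
      by (rule S.multiples_minus_commute) (use u rc in auto)
    have 4: "\<phi> u \<ominus>\<^bsub>S\<^esub> \<iota> r [^]\<^bsub>S\<^esub> p \<in> multiples S p"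
      by (rule S.multiples_minus_trans[OF 1 2]) (use u rc in simp_all)
    show ?thesis by (rule S.multiples_minus_trans[OF 4 3]) (use u rc in simp_all)
  qed
  \<comment> \<open>The quotient of \<phi> u - u^p by p. It is unique because the ring has no
    p-torsion, which is how \<open>\<delta>_eqI\<close> identifies its values.\<close>
  define \<delta> where "\<delta> = (\<lambda>u\<in>carrier S. SOME s. s \<in> carrier S \<and> \<phi> u \<ominus>\<^bsub>S\<^esub> u [^]\<^bsub>S\<^esub> p = [p] \<cdot>\<^bsub>S\<^esub> s)"
  have \<delta>: "\<delta> u \<in> carrier S" "\<phi> u \<ominus>\<^bsub>S\<^esub> u [^]\<^bsub>S\<^esub> p = [p] \<cdot>\<^bsub>S\<^esub> \<delta> u" if "u \<in> carrier S" for u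
  proof -
    have "\<exists>s. s \<in> carrier S \<and> \<phi> u \<ominus>\<^bsub>S\<^esub> u [^]\<^bsub>S\<^esub> p = [p] \<cdot>\<^bsub>S\<^esub> s"
      using frob[OF that] by (auto simp: multiples_def)
    from someI_ex[OF this] show "\<delta> u \<in> carrier S" "\<phi> u \<ominus>\<^bsub>S\<^esub> u [^]\<^bsub>S\<^esub> p = [p] \<cdot>\<^bsub>S\<^esub> \<delta> u"
      using that by (simp_all add: \<delta>_def)
  qed
  have \<phi>\<delta>: "frob p S \<delta> u = \<phi> u" if "u \<in> carrier S" for u
    unfolding frob_def \<delta>(2)[OF that, symmetric] using that by simp
  have \<delta>_eqI: "\<delta> u = s" if "u \<in> carrier S" "s \<in> carrier S" "\<phi> u = u [^]\<^bsub>S\<^esub> p \<oplus>\<^bsub>S\<^esub> [p] \<cdot>\<^bsub>S\<^esub> s" for u s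
  proof (rule S_cancel)
    show "[p] \<cdot>\<^bsub>S\<^esub> \<delta> u = [p] \<cdot>\<^bsub>S\<^esub> s"
      unfolding \<delta>(2)[OF that(1), symmetric] that(3) using that(1,2)
      by (simp add: S.add_minus_cancel_left)
  qed (use that \<delta> in auto)
  have "frob p S \<delta> \<in> ring_hom S S"
    using ring_hom_add[OF \<phi>(1)] ring_hom_mult[OF \<phi>(1)] ring_hom_one[OF \<phi>(1)]
    by (intro ring_hom_memI) (simp_all add: \<phi>\<delta>)
  moreover have "\<delta> \<in> carrier S \<rightarrow>\<^sub>E carrier S"
    by (rule PiE_I) (use \<delta>(1) in \<open>auto simp: \<delta>_def\<close>)
  moreover have "\<delta> (kA s) = kA (the_p_derivation p s)" for s
    by (rule \<delta>_eqI) (simp_all only: \<phi>_emb H(2) kA_fr \<iota>_simps emb_RR)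
  moreover have "\<delta> (\<iota> (emb (H1 a))) = \<zero>\<^bsub>S\<^esub>" "\<delta> (\<iota> (emb H2)) = \<zero>\<^bsub>S\<^esub>"
    by (rule \<delta>_eqI; simp add: \<phi>_emb H_H h1_def h2_def \<iota>_simps)+
  moreover have "\<delta> (\<iota> X3) = f"
    by (rule \<delta>_eqI) (simp_all add: \<phi>_emb H y3_def x_def \<iota>_simps f)
  ultimately show ?thesis
    by (intro exI[of _ \<delta>]) (simp add: p_flow_def compatible_p_derivation_def p_derivation_def in_Xhat_eq)
qed

lemma p_flowD:
  assumes "p_flow \<delta>"
  shows "frob p S \<delta> \<in> ring_hom S S" "u \<in> carrier S \<Longrightarrow> \<delta> u \<in> carrier S"
    "frob p S \<delta> (kA c) = kA (fr c)"
    "frob p S \<delta> (\<iota> (emb (H1 a))) = \<iota> (emb (H1 a)) [^]\<^bsub>S\<^esub> p"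
    "frob p S \<delta> (\<iota> (emb H2)) = \<iota> (emb H2) [^]\<^bsub>S\<^esub> p"
    "u \<in> carrier S \<Longrightarrow> frob p S \<delta> u \<ominus>\<^bsub>S\<^esub> u [^]\<^bsub>S\<^esub> p = [p] \<cdot>\<^bsub>S\<^esub> \<delta> u"
proof -
  have d: "p_derivation p S \<delta>" "\<And>s. \<delta> (kA s) = kA (the_p_derivation p s)"
    "\<delta> (\<iota> (emb (H1 a))) = \<zero>\<^bsub>S\<^esub>" "\<delta> (\<iota> (emb H2)) = \<zero>\<^bsub>S\<^esub>"
    using assms by (auto simp: p_flow_def compatible_p_derivation_def in_Xhat_eq)
  show "frob p S \<delta> \<in> ring_hom S S" and c: "\<And>u. u \<in> carrier S \<Longrightarrow> \<delta> u \<in> carrier S"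
    using d(1) by (auto simp: p_derivation_def)
  show "frob p S \<delta> (kA c) = kA (fr c)" unfolding frob_def d(2) kA_fr ..
  show "frob p S \<delta> (\<iota> (emb (H1 a))) = \<iota> (emb (H1 a)) [^]\<^bsub>S\<^esub> p" "frob p S \<delta> (\<iota> (emb H2)) = \<iota> (emb H2) [^]\<^bsub>S\<^esub> p"
    by (simp_all add: frob_def d \<iota>_simps)
  show "u \<in> carrier S \<Longrightarrow> frob p S \<delta> u \<ominus>\<^bsub>S\<^esub> u [^]\<^bsub>S\<^esub> p = [p] \<cdot>\<^bsub>S\<^esub> \<delta> u"
    using c by (simp add: frob_def S.add_minus_cancel_left)
qed

text \<open>The squares of \<phi>(x_1) and \<phi>(x_2) are determined by that of \<phi>(x_3), and
  their roots are pinned down by being congruent to x_1^p and x_2^p, which are units.\<close>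

lemma p_flow_unique:
  assumes \<delta>: "p_flow \<delta>" and \<delta>': "p_flow \<delta>'"
    and x3: "\<delta> (in_Xhat p a (var 3)) \<ominus>\<^bsub>S\<^esub> \<delta>' (in_Xhat p a (var 3)) \<in> multiples S p"
    and K: "K \<in> carrier S"
  shows "\<delta> K \<ominus>\<^bsub>S\<^esub> \<delta>' K \<in> multiples S p"
proof -
  define \<phi> where "\<phi> = frob p S \<delta>"
  define \<phi>' where "\<phi>' = frob p S \<delta>'"
  note d = p_flowD[OF \<delta>, folded \<phi>_def] and d' = p_flowD[OF \<delta>', folded \<phi>'_def]
  have c [simp]: "\<phi> u \<in> carrier S" "\<phi>' u \<in> carrier S" if "u \<in> carrier S" for u
    using ring_hom_closed[OF d(1) that] ring_hom_closed[OF d'(1) that] by auto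
  have ic [simp]: "\<iota> u \<in> carrier S" if "u \<in> RR" for u using that by (rule \<iota>_simps)
  have diff: "\<phi> u \<ominus>\<^bsub>S\<^esub> \<phi>' u = [p] \<cdot>\<^bsub>S\<^esub> (\<delta> u \<ominus>\<^bsub>S\<^esub> \<delta>' u)" if "u \<in> carrier S" for u
  proof -
    have "\<phi> u \<ominus>\<^bsub>S\<^esub> \<phi>' u = (\<phi> u \<ominus>\<^bsub>S\<^esub> u [^]\<^bsub>S\<^esub> p) \<ominus>\<^bsub>S\<^esub> (\<phi>' u \<ominus>\<^bsub>S\<^esub> u [^]\<^bsub>S\<^esub> p)"
      using that by (simp add: S.minus_minus_minus_cancel)
    then show ?thesis using that d(2)[OF that] d'(2)[OF that] by (simp add: d(6) d'(6) S.add_pow_minus)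
  qed
  \<comment> \<open>As the Frobenius lifts differ by p times the difference of the p-derivations,
    the claim is a congruence of ring homomorphisms modulo p^2, and this can be checked on
    generators.\<close>
  define P where "P u \<longleftrightarrow> \<phi> u \<ominus>\<^bsub>S\<^esub> \<phi>' u \<in> multiples S (p ^ 2)" for u
  define x where "x i = \<iota> (emb (var i))" for i
  have x [simp]: "x i \<in> carrier S" for i by (simp add: x_def)
  have P3: "P (x 3)"
  proof -
    obtain s where s: "s \<in> carrier S" "\<delta> (x 3) \<ominus>\<^bsub>S\<^esub> \<delta>' (x 3) = [p] \<cdot>\<^bsub>S\<^esub> s"
      using x3 by (auto simp: multiples_def in_Xhat_eq x_def)
    then have "\<phi> (x 3) \<ominus>\<^bsub>S\<^esub> \<phi>' (x 3) = [(p ^ 2)] \<cdot>\<^bsub>S\<^esub> s"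
      by (simp add: diff S.add.nat_pow_pow power2_eq_square)
    then show ?thesis using s by (auto simp: P_def)
  qed
  define A where "A i = kA (fr (a i))" for i
  define h1 where "h1 = \<iota> (emb (H1 a)) [^]\<^bsub>S\<^esub> p"
  define h2 where "h2 = \<iota> (emb H2) [^]\<^bsub>S\<^esub> p"
  have [simp]: "A i \<in> carrier S" "h1 \<in> carrier S" "h2 \<in> carrier S" for i
    by (simp_all add: A_def h1_def h2_def)
  have system: "A 1 \<otimes>\<^bsub>S\<^esub> (f (x 1) \<otimes>\<^bsub>S\<^esub> f (x 1)) \<oplus>\<^bsub>S\<^esub> A 2 \<otimes>\<^bsub>S\<^esub> (f (x 2) \<otimes>\<^bsub>S\<^esub> f (x 2)) \<oplus>\<^bsub>S\<^esub> A 3 \<otimes>\<^bsub>S\<^esub> (f (x 3) \<otimes>\<^bsub>S\<^esub> f (x 3)) = h1"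
      "f (x 1) \<otimes>\<^bsub>S\<^esub> f (x 1) \<oplus>\<^bsub>S\<^esub> f (x 2) \<otimes>\<^bsub>S\<^esub> f (x 2) \<oplus>\<^bsub>S\<^esub> f (x 3) \<otimes>\<^bsub>S\<^esub> f (x 3) = h2"
    if "f \<in> ring_hom S S" "\<And>c. f (kA c) = kA (fr c)" "f (\<iota> (emb (H1 a))) = \<iota> (emb (H1 a)) [^]\<^bsub>S\<^esub> p"
      "f (\<iota> (emb H2)) = \<iota> (emb H2) [^]\<^bsub>S\<^esub> p" for f
  proof -
    have "(\<lambda>g. f (\<iota> (emb g))) \<in> ring_hom ring_of_type_algebra S"
      using ring_hom_closed[OF that(1)] ring_hom_add[OF that(1)] ring_hom_mult[OF that(1)] ring_hom_one[OF that(1)]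
      by (intro ring_hom_memI) (simp_all add: is_homD[OF is_hom_emb] \<iota>_simps)
    note H = poly_hom_H(1)[OF S.is_cring this, of a, unfolded that, folded A_def x_def h1_def]
      poly_hom_H(2)[OF S.is_cring this, unfolded that, folded x_def h2_def]
    show "A 1 \<otimes>\<^bsub>S\<^esub> (f (x 1) \<otimes>\<^bsub>S\<^esub> f (x 1)) \<oplus>\<^bsub>S\<^esub> A 2 \<otimes>\<^bsub>S\<^esub> (f (x 2) \<otimes>\<^bsub>S\<^esub> f (x 2)) \<oplus>\<^bsub>S\<^esub> A 3 \<otimes>\<^bsub>S\<^esub> (f (x 3) \<otimes>\<^bsub>S\<^esub> f (x 3)) = h1"
      "f (x 1) \<otimes>\<^bsub>S\<^esub> f (x 1) \<oplus>\<^bsub>S\<^esub> f (x 2) \<otimes>\<^bsub>S\<^esub> f (x 2) \<oplus>\<^bsub>S\<^esub> f (x 3) \<otimes>\<^bsub>S\<^esub> f (x 3) = h2"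
      using H by simp_all
  qed
  note sol = S.linear_system_unique[OF _ _ _ _ _ _ _ _ system[OF d(1,3,4,5)]]
    and sol' = S.linear_system_unique[OF _ _ _ _ _ _ _ _ system[OF d'(1,3,4,5)]]
  obtain d where "kA d \<otimes>\<^bsub>S\<^esub> (A 1 \<ominus>\<^bsub>S\<^esub> A 2) = \<one>\<^bsub>S\<^esub>"
    using difference_unit unfolding A_def by blast
  then have A12: "A 1 \<ominus>\<^bsub>S\<^esub> A 2 \<in> Units S"
    by (auto simp: Units_def S.m_comm intro!: bexI[of _ "kA d"])
  have w: "\<phi> (x 3) \<otimes>\<^bsub>S\<^esub> \<phi> (x 3) \<ominus>\<^bsub>S\<^esub> \<phi>' (x 3) \<otimes>\<^bsub>S\<^esub> \<phi>' (x 3) \<in> multiples S (p ^ 2)"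
    using P3 by (intro S.multiples_cong_mult) (simp_all add: P_def)
  \<comment> \<open>The difference of squares is the product of sum and difference of the two
    values. The sum is congruent to 2 x_i^p modulo p, hence a unit, and can be cancelled.\<close>
  have sq: "P (x i)"
    if i: "i = 1 \<or> i = 2" and "\<phi> (x i) \<otimes>\<^bsub>S\<^esub> \<phi> (x i) \<ominus>\<^bsub>S\<^esub> \<phi>' (x i) \<otimes>\<^bsub>S\<^esub> \<phi>' (x i) \<in> multiples S (p ^ 2)" for i
  proof -
    have xi: "x i \<in> Units S"
      using i unit_poly_\<iota>[OF unit_polys(1)] unit_poly_\<iota>[OF unit_polys(2)] by (auto simp: x_def)
    define v where "v = x i [^]\<^bsub>S\<^esub> p \<oplus>\<^bsub>S\<^esub> x i [^]\<^bsub>S\<^esub> p"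
    have v: "v \<in> Units S" "v \<in> carrier S" unfolding v_def using double_unit[OF S.Units_pow_closed[OF xi]] by auto
    have "\<phi> (x i) \<oplus>\<^bsub>S\<^esub> \<phi>' (x i) \<ominus>\<^bsub>S\<^esub> v \<in> multiples S p"
      unfolding v_def
    proof (rule S.multiples_cong_add)
      show "\<phi> (x i) \<ominus>\<^bsub>S\<^esub> x i [^]\<^bsub>S\<^esub> p \<in> multiples S p" "\<phi>' (x i) \<ominus>\<^bsub>S\<^esub> x i [^]\<^bsub>S\<^esub> p \<in> multiples S p"
        unfolding d(6)[OF x] d'(6)[OF x] multiples_def using d(2)[OF x] d'(2)[OF x] by blast+
    qed simp_all
    then have "(\<phi> (x i) \<oplus>\<^bsub>S\<^esub> \<phi>' (x i)) \<otimes>\<^bsub>S\<^esub> inv\<^bsub>S\<^esub> v \<ominus>\<^bsub>S\<^esub> v \<otimes>\<^bsub>S\<^esub> inv\<^bsub>S\<^esub> v \<in> multiples S p"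
      using v by (intro S.multiples_cong_mult) auto
    then have "\<phi> (x i) \<oplus>\<^bsub>S\<^esub> \<phi>' (x i) \<in> Units S"
      using v by (intro S.Units_lift[of _ "inv\<^bsub>S\<^esub> v"]) auto
    from S.unit_multiples_cancel[OF this S.minus_closed[OF c(1)[OF x] c(2)[OF x]]
        that(2)[unfolded S.square_diff_factor[OF c(1)[OF x] c(2)[OF x]]]]
    show ?thesis by (simp add: P_def)
  qed
  have P1: "P (x 1)"
  proof (rule sq)
    have "(A 1 \<ominus>\<^bsub>S\<^esub> A 2) \<otimes>\<^bsub>S\<^esub> (\<phi> (x 1) \<otimes>\<^bsub>S\<^esub> \<phi> (x 1)) \<ominus>\<^bsub>S\<^esub> (A 1 \<ominus>\<^bsub>S\<^esub> A 2) \<otimes>\<^bsub>S\<^esub> (\<phi>' (x 1) \<otimes>\<^bsub>S\<^esub> \<phi>' (x 1)) \<in> multiples S (p ^ 2)"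
    proof -
      have 1: "(A 1 \<ominus>\<^bsub>S\<^esub> A 2) \<otimes>\<^bsub>S\<^esub> (\<phi> (x 1) \<otimes>\<^bsub>S\<^esub> \<phi> (x 1)) = (A 2 \<ominus>\<^bsub>S\<^esub> A 3) \<otimes>\<^bsub>S\<^esub> (\<phi> (x 3) \<otimes>\<^bsub>S\<^esub> \<phi> (x 3)) \<oplus>\<^bsub>S\<^esub> h1 \<ominus>\<^bsub>S\<^esub> A 2 \<otimes>\<^bsub>S\<^esub> h2"
          "(A 1 \<ominus>\<^bsub>S\<^esub> A 2) \<otimes>\<^bsub>S\<^esub> (\<phi>' (x 1) \<otimes>\<^bsub>S\<^esub> \<phi>' (x 1)) = (A 2 \<ominus>\<^bsub>S\<^esub> A 3) \<otimes>\<^bsub>S\<^esub> (\<phi>' (x 3) \<otimes>\<^bsub>S\<^esub> \<phi>' (x 3)) \<oplus>\<^bsub>S\<^esub> h1 \<ominus>\<^bsub>S\<^esub> A 2 \<otimes>\<^bsub>S\<^esub> h2"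
        by (rule sol(1) sol'(1); simp)+
      show ?thesis unfolding 1 using w P3[unfolded P_def]
        by (intro S.multiples_cong_mult S.multiples_cong_add S.multiples_cong_minus; simp)+
    qed
    then show "\<phi> (x 1) \<otimes>\<^bsub>S\<^esub> \<phi> (x 1) \<ominus>\<^bsub>S\<^esub> \<phi>' (x 1) \<otimes>\<^bsub>S\<^esub> \<phi>' (x 1) \<in> multiples S (p ^ 2)"
      using S.unit_multiples_cancel[OF A12] by (simp add: S.r_diff_distr)
  qed simp
  have P2: "P (x 2)"
  proof (rule sq)
    have "(A 1 \<ominus>\<^bsub>S\<^esub> A 2) \<otimes>\<^bsub>S\<^esub> (\<phi> (x 2) \<otimes>\<^bsub>S\<^esub> \<phi> (x 2)) \<ominus>\<^bsub>S\<^esub> (A 1 \<ominus>\<^bsub>S\<^esub> A 2) \<otimes>\<^bsub>S\<^esub> (\<phi>' (x 2) \<otimes>\<^bsub>S\<^esub> \<phi>' (x 2)) \<in> multiples S (p ^ 2)"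
    proof -
      have 1: "(A 1 \<ominus>\<^bsub>S\<^esub> A 2) \<otimes>\<^bsub>S\<^esub> (\<phi> (x 2) \<otimes>\<^bsub>S\<^esub> \<phi> (x 2)) = (A 3 \<ominus>\<^bsub>S\<^esub> A 1) \<otimes>\<^bsub>S\<^esub> (\<phi> (x 3) \<otimes>\<^bsub>S\<^esub> \<phi> (x 3)) \<ominus>\<^bsub>S\<^esub> h1 \<oplus>\<^bsub>S\<^esub> A 1 \<otimes>\<^bsub>S\<^esub> h2"
          "(A 1 \<ominus>\<^bsub>S\<^esub> A 2) \<otimes>\<^bsub>S\<^esub> (\<phi>' (x 2) \<otimes>\<^bsub>S\<^esub> \<phi>' (x 2)) = (A 3 \<ominus>\<^bsub>S\<^esub> A 1) \<otimes>\<^bsub>S\<^esub> (\<phi>' (x 3) \<otimes>\<^bsub>S\<^esub> \<phi>' (x 3)) \<ominus>\<^bsub>S\<^esub> h1 \<oplus>\<^bsub>S\<^esub> A 1 \<otimes>\<^bsub>S\<^esub> h2"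
        by (rule sol(2) sol'(2); simp)+
      show ?thesis unfolding 1 using w P3[unfolded P_def]
        by (intro S.multiples_cong_mult S.multiples_cong_add S.multiples_cong_minus; simp)+
    qed
    then show "\<phi> (x 2) \<otimes>\<^bsub>S\<^esub> \<phi> (x 2) \<ominus>\<^bsub>S\<^esub> \<phi>' (x 2) \<otimes>\<^bsub>S\<^esub> \<phi>' (x 2) \<in> multiples S (p ^ 2)"
      using S.unit_multiples_cancel[OF A12] by (simp add: S.r_diff_distr)
  qed simp
  have P_RR: "P (\<iota> u)" if "u \<in> RR" for u
    using that
  proof (induction rule: RR_induct)
    case (cst c)
    then show ?case by (simp add: P_def d d')
  next
    case (var i)
    then show ?case using P1 P2 P3 by (auto simp: x_def)
  next
    case Qinv
    define q where "q = \<iota> (emb Q)"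
    define r where "r = \<iota> Qinv"
    have qr: "q \<in> carrier S" "r \<in> carrier S" "q \<otimes>\<^bsub>S\<^esub> r = \<one>\<^bsub>S\<^esub>"
      by (simp_all add: q_def r_def \<iota>_simps(3,8)[symmetric] emb_Q_Qinv)
    have 1: "\<phi> q \<otimes>\<^bsub>S\<^esub> \<phi> r = \<one>\<^bsub>S\<^esub>" "\<phi>' q \<otimes>\<^bsub>S\<^esub> \<phi>' r = \<one>\<^bsub>S\<^esub>"
      using ring_hom_mult[OF d(1) qr(1,2)] ring_hom_one[OF d(1)] ring_hom_mult[OF d'(1) qr(1,2)]
        ring_hom_one[OF d'(1)] qr(3) by simp_all
    \<comment> \<open>Inverses b, b' of c, c' differ by - b b' (c - c').\<close>
    have *: "b \<ominus>\<^bsub>S\<^esub> b' = \<ominus>\<^bsub>S\<^esub> (b \<otimes>\<^bsub>S\<^esub> b' \<otimes>\<^bsub>S\<^esub> (c \<ominus>\<^bsub>S\<^esub> c'))"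
      if "b \<in> carrier S" "b' \<in> carrier S" "c \<in> carrier S" "c' \<in> carrier S"
        "c \<otimes>\<^bsub>S\<^esub> b = \<one>\<^bsub>S\<^esub>" "c' \<otimes>\<^bsub>S\<^esub> b' = \<one>\<^bsub>S\<^esub>" for b b' c c'
    proof -
      have "b \<otimes>\<^bsub>S\<^esub> b' \<otimes>\<^bsub>S\<^esub> (c \<ominus>\<^bsub>S\<^esub> c') = (c \<otimes>\<^bsub>S\<^esub> b) \<otimes>\<^bsub>S\<^esub> b' \<ominus>\<^bsub>S\<^esub> (c' \<otimes>\<^bsub>S\<^esub> b') \<otimes>\<^bsub>S\<^esub> b"
        using that(1-4) by (simp add: S.r_diff_distr S.m_ac)
      then show ?thesis using that by (simp add: S.minus_eq S.minus_add S.a_ac)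
    qed
    have "\<phi> q \<ominus>\<^bsub>S\<^esub> \<phi>' q \<in> multiples S (p ^ 2)" using Qinv by (simp add: P_def q_def)
    then have "\<phi> r \<ominus>\<^bsub>S\<^esub> \<phi>' r \<in> multiples S (p ^ 2)"
      unfolding *[OF c(1)[OF qr(2)] c(2)[OF qr(2)] c(1)[OF qr(1)] c(2)[OF qr(1)] 1]
      using qr by (simp add: S.multiples_neg S.multiples_mult_left)
    then show ?case by (simp add: P_def r_def)
  next
    case (add u v)
    then show ?case
      by (simp add: P_def \<iota>_simps ring_hom_add[OF d(1)] ring_hom_add[OF d'(1)] S.multiples_cong_add)
  next
    case (mult u v)
    then show ?case
      by (simp add: P_def \<iota>_simps ring_hom_mult[OF d(1)] ring_hom_mult[OF d'(1)] S.multiples_cong_mult)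
  qed
  obtain r where r: "r \<in> RR" "K \<ominus>\<^bsub>S\<^esub> \<iota> r \<in> multiples S (p ^ 2)" using S_approx[OF K, of 2] by blast
  have close: "f K \<ominus>\<^bsub>S\<^esub> f (\<iota> r) \<in> multiples S (p ^ 2)" if "f \<in> ring_hom S S" for f
    using ring_hom_simps(5)[OF S.ring_axioms S.ring_axioms that r(2)]
      ring_hom_simps(2)[OF S.ring_axioms S.ring_axioms that K, of "\<iota> r"] r(1) by simp
  have "\<phi> K \<ominus>\<^bsub>S\<^esub> \<phi>' (\<iota> r) \<in> multiples S (p ^ 2)"
    using S.multiples_minus_trans[OF close[OF d(1)] P_RR[OF r(1), unfolded P_def]] K r(1) by simp
  moreover have "\<phi>' (\<iota> r) \<ominus>\<^bsub>S\<^esub> \<phi>' K \<in> multiples S (p ^ 2)"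
    by (rule S.multiples_minus_commute[OF close[OF d'(1)]]) (use K r(1) in simp_all)
  ultimately have "\<phi> K \<ominus>\<^bsub>S\<^esub> \<phi>' K \<in> multiples S (p ^ 2)"
    using K r(1) S.multiples_minus_trans[of "\<phi> K" "\<phi>' (\<iota> r)" "p ^ 2" "\<phi>' K"] by simp
  then show ?thesis
    using K d(2) d'(2) by (intro S_multiples_cancel) (simp_all add: diff)
qed

end

section \<open>Differentials\<close>

lemma (in abelian_subgroup) coset_eq_iff:
  assumes "x \<in> carrier G" "y \<in> carrier G"
  shows "H +> x = H +> y \<longleftrightarrow> x \<ominus> y \<in> H"
  using assms a_rcos_module[of y x] a_rcos_self[of x] a_repr_independence'[of x y]
  unfolding a_minus_def by auto

lemma (in module) submodule_abelian_subgroup: "submodule N R M \<Longrightarrow> abelian_subgroup N M"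
  by (intro abelian_subgroupI3 additive_subgroup.intro M.abelian_group_axioms) (rule submodule.axioms)

lemma (in module) smult_minus:
  "r \<in> carrier R \<Longrightarrow> x \<in> carrier M \<Longrightarrow> y \<in> carrier M \<Longrightarrow> r \<odot>\<^bsub>M\<^esub> (x \<ominus>\<^bsub>M\<^esub> y) = r \<odot>\<^bsub>M\<^esub> x \<ominus>\<^bsub>M\<^esub> r \<odot>\<^bsub>M\<^esub> y"
  by (simp add: M.minus_eq smult_r_distr smult_r_minus)

text \<open>The union over representatives in the scalar product of \<open>quot_module\<close> is a
  union of equal cosets, because a submodule is closed under scalars.\<close>

lemma (in module) quot_module_simps:
  assumes N: "submodule N R M"
  shows "carrier (quot_module M N) = (\<lambda>x. N +>\<^bsub>M\<^esub> x) ` carrier M"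
    "x \<in> carrier M \<Longrightarrow> y \<in> carrier M \<Longrightarrow>
      (N +>\<^bsub>M\<^esub> x) \<oplus>\<^bsub>quot_module M N\<^esub> (N +>\<^bsub>M\<^esub> y) = N +>\<^bsub>M\<^esub> (x \<oplus>\<^bsub>M\<^esub> y)"
    "\<zero>\<^bsub>quot_module M N\<^esub> = N +>\<^bsub>M\<^esub> \<zero>\<^bsub>M\<^esub>"
    "r \<in> carrier R \<Longrightarrow> x \<in> carrier M \<Longrightarrow>
      r \<odot>\<^bsub>quot_module M N\<^esub> (N +>\<^bsub>M\<^esub> x) = N +>\<^bsub>M\<^esub> (r \<odot>\<^bsub>M\<^esub> x)"
proof -
  interpret N: abelian_subgroup N M by (rule submodule_abelian_subgroup[OF N])
  show "carrier (quot_module M N) = (\<lambda>x. N +>\<^bsub>M\<^esub> x) ` carrier M"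
    by (auto simp: quot_module_def A_RCOSETS_def')
  show "x \<in> carrier M \<Longrightarrow> y \<in> carrier M \<Longrightarrow>
      (N +>\<^bsub>M\<^esub> x) \<oplus>\<^bsub>quot_module M N\<^esub> (N +>\<^bsub>M\<^esub> y) = N +>\<^bsub>M\<^esub> (x \<oplus>\<^bsub>M\<^esub> y)"
    by (simp add: quot_module_def N.a_rcos_sum)
  show "\<zero>\<^bsub>quot_module M N\<^esub> = N +>\<^bsub>M\<^esub> \<zero>\<^bsub>M\<^esub>"
    by (simp add: quot_module_def N.a_rcos_const)
  assume r: "r \<in> carrier R" and x: "x \<in> carrier M"
  have "N +>\<^bsub>M\<^esub> (r \<odot>\<^bsub>M\<^esub> y) = N +>\<^bsub>M\<^esub> (r \<odot>\<^bsub>M\<^esub> x)" if "y \<in> N +>\<^bsub>M\<^esub> x" for y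
  proof -
    have y: "y \<in> carrier M" using N.a_elemrcos_carrier[OF x that] .
    have "y \<ominus>\<^bsub>M\<^esub> x \<in> N" using N.a_rcos_module[OF x y] that by (simp add: a_minus_def)
    then have "r \<odot>\<^bsub>M\<^esub> (y \<ominus>\<^bsub>M\<^esub> x) \<in> N" using submodule.smult_closed[OF N r] by simp
    then show ?thesis using r x y by (simp add: N.coset_eq_iff smult_minus)
  qed
  moreover have "x \<in> N +>\<^bsub>M\<^esub> x" using x by (rule N.a_rcos_self)
  ultimately have "(\<Union>y\<in>N +>\<^bsub>M\<^esub> x. N +>\<^bsub>M\<^esub> (r \<odot>\<^bsub>M\<^esub> y)) = N +>\<^bsub>M\<^esub> (r \<odot>\<^bsub>M\<^esub> x)" by blast
  then show "r \<odot>\<^bsub>quot_module M N\<^esub> (N +>\<^bsub>M\<^esub> x) = N +>\<^bsub>M\<^esub> (r \<odot>\<^bsub>M\<^esub> x)"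
    by (simp add: quot_module_def)
qed

lemma (in module) quot_module_is_module:
  assumes N: "submodule N R M" shows "module R (quot_module M N)"
proof -
  interpret N: abelian_subgroup N M by (rule submodule_abelian_subgroup[OF N])
  note q = quot_module_simps[OF N]
  show ?thesis
  proof (rule moduleI)
    show "abelian_group (quot_module M N)"
    proof (rule abelian_groupI)
      fix W assume "W \<in> carrier (quot_module M N)"
      then obtain x where x: "x \<in> carrier M" "W = N +>\<^bsub>M\<^esub> x" by (auto simp: q)
      then show "\<exists>Y\<in>carrier (quot_module M N). Y \<oplus>\<^bsub>quot_module M N\<^esub> W = \<zero>\<^bsub>quot_module M N\<^esub>"
        by (intro bexI[of _ "N +>\<^bsub>M\<^esub> (\<ominus>\<^bsub>M\<^esub> x)"]) (auto simp: q(2,3) M.l_neg q(1))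
    qed (auto simp: q M.a_ac)
  qed (auto simp: q R.cring_axioms smult_l_distr smult_r_distr smult_assoc1)
qed

section \<open>Kaehler differentials\<close>

context cring
begin

lemma free_module_simps:
  "carrier (free_module R) = {u. (\<forall>x. u x \<in> carrier R) \<and> (\<forall>x. x \<notin> carrier R \<longrightarrow> u x = \<zero>) \<and> finite {x. u x \<noteq> \<zero>}}"
  "u \<oplus>\<^bsub>free_module R\<^esub> v = (\<lambda>x. u x \<oplus> v x)" "\<zero>\<^bsub>free_module R\<^esub> = (\<lambda>x. \<zero>)"
  "r \<odot>\<^bsub>free_module R\<^esub> u = (\<lambda>x. r \<otimes> u x)"
  by (simp_all add: free_module_def)

lemma free_module_is_module: "module R (free_module R)"
proof (rule moduleI)
  show "abelian_group (free_module R)"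
  proof (rule abelian_groupI)
    fix u v assume "u \<in> carrier (free_module R)" "v \<in> carrier (free_module R)"
    then have uv: "\<And>x. u x \<in> carrier R" "\<And>x. v x \<in> carrier R" "\<And>x. x \<notin> carrier R \<Longrightarrow> u x = \<zero> \<and> v x = \<zero>"
      "finite {x. u x \<noteq> \<zero>}" "finite {x. v x \<noteq> \<zero>}" by (auto simp: free_module_simps)
    have "finite {x. u x \<oplus> v x \<noteq> \<zero>}"
      by (rule finite_subset[OF _ finite_UnI[OF uv(4,5)]]) auto
    then show "u \<oplus>\<^bsub>free_module R\<^esub> v \<in> carrier (free_module R)" using uv by (simp add: free_module_simps)
  next
    fix u assume "u \<in> carrier (free_module R)"
    then have u: "\<And>x. u x \<in> carrier R" "\<And>x. x \<notin> carrier R \<Longrightarrow> u x = \<zero>" "finite {x. u x \<noteq> \<zero>}"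
      by (auto simp: free_module_simps)
    have "finite {x. \<ominus> u x \<noteq> \<zero>}"
      by (rule finite_subset[OF _ u(3)]) auto
    then show "\<exists>v\<in>carrier (free_module R). v \<oplus>\<^bsub>free_module R\<^esub> u = \<zero>\<^bsub>free_module R\<^esub>"
      using u by (intro bexI[of _ "\<lambda>x. \<ominus> u x"]) (auto simp: free_module_simps l_neg)
  qed (auto simp: free_module_simps a_ac)
next
  fix r u assume r: "r \<in> carrier R" and "u \<in> carrier (free_module R)"
  then have u: "\<And>x. u x \<in> carrier R" "\<And>x. x \<notin> carrier R \<Longrightarrow> u x = \<zero>" "finite {x. u x \<noteq> \<zero>}"
    by (auto simp: free_module_simps)
  have "finite {x. r \<otimes> u x \<noteq> \<zero>}"
    by (rule finite_subset[OF _ u(3)]) (use r in auto)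
  then show "r \<odot>\<^bsub>free_module R\<^esub> u \<in> carrier (free_module R)" using r u by (simp add: free_module_simps)
qed (auto simp: free_module_simps l_distr r_distr m_assoc cring_axioms)

lemma free_gen_closed [simp]: "g \<in> carrier R \<Longrightarrow> free_gen R g \<in> carrier (free_module R)"
  by (auto simp: free_module_simps free_gen_def)

lemma kahler_relators_subset:
  assumes "S \<subseteq> carrier R" shows "kahler_relators R S \<subseteq> carrier (free_module R)"
proof -
  interpret F: module R "free_module R" by (rule free_module_is_module)
  show ?thesis using assms unfolding kahler_relators_def by auto
qed

lemma kahler_relations_submodule:
  assumes "S \<subseteq> carrier R" shows "submodule (kahler_relations R S) R (free_module R)"
proof -
  interpret F: module R "free_module R" by (rule free_module_is_module)
  let ?C = "{N. submodule N R (free_module R) \<and> kahler_relators R S \<subseteq> N}"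
  have C: "carrier (free_module R) \<in> ?C"
    using F.carrier_is_submodule kahler_relators_subset[OF assms] by simp
  note E = F.submoduleE
  have zero: "\<zero>\<^bsub>free_module R\<^esub> \<in> N" if "submodule N R (free_module R)" for N
    using additive_subgroup.zero_closed[OF abelian_subgroup.axioms(1)[OF F.submodule_abelian_subgroup[OF that]]] .
  show ?thesis
    unfolding kahler_relations_def
  proof (rule F.submoduleI)
    show "\<Inter>?C \<subseteq> carrier (free_module R)" using C by blast
  qed (use zero E(3,4,5) in blast)+
qed

lemma kahler_relators_relations: "kahler_relators R S \<subseteq> kahler_relations R S"
  unfolding kahler_relations_def by blast

lemma kahler_module: "S \<subseteq> carrier R \<Longrightarrow> module R (kahler R S)"
  unfolding kahler_def
  by (rule module.quot_module_is_module[OF free_module_is_module kahler_relations_submodule])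

lemma kahler_d:
  assumes S: "S \<subseteq> carrier R"
  shows "g \<in> carrier R \<Longrightarrow> kahler_d R S g \<in> carrier (kahler R S)"
    "g \<in> carrier R \<Longrightarrow> h \<in> carrier R \<Longrightarrow>
      kahler_d R S (g \<oplus> h) = kahler_d R S g \<oplus>\<^bsub>kahler R S\<^esub> kahler_d R S h"
    "g \<in> carrier R \<Longrightarrow> h \<in> carrier R \<Longrightarrow>
      kahler_d R S (g \<otimes> h) = g \<odot>\<^bsub>kahler R S\<^esub> kahler_d R S h \<oplus>\<^bsub>kahler R S\<^esub> h \<odot>\<^bsub>kahler R S\<^esub> kahler_d R S g"
    "s \<in> S \<Longrightarrow> kahler_d R S s = \<zero>\<^bsub>kahler R S\<^esub>"
proof -
  interpret F: module R "free_module R" by (rule free_module_is_module)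
  have N: "submodule (kahler_relations R S) R (free_module R)" by (rule kahler_relations_submodule[OF S])
  interpret N: abelian_subgroup "kahler_relations R S" "free_module R"
    by (rule F.submodule_abelian_subgroup[OF N])
  note q = F.quot_module_simps[OF N, folded kahler_def]
  have rel: "u \<in> kahler_relators R S \<Longrightarrow> u \<in> kahler_relations R S" for u
    using kahler_relators_relations by blast
  show "g \<in> carrier R \<Longrightarrow> kahler_d R S g \<in> carrier (kahler R S)"
    by (auto simp: q kahler_d_def)
  show "kahler_d R S (g \<oplus> h) = kahler_d R S g \<oplus>\<^bsub>kahler R S\<^esub> kahler_d R S h"
    if "g \<in> carrier R" "h \<in> carrier R"
  proof -
    have "free_gen R (g \<oplus> h) \<ominus>\<^bsub>free_module R\<^esub> free_gen R g \<ominus>\<^bsub>free_module R\<^esub> free_gen R h \<in> kahler_relations R S"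
      using that by (intro rel) (auto simp: kahler_relators_def)
    moreover have "free_gen R (g \<oplus> h) \<ominus>\<^bsub>free_module R\<^esub> free_gen R g \<ominus>\<^bsub>free_module R\<^esub> free_gen R h =
        free_gen R (g \<oplus> h) \<ominus>\<^bsub>free_module R\<^esub> (free_gen R g \<oplus>\<^bsub>free_module R\<^esub> free_gen R h)"
      using that by (simp add: a_minus_def F.M.minus_add F.M.a_ac)
    ultimately show ?thesis using that by (simp add: kahler_d_def q N.coset_eq_iff)
  qed
  show "kahler_d R S (g \<otimes> h) = g \<odot>\<^bsub>kahler R S\<^esub> kahler_d R S h \<oplus>\<^bsub>kahler R S\<^esub> h \<odot>\<^bsub>kahler R S\<^esub> kahler_d R S g"
    if "g \<in> carrier R" "h \<in> carrier R"
  proof -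
    have "free_gen R (g \<otimes> h) \<ominus>\<^bsub>free_module R\<^esub> g \<odot>\<^bsub>free_module R\<^esub> free_gen R h
        \<ominus>\<^bsub>free_module R\<^esub> h \<odot>\<^bsub>free_module R\<^esub> free_gen R g \<in> kahler_relations R S"
      using that by (intro rel) (auto simp: kahler_relators_def)
    moreover have "free_gen R (g \<otimes> h) \<ominus>\<^bsub>free_module R\<^esub> g \<odot>\<^bsub>free_module R\<^esub> free_gen R h
        \<ominus>\<^bsub>free_module R\<^esub> h \<odot>\<^bsub>free_module R\<^esub> free_gen R g =
        free_gen R (g \<otimes> h) \<ominus>\<^bsub>free_module R\<^esub>
          (g \<odot>\<^bsub>free_module R\<^esub> free_gen R h \<oplus>\<^bsub>free_module R\<^esub> h \<odot>\<^bsub>free_module R\<^esub> free_gen R g)"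
      using that by (simp add: a_minus_def F.M.minus_add F.M.a_ac)
    ultimately show ?thesis using that by (simp add: kahler_d_def q N.coset_eq_iff)
  qed
  show "kahler_d R S s = \<zero>\<^bsub>kahler R S\<^esub>" if "s \<in> S"
  proof -
    have "free_gen R s \<in> kahler_relations R S" using that by (intro rel) (auto simp: kahler_relators_def)
    then show ?thesis using that S by (auto simp: kahler_d_def q N.coset_eq_iff)
  qed
qed

end

text \<open>The formula of \<open>kahler_pullback\<close> with a free choice of target: T may be a
  module over another ring, and D takes the place of g -> d\<phi>(g). Pullback of forms and
  evaluation of forms at a point are both instances.\<close>

definition kahler_lift ::
    "('r, 'x) ring_scheme \<Rightarrow> ('s, 'm, 'y) module_scheme \<Rightarrow> ('r \<Rightarrow> 's) \<Rightarrow> ('r \<Rightarrow> 'm) \<Rightarrow> ('r \<Rightarrow> 'r) set \<Rightarrow> 'm"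
  where "kahler_lift R T \<theta> D U =
    the_elem ((\<lambda>u. \<Oplus>\<^bsub>T\<^esub>g\<in>{g. u g \<noteq> \<zero>\<^bsub>R\<^esub>}. \<theta> (u g) \<odot>\<^bsub>T\<^esub> D g) ` U)"

lemma kahler_pullback_lift:
  "kahler_pullback R S \<phi> = kahler_lift R (kahler R S) \<phi> (\<lambda>g. kahler_d R S (\<phi> g))"
  by (simp add: kahler_pullback_def kahler_lift_def fun_eq_iff)

text \<open>The data of the universal property of differentials along a change of rings: R acts on T
  through \<theta>, and D is a derivation for this action.\<close>

locale semilinear_derivation = R: cring R + T: module R' T
  for R :: "('r, 'x) ring_scheme" and R' :: "('s, 'z) ring_scheme" and T :: "('s, 'm, 'y) module_scheme" +
  fixes S :: "'r set" and \<theta> :: "'r \<Rightarrow> 's" and D :: "'r \<Rightarrow> 'm"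
  assumes S: "S \<subseteq> carrier R" and \<theta>: "\<theta> \<in> ring_hom R R'"
    and D_closed: "g \<in> carrier R \<Longrightarrow> D g \<in> carrier T"
    and D_add: "g \<in> carrier R \<Longrightarrow> h \<in> carrier R \<Longrightarrow> D (g \<oplus>\<^bsub>R\<^esub> h) = D g \<oplus>\<^bsub>T\<^esub> D h"
    and D_mult: "g \<in> carrier R \<Longrightarrow> h \<in> carrier R \<Longrightarrow>
      D (g \<otimes>\<^bsub>R\<^esub> h) = \<theta> g \<odot>\<^bsub>T\<^esub> D h \<oplus>\<^bsub>T\<^esub> \<theta> h \<odot>\<^bsub>T\<^esub> D g"
    and D_base: "s \<in> S \<Longrightarrow> D s = \<zero>\<^bsub>T\<^esub>"
begin

abbreviation "F \<equiv> free_module R"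
sublocale F: module R F by (rule R.free_module_is_module)

definition \<Phi> :: "('r \<Rightarrow> 'r) \<Rightarrow> 'm"
  where "\<Phi> u = (\<Oplus>\<^bsub>T\<^esub>g\<in>{g. u g \<noteq> \<zero>\<^bsub>R\<^esub>}. \<theta> (u g) \<odot>\<^bsub>T\<^esub> D g)"

lemma \<theta>0: "\<theta> \<zero>\<^bsub>R\<^esub> = \<zero>\<^bsub>R'\<^esub>"
  by (rule ring_hom_simps(1)[OF R.ring_axioms T.R.ring_axioms \<theta>])

lemma FD:
  assumes "u \<in> carrier F"
  shows "u x \<in> carrier R" "\<theta> (u x) \<in> carrier R'" "finite {g. u g \<noteq> \<zero>\<^bsub>R\<^esub>}" "{g. u g \<noteq> \<zero>\<^bsub>R\<^esub>} \<subseteq> carrier R"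
  using assms ring_hom_closed[OF \<theta>] by (auto simp: R.free_module_simps)

text \<open>The support varies with u. Summing over a common finite superset, where the extra terms
  are zero, is what allows the values at u, v and their sum to be compared.\<close>

lemma \<Phi>_superset:
  assumes u: "u \<in> carrier F" and W: "finite W" "{g. u g \<noteq> \<zero>\<^bsub>R\<^esub>} \<subseteq> W" "W \<subseteq> carrier R"
  shows "\<Phi> u = (\<Oplus>\<^bsub>T\<^esub>g\<in>W. \<theta> (u g) \<odot>\<^bsub>T\<^esub> D g)"
  unfolding \<Phi>_def
  by (rule T.add.finprod_mono_neutral_cong_left)
    (use W FD[OF u] D_closed in \<open>auto simp: \<theta>0\<close>)

lemma \<Phi>_closed: "u \<in> carrier F \<Longrightarrow> \<Phi> u \<in> carrier T"
  unfolding \<Phi>_def using FD[of u] D_closed by (intro T.finsum_closed) auto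

lemma \<Phi>_add:
  assumes u: "u \<in> carrier F" and v: "v \<in> carrier F"
  shows "\<Phi> (u \<oplus>\<^bsub>F\<^esub> v) = \<Phi> u \<oplus>\<^bsub>T\<^esub> \<Phi> v"
proof -
  define W where "W = {g. u g \<noteq> \<zero>\<^bsub>R\<^esub>} \<union> {g. v g \<noteq> \<zero>\<^bsub>R\<^esub>}"
  have W: "finite W" "W \<subseteq> carrier R" using FD[OF u] FD[OF v] by (auto simp: W_def)
  have "\<Phi> (u \<oplus>\<^bsub>F\<^esub> v) = (\<Oplus>\<^bsub>T\<^esub>g\<in>W. \<theta> ((u \<oplus>\<^bsub>F\<^esub> v) g) \<odot>\<^bsub>T\<^esub> D g)"
    using F.M.add.m_closed[OF u v] W
    by (intro \<Phi>_superset) (auto simp: W_def R.free_module_simps(2))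
  also have "\<dots> = (\<Oplus>\<^bsub>T\<^esub>g\<in>W. \<theta> (u g) \<odot>\<^bsub>T\<^esub> D g \<oplus>\<^bsub>T\<^esub> \<theta> (v g) \<odot>\<^bsub>T\<^esub> D g)"
    using FD[OF u] FD[OF v] W D_closed
    by (intro T.finsum_cong') (auto simp: R.free_module_simps(2) ring_hom_add[OF \<theta>] T.smult_l_distr subset_iff)
  also have "\<dots> = (\<Oplus>\<^bsub>T\<^esub>g\<in>W. \<theta> (u g) \<odot>\<^bsub>T\<^esub> D g) \<oplus>\<^bsub>T\<^esub> (\<Oplus>\<^bsub>T\<^esub>g\<in>W. \<theta> (v g) \<odot>\<^bsub>T\<^esub> D g)"
    using FD[OF u] FD[OF v] W D_closed by (intro T.finsum_addf) (auto simp: subset_iff)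
  also have "\<dots> = \<Phi> u \<oplus>\<^bsub>T\<^esub> \<Phi> v"
    using \<Phi>_superset[OF u W(1) _ W(2)] \<Phi>_superset[OF v W(1) _ W(2)] by (auto simp: W_def)
  finally show ?thesis .
qed

lemma \<Phi>_smult:
  assumes r: "r \<in> carrier R" and u: "u \<in> carrier F"
  shows "\<Phi> (r \<odot>\<^bsub>F\<^esub> u) = \<theta> r \<odot>\<^bsub>T\<^esub> \<Phi> u"
proof -
  define W where "W = {g. u g \<noteq> \<zero>\<^bsub>R\<^esub>}"
  have W: "finite W" "W \<subseteq> carrier R" using FD[OF u] by (auto simp: W_def)
  have \<theta>r: "\<theta> r \<in> carrier R'" using ring_hom_closed[OF \<theta> r] .
  have "\<Phi> (r \<odot>\<^bsub>F\<^esub> u) = (\<Oplus>\<^bsub>T\<^esub>g\<in>W. \<theta> ((r \<odot>\<^bsub>F\<^esub> u) g) \<odot>\<^bsub>T\<^esub> D g)"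
    using F.smult_closed[OF r u] r W
    by (intro \<Phi>_superset) (auto simp: W_def R.free_module_simps(4))
  also have "\<dots> = (\<Oplus>\<^bsub>T\<^esub>g\<in>W. \<theta> r \<odot>\<^bsub>T\<^esub> (\<theta> (u g) \<odot>\<^bsub>T\<^esub> D g))"
    using FD[OF u] W D_closed r \<theta>r
    by (intro T.finsum_cong') (auto simp: R.free_module_simps(4) ring_hom_mult[OF \<theta>] T.smult_assoc1 subset_iff)
  also have "\<dots> = \<theta> r \<odot>\<^bsub>T\<^esub> \<Phi> u"
    unfolding \<Phi>_def W_def[symmetric] using FD[OF u] W D_closed \<theta>r
    by (intro T.finsum_smult_ldistr[symmetric]) (auto simp: subset_iff)
  finally show ?thesis .
qed

lemma \<Phi>_gen: assumes "g \<in> carrier R" shows "\<Phi> (free_gen R g) = D g"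
proof -
  have "\<Phi> (free_gen R g) = (\<Oplus>\<^bsub>T\<^esub>h\<in>{g}. \<theta> (free_gen R g h) \<odot>\<^bsub>T\<^esub> D h)"
    by (rule \<Phi>_superset[OF R.free_gen_closed[OF assms]]) (use assms in \<open>auto simp: free_gen_def\<close>)
  also have "\<dots> = \<theta> \<one>\<^bsub>R\<^esub> \<odot>\<^bsub>T\<^esub> D g"
    using assms D_closed ring_hom_closed[OF \<theta>] by (subst T.finsum_insert) (auto simp: free_gen_def)
  finally show ?thesis using assms D_closed by (simp add: ring_hom_one[OF \<theta>])
qed

lemma \<Phi>_hom: "\<Phi> \<in> hom (add_monoid F) (add_monoid T)"
  by (auto simp: hom_def \<Phi>_closed \<Phi>_add)

lemmas \<Phi>_minus = additive_hom_minus[OF F.abelian_group_axioms T.abelian_group_axioms \<Phi>_hom]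

lemma \<Phi>_zero: "\<Phi> \<zero>\<^bsub>F\<^esub> = \<zero>\<^bsub>T\<^esub>"
  using \<Phi>_minus[OF F.M.zero_closed F.M.zero_closed] \<Phi>_closed[OF F.M.zero_closed] by simp

text \<open>The zeros of \<Phi> form a submodule that contains the relators, hence one of the
  submodules whose intersection is \<open>kahler_relations\<close>.\<close>

lemma \<Phi>_relations:
  assumes "u \<in> kahler_relations R S" shows "\<Phi> u = \<zero>\<^bsub>T\<^esub>"
proof -
  let ?N = "{u \<in> carrier F. \<Phi> u = \<zero>\<^bsub>T\<^esub>}"
  have "submodule ?N R F"
  proof (rule F.submoduleI)
    fix u assume u: "u \<in> ?N"
    have "\<ominus>\<^bsub>F\<^esub> u = \<zero>\<^bsub>F\<^esub> \<ominus>\<^bsub>F\<^esub> u" using u by (simp add: a_minus_def)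
    then show "\<ominus>\<^bsub>F\<^esub> u \<in> ?N" using u by (simp add: \<Phi>_minus \<Phi>_zero)
  next
    fix r u assume "r \<in> carrier R" "u \<in> ?N"
    then show "r \<odot>\<^bsub>F\<^esub> u \<in> ?N" using ring_hom_closed[OF \<theta>] by (simp add: \<Phi>_smult)
  qed (auto simp: \<Phi>_add \<Phi>_zero)
  moreover have "kahler_relators R S \<subseteq> ?N"
  proof
    fix u assume u: "u \<in> kahler_relators R S"
    then have uF: "u \<in> carrier F" using R.kahler_relators_subset[OF S] by blast
    have \<theta>c: "g \<in> carrier R \<Longrightarrow> \<theta> g \<in> carrier R'" for g using ring_hom_closed[OF \<theta>] .
    consider g h where "g \<in> carrier R" "h \<in> carrier R"
        "u = free_gen R (g \<oplus>\<^bsub>R\<^esub> h) \<ominus>\<^bsub>F\<^esub> free_gen R g \<ominus>\<^bsub>F\<^esub> free_gen R h"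
      | g h where "g \<in> carrier R" "h \<in> carrier R"
        "u = free_gen R (g \<otimes>\<^bsub>R\<^esub> h) \<ominus>\<^bsub>F\<^esub> g \<odot>\<^bsub>F\<^esub> free_gen R h \<ominus>\<^bsub>F\<^esub> h \<odot>\<^bsub>F\<^esub> free_gen R g"
      | s where "s \<in> S" "u = free_gen R s"
      using u unfolding kahler_relators_def by blast
    then have "\<Phi> u = \<zero>\<^bsub>T\<^esub>"
    proof cases
      case 1
      have *: "x \<oplus>\<^bsub>T\<^esub> y \<ominus>\<^bsub>T\<^esub> x \<ominus>\<^bsub>T\<^esub> y = \<zero>\<^bsub>T\<^esub>" if "x \<in> carrier T" "y \<in> carrier T" for x y
        using that by (simp add: T.M.add_minus_cancel_left)
      show ?thesis using 1 D_closed by (simp add: \<Phi>_minus \<Phi>_gen D_add *)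
    next
      case 2
      have *: "x \<oplus>\<^bsub>T\<^esub> y \<ominus>\<^bsub>T\<^esub> x \<ominus>\<^bsub>T\<^esub> y = \<zero>\<^bsub>T\<^esub>" if "x \<in> carrier T" "y \<in> carrier T" for x y
        using that by (simp add: T.M.add_minus_cancel_left)
      show ?thesis using 2 D_closed \<theta>c by (simp add: \<Phi>_minus \<Phi>_gen \<Phi>_smult D_mult *)
    next
      case 3
      then show ?thesis using S D_base by (auto simp: \<Phi>_gen)
    qed
    with uF show "u \<in> ?N" by simp
  qed
  ultimately have "kahler_relations R S \<subseteq> ?N" unfolding kahler_relations_def by blast
  then show ?thesis using assms by blast
qed

abbreviation "\<Omega> \<equiv> kahler R S"
abbreviation "lift \<equiv> kahler_lift R T \<theta> D"

lemma lift_coset: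
  assumes u: "u \<in> carrier F" shows "lift (kahler_relations R S +>\<^bsub>F\<^esub> u) = \<Phi> u"
proof -
  have N: "submodule (kahler_relations R S) R F" by (rule R.kahler_relations_submodule[OF S])
  interpret N: abelian_subgroup "kahler_relations R S" F
    by (rule F.submodule_abelian_subgroup[OF N])
  have "\<Phi> v = \<Phi> u" if "v \<in> kahler_relations R S +>\<^bsub>F\<^esub> u" for v
  proof -
    have v: "v \<in> carrier F" using N.a_elemrcos_carrier[OF u that] .
    then have "v \<ominus>\<^bsub>F\<^esub> u \<in> kahler_relations R S" using N.a_rcos_module[OF u v] that by (simp add: a_minus_def)
    then have "\<Phi> v \<ominus>\<^bsub>T\<^esub> \<Phi> u = \<zero>\<^bsub>T\<^esub>" using \<Phi>_relations \<Phi>_minus[OF v u] by simp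
    then show ?thesis using T.M.a_minus_zero_iff \<Phi>_closed u v by blast
  qed
  moreover have "u \<in> kahler_relations R S +>\<^bsub>F\<^esub> u" using u by (rule N.a_rcos_self)
  ultimately have "\<Phi> ` (kahler_relations R S +>\<^bsub>F\<^esub> u) = {\<Phi> u}" by blast
  then show ?thesis by (simp add: kahler_lift_def \<Phi>_def[abs_def])
qed

lemma kahler_cases:
  assumes "k \<in> carrier \<Omega>"
  obtains u where "u \<in> carrier F" "k = kahler_relations R S +>\<^bsub>F\<^esub> u"
  using assms F.quot_module_simps(1)[OF R.kahler_relations_submodule[OF S]] by (auto simp: kahler_def)

lemma lift_hom: "lift \<in> hom (add_monoid \<Omega>) (add_monoid T)"
proof -
  note q = F.quot_module_simps[OF R.kahler_relations_submodule[OF S], folded kahler_def]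
  have "lift k \<in> carrier T" if "k \<in> carrier \<Omega>" for k
    using that by (auto elim!: kahler_cases simp: lift_coset \<Phi>_closed)
  moreover have "lift (k \<oplus>\<^bsub>\<Omega>\<^esub> l) = lift k \<oplus>\<^bsub>T\<^esub> lift l" if "k \<in> carrier \<Omega>" "l \<in> carrier \<Omega>" for k l
    using that by (auto elim!: kahler_cases simp: q lift_coset \<Phi>_add)
  ultimately show ?thesis by (auto simp: hom_def)
qed

lemma lift_smult:
  assumes "r \<in> carrier R" "k \<in> carrier \<Omega>" shows "lift (r \<odot>\<^bsub>\<Omega>\<^esub> k) = \<theta> r \<odot>\<^bsub>T\<^esub> lift k"
proof -
  note q = F.quot_module_simps[OF R.kahler_relations_submodule[OF S], folded kahler_def]
  show ?thesis using assms by (auto elim!: kahler_cases simp: q lift_coset \<Phi>_smult)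
qed

lemma lift_d: "g \<in> carrier R \<Longrightarrow> lift (kahler_d R S g) = D g"
  by (simp add: kahler_d_def lift_coset \<Phi>_gen)

end

lemma padic_completion_module_additive:
  "abelian_group M \<Longrightarrow> additive_completion M p (padic_completion_module p M)"
  by (intro additive_completion.intro additive_completion_axioms.intro)
    (simp_all add: padic_completion_module_def quot_module_def)

lemma (in module) multiples_submodule: "submodule (multiples M m) R M"
proof (rule submoduleI)
  fix r x assume "r \<in> carrier R" "x \<in> multiples M m"
  then obtain y where y: "y \<in> carrier M" "x = [m] \<cdot>\<^bsub>M\<^esub> y" by (auto simp: multiples_def)
  have "r \<odot>\<^bsub>M\<^esub> ([k] \<cdot>\<^bsub>M\<^esub> y) = [k] \<cdot>\<^bsub>M\<^esub> (r \<odot>\<^bsub>M\<^esub> y)" for k :: nat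
    by (induction k) (use y \<open>r \<in> carrier R\<close> in \<open>simp_all add: smult_r_distr\<close>)
  with y \<open>r \<in> carrier R\<close> show "r \<odot>\<^bsub>M\<^esub> x \<in> multiples M m" by auto
qed (auto simp: M.multiples_carrier M.multiples_neg M.multiples_add)

lemma (in module) padic_completion_module_smult_const:
  assumes "r \<in> carrier R" "x \<in> carrier M"
  shows "r \<odot>\<^bsub>padic_completion_module p M\<^esub> to_completion p M x = to_completion p M (r \<odot>\<^bsub>M\<^esub> x)"
  using quot_module_simps(4)[OF multiples_submodule assms]
  by (simp add: padic_completion_module_def to_completion_def)

section \<open>Level sets\<close>

locale level_set = euler_setting p \<pi> a
  for p :: nat and \<pi> :: "'a::idom" and a :: "nat \<Rightarrow> 'a" +
  fixes c1 c2 :: 'a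
  assumes c_const: "the_p_derivation p c1 = 0" "the_p_derivation p c2 = 0"
    and c_regular: "\<not> \<pi> dvd eval2 id (N_poly a) c1 c2 * eval2 id (hasse p a) c1 c2"
begin

abbreviation "I \<equiv> level_ideal p a c1 c2"
abbreviation "EE \<equiv> O_E p a c1 c2"
abbreviation "Eh \<equiv> O_Ehat p a c1 c2"
abbreviation "res \<equiv> res_E p a c1 c2"
abbreviation "loc \<equiv> \<lambda>u. res (\<iota> u)"

definition e :: "'a poly poly poly fract \<Rightarrow> 'a poly poly poly fract set"
  where "e u = I +>\<^bsub>R\<^esub> u"

lemma I_eq: "I = Idl\<^bsub>R\<^esub> {emb (H1 a - cst c1), emb (H2 - cst c2)}"
  by (simp add: level_ideal_def emb_def)

lemma I_ideal: "ideal I R"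
  unfolding I_eq by (rule R.genideal_ideal) simp

lemma I_generators: "emb (H1 a - cst c1) \<in> I" "emb (H2 - cst c2) \<in> I"
  unfolding I_eq using R.genideal_self[of "{emb (H1 a - cst c1), emb (H2 - cst c2)}"] by auto

lemma I_minimal: "ideal J R \<Longrightarrow> emb (H1 a - cst c1) \<in> J \<Longrightarrow> emb (H2 - cst c2) \<in> J \<Longrightarrow> I \<subseteq> J"
  unfolding I_eq by (rule R.genideal_minimal) auto

lemma I_RR: "u \<in> I \<Longrightarrow> u \<in> RR"
  using ideal.Icarr[OF I_ideal] by simp

lemma EE_cring: "cring EE"
  unfolding O_E_def by (rule ideal.quotient_is_cring[OF I_ideal R_cring])

lemma e_hom: "e \<in> ring_hom R EE"
  unfolding O_E_def e_def[abs_def] by (rule ideal.rcos_ring_hom[OF I_ideal])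

lemma EE_carrier: "carrier EE = e ` RR"
  by (auto simp: O_E_def FactRing_def A_RCOSETS_def' e_def)

lemma e_eq_iff: "u \<in> RR \<Longrightarrow> v \<in> RR \<Longrightarrow> e u = e v \<longleftrightarrow> u - v \<in> I"
proof -
  interpret I: ideal I R by (rule I_ideal)
  show "u \<in> RR \<Longrightarrow> v \<in> RR \<Longrightarrow> e u = e v \<longleftrightarrow> u - v \<in> I"
    using I.coset_eq_iff[of u v] by (simp add: e_def)
qed

lemma e_self: "u \<in> RR \<Longrightarrow> u \<in> e u"
proof -
  interpret I: ideal I R by (rule I_ideal)
  show "u \<in> RR \<Longrightarrow> u \<in> e u" using I.a_rcos_self[of u] by (simp add: e_def)
qed

lemma e_mem: "u \<in> RR \<Longrightarrow> v \<in> e u \<Longrightarrow> v \<in> RR \<and> v - u \<in> I"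
proof -
  interpret I: ideal I R by (rule I_ideal)
  assume u: "u \<in> RR" and v: "v \<in> e u"
  have vR: "v \<in> RR" using I.a_elemrcos_carrier[of u v] u v by (simp add: e_def)
  show ?thesis using I.a_rcos_module[of u v] u v vR by (simp add: e_def a_minus_def[symmetric])
qed

sublocale EC: ring_completion EE p by (intro ring_completion.intro EE_cring)

lemma Eh_eq: "padic_completion p EE = Eh"
  by (simp add: O_Ehat_def)

sublocale E: padic_ring Eh p
  unfolding O_Ehat_def by (rule EC.C.padic_ring_axioms)

lemma res_eq: "res = completion_map p EE e"
  by (simp add: res_E_def e_def[abs_def])

lemma res_hom: "res \<in> ring_hom S Eh"
  unfolding res_eq using completion_map_hom[OF R_cring EE_cring e_hom, of p] by (simp add: S_eq Eh_eq)

lemma res_Pl: "XC.Cy r \<Longrightarrow> res (XC.Pl r) = EC.Pl (\<lambda>n. e (r n))"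
  unfolding res_eq
  by (rule completion_map_lim[OF R.abelian_group_axioms EC.abelian_group_axioms ring_hom_in_hom(2)[OF e_hom]])

lemma loc_eq: "u \<in> RR \<Longrightarrow> loc u = to_completion p EE (e u)"
  using res_Pl[of "\<lambda>_. u"] by (simp add: XC.to_completion_lim EC.to_completion_lim)

lemmas res_simps = ring_hom_one[OF res_hom] ring_hom_add[OF res_hom] ring_hom_mult[OF res_hom]
  ring_hom_simps[OF S.ring_axioms E.ring_axioms res_hom]

lemma res_closed [simp, intro]: "b \<in> carrier S \<Longrightarrow> res b \<in> carrier Eh"
  using ring_hom_closed[OF res_hom] .

lemma loc_simps:
  "u \<in> RR \<Longrightarrow> loc u \<in> carrier Eh" "u \<in> RR \<Longrightarrow> v \<in> RR \<Longrightarrow> loc (u + v) = loc u \<oplus>\<^bsub>Eh\<^esub> loc v"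
  "u \<in> RR \<Longrightarrow> v \<in> RR \<Longrightarrow> loc (u * v) = loc u \<otimes>\<^bsub>Eh\<^esub> loc v" "loc 1 = \<one>\<^bsub>Eh\<^esub>" "loc 0 = \<zero>\<^bsub>Eh\<^esub>"
  "u \<in> RR \<Longrightarrow> loc (u ^ n) = loc u [^]\<^bsub>Eh\<^esub> n"
  by (simp_all add: \<iota>_simps res_simps)

text \<open>Surjectivity survives completion: the n-th step of a Cauchy sequence is p^n times an
  element, and lifting that element lifts the step together with its factor p^n.\<close>

lemma res_surj:
  assumes "y \<in> carrier Eh" shows "\<exists>b\<in>carrier S. res b = y"
proof -
  have "y \<in> carrier (padic_completion p EE)" using assms by (simp add: Eh_eq)
  then obtain t where t: "EC.Cy t" "y = EC.Pl t" using EC.Lim_cases by blast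
  have "\<exists>w\<in>RR. t (Suc n) \<ominus>\<^bsub>EE\<^esub> t n = [(p ^ n)] \<cdot>\<^bsub>EE\<^esub> e w" for n
  proof -
    have "t (Suc n) \<ominus>\<^bsub>EE\<^esub> t n \<in> multiples EE (p ^ n)" using t(1) by (simp add: cauchy_def)
    then obtain x where x: "x \<in> e ` RR" "t (Suc n) \<ominus>\<^bsub>EE\<^esub> t n = [(p ^ n)] \<cdot>\<^bsub>EE\<^esub> x"
      by (auto simp: multiples_def EE_carrier)
    obtain w where "w \<in> RR" "x = e w" using x(1) by blast
    with x(2) show ?thesis by blast
  qed
  then obtain w where w: "\<And>n. w n \<in> RR" "\<And>n. t (Suc n) \<ominus>\<^bsub>EE\<^esub> t n = [(p ^ n)] \<cdot>\<^bsub>EE\<^esub> e (w n)" by metis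
  have tc: "t n \<in> carrier EE" for n using EC.cauchyD[OF t(1)] .
  obtain r0 where r0: "r0 \<in> RR" "t 0 = e r0" using tc[of 0] by (auto simp: EE_carrier)
  define s where "s = rec_nat r0 (\<lambda>n b. b \<oplus>\<^bsub>R\<^esub> [(p ^ n)] \<cdot>\<^bsub>R\<^esub> w n)"
  have s0: "s 0 = r0" and sS: "s (Suc n) = s n \<oplus>\<^bsub>R\<^esub> [(p ^ n)] \<cdot>\<^bsub>R\<^esub> w n" for n by (simp_all add: s_def)
  have wc: "w n \<in> carrier R" for n using w(1) by simp
  have wm: "[(p ^ n)] \<cdot>\<^bsub>R\<^esub> w n \<in> carrier R" for n using wc by (rule R.add.nat_pow_closed)
  have sc: "s n \<in> carrier R" for n
  proof (induction n)
    case 0 then show ?case using r0 by (simp add: s0)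
  next
    case (Suc n) then show ?case unfolding sS using wm by (rule R.a_closed)
  qed
  have et: "e (s n) = t n" for n
  proof (induction n)
    case 0 then show ?case by (simp add: s0 r0)
  next
    case (Suc n)
    have "e (s (Suc n)) = t n \<oplus>\<^bsub>EE\<^esub> (t (Suc n) \<ominus>\<^bsub>EE\<^esub> t n)"
      unfolding sS w(2) ring_hom_add[OF e_hom sc wm] Suc
        ring_hom_simps(4)[OF R.ring_axioms EC.ring_axioms e_hom wc] ..
    then show ?case using tc by simp
  qed
  have "s (Suc n) \<ominus>\<^bsub>R\<^esub> s n \<in> multiples R (p ^ n)" for n
    unfolding sS R.add_minus_cancel_left[OF sc wm] using wc by (rule R.multiplesI)
  then have "XC.Cy s" using sc by (auto simp: cauchy_def)
  then have "XC.Pl s \<in> carrier S" "res (XC.Pl s) = y" by (auto simp: S_eq[symmetric] res_Pl et t)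
  then show ?thesis by blast
qed

lemma loc_multiples_iff:
  assumes "u \<in> RR" "loc u \<in> multiples Eh (p ^ n)" shows "e u \<in> multiples EE (p ^ n)"
proof -
  have "e u \<in> carrier EE" using assms(1) by (auto simp: EE_carrier)
  then show ?thesis
    using assms EC.Lim_multiples_iff[of "\<lambda>_. e u" n]
    by (simp add: loc_eq EC.to_completion_lim Eh_eq)
qed

text \<open>The ideal is dense in the kernel. Modulo p^n an element is represented by some r in
  \<open>RR\<close>; its class on the level set is p^n times another class, so r differs from a
  member of the ideal by a multiple of p^n.\<close>

lemma kernel_approx:
  assumes b: "b \<in> carrier S" "res b = \<zero>\<^bsub>Eh\<^esub>"
  shows "\<exists>i\<in>I. b \<ominus>\<^bsub>S\<^esub> \<iota> i \<in> multiples S (p ^ n)"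
proof -
  obtain r where r: "r \<in> RR" "b \<ominus>\<^bsub>S\<^esub> \<iota> r \<in> multiples S (p ^ n)" using S_approx[OF b(1)] by blast
  have rS: "\<iota> r \<in> carrier S" using r(1) by (simp add: \<iota>_simps)
  have "\<zero>\<^bsub>Eh\<^esub> \<ominus>\<^bsub>Eh\<^esub> loc r \<in> multiples Eh (p ^ n)"
    using res_simps(8)[OF r(2)] by (simp only: res_simps(5)[OF b(1) rS] b(2))
  then have "\<ominus>\<^bsub>Eh\<^esub> (\<zero>\<^bsub>Eh\<^esub> \<ominus>\<^bsub>Eh\<^esub> loc r) \<in> multiples Eh (p ^ n)" by (rule E.multiples_neg)
  then have "loc r \<in> multiples Eh (p ^ n)" using rS by (simp add: E.minus_eq)
  then have "e r \<in> multiples EE (p ^ n)" by (rule loc_multiples_iff[OF r(1)])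
  then obtain w where w: "w \<in> RR" "e r = [(p ^ n)] \<cdot>\<^bsub>EE\<^esub> e w" by (auto simp: multiples_def EE_carrier)
  define v where "v = [(p ^ n)] \<cdot>\<^bsub>R\<^esub> w"
  have wc: "w \<in> carrier R" using w(1) by simp
  have v: "v \<in> RR" "v \<in> multiples R (p ^ n)"
    unfolding v_def using R.add.nat_pow_closed[OF wc, of "p ^ n"] R.multiplesI[OF wc, of "p ^ n"] by auto
  have "e v = e r"
    unfolding v_def w(2) by (rule ring_hom_simps(4)[OF R.ring_axioms EC.ring_axioms e_hom wc])
  then have i: "r - v \<in> I" using e_eq_iff[OF r(1) v(1)] by simp
  have vS: "\<iota> v \<in> multiples S (p ^ n)" using v(2) by (rule \<iota>_multiples)
  have "b \<ominus>\<^bsub>S\<^esub> \<iota> (r - v) = (b \<ominus>\<^bsub>S\<^esub> \<iota> r) \<oplus>\<^bsub>S\<^esub> \<iota> v"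
  proof -
    have "\<iota> (r - v) = \<iota> r \<ominus>\<^bsub>S\<^esub> \<iota> v" using r(1) v(1) by (simp add: \<iota>_simps)
    then show ?thesis using b(1) rS S.multiples_carrier[OF vS] by (simp add: S.minus_eq S.minus_add S.a_assoc)
  qed
  then have "b \<ominus>\<^bsub>S\<^esub> \<iota> (r - v) \<in> multiples S (p ^ n)" using S.multiples_add[OF r(2) vS] by simp
  with i show ?thesis by blast
qed

lemma loc_generators: "loc (emb (H1 a)) = loc (emb (cst c1))" "loc (emb H2) = loc (emb (cst c2))"
proof -
  have "e (emb (H1 a)) = e (emb (cst c1))" "e (emb H2) = e (emb (cst c2))"
    using I_generators by (simp_all add: e_eq_iff is_homD[OF is_hom_emb])
  then show "loc (emb (H1 a)) = loc (emb (cst c1))" "loc (emb H2) = loc (emb (cst c2))"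
    by (simp_all add: loc_eq)
qed

abbreviation "\<theta> f \<equiv> loc (emb f)"

lemma \<theta>_simps: "\<theta> (f + g) = \<theta> f \<oplus>\<^bsub>Eh\<^esub> \<theta> g" "\<theta> (f * g) = \<theta> f \<otimes>\<^bsub>Eh\<^esub> \<theta> g" "\<theta> 1 = \<one>\<^bsub>Eh\<^esub>"
    "\<theta> 0 = \<zero>\<^bsub>Eh\<^esub>" "\<theta> f \<in> carrier Eh" "\<theta> (f ^ n) = \<theta> f [^]\<^bsub>Eh\<^esub> n"
  by (simp_all add: is_homD[OF is_hom_emb] loc_simps)

lemma loc_eval2_H: "\<theta> (eval2 cst f (H1 a) H2) = \<theta> (cst (eval2 id f c1 c2))"
proof -
  have 1: "\<theta> (eval_hom cst (H1 a) g) = \<theta> (cst (eval_hom id c1 g))" for g :: "'a poly"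
  proof (induction g)
    case 0
    then show ?case by (simp add: is_homD[OF is_hom_eval_hom] is_homD[OF is_hom_cst] eval_hom_def)
  next
    case (pCons c g)
    then show ?case
      by (simp add: eval_hom_pCons \<theta>_simps is_homD[OF is_hom_cst] loc_generators)
  qed
  show ?thesis
    unfolding eval2_eval_hom
  proof (induction f)
    case 0
    then show ?case by (simp add: is_homD[OF is_hom_cst] eval_hom_def)
  next
    case (pCons g f)
    then show ?case
      by (simp add: eval_hom_pCons is_hom_eval_hom \<theta>_simps is_homD[OF is_hom_cst] loc_generators id_def 1[unfolded id_def])
  qed
qed

lemma in_Ehat_eq: "in_Ehat p a c1 c2 f = \<theta> f"
  by (simp add: in_Ehat_def in_Xhat_eq)

abbreviation "base \<equiv> base_E p a c1 c2"

lemma base_eq: "base = range (\<lambda>s. \<theta> (cst s))"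
  by (simp add: base_E_def in_Ehat_eq)

lemma base_closed: "base \<subseteq> carrier Eh"
  by (auto simp: base_eq \<theta>_simps)

lemma loc_unit:
  assumes "u \<in> RR" "v \<in> RR" "u * v = 1" shows "loc u \<in> Units Eh" "inv\<^bsub>Eh\<^esub> (loc u) = loc v"
proof -
  have 1: "loc u \<otimes>\<^bsub>Eh\<^esub> loc v = \<one>\<^bsub>Eh\<^esub>" using assms by (simp add: loc_simps(3,4)[symmetric])
  then show u: "loc u \<in> Units Eh" using assms(1,2)
    by (auto simp: Units_def E.m_comm[of "loc v"] loc_simps(1) intro!: bexI[of _ "loc v"])
  show "inv\<^bsub>Eh\<^esub> (loc u) = loc v"
    by (rule E.comm_inv_char) (use 1 assms(1,2) in \<open>simp_all add: loc_simps\<close>)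
qed

end

section \<open>The Frobenius lift induced on a level set\<close>

locale level_flow = level_set +
  fixes \<delta> :: "'a X_hat \<Rightarrow> 'a X_hat"
  assumes flow: "p_flow \<delta>"
begin

definition \<phi> where "\<phi> = frob p S \<delta>"
abbreviation "\<psi> \<equiv> phi_E p a c1 c2 \<phi>"

lemmas \<phi> = p_flowD[OF flow, folded \<phi>_def]

lemma \<phi>_closed [simp, intro]: "b \<in> carrier S \<Longrightarrow> \<phi> b \<in> carrier S"
  using ring_hom_closed[OF \<phi>(1)] .

lemmas \<phi>_simps = ring_hom_one[OF \<phi>(1)] ring_hom_add[OF \<phi>(1)] ring_hom_mult[OF \<phi>(1)]
  ring_hom_simps[OF S.ring_axioms S.ring_axioms \<phi>(1)]

text \<open>Here c_1 and c_2 have to be p-constants: \<phi> takes H_i - c_i to H_i^p - c_i^p, which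
  vanishes on the level set. The kernel of the composed map is an ideal, so the two generators
  suffice.\<close>

lemma res_\<phi>_ideal:
  assumes "i \<in> I" shows "res (\<phi> (\<iota> i)) = \<zero>\<^bsub>Eh\<^esub>"
proof -
  have h: "(\<lambda>u. res (\<phi> (\<iota> u))) \<in> ring_hom R Eh"
    using ring_hom_trans[OF ring_hom_trans[OF \<iota>_hom \<phi>(1)] res_hom] by (simp add: comp_def)
  let ?J = "a_kernel R Eh (\<lambda>u. res (\<phi> (\<iota> u)))"
  have J: "u \<in> ?J \<longleftrightarrow> u \<in> RR \<and> res (\<phi> (\<iota> u)) = \<zero>\<^bsub>Eh\<^esub>" for u
    by (simp add: a_kernel_def')
  have gen: "emb (h - cst c) \<in> ?J"
    if "\<phi> (\<iota> (emb h)) = \<iota> (emb h) [^]\<^bsub>S\<^esub> p" "the_p_derivation p c = 0" "\<theta> h = \<theta> (cst c)" for h c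
  proof -
    have hc: "\<iota> (emb h) \<in> carrier S" "kA c \<in> carrier S" by (simp_all add: \<iota>_simps)
    have kc: "\<phi> (kA c) = kA c [^]\<^bsub>S\<^esub> p"
    proof -
      have "fr c = c ^ p" using that(2) by simp
      then show ?thesis
        unfolding \<phi>(3) by (simp only: is_homD(7)[OF is_hom_cst] is_homD(7)[OF is_hom_emb] \<iota>_simps(5)[OF emb_RR])
    qed
    have "res (\<phi> (\<iota> (emb (h - cst c)))) = \<theta> h [^]\<^bsub>Eh\<^esub> p \<ominus>\<^bsub>Eh\<^esub> \<theta> (cst c) [^]\<^bsub>Eh\<^esub> p"
    proof -
      have "\<iota> (emb (h - cst c)) = \<iota> (emb h) \<ominus>\<^bsub>S\<^esub> kA c"
        by (simp only: is_homD[OF is_hom_emb] \<iota>_simps emb_RR)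
      then show ?thesis
        by (simp only: \<phi>_simps(5)[OF hc] that(1) kc
            res_simps(5)[OF S.nat_pow_closed S.nat_pow_closed, OF hc] res_simps(6)[OF hc(1)] res_simps(6)[OF hc(2)])
    qed
    then show ?thesis unfolding J that(3) by (simp add: \<theta>_simps)
  qed
  interpret h: ring_hom_ring R Eh "\<lambda>u. res (\<phi> (\<iota> u))"
    by (intro ring_hom_ring.intro ring_hom_ring_axioms.intro h R.ring_axioms E.ring_axioms)
  have "I \<subseteq> ?J"
    by (intro I_minimal h.kernel_is_ideal gen \<phi> c_const loc_generators)
  then show ?thesis using assms J by blast
qed

text \<open>The ideal is dense in the kernel, the maps preserve multiples of p^n, and the target is
  separated.\<close>

lemma res_\<phi>_kernel:
  assumes b: "b \<in> carrier S" "res b = \<zero>\<^bsub>Eh\<^esub>" shows "res (\<phi> b) = \<zero>\<^bsub>Eh\<^esub>"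
proof (rule E.padic_zero)
  fix n
  obtain i where i: "i \<in> I" "b \<ominus>\<^bsub>S\<^esub> \<iota> i \<in> multiples S (p ^ n)" using kernel_approx[OF b] by blast
  have iS: "\<iota> i \<in> carrier S" using I_RR[OF i(1)] by (simp add: \<iota>_simps)
  have "res (\<phi> (b \<ominus>\<^bsub>S\<^esub> \<iota> i)) = res (\<phi> b) \<ominus>\<^bsub>Eh\<^esub> res (\<phi> (\<iota> i))"
    using b iS by (simp add: \<phi>_simps(5) res_simps(5))
  then have "res (\<phi> b) = res (\<phi> (b \<ominus>\<^bsub>S\<^esub> \<iota> i))"
    using b iS by (simp add: res_\<phi>_ideal[OF i(1)])
  then show "res (\<phi> b) \<in> multiples Eh (p ^ n)"
    using res_simps(8)[OF \<phi>_simps(8)[OF i(2)]] by simp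
qed (use b in auto)

text \<open>Preimages of the same function differ by an element of the kernel, so the set under
  \<open>the_elem\<close> in \<open>phi_E\<close> is a singleton.\<close>

lemma \<psi>_res:
  assumes b: "b \<in> carrier S" shows "\<psi> (res b) = res (\<phi> b)"
proof -
  have "res (\<phi> b') = res (\<phi> b)" if "b' \<in> carrier S" "res b' = res b" for b'
  proof -
    have "res (b' \<ominus>\<^bsub>S\<^esub> b) = \<zero>\<^bsub>Eh\<^esub>" using b that by (simp add: res_simps)
    then have "res (\<phi> b') \<ominus>\<^bsub>Eh\<^esub> res (\<phi> b) = \<zero>\<^bsub>Eh\<^esub>"
      using res_\<phi>_kernel[of "b' \<ominus>\<^bsub>S\<^esub> b"] b that by (simp add: res_simps \<phi>_simps)
    then show ?thesis using b that by (simp add: E.a_minus_zero_iff)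
  qed
  then have "(\<lambda>b. res (\<phi> b)) ` {b' \<in> carrier S. res b' = res b} = {res (\<phi> b)}" using b by blast
  then show ?thesis by (simp add: phi_E_def)
qed

lemma \<psi>_hom: "\<psi> \<in> ring_hom Eh Eh"
proof (rule ring_hom_memI)
  fix x y assume "x \<in> carrier Eh" "y \<in> carrier Eh"
  then obtain b b' where b: "b \<in> carrier S" "res b = x" "b' \<in> carrier S" "res b' = y" using res_surj by metis
  show "\<psi> x \<in> carrier Eh" using b(1) unfolding b(2)[symmetric] by (simp add: \<psi>_res)
  have "\<psi> (res (b \<otimes>\<^bsub>S\<^esub> b')) = \<psi> (res b) \<otimes>\<^bsub>Eh\<^esub> \<psi> (res b')"
    using \<psi>_res[OF S.m_closed[OF b(1,3)]] b(1,3) by (simp add: \<psi>_res \<phi>_simps res_simps(3))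
  then show "\<psi> (x \<otimes>\<^bsub>Eh\<^esub> y) = \<psi> x \<otimes>\<^bsub>Eh\<^esub> \<psi> y" using b by (simp add: res_simps)
  have "\<psi> (res (b \<oplus>\<^bsub>S\<^esub> b')) = \<psi> (res b) \<oplus>\<^bsub>Eh\<^esub> \<psi> (res b')"
    using \<psi>_res[OF S.a_closed[OF b(1,3)]] b(1,3) by (simp add: \<psi>_res \<phi>_simps res_simps(2))
  then show "\<psi> (x \<oplus>\<^bsub>Eh\<^esub> y) = \<psi> x \<oplus>\<^bsub>Eh\<^esub> \<psi> y" using b by (simp add: res_simps)
next
  show "\<psi> \<one>\<^bsub>Eh\<^esub> = \<one>\<^bsub>Eh\<^esub>" using \<psi>_res[of "\<one>\<^bsub>S\<^esub>"] by (simp add: \<phi>_simps res_simps)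
qed

lemma \<psi>_frob: "b \<in> carrier S \<Longrightarrow> \<psi> (res b) = res b [^]\<^bsub>Eh\<^esub> p \<oplus>\<^bsub>Eh\<^esub> [p] \<cdot>\<^bsub>Eh\<^esub> res (\<delta> b)"
  using \<phi>(2)[of b] by (simp add: \<psi>_res) (simp add: \<phi>_def frob_def res_simps)

lemma \<psi>_base: "\<psi> (\<theta> (cst s)) = \<theta> (cst (fr s))"
  by (simp add: \<psi>_res \<iota>_simps \<phi>(3))

lemma \<psi>_cong:
  assumes "y \<in> carrier Eh" shows "\<psi> y \<ominus>\<^bsub>Eh\<^esub> y [^]\<^bsub>Eh\<^esub> p \<in> multiples Eh p"
proof -
  obtain b where b: "b \<in> carrier S" "res b = y" using res_surj[OF assms] by blast
  show ?thesis using b(1) \<phi>(2)[OF b(1)] unfolding b(2)[symmetric] \<psi>_frob[OF b(1)]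
    by (simp add: E.add_minus_cancel_left E.multiplesI)
qed

end

section \<open>Forms on a level set\<close>

lemma (in module) smult_add_pow:
  "r \<in> carrier R \<Longrightarrow> x \<in> carrier M \<Longrightarrow> r \<odot>\<^bsub>M\<^esub> ([(k::nat)] \<cdot>\<^bsub>M\<^esub> x) = [k] \<cdot>\<^bsub>M\<^esub> (r \<odot>\<^bsub>M\<^esub> x)"
  by (induction k) (simp_all add: smult_r_distr)

lemma (in module) add_pow_smult:
  "r \<in> carrier R \<Longrightarrow> x \<in> carrier M \<Longrightarrow> ([(k::nat)] \<cdot>\<^bsub>R\<^esub> r) \<odot>\<^bsub>M\<^esub> x = [k] \<cdot>\<^bsub>M\<^esub> (r \<odot>\<^bsub>M\<^esub> x)"
  by (induction k) (simp_all add: smult_l_distr)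

lemma (in module) diff_smult:
  "r \<in> carrier R \<Longrightarrow> s \<in> carrier R \<Longrightarrow> x \<in> carrier M \<Longrightarrow> (r \<ominus> s) \<odot>\<^bsub>M\<^esub> x = r \<odot>\<^bsub>M\<^esub> x \<ominus>\<^bsub>M\<^esub> s \<odot>\<^bsub>M\<^esub> x"
  by (simp add: R.minus_eq M.minus_eq smult_l_distr smult_l_minus)

lemma (in module) multiples_cong_smult:
  assumes "r \<ominus> r' \<in> multiples R m" "x \<ominus>\<^bsub>M\<^esub> x' \<in> multiples M m"
    and [simp]: "r \<in> carrier R" "r' \<in> carrier R" "x \<in> carrier M" "x' \<in> carrier M"
  shows "r \<odot>\<^bsub>M\<^esub> x \<ominus>\<^bsub>M\<^esub> r' \<odot>\<^bsub>M\<^esub> x' \<in> multiples M m"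
proof (rule M.multiples_minus_trans)
  obtain y where y: "y \<in> carrier M" "x \<ominus>\<^bsub>M\<^esub> x' = [m] \<cdot>\<^bsub>M\<^esub> y" using assms(2) by (auto simp: multiples_def)
  then have "r \<odot>\<^bsub>M\<^esub> (x \<ominus>\<^bsub>M\<^esub> x') = [m] \<cdot>\<^bsub>M\<^esub> (r \<odot>\<^bsub>M\<^esub> y)" by (simp add: smult_add_pow)
  then show "r \<odot>\<^bsub>M\<^esub> x \<ominus>\<^bsub>M\<^esub> r \<odot>\<^bsub>M\<^esub> x' \<in> multiples M m"
    using y(1) by (simp add: smult_minus M.multiplesI)
  obtain s where s: "s \<in> carrier R" "r \<ominus> r' = [m] \<cdot>\<^bsub>R\<^esub> s" using assms(1) by (auto simp: multiples_def)
  then have "(r \<ominus> r') \<odot>\<^bsub>M\<^esub> x' = [m] \<cdot>\<^bsub>M\<^esub> (s \<odot>\<^bsub>M\<^esub> x')" by (simp add: add_pow_smult)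
  then show "r \<odot>\<^bsub>M\<^esub> x' \<ominus>\<^bsub>M\<^esub> r' \<odot>\<^bsub>M\<^esub> x' \<in> multiples M m"
    using s(1) by (simp add: diff_smult M.multiplesI)
qed simp_all

context euler_setting
begin

lemma euler_squares:
  "cst A12 * (var 1 * var 1) = H1 a + cst (- a 2) * H2 + cst A23 * (var 3 * var 3)"
  "cst A12 * (var 2 * var 2) = cst (- 1) * H1 a + cst (a 1) * H2 + cst A31 * (var 3 * var 3)"
  unfolding H1_def H2_def sum_1_3
  by (simp_all only: is_homD[OF is_hom_cst]) (simp_all add: algebra_simps power2_eq_square)

text \<open>Differentiating $H_1$ and $H_2$ shows that \<open>D\<close> kills $x_1^2$ and $x_2^2$; here $2$, $x_1$
  and $x_2$ are invertible.\<close>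

lemma derivation_vanishes:
  assumes "module R' T" and h: "h \<in> ring_hom R R'"
    and D: "\<And>u. u \<in> RR \<Longrightarrow> D u \<in> carrier T"
      "\<And>u v. u \<in> RR \<Longrightarrow> v \<in> RR \<Longrightarrow> D (u + v) = D u \<oplus>\<^bsub>T\<^esub> D v"
      "\<And>u v. u \<in> RR \<Longrightarrow> v \<in> RR \<Longrightarrow> D (u * v) = h u \<odot>\<^bsub>T\<^esub> D v \<oplus>\<^bsub>T\<^esub> h v \<odot>\<^bsub>T\<^esub> D u"
    and D0: "\<And>c. D (emb (cst c)) = \<zero>\<^bsub>T\<^esub>" "D X3 = \<zero>\<^bsub>T\<^esub>" "D (emb (H1 a)) = \<zero>\<^bsub>T\<^esub>" "D (emb H2) = \<zero>\<^bsub>T\<^esub>"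
    and u: "u \<in> RR"
  shows "D u = \<zero>\<^bsub>T\<^esub>"
proof -
  interpret T: module R' T by fact
  have hc [simp]: "h u \<in> carrier R'" if "u \<in> RR" for u using ring_hom_closed[OF h] that by simp
  have h_add: "h (u + v) = h u \<oplus>\<^bsub>R'\<^esub> h v" and h_mult: "h (u * v) = h u \<otimes>\<^bsub>R'\<^esub> h v"
    if "u \<in> RR" "v \<in> RR" for u v
    using ring_hom_add[OF h] ring_hom_mult[OF h] that by simp_all
  have h1: "h 1 = \<one>\<^bsub>R'\<^esub>" using ring_hom_one[OF h] by simp
  have zero_mult: "D (u * v) = \<zero>\<^bsub>T\<^esub>" and zero_add: "D (u + v) = \<zero>\<^bsub>T\<^esub>"
    if "D u = \<zero>\<^bsub>T\<^esub>" "D v = \<zero>\<^bsub>T\<^esub>" "u \<in> RR" "v \<in> RR" for u v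
    using that by (simp_all add: D)
  have cancel: "D w = \<zero>\<^bsub>T\<^esub>" if "h u \<odot>\<^bsub>T\<^esub> D w = \<zero>\<^bsub>T\<^esub>" "u * v = 1" "u \<in> RR" "v \<in> RR" "w \<in> RR" for u v w
  proof -
    have 1: "h (v * u) \<odot>\<^bsub>T\<^esub> D w = h v \<odot>\<^bsub>T\<^esub> (h u \<odot>\<^bsub>T\<^esub> D w)"
      unfolding h_mult[OF that(4,3)] by (rule T.smult_assoc1) (use that D(1) in simp_all)
    have "v * u = 1" using that(2) by (simp add: mult.commute)
    then show ?thesis using 1 that(4) D(1)[OF that(5)] by (simp add: h1 that(1))
  qed
  \<comment> \<open>Writing x for the variable and k = a_1 - a_2, one has D(k x^2) = 2 k x D x. As
    k, 2 and x are units on X, D x vanishes together with D(k x^2), and \<open>euler_squares\<close>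
    expresses k x^2 through H_1, H_2 and x_3.\<close>
  have square: "D (emb (var i)) = \<zero>\<^bsub>T\<^esub>"
    if i: "i = 1 \<or> i = 2" and z: "D (emb (cst A12 * (var i * var i))) = \<zero>\<^bsub>T\<^esub>" for i
  proof -
    define x where "x = emb (var i)"
    define k where "k = emb (cst A12)"
    have xk: "x \<in> RR" "k \<in> RR" by (simp_all add: x_def k_def)
    have two: "(1 + 1 :: 'a) dvd 1" using two_unit by (simp only: one_add_one)
    have "unit_poly (cst A12 * (cst (1 + 1) * var i))"
      using i unit_polys by (intro unit_poly_mult unit_poly_cst a_units two) auto
    then obtain v where v: "v \<in> RR" "emb (cst A12 * (cst (1 + 1) * var i)) * v = 1" by (auto simp only: unit_poly_def)
    have "emb (cst A12 * (cst (1 + 1) * var i)) = k * (x + x)"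
      unfolding k_def x_def
      by (simp only: is_homD(1,2)[OF is_hom_cst] is_homD(2,3)[OF is_hom_emb] distrib_right mult_1)
    then have kx: "k * (x + x) * v = 1" using v(2) by (simp only:)
    note xx = RR_add[OF xk(1,1)]
    have Dxx: "D (x * x) = h (x + x) \<odot>\<^bsub>T\<^esub> D x"
      unfolding h_add[OF xk(1,1)] D(3)[OF xk(1,1)]
      by (rule T.smult_l_distr[symmetric]) (intro hc D(1) xk)+
    have "D (k * (x * x)) = h k \<odot>\<^bsub>T\<^esub> D (x * x)"
      using xk D(3)[OF xk(2) RR_mult[OF xk(1,1)]] by (simp add: k_def D0 D(1) RR_mult)
    also have "\<dots> = h (k * (x + x)) \<odot>\<^bsub>T\<^esub> D x"
      unfolding Dxx h_mult[OF xk(2) xx] by (rule T.smult_assoc1[symmetric]) (intro hc D(1) xk xx)+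
    finally have e: "D (k * (x * x)) = h (k * (x + x)) \<odot>\<^bsub>T\<^esub> D x" .
    have "D (k * (x * x)) = \<zero>\<^bsub>T\<^esub>" using z by (simp only: k_def x_def is_homD(3)[OF is_hom_emb])
    then have "h (k * (x + x)) \<odot>\<^bsub>T\<^esub> D x = \<zero>\<^bsub>T\<^esub>" by (simp only: e)
    from cancel[OF this kx RR_mult[OF xk(2) xx] v(1) xk(1)] show ?thesis unfolding x_def .
  qed
  have x1: "D (emb (var 1)) = \<zero>\<^bsub>T\<^esub>"
    by (rule square) (simp_all only: euler_squares is_homD[OF is_hom_emb], auto intro!: zero_add zero_mult D0 RR_mult RR_add emb_RR)
  have x2: "D (emb (var 2)) = \<zero>\<^bsub>T\<^esub>"
    by (rule square) (simp_all only: euler_squares is_homD[OF is_hom_emb], auto intro!: zero_add zero_mult D0 RR_mult RR_add emb_RR)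
  show ?thesis using u
  proof (induction rule: RR_induct)
    case (var i)
    then show ?case using x1 x2 D0(2) by auto
  next
    case Qinv
    have "D (emb Q * Qinv) = \<zero>\<^bsub>T\<^esub>"
      unfolding emb_Q_Qinv using D0(1)[of 1] by (simp add: is_homD[OF is_hom_cst] is_homD[OF is_hom_emb])
    then have "h (emb Q) \<odot>\<^bsub>T\<^esub> D Qinv = \<zero>\<^bsub>T\<^esub>"
      using D(3)[of "emb Q" Qinv] Qinv D(1)[of Qinv] by simp
    then show ?case by (rule cancel[OF _ emb_Q_Qinv]) simp_all
  qed (use D0 zero_add zero_mult in auto)
qed

definition b3inv :: "'a poly poly poly fract"
  where "b3inv = inverse b3"

lemma b3inv: "b3 * b3inv = 1" "b3inv \<in> RR"
proof -
  have "unit_poly (cst A12 * (var 1 * var 2))"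
    by (intro unit_poly_mult unit_poly_cst a_units unit_polys)
  then obtain v where v: "v \<in> RR" "b3 * v = 1" by (auto simp: unit_poly_def)
  then have "b3inv = v" unfolding b3inv_def by (metis inverse_unique)
  with v show "b3 * b3inv = 1" "b3inv \<in> RR" by simp_all
qed

end

context level_set
begin

abbreviation "\<Omega> \<equiv> kahler Eh base"
abbreviation "dE \<equiv> kahler_d Eh base"

sublocale W: module Eh \<Omega>
  by (rule E.kahler_module[OF base_closed])

lemmas dE = E.kahler_d[OF base_closed]

lemma dE_hom: "dE \<in> hom (add_monoid Eh) (add_monoid \<Omega>)"
  by (auto simp: hom_def dE)

lemma dE_pow:
  assumes "x \<in> carrier Eh"
  shows "dE (x [^]\<^bsub>Eh\<^esub> Suc n) = [Suc n] \<cdot>\<^bsub>\<Omega>\<^esub> (x [^]\<^bsub>Eh\<^esub> n \<odot>\<^bsub>\<Omega>\<^esub> dE x)"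
proof (induction n)
  case 0
  then show ?case using assms by (simp add: dE)
next
  case (Suc n)
  have "dE (x [^]\<^bsub>Eh\<^esub> Suc n \<otimes>\<^bsub>Eh\<^esub> x) =
      x [^]\<^bsub>Eh\<^esub> Suc n \<odot>\<^bsub>\<Omega>\<^esub> dE x \<oplus>\<^bsub>\<Omega>\<^esub> x \<odot>\<^bsub>\<Omega>\<^esub> ([Suc n] \<cdot>\<^bsub>\<Omega>\<^esub> (x [^]\<^bsub>Eh\<^esub> n \<odot>\<^bsub>\<Omega>\<^esub> dE x))"
    by (subst dE(3)) (use assms Suc in \<open>simp_all del: E.nat_pow_Suc\<close>)
  also have "x \<odot>\<^bsub>\<Omega>\<^esub> ([Suc n] \<cdot>\<^bsub>\<Omega>\<^esub> (x [^]\<^bsub>Eh\<^esub> n \<odot>\<^bsub>\<Omega>\<^esub> dE x)) = [Suc n] \<cdot>\<^bsub>\<Omega>\<^esub> (x \<odot>\<^bsub>\<Omega>\<^esub> (x [^]\<^bsub>Eh\<^esub> n \<odot>\<^bsub>\<Omega>\<^esub> dE x))"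
    by (rule W.smult_add_pow) (use assms dE(1) in simp_all)
  also have "x \<odot>\<^bsub>\<Omega>\<^esub> (x [^]\<^bsub>Eh\<^esub> n \<odot>\<^bsub>\<Omega>\<^esub> dE x) = x [^]\<^bsub>Eh\<^esub> Suc n \<odot>\<^bsub>\<Omega>\<^esub> dE x"
    using assms dE(1) by (simp add: W.smult_assoc1[symmetric] E.m_comm)
  finally show ?case using assms dE(1)[OF assms] by (simp add: W.M.a_comm)
qed

lemma dE_add_pow: "x \<in> carrier Eh \<Longrightarrow> dE ([(k::nat)] \<cdot>\<^bsub>Eh\<^esub> x) = [k] \<cdot>\<^bsub>\<Omega>\<^esub> dE x"
  by (rule additive_hom_add_pow[OF E.abelian_group_axioms W.M.abelian_group_axioms dE_hom])

abbreviation "bi \<equiv> loc b3inv"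
abbreviation "x3 \<equiv> loc X3"

definition "\<omega>0 = bi \<odot>\<^bsub>\<Omega>\<^esub> dE x3"

lemma loc_closed [simp]: "u \<in> RR \<Longrightarrow> loc u \<in> carrier Eh"
  by (rule loc_simps)

lemma bi_closed [simp]: "bi \<in> carrier Eh" and \<omega>0_closed [simp]: "\<omega>0 \<in> carrier \<Omega>"
  using b3inv by (simp_all add: \<omega>0_def dE)

text \<open>The difference of the two sides is a derivation into the module of forms. It kills H_1
  and H_2, which are constant on the level set and first integrals of \<open>dd\<close>, and it
  kills x_3 by the choice \<omega> = dx_3 / \<delta>^cl x_3. So \<open>derivation_vanishes\<close>
  applies. Nothing is claimed for functions in the completed ring.\<close>

lemma dE_loc:
  assumes u: "u \<in> RR" shows "dE (loc u) = loc (dd u) \<odot>\<^bsub>\<Omega>\<^esub> \<omega>0"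
proof -
  define \<Delta> where "\<Delta> u = dE (loc u) \<ominus>\<^bsub>\<Omega>\<^esub> loc (dd u) \<odot>\<^bsub>\<Omega>\<^esub> \<omega>0" for u
  have h: "loc \<in> ring_hom R Eh"
    using ring_hom_trans[OF \<iota>_hom res_hom] by (simp add: comp_def)
  have d_closed: "dE (loc u) \<in> carrier \<Omega>" if "u \<in> RR" for u using that by (simp add: dE)
  have "\<Delta> u = \<zero>\<^bsub>\<Omega>\<^esub>"
  proof (rule derivation_vanishes[OF W.module_axioms h _ _ _ _ _ _ _ u])
    fix u v assume uv: "u \<in> RR" "v \<in> RR"
    show "\<Delta> u \<in> carrier \<Omega>" using uv by (simp add: \<Delta>_def d_closed dd_RR)
    show "\<Delta> (u + v) = \<Delta> u \<oplus>\<^bsub>\<Omega>\<^esub> \<Delta> v"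
      using uv by (simp add: \<Delta>_def loc_simps dd dd_RR dE d_closed W.smult_l_distr W.M.minus_plus_minus)
    have "loc u \<odot>\<^bsub>\<Omega>\<^esub> \<Delta> v \<oplus>\<^bsub>\<Omega>\<^esub> loc v \<odot>\<^bsub>\<Omega>\<^esub> \<Delta> u =
        (loc u \<odot>\<^bsub>\<Omega>\<^esub> dE (loc v) \<ominus>\<^bsub>\<Omega>\<^esub> loc u \<odot>\<^bsub>\<Omega>\<^esub> (loc (dd v) \<odot>\<^bsub>\<Omega>\<^esub> \<omega>0)) \<oplus>\<^bsub>\<Omega>\<^esub>
        (loc v \<odot>\<^bsub>\<Omega>\<^esub> dE (loc u) \<ominus>\<^bsub>\<Omega>\<^esub> loc v \<odot>\<^bsub>\<Omega>\<^esub> (loc (dd u) \<odot>\<^bsub>\<Omega>\<^esub> \<omega>0))"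
      using uv by (simp add: \<Delta>_def W.smult_minus d_closed dd_RR)
    also have "\<dots> = (loc u \<odot>\<^bsub>\<Omega>\<^esub> dE (loc v) \<oplus>\<^bsub>\<Omega>\<^esub> loc v \<odot>\<^bsub>\<Omega>\<^esub> dE (loc u)) \<ominus>\<^bsub>\<Omega>\<^esub>
        (loc u \<odot>\<^bsub>\<Omega>\<^esub> (loc (dd v) \<odot>\<^bsub>\<Omega>\<^esub> \<omega>0) \<oplus>\<^bsub>\<Omega>\<^esub> loc v \<odot>\<^bsub>\<Omega>\<^esub> (loc (dd u) \<odot>\<^bsub>\<Omega>\<^esub> \<omega>0))"
      by (rule W.M.minus_plus_minus[symmetric]) (use uv in \<open>simp_all add: d_closed dd_RR\<close>)
    also have "\<dots> = \<Delta> (u * v)"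
      using uv by (simp add: \<Delta>_def loc_simps dd dd_RR RR_mult dE d_closed W.smult_l_distr W.smult_assoc1)
    finally show "\<Delta> (u * v) = loc u \<odot>\<^bsub>\<Omega>\<^esub> \<Delta> v \<oplus>\<^bsub>\<Omega>\<^esub> loc v \<odot>\<^bsub>\<Omega>\<^esub> \<Delta> u" ..
  next
    have d_cst: "dE (\<theta> (cst c)) = \<zero>\<^bsub>\<Omega>\<^esub>" for c by (rule dE) (auto simp: base_eq)
    then show "\<Delta> (emb (cst c)) = \<zero>\<^bsub>\<Omega>\<^esub>" for c by (simp add: \<Delta>_def loc_simps)
    show "\<Delta> (emb (H1 a)) = \<zero>\<^bsub>\<Omega>\<^esub>" "\<Delta> (emb H2) = \<zero>\<^bsub>\<Omega>\<^esub>"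
      by (simp_all add: \<Delta>_def loc_generators d_cst dd_emb euler_derivation_H is_homD[OF is_hom_emb] loc_simps)
    have "loc b3 \<odot>\<^bsub>\<Omega>\<^esub> \<omega>0 = loc (b3 * b3inv) \<odot>\<^bsub>\<Omega>\<^esub> dE x3"
      unfolding loc_simps(3)[OF emb_RR b3inv(2)] \<omega>0_def
      by (rule W.smult_assoc1[symmetric]) (simp_all add: b3inv d_closed)
    then have b: "loc b3 \<odot>\<^bsub>\<Omega>\<^esub> \<omega>0 = dE x3"
      unfolding b3inv(1) by (simp only: loc_simps(4) W.smult_one d_closed[OF emb_RR])
    show "\<Delta> X3 = \<zero>\<^bsub>\<Omega>\<^esub>"
      unfolding \<Delta>_def dd_X3 b by (rule W.M.a_minus_self[OF d_closed[OF emb_RR]])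
  qed
  then show ?thesis
    using W.M.a_minus_zero_iff[of "dE (loc u)" "loc (dd u) \<odot>\<^bsub>\<Omega>\<^esub> \<omega>0"] d_closed[OF u] dd_RR[OF u]
    by (simp add: \<Delta>_def)
qed

abbreviation "\<Omega>E \<equiv> Omega_E p a c1 c2"

sublocale WC: additive_completion \<Omega> p \<Omega>E
  unfolding Omega_E_def by (rule padic_completion_module_additive[OF W.M.abelian_group_axioms])

lemma to_completion_form: "to_completion p \<Omega> y = WC.Pl (\<lambda>_. y)"
  by (simp add: to_completion_def padic_lim_def)

lemma smult_form:
  "r \<in> carrier Eh \<Longrightarrow> y \<in> carrier \<Omega> \<Longrightarrow> r \<odot>\<^bsub>\<Omega>E\<^esub> to_completion p \<Omega> y = to_completion p \<Omega> (r \<odot>\<^bsub>\<Omega>\<^esub> y)"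
  unfolding Omega_E_def by (rule W.padic_completion_module_smult_const)

lemma omega_eq: "omega_E p a c1 c2 = to_completion p \<Omega> \<omega>0"
proof -
  have "inv\<^bsub>Eh\<^esub> (in_Ehat p a c1 c2 (cst A12 * var 1 * var 2)) = bi"
    unfolding in_Ehat_eq mult.assoc by (rule loc_unit(2)[OF emb_RR b3inv(2,1)])
  then show ?thesis
    unfolding omega_E_def d_E_def \<omega>0_def by (simp add: in_Ehat_eq smult_form dE)
qed

lemma hasse_inverse:
  "in_Ehat p a c1 c2 (cst (inv\<^bsub>ring_of_type_algebra\<^esub> eval2 id (hasse p a) c1 c2)) = loc AHinv"
proof -
  define A where "A = eval2 id (hasse p a) c1 c2"
  have "\<not> \<pi> dvd A" using c_regular by (auto simp: A_def)
  then obtain B where B: "1 = A * B" using unitI by (auto simp: dvd_def)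
  interpret T: cring "ring_of_type_algebra :: 'a ring" by (rule cring_from_type_algebra)
  have inv: "inv\<^bsub>ring_of_type_algebra\<^esub> A = B" by (rule T.comm_inv_char) (simp_all add: B)
  have 1: "\<theta> (cst A) \<otimes>\<^bsub>Eh\<^esub> \<theta> (cst B) = \<one>\<^bsub>Eh\<^esub>"
    by (simp only: \<theta>_simps(2,3)[symmetric] is_homD(3)[OF is_hom_cst, symmetric] B[symmetric] is_homD(1)[OF is_hom_cst])
  have 2: "\<theta> (cst A) \<otimes>\<^bsub>Eh\<^esub> loc AHinv = \<one>\<^bsub>Eh\<^esub>"
    unfolding A_def loc_eval2_H[symmetric] using AHinv by (simp add: loc_simps(3,4)[symmetric])
  have "inv\<^bsub>Eh\<^esub> (\<theta> (cst A)) = \<theta> (cst B)" "inv\<^bsub>Eh\<^esub> (\<theta> (cst A)) = loc AHinv"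
    by (rule E.comm_inv_char, use 1 2 AHinv in \<open>simp_all add: loc_simps\<close>)+
  then show ?thesis unfolding A_def[symmetric] inv in_Ehat_eq by simp
qed

end

section \<open>The pullback of \<omega> divided by p\<close>

context level_flow
begin

sublocale PB: semilinear_derivation Eh Eh \<Omega> base \<psi> "\<lambda>g. dE (\<psi> g)"
proof (intro semilinear_derivation.intro semilinear_derivation_axioms.intro)
  have c: "\<psi> g \<in> carrier Eh" if "g \<in> carrier Eh" for g using ring_hom_closed[OF \<psi>_hom that] .
  show "dE (\<psi> g) \<in> carrier \<Omega>" if "g \<in> carrier Eh" for g using c[OF that] by (rule dE)
  show "dE (\<psi> (g \<oplus>\<^bsub>Eh\<^esub> h)) = dE (\<psi> g) \<oplus>\<^bsub>\<Omega>\<^esub> dE (\<psi> h)" if "g \<in> carrier Eh" "h \<in> carrier Eh" for g h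
    using c that by (simp add: ring_hom_add[OF \<psi>_hom] dE)
  show "dE (\<psi> (g \<otimes>\<^bsub>Eh\<^esub> h)) = \<psi> g \<odot>\<^bsub>\<Omega>\<^esub> dE (\<psi> h) \<oplus>\<^bsub>\<Omega>\<^esub> \<psi> h \<odot>\<^bsub>\<Omega>\<^esub> dE (\<psi> g)"
    if "g \<in> carrier Eh" "h \<in> carrier Eh" for g h
    using c that by (simp add: ring_hom_mult[OF \<psi>_hom] dE)
  show "dE (\<psi> s) = \<zero>\<^bsub>\<Omega>\<^esub>" if s: "s \<in> base" for s
  proof -
    obtain c where c: "s = \<theta> (cst c)" using s by (auto simp: base_eq)
    have "\<theta> (cst (fr c)) \<in> base" by (auto simp: base_eq)
    then show ?thesis unfolding c \<psi>_base by (rule dE(4))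
  qed
qed (rule E.cring_axioms W.module_axioms base_closed \<psi>_hom)+

definition "f3 = res (\<delta> (\<iota> X3))"

text \<open>The pullback of \<omega> divided by p, before the module is completed: the differential
  of \<phi>(x_3) = x_3^p + p \<delta> x_3 is p times x_3^{p-1} dx_3 + d(\<delta> x_3).\<close>

definition "\<eta>0 = \<psi> bi \<odot>\<^bsub>\<Omega>\<^esub> (x3 [^]\<^bsub>Eh\<^esub> (p - 1) \<odot>\<^bsub>\<Omega>\<^esub> dE x3 \<oplus>\<^bsub>\<Omega>\<^esub> dE f3)"

lemma f3_closed [simp]: "f3 \<in> carrier Eh"
  unfolding f3_def by (intro res_closed \<phi>(2)) (simp add: \<iota>_simps)

lemma \<psi>_bi_closed [simp]: "\<psi> bi \<in> carrier Eh"
  using ring_hom_closed[OF \<psi>_hom bi_closed] .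

lemma \<eta>0_closed [simp]: "\<eta>0 \<in> carrier \<Omega>"
  by (simp add: \<eta>0_def dE)

lemma lift_\<omega>0: "PB.lift \<omega>0 = [p] \<cdot>\<^bsub>\<Omega>\<^esub> \<eta>0"
proof -
  have sp: "Suc (p - 1) = p" using prime_gt_0_nat[OF p_prime] by simp
  have x3: "dE x3 \<in> carrier \<Omega>" "dE f3 \<in> carrier \<Omega>" by (simp_all add: dE)
  have "\<psi> x3 = x3 [^]\<^bsub>Eh\<^esub> p \<oplus>\<^bsub>Eh\<^esub> [p] \<cdot>\<^bsub>Eh\<^esub> f3"
    unfolding f3_def by (rule \<psi>_frob) (simp add: \<iota>_simps)
  then have "dE (\<psi> x3) = dE (x3 [^]\<^bsub>Eh\<^esub> p) \<oplus>\<^bsub>\<Omega>\<^esub> [p] \<cdot>\<^bsub>\<Omega>\<^esub> dE f3"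
    by (simp add: dE dE_add_pow)
  also have "dE (x3 [^]\<^bsub>Eh\<^esub> p) = [p] \<cdot>\<^bsub>\<Omega>\<^esub> (x3 [^]\<^bsub>Eh\<^esub> (p - 1) \<odot>\<^bsub>\<Omega>\<^esub> dE x3)"
    by (rule dE_pow[of x3 "p - 1", unfolded sp]) simp
  also have "\<dots> \<oplus>\<^bsub>\<Omega>\<^esub> [p] \<cdot>\<^bsub>\<Omega>\<^esub> dE f3 = [p] \<cdot>\<^bsub>\<Omega>\<^esub> (x3 [^]\<^bsub>Eh\<^esub> (p - 1) \<odot>\<^bsub>\<Omega>\<^esub> dE x3 \<oplus>\<^bsub>\<Omega>\<^esub> dE f3)"
    by (rule W.M.add.nat_pow_distrib[symmetric]) (simp_all add: x3)
  finally have d: "dE (\<psi> x3) = \<dots>" .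
  have "PB.lift \<omega>0 = \<psi> bi \<odot>\<^bsub>\<Omega>\<^esub> dE (\<psi> x3)"
    unfolding \<omega>0_def by (simp add: PB.lift_smult PB.lift_d x3)
  then show ?thesis unfolding d \<eta>0_def using x3 by (simp add: W.smult_add_pow)
qed

lemma pullback_eq:
  "pullback_E p a c1 c2 \<psi> (omega_E p a c1 c2) = to_completion p \<Omega> ([p] \<cdot>\<^bsub>\<Omega>\<^esub> \<eta>0)"
proof -
  have "pullback_E p a c1 c2 \<psi> (omega_E p a c1 c2) = completion_map p \<Omega> PB.lift (WC.Pl (\<lambda>_. \<omega>0))"
    by (simp add: pullback_E_def kahler_pullback_lift omega_eq to_completion_form)
  also have "\<dots> = WC.Pl (\<lambda>_. PB.lift \<omega>0)"
    by (rule completion_map_lim[OF W.M.abelian_group_axioms W.M.abelian_group_axioms PB.lift_hom]) simp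
  finally show ?thesis by (simp add: lift_\<omega>0 to_completion_form)
qed

text \<open>The differential of \<delta> x_3 is not given by \<open>dE_loc\<close>, since \<delta>
  x_3 lies in the completed ring. Modulo p it may be replaced by that of a fraction r, for which
  \<open>dE_loc\<close> holds, and \<phi>(1/b) by 1/b^p.\<close>

lemma \<eta>0_cong:
  assumes r: "r \<in> RR" and \<delta>r: "\<delta> (\<iota> X3) \<ominus>\<^bsub>S\<^esub> \<iota> r \<in> multiples S p"
  shows "\<eta>0 \<ominus>\<^bsub>\<Omega>\<^esub> loc (b3inv ^ p * (X3 ^ (p - 1) * b3 + dd r)) \<odot>\<^bsub>\<Omega>\<^esub> \<omega>0 \<in> multiples \<Omega> p"
proof -
  define y where "y = X3 ^ (p - 1) * b3 + dd r"
  have y: "y \<in> RR" using dd_RR[OF r] by (simp add: y_def RR_add RR_mult RR_power)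
  have dX: "\<delta> (\<iota> X3) \<in> carrier S" by (rule \<phi>(2)) (simp add: \<iota>_simps)
  obtain s where s: "s \<in> carrier S" "\<delta> (\<iota> X3) \<ominus>\<^bsub>S\<^esub> \<iota> r = [p] \<cdot>\<^bsub>S\<^esub> s" using \<delta>r by (auto simp: multiples_def)
  have rS: "\<iota> r \<in> carrier S" using r by (simp add: \<iota>_simps)
  have "f3 \<ominus>\<^bsub>Eh\<^esub> loc r = [p] \<cdot>\<^bsub>Eh\<^esub> res s"
    using res_simps(5)[OF dX rS] s by (simp add: f3_def res_simps(7))
  then have "dE f3 \<ominus>\<^bsub>\<Omega>\<^esub> dE (loc r) = [p] \<cdot>\<^bsub>\<Omega>\<^esub> dE (res s)"
    using r s(1) additive_hom_minus[OF E.abelian_group_axioms W.M.abelian_group_axioms dE_hom f3_closed loc_closed[OF r]]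
    by (simp add: dE_add_pow)
  then have 1: "dE f3 \<ominus>\<^bsub>\<Omega>\<^esub> loc (dd r) \<odot>\<^bsub>\<Omega>\<^esub> \<omega>0 \<in> multiples \<Omega> p"
    using dE(1)[OF res_closed[OF s(1)]] by (simp add: dE_loc[OF r] W.M.multiplesI)
  have xy: "loc y \<odot>\<^bsub>\<Omega>\<^esub> \<omega>0 = x3 [^]\<^bsub>Eh\<^esub> (p - 1) \<odot>\<^bsub>\<Omega>\<^esub> dE x3 \<oplus>\<^bsub>\<Omega>\<^esub> loc (dd r) \<odot>\<^bsub>\<Omega>\<^esub> \<omega>0"
    unfolding y_def dE_loc[OF emb_RR] dd_X3 using dd_RR[OF r]
    by (simp add: loc_simps RR_mult RR_power W.smult_l_distr W.smult_assoc1)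
  have 2: "(x3 [^]\<^bsub>Eh\<^esub> (p - 1) \<odot>\<^bsub>\<Omega>\<^esub> dE x3 \<oplus>\<^bsub>\<Omega>\<^esub> dE f3) \<ominus>\<^bsub>\<Omega>\<^esub> loc y \<odot>\<^bsub>\<Omega>\<^esub> \<omega>0 \<in> multiples \<Omega> p"
  proof -
    have "(z \<oplus>\<^bsub>\<Omega>\<^esub> u) \<ominus>\<^bsub>\<Omega>\<^esub> (z \<oplus>\<^bsub>\<Omega>\<^esub> v) = u \<ominus>\<^bsub>\<Omega>\<^esub> v"
      if "z \<in> carrier \<Omega>" "u \<in> carrier \<Omega>" "v \<in> carrier \<Omega>" for z u v
      using that W.M.minus_plus_minus[of z u z v] by simp
    then show ?thesis using 1 dd_RR[OF r] unfolding xy by (simp add: dE)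
  qed
  have 3: "\<psi> bi \<ominus>\<^bsub>Eh\<^esub> loc (b3inv ^ p) \<in> multiples Eh p"
    using \<psi>_cong[OF bi_closed] b3inv by (simp add: loc_simps)
  have "\<eta>0 \<ominus>\<^bsub>\<Omega>\<^esub> loc (b3inv ^ p) \<odot>\<^bsub>\<Omega>\<^esub> (loc y \<odot>\<^bsub>\<Omega>\<^esub> \<omega>0) \<in> multiples \<Omega> p"
    unfolding \<eta>0_def by (rule W.multiples_cong_smult[OF 3 2]) (use y b3inv in \<open>simp_all add: dE RR_power\<close>)
  moreover have "loc (b3inv ^ p) \<odot>\<^bsub>\<Omega>\<^esub> (loc y \<odot>\<^bsub>\<Omega>\<^esub> \<omega>0) = loc (b3inv ^ p * y) \<odot>\<^bsub>\<Omega>\<^esub> \<omega>0"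
    using y b3inv by (simp add: loc_simps(3) RR_power W.smult_assoc1)
  ultimately show ?thesis by (simp add: y_def)
qed

definition flow_condition :: bool
  where "flow_condition \<longleftrightarrow> (\<exists>\<eta>\<in>carrier \<Omega>E. [p] \<cdot>\<^bsub>\<Omega>E\<^esub> \<eta> = pullback_E p a c1 c2 \<psi> (omega_E p a c1 c2) \<and>
    cong_mod p \<Omega>E \<eta> (in_Ehat p a c1 c2 (cst (inv\<^bsub>ring_of_type_algebra\<^esub> eval2 id (hasse p a) c1 c2))
      \<odot>\<^bsub>\<Omega>E\<^esub> omega_E p a c1 c2))"

lemma flow_condition_eq:
  "flow_condition \<longleftrightarrow> (\<exists>\<eta>\<in>carrier \<Omega>E. [p] \<cdot>\<^bsub>\<Omega>E\<^esub> \<eta> = to_completion p \<Omega> ([p] \<cdot>\<^bsub>\<Omega>\<^esub> \<eta>0) \<and>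
    \<eta> \<ominus>\<^bsub>\<Omega>E\<^esub> to_completion p \<Omega> (loc AHinv \<odot>\<^bsub>\<Omega>\<^esub> \<omega>0) \<in> multiples \<Omega>E p)"
  unfolding flow_condition_def pullback_eq
  unfolding hasse_inverse cong_mod_def omega_eq
  using AHinv(2) by (simp add: smult_form)

lemma form_multiples_iff:
  assumes "WC.Cy t" "z \<in> carrier \<Omega>"
  shows "WC.Pl t \<ominus>\<^bsub>\<Omega>E\<^esub> to_completion p \<Omega> z \<in> multiples \<Omega>E (p ^ n) \<longleftrightarrow> t n \<ominus>\<^bsub>\<Omega>\<^esub> z \<in> multiples \<Omega> (p ^ n)"
  unfolding to_completion_form using assms
  by (simp add: WC.Lim_minus WC.Lim_multiples_iff[OF W.M.cauchy_minus[OF assms(1) W.M.cauchy_const[OF assms(2)]]])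

text \<open>The origin of the flow equation: if \<delta>^cl r is \<open>flow_rhs\<close> plus v, the
  coefficient of \<omega> in \<open>\<eta>0\<close> modulo p is the inverse Hasse invariant plus
  b^{-p} v. So the condition on the level set is a condition on v modulo p.\<close>

lemma flow_rhs_b3: "b3inv ^ p * (X3 ^ (p - 1) * b3 + (flow_rhs + v)) = AHinv + b3inv ^ p * v"
proof -
  have "b3inv ^ p * b3 ^ p = 1" using b3inv(1) by (simp add: power_mult_distrib[symmetric] mult.commute)
  then have "b3inv ^ p * (AHinv * b3 ^ p) = AHinv" by (metis mult.assoc mult.commute mult.right_neutral)
  then show ?thesis by (simp add: flow_rhs_def algebra_simps)
qed

text \<open>The image of \<open>\<eta>0\<close> in the completed module serves as the required
  form.\<close>

lemma flow_conditionI: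
  assumes r: "r \<in> RR" and \<delta>r: "\<delta> (\<iota> X3) \<ominus>\<^bsub>S\<^esub> \<iota> r \<in> multiples S p"
    and eq: "dd r - flow_rhs \<in> multiples R p"
  shows flow_condition
  unfolding flow_condition_eq
proof (intro bexI conjI)
  define v where "v = dd r - flow_rhs"
  define g where "g = b3inv ^ p * (X3 ^ (p - 1) * b3 + dd r)"
  have v: "v \<in> multiples R p" "v \<in> RR" using eq dd_RR[OF r] flow_rhs_RR by (simp_all add: v_def RR_diff)
  have g: "g \<in> RR" using b3inv dd_RR[OF r] by (simp add: g_def RR_add RR_mult RR_power)
  have "g = AHinv + b3inv ^ p * v" using flow_rhs_b3[of v] by (simp add: g_def v_def)
  then have "g - AHinv \<in> multiples R p"
    using R.multiples_mult_left[OF v(1), of "b3inv ^ p"] b3inv by (simp add: RR_power)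
  then have "\<iota> (g - AHinv) \<in> multiples S p" by (rule \<iota>_multiples)
  then have "loc g \<ominus>\<^bsub>Eh\<^esub> loc AHinv \<in> multiples Eh p"
    using res_simps(8)[of "\<iota> (g - AHinv)" p] g AHinv(2) by (simp add: \<iota>_simps res_simps)
  then have "loc g \<odot>\<^bsub>\<Omega>\<^esub> \<omega>0 \<ominus>\<^bsub>\<Omega>\<^esub> loc AHinv \<odot>\<^bsub>\<Omega>\<^esub> \<omega>0 \<in> multiples \<Omega> p"
    using g AHinv(2) by (intro W.multiples_cong_smult) simp_all
  then have "\<eta>0 \<ominus>\<^bsub>\<Omega>\<^esub> loc AHinv \<odot>\<^bsub>\<Omega>\<^esub> \<omega>0 \<in> multiples \<Omega> p"
    by (rule W.M.multiples_minus_trans[OF \<eta>0_cong[OF r \<delta>r, folded g_def]]) (use g AHinv(2) in simp_all)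
  then show "to_completion p \<Omega> \<eta>0 \<ominus>\<^bsub>\<Omega>E\<^esub> to_completion p \<Omega> (loc AHinv \<odot>\<^bsub>\<Omega>\<^esub> \<omega>0) \<in> multiples \<Omega>E p"
    using form_multiples_iff[of "\<lambda>_. \<eta>0" "loc AHinv \<odot>\<^bsub>\<Omega>\<^esub> \<omega>0" 1] AHinv(2) by (simp add: to_completion_form)
  show "to_completion p \<Omega> \<eta>0 \<in> carrier \<Omega>E" by (simp add: to_completion_form)
  show "[p] \<cdot>\<^bsub>\<Omega>E\<^esub> to_completion p \<Omega> \<eta>0 = to_completion p \<Omega> ([p] \<cdot>\<^bsub>\<Omega>\<^esub> \<eta>0)"
    by (simp add: to_completion_form WC.Lim_add_pow)
qed

text \<open>The form \<eta> of the condition could differ from \<open>\<eta>0\<close> by p-torsion.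
  After mapping to a module without p-torsion the two agree modulo p, so the congruence known for
  \<eta> becomes one for the explicit \<open>\<eta>0\<close>.\<close>

lemma flow_condition_lift:
  assumes fc: flow_condition
    and "semilinear_derivation Eh R' T base \<Theta> D"
    and tf: "\<And>y. y \<in> carrier T \<Longrightarrow> [p] \<cdot>\<^bsub>T\<^esub> y = \<zero>\<^bsub>T\<^esub> \<Longrightarrow> y = \<zero>\<^bsub>T\<^esub>"
    and r: "r \<in> RR" and \<delta>r: "\<delta> (\<iota> X3) \<ominus>\<^bsub>S\<^esub> \<iota> r \<in> multiples S p"
  defines "z \<equiv> \<Theta> bi \<odot>\<^bsub>T\<^esub> D x3"
  shows "\<Theta> (loc (b3inv ^ p * (X3 ^ (p - 1) * b3 + dd r))) \<odot>\<^bsub>T\<^esub> z \<ominus>\<^bsub>T\<^esub> \<Theta> (loc AHinv) \<odot>\<^bsub>T\<^esub> z \<in> multiples T p"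
proof -
  interpret L: semilinear_derivation Eh R' T base \<Theta> D by fact
  define g where "g = b3inv ^ p * (X3 ^ (p - 1) * b3 + dd r)"
  have g: "g \<in> RR" using b3inv dd_RR[OF r] by (simp add: g_def RR_add RR_mult RR_power)
  note minus = additive_hom_minus[OF W.M.abelian_group_axioms L.T.abelian_group_axioms L.lift_hom]
    and mult = additive_hom_multiples[OF W.M.abelian_group_axioms L.T.abelian_group_axioms L.lift_hom]
    and add_pow = additive_hom_add_pow[OF W.M.abelian_group_axioms L.T.abelian_group_axioms L.lift_hom]
  have Lc [simp]: "L.lift y \<in> carrier T" if "y \<in> carrier \<Omega>" for y
    using L.lift_hom that by (auto simp: hom_def)
  have z: "L.lift \<omega>0 = z" unfolding \<omega>0_def z_def by (simp add: L.lift_smult L.lift_d dE)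
  obtain \<eta> where \<eta>: "\<eta> \<in> carrier \<Omega>E" "[p] \<cdot>\<^bsub>\<Omega>E\<^esub> \<eta> = to_completion p \<Omega> ([p] \<cdot>\<^bsub>\<Omega>\<^esub> \<eta>0)"
      "\<eta> \<ominus>\<^bsub>\<Omega>E\<^esub> to_completion p \<Omega> (loc AHinv \<odot>\<^bsub>\<Omega>\<^esub> \<omega>0) \<in> multiples \<Omega>E p"
    using fc unfolding flow_condition_eq by blast
  obtain t where t: "WC.Cy t" "\<eta> = WC.Pl t" using WC.Lim_cases[OF \<eta>(1)] by blast
  have tc [simp]: "t n \<in> carrier \<Omega>" for n using W.M.cauchyD[OF t(1)] .
  have A: "loc AHinv \<odot>\<^bsub>\<Omega>\<^esub> \<omega>0 \<in> carrier \<Omega>" using AHinv(2) by simp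
  have "WC.Pl (\<lambda>n. [p] \<cdot>\<^bsub>\<Omega>\<^esub> t n) = WC.Pl (\<lambda>_. [p] \<cdot>\<^bsub>\<Omega>\<^esub> \<eta>0)"
    using \<eta>(2) by (simp add: t WC.Lim_add_pow[OF t(1), symmetric] to_completion_form)
  \<comment> \<open>Level 2 is needed because dividing by p costs one power: agreement of the
    multiples by p modulo p^2 gives agreement modulo p in T.\<close>
  then have "[p] \<cdot>\<^bsub>\<Omega>\<^esub> t 2 \<ominus>\<^bsub>\<Omega>\<^esub> [p] \<cdot>\<^bsub>\<Omega>\<^esub> \<eta>0 \<in> multiples \<Omega> (p ^ 2)"
    using W.M.padic_lim_eq_iff[OF W.M.cauchy_add_pow[OF t(1)] W.M.cauchy_const[of "[p] \<cdot>\<^bsub>\<Omega>\<^esub> \<eta>0"], of p] by simp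
  then have "L.lift ([p] \<cdot>\<^bsub>\<Omega>\<^esub> (t 2 \<ominus>\<^bsub>\<Omega>\<^esub> \<eta>0)) \<in> multiples T (p ^ 2)"
    by (intro mult) (simp add: W.M.add_pow_minus)
  then have "[p] \<cdot>\<^bsub>T\<^esub> L.lift (t 2 \<ominus>\<^bsub>\<Omega>\<^esub> \<eta>0) \<in> multiples T (p ^ 2)"
    by (simp add: add_pow)
  then obtain w where w: "w \<in> carrier T" "[p] \<cdot>\<^bsub>T\<^esub> L.lift (t 2 \<ominus>\<^bsub>\<Omega>\<^esub> \<eta>0) = [(p ^ 2)] \<cdot>\<^bsub>T\<^esub> w"
    by (auto simp: multiples_def)
  define q where "q = L.lift (t 2 \<ominus>\<^bsub>\<Omega>\<^esub> \<eta>0)"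
  have q: "q \<in> carrier T" by (simp add: q_def)
  define pw where "pw = [p] \<cdot>\<^bsub>T\<^esub> w"
  have pw: "pw \<in> carrier T" "[p] \<cdot>\<^bsub>T\<^esub> pw = [(p ^ 2)] \<cdot>\<^bsub>T\<^esub> w"
    using w(1) by (simp_all add: pw_def L.T.M.add.nat_pow_pow power2_eq_square)
  have "[p] \<cdot>\<^bsub>T\<^esub> (q \<ominus>\<^bsub>T\<^esub> pw) = [p] \<cdot>\<^bsub>T\<^esub> q \<ominus>\<^bsub>T\<^esub> [p] \<cdot>\<^bsub>T\<^esub> pw"
    by (rule L.T.M.add_pow_minus[symmetric, OF q pw(1)])
  also have "\<dots> = \<zero>\<^bsub>T\<^esub>"
    unfolding pw(2) q_def w(2) using w(1) by simp
  finally have "q \<ominus>\<^bsub>T\<^esub> pw = \<zero>\<^bsub>T\<^esub>" by (rule tf[OF L.T.M.minus_closed[OF q pw(1)]])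
  then have "q = pw" using q pw(1) by (simp add: L.T.M.a_minus_zero_iff)
  then have "q \<in> multiples T p" unfolding pw_def using w(1) by (simp add: L.T.M.multiplesI)
  then have "L.lift (t 2) \<ominus>\<^bsub>T\<^esub> L.lift \<eta>0 \<in> multiples T p" by (simp add: q_def minus)
  then have 1: "L.lift \<eta>0 \<ominus>\<^bsub>T\<^esub> L.lift (t 2) \<in> multiples T p"
    by (rule L.T.M.multiples_minus_commute) simp_all
  have "t 2 \<ominus>\<^bsub>\<Omega>\<^esub> t 1 \<in> multiples \<Omega> (p ^ 1)" by (rule W.M.cauchy_diff[OF t(1)]) simp
  moreover have "t 1 \<ominus>\<^bsub>\<Omega>\<^esub> loc AHinv \<odot>\<^bsub>\<Omega>\<^esub> \<omega>0 \<in> multiples \<Omega> (p ^ 1)"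
    using form_multiples_iff[OF t(1) A, of 1] \<eta>(3) by (simp add: t)
  ultimately have "t 2 \<ominus>\<^bsub>\<Omega>\<^esub> loc AHinv \<odot>\<^bsub>\<Omega>\<^esub> \<omega>0 \<in> multiples \<Omega> p"
    using W.M.multiples_minus_trans[of "t 2" "t 1" p "loc AHinv \<odot>\<^bsub>\<Omega>\<^esub> \<omega>0"] A by simp
  from mult[OF this] have 2: "L.lift (t 2) \<ominus>\<^bsub>T\<^esub> L.lift (loc AHinv \<odot>\<^bsub>\<Omega>\<^esub> \<omega>0) \<in> multiples T p"
    unfolding minus[OF tc[of 2] A] .
  have 3: "L.lift \<eta>0 \<ominus>\<^bsub>T\<^esub> L.lift (loc g \<odot>\<^bsub>\<Omega>\<^esub> \<omega>0) \<in> multiples T p"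
    using mult[OF \<eta>0_cong[OF r \<delta>r, folded g_def]] g by (simp add: minus)
  have 4: "L.lift (loc g \<odot>\<^bsub>\<Omega>\<^esub> \<omega>0) \<ominus>\<^bsub>T\<^esub> L.lift \<eta>0 \<in> multiples T p"
    by (rule L.T.M.multiples_minus_commute[OF 3]) (use g in simp_all)
  have 5: "L.lift (loc g \<odot>\<^bsub>\<Omega>\<^esub> \<omega>0) \<ominus>\<^bsub>T\<^esub> L.lift (t 2) \<in> multiples T p"
    by (rule L.T.M.multiples_minus_trans[OF 4 1]) (use g in simp_all)
  have "L.lift (loc g \<odot>\<^bsub>\<Omega>\<^esub> \<omega>0) \<ominus>\<^bsub>T\<^esub> L.lift (loc AHinv \<odot>\<^bsub>\<Omega>\<^esub> \<omega>0) \<in> multiples T p"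
    by (rule L.T.M.multiples_minus_trans[OF 5 2]) (use g A in simp_all)
  then show ?thesis using g AHinv(2) by (simp add: L.lift_smult z g_def)
qed

end

section \<open>Evaluation at points\<close>

text \<open>The ring as a module over itself, the target for evaluating forms at a point.\<close>

definition regular_module :: "('r, 'x) ring_scheme \<Rightarrow> ('r, 'r) module"
  where "regular_module R = \<lparr>carrier = carrier R, monoid.mult = undefined, one = undefined,
    ring.zero = \<zero>\<^bsub>R\<^esub>, ring.add = ring.add R, module.smult = monoid.mult R\<rparr>"

lemma regular_module_simps:
  "carrier (regular_module R) = carrier R" "\<zero>\<^bsub>regular_module R\<^esub> = \<zero>\<^bsub>R\<^esub>"
  "x \<oplus>\<^bsub>regular_module R\<^esub> y = x \<oplus>\<^bsub>R\<^esub> y" "x \<odot>\<^bsub>regular_module R\<^esub> y = x \<otimes>\<^bsub>R\<^esub> y"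
  by (simp_all add: regular_module_def)

lemma (in cring) regular_module: "module R (regular_module R)"
proof (rule moduleI)
  show "abelian_group (regular_module R)"
  proof (rule abelian_groupI)
    fix x assume "x \<in> carrier (regular_module R)"
    then show "\<exists>y\<in>carrier (regular_module R). y \<oplus>\<^bsub>regular_module R\<^esub> x = \<zero>\<^bsub>regular_module R\<^esub>"
      by (intro bexI[of _ "\<ominus> x"]) (auto simp: regular_module_simps l_neg)
  qed (auto simp: regular_module_simps a_ac)
qed (auto simp: regular_module_simps l_distr r_distr m_assoc cring_axioms)

lemma (in cring) regular_module_add_pow:
  assumes "x \<in> carrier R" shows "[(k::nat)] \<cdot>\<^bsub>regular_module R\<^esub> x = [k] \<cdot> x"
proof -
  interpret M: module R "regular_module R" by (rule regular_module)
  show ?thesis by (induction k) (use assms in \<open>simp_all add: regular_module_simps\<close>)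
qed

lemma (in cring) regular_module_multiples: "multiples (regular_module R) m = multiples R m"
  unfolding multiples_def regular_module_simps
  by (metis (no_types, lifting) regular_module_add_pow)

lemma (in cring) regular_module_minus:
  assumes "x \<in> carrier R" "y \<in> carrier R" shows "x \<ominus>\<^bsub>regular_module R\<^esub> y = x \<ominus> y"
proof -
  interpret M: module R "regular_module R" by (rule regular_module)
  have xy: "x \<in> carrier (regular_module R)" "y \<in> carrier (regular_module R)"
    using assms by (simp_all add: regular_module_simps)
  have "(x \<ominus>\<^bsub>regular_module R\<^esub> y) \<oplus> y = x"
    using M.M.minus_add_cancel[OF xy] by (simp add: regular_module_simps)
  moreover have "x \<ominus>\<^bsub>regular_module R\<^esub> y \<in> carrier R"
    using M.M.minus_closed[OF xy] by (simp add: regular_module_simps)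
  ultimately show ?thesis using assms add_minus_cancel_left[of y "x \<ominus>\<^bsub>regular_module R\<^esub> y"]
    by (simp add: a_comm)
qed

section \<open>Congruent points and their lifts\<close>

context euler_setting
begin

lemma ev_simps:
  assumes x: "\<not> \<pi> dvd poly3_eval x Q" and u: "u \<in> RR"
  shows "ev x 0 = 0" "ev x 1 = 1" "ev x (- u) = - ev x u" "v \<in> RR \<Longrightarrow> ev x (u - v) = ev x u - ev x v"
    "ev x (u ^ n) = ev x u ^ n"
proof -
  show 0: "ev x 0 = 0" and 1: "ev x 1 = 1"
    using ev_emb[OF x, of 0] ev_emb[OF x, of 1]
    by (simp_all add: is_homD[OF is_hom_emb] is_homD[OF is_hom_poly3_eval])
  have neg: "ev x (- v) = - ev x v" if "v \<in> RR" for v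
    using ev_hom(1)[OF x RR_neg[OF that] that] 0 by (simp add: eq_neg_iff_add_eq_0)
  then show "ev x (- u) = - ev x u" using u .
  show "ev x (u - v) = ev x u - ev x v" if "v \<in> RR"
    using ev_hom(1)[OF x u RR_neg[OF that]] neg[OF that] by simp
  show "ev x (u ^ n) = ev x u ^ n"
    by (induction n) (simp_all add: 1 ev_hom[OF x] u RR_power)
qed

lemma ev_cong:
  assumes x: "\<not> \<pi> dvd poly3_eval x Q" and y: "\<not> \<pi> dvd poly3_eval y Q"
    and xy: "\<And>i. i \<in> {1, 2, 3} \<Longrightarrow> \<pi> dvd x i - y i" and u: "u \<in> RR"
  shows "\<pi> dvd ev x u - ev y u"
  using u
proof (induction rule: RR_induct)
  case (cst c)
  then show ?case by (simp add: ev_emb[OF x] ev_emb[OF y])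
next
  case (var i)
  then show ?case using xy[of i] by (simp add: ev_emb[OF x] ev_emb[OF y])
next
  case Qinv
  have q: "ev x (emb Q) * ev x Qinv = 1" "ev y (emb Q) * ev y Qinv = 1"
    by (simp_all add: ev_hom(2)[OF x, symmetric] ev_hom(2)[OF y, symmetric] emb_Q_Qinv ev_simps(2)[OF x RR_1] ev_simps(2)[OF y RR_1])
  define qx qy V W where "qx = ev x (emb Q)" and "qy = ev y (emb Q)" and "V = ev x Qinv" and "W = ev y Qinv"
  \<comment> \<open>Both bracketed products are 1; this exhibits the difference of inverses as a
    multiple of the difference of the values of Q.\<close>
  have "V - W = V * (qy * W) - W * (qx * V)" using q by (simp add: qx_def qy_def V_def W_def)
  then have "V - W = (qx - qy) * (- (V * W))" by (simp add: algebra_simps)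
  then show ?case using Qinv unfolding qx_def qy_def V_def W_def by (metis dvd_mult2)
next
  case (add u v)
  have "ev x (u + v) - ev y (u + v) = (ev x u - ev y u) + (ev x v - ev y v)"
    using add by (simp add: ev_hom[OF x] ev_hom[OF y])
  then show ?case using add by (metis dvd_add)
next
  case (mult u v)
  have "ev x (u * v) - ev y (u * v) = (ev x u - ev y u) * ev x v + ev y u * (ev x v - ev y v)"
    using mult by (simp add: ev_hom[OF x] ev_hom[OF y] algebra_simps)
  then show ?case using mult by (metis dvd_add dvd_mult dvd_mult2)
qed

lemma poly3_eval_dvd_diff:
  assumes "\<And>i. i \<in> {1, 2, 3} \<Longrightarrow> \<pi> dvd x i - y i"
  shows "\<pi> dvd poly3_eval x f - poly3_eval y f"
proof (induction f rule: poly3_induct)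
  case (cst c)
  then show ?case by simp
next
  case (var i)
  then show ?case using assms[of i] by simp
next
  case (add f g)
  have "poly3_eval x (f + g) - poly3_eval y (f + g) = (poly3_eval x f - poly3_eval y f) + (poly3_eval x g - poly3_eval y g)"
    by (simp add: is_homD[OF is_hom_poly3_eval])
  then show ?case using add by (metis dvd_add)
next
  case (mult f g)
  have "poly3_eval x (f * g) - poly3_eval y (f * g) =
      (poly3_eval x f - poly3_eval y f) * poly3_eval x g + poly3_eval y f * (poly3_eval x g - poly3_eval y g)"
    by (simp add: is_homD[OF is_hom_poly3_eval] algebra_simps)
  then show ?case using mult by (metis dvd_add dvd_mult dvd_mult2)
qed

text \<open>Every residue point of $X$ lifts to a point with $\delta H_1 = \delta H_2 = 0$: lift the
  values of $H_1$ and $H_2$ to \<open>p\<close>-constants, keep $x_3$, and solve for $x_1$ and $x_2$ by Hensel.\<close>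

lemma constant_point_lift:
  assumes x: "\<not> \<pi> dvd poly3_eval x Q"
  shows "\<exists>y. (\<forall>i\<in>{1, 2, 3}. \<pi> dvd x i - y i) \<and> \<not> \<pi> dvd poly3_eval y Q \<and>
    the_p_derivation p (poly3_eval y (H1 a)) = 0 \<and> the_p_derivation p (poly3_eval y H2) = 0"
proof -
  define h1 h2 where "h1 = poly3_eval x (H1 a)" and "h2 = poly3_eval x H2"
  obtain c1 where c1: "\<pi> dvd h1 - c1" "the_p_derivation p c1 = 0" using p_constant_lift .
  obtain c2 where c2: "\<pi> dvd h2 - c2" "the_p_derivation p c2 = 0" using p_constant_lift .
  obtain k where k: "1 = A12 * k" using a_units(1) by (auto simp: dvd_def)
  have h: "h1 = a 1 * (x 1 * x 1) + a 2 * (x 2 * x 2) + a 3 * (x 3 * x 3)" "h2 = x 1 * x 1 + x 2 * x 2 + x 3 * x 3"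
    by (simp_all add: h1_def h2_def poly3_eval_H power2_eq_square sum_1_3)
  have x12: "\<not> \<pi> dvd x 1" "\<not> \<pi> dvd x 2"
    using x unfolding poly3_eval_Q by (auto simp: dvd_mult dvd_mult2)
  \<comment> \<open>The values prescribed for y_1^2 and y_2^2 solve H_1 = c_1, H_2 = c_2 with x_3
    kept. They are congruent to x_1^2 and x_2^2 because c_1 and c_2 are congruent to the values of
    H_1 and H_2 at x.\<close>
  have "x 1 * x 1 - k * (c1 - a 2 * c2 + A23 * (x 3 * x 3)) = k * (h1 - c1) - k * a 2 * (h2 - c2)"
  proof -
    have "x 1 * x 1 = (A12 * k) * (x 1 * x 1)" using k by simp
    then show ?thesis by (simp add: h algebra_simps)
  qed
  then have "\<pi> dvd x 1 * x 1 - k * (c1 - a 2 * c2 + A23 * (x 3 * x 3))" using c1(1) c2(1) by (simp add: dvd_diff)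
  then obtain y1 where y1: "y1 * y1 = k * (c1 - a 2 * c2 + A23 * (x 3 * x 3))" "\<pi> dvd y1 - x 1"
    using sqrt_exists[OF x12(1)] by metis
  have "x 2 * x 2 - k * (a 1 * c2 - c1 + A31 * (x 3 * x 3)) = k * a 1 * (h2 - c2) - k * (h1 - c1)"
  proof -
    have "x 2 * x 2 = (A12 * k) * (x 2 * x 2)" using k by simp
    then show ?thesis by (simp add: h algebra_simps)
  qed
  then have "\<pi> dvd x 2 * x 2 - k * (a 1 * c2 - c1 + A31 * (x 3 * x 3))" using c1(1) c2(1) by (simp add: dvd_diff)
  then obtain y2 where y2: "y2 * y2 = k * (a 1 * c2 - c1 + A31 * (x 3 * x 3))" "\<pi> dvd y2 - x 2"
    using sqrt_exists[OF x12(2)] by metis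
  define y where "y i = (if i = 1 then y1 else if i = 2 then y2 else x 3)" for i :: nat
  have xy: "\<forall>i\<in>{1, 2, 3}. \<pi> dvd x i - y i"
  proof -
    have "\<pi> dvd x 1 - y1" "\<pi> dvd x 2 - y2" 
      using y1(2) y2(2) dvd_minus_iff[of \<pi> "y1 - x 1"] dvd_minus_iff[of \<pi> "y2 - x 2"] by simp_all
    then show ?thesis by (auto simp: y_def)
  qed
  have "\<pi> dvd poly3_eval x Q - poly3_eval y Q" using xy by (intro poly3_eval_dvd_diff) blast
  then have Q: "\<not> \<pi> dvd poly3_eval y Q" using x by (metis diff_add_cancel dvd_add)
  have e1: "poly3_eval y (H1 a) = a 1 * (y1 * y1) + a 2 * (y2 * y2) + a 3 * (x 3 * x 3)"
    and e2: "poly3_eval y H2 = y1 * y1 + y2 * y2 + x 3 * x 3"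
    by (simp_all add: poly3_eval_H power2_eq_square y_def sum_1_3)
  have "poly3_eval y (H1 a) = (A12 * k) * c1 + a 3 * (x 3 * x 3) - (A12 * k) * (a 3 * (x 3 * x 3))"
    unfolding e1 y1(1) y2(1) by (simp add: algebra_simps)
  moreover have "poly3_eval y H2 = (A12 * k) * c2 + x 3 * x 3 - (A12 * k) * (x 3 * x 3)"
    unfolding e2 y1(1) y2(1) by (simp add: algebra_simps)
  ultimately have "poly3_eval y (H1 a) = c1" "poly3_eval y H2 = c2" unfolding k[symmetric] by simp_all
  with xy Q c1(2) c2(2) show ?thesis by (intro exI[of _ y]) simp
qed

abbreviation "Aring \<equiv> ring_of_type_algebra :: 'a ring"
abbreviation "Ah \<equiv> padic_completion p Aring"

sublocale AC: ring_completion Aring p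
  by (intro ring_completion.intro cring_from_type_algebra)

end

lemma (in ring_completion) multiples_lim_p: "r \<in> carrier R \<Longrightarrow> to_completion p R r \<in> multiples C p \<longleftrightarrow> r \<in> multiples R p"
  using Lim_multiples_iff[of "\<lambda>_. r" 1] by (simp add: to_completion_lim)

section \<open>A point of a level set as a functional on forms\<close>

locale level_point = level_flow +
  fixes x :: "nat \<Rightarrow> 'a"
  assumes x_H: "poly3_eval x (H1 a) = c1" "poly3_eval x H2 = c2"
    and x_Q: "\<not> \<pi> dvd poly3_eval x Q"
begin

lemmas ev_rules = ev_hom[OF x_Q] ev_simps[OF x_Q] ev_emb[OF x_Q]

text \<open>Together with \<open>dvE\<close> this gives the value and the derivative along
  \<delta>^cl at the point. A representative of the class is chosen, so independence of it has to be
  shown.\<close>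

definition "evE U = ev x (SOME u. u \<in> U)"
definition "dvE U = ev x (dd (SOME u. u \<in> U))"

text \<open>H_1 and H_2 are first integrals, so the vector field is tangent to the level set and the
  derivative vanishes with the value. By the Leibniz rule the two conditions together define an
  ideal, hence the generators suffice.\<close>

lemma ev_I:
  assumes "i \<in> I" shows "ev x i = 0 \<and> ev x (dd i) = 0"
proof -
  let ?J = "{i \<in> RR. ev x i = 0 \<and> ev x (dd i) = 0}"
  have "ideal ?J R"
  proof (rule idealI)
    show "subgroup ?J (add_monoid R)"
    proof (rule R.add.subgroupI)
      fix u assume "u \<in> ?J"
      then show "\<ominus>\<^bsub>R\<^esub> u \<in> ?J"
        using R_minus[of u 0] by (auto simp: R.minus_eq ev_rules dd RR_neg dd_RR)
    qed (auto simp: ev_rules dd dd_RR RR_add ev_simps(1)[OF x_Q RR_1] intro!: exI[of _ 0])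
    fix u v assume "u \<in> ?J" "v \<in> carrier R"
    then show "u \<otimes>\<^bsub>R\<^esub> v \<in> ?J" "v \<otimes>\<^bsub>R\<^esub> u \<in> ?J"
      by (auto simp: ev_rules dd dd_RR RR_mult)
  qed (rule R.ring_axioms)
  moreover have "emb (H1 a - cst c1) \<in> ?J" "emb (H2 - cst c2) \<in> ?J"
    by (simp_all add: ev_rules x_H is_homD[OF is_hom_poly3_eval] is_homD[OF is_hom_emb] dd dd_emb
        euler_derivation_H ev_simps(1)[OF x_Q RR_1] RR_diff)
  ultimately have "I \<subseteq> ?J" by (rule I_minimal)
  then show ?thesis using assms by blast
qed

lemma factor_e:
  assumes u: "u \<in> RR" shows "evE (e u) = ev x u" "dvE (e u) = ev x (dd u)"
proof -
  define v where "v = (SOME v. v \<in> e u)"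
  have "v \<in> e u" unfolding v_def using e_self[OF u] by (rule someI)
  then have v: "v \<in> RR" "v - u \<in> I" using e_mem[OF u] by auto
  have "ev x (v - u) = 0" "ev x (dd (v - u)) = 0" using ev_I[OF v(2)] by auto
  then show "evE (e u) = ev x u" "dvE (e u) = ev x (dd u)"
    using u v(1) by (simp_all add: ev_rules dd dd_RR evE_def dvE_def v_def[symmetric])
qed

lemma evE_hom: "evE \<in> ring_hom EE Aring"
proof (rule ring_hom_memI)
  fix U V assume "U \<in> carrier EE" "V \<in> carrier EE"
  then obtain u v where uv: "u \<in> RR" "v \<in> RR" "U = e u" "V = e v" by (auto simp: EE_carrier)
  have "evE (e (u * v)) = evE (e u) * evE (e v)" "evE (e (u + v)) = evE (e u) + evE (e v)"
    using uv by (simp_all add: factor_e RR_mult RR_add ev_rules)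
  then show "evE (U \<otimes>\<^bsub>EE\<^esub> V) = evE U \<otimes>\<^bsub>Aring\<^esub> evE V" "evE (U \<oplus>\<^bsub>EE\<^esub> V) = evE U \<oplus>\<^bsub>Aring\<^esub> evE V"
    using uv ring_hom_mult[OF e_hom, of u v] ring_hom_add[OF e_hom, of u v] by simp_all
next
  show "evE \<one>\<^bsub>EE\<^esub> = \<one>\<^bsub>Aring\<^esub>"
    using factor_e(1)[OF RR_1] ring_hom_one[OF e_hom] by (simp add: ev_simps(2)[OF x_Q RR_1])
qed simp

lemma dvE_hom: "dvE \<in> hom (add_monoid EE) (add_monoid Aring)"
proof -
  have "dvE (U \<oplus>\<^bsub>EE\<^esub> V) = dvE U + dvE V" if UV: "U \<in> carrier EE" "V \<in> carrier EE" for U V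
  proof -
    obtain u v where uv: "u \<in> RR" "v \<in> RR" "U = e u" "V = e v" using UV by (auto simp: EE_carrier)
    have "dvE (e (u + v)) = dvE (e u) + dvE (e v)"
      using uv by (simp add: factor_e RR_add ev_rules dd dd_RR)
    then show ?thesis using uv ring_hom_add[OF e_hom, of u v] by simp
  qed
  then show ?thesis by (simp add: hom_def)
qed

lemma dvE_mult:
  assumes "U \<in> carrier EE" "V \<in> carrier EE"
  shows "dvE (U \<otimes>\<^bsub>EE\<^esub> V) = evE U * dvE V + evE V * dvE U"
proof -
  obtain u v where uv: "u \<in> RR" "v \<in> RR" "U = e u" "V = e v" using assms by (auto simp: EE_carrier)
  have "dvE (e (u * v)) = evE (e u) * dvE (e v) + evE (e v) * dvE (e u)"
    using uv by (simp add: factor_e RR_mult ev_rules dd dd_RR)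
  then show ?thesis using uv ring_hom_mult[OF e_hom, of u v] by simp
qed

text \<open>Value and derivative extended by continuity: forms are built from the completed ring, so
  a homomorphism and a derivation are needed on that ring.\<close>

definition "\<Theta> = completion_map p Aring evE"
definition "D = completion_map p Aring dvE"

lemmas evE_add = ring_hom_in_hom(2)[OF evE_hom]

lemma Aring_abelian: "abelian_group Aring"
  by (rule AC.abelian_group_axioms)

lemma \<Theta>_Pl: "EC.Cy t \<Longrightarrow> \<Theta> (EC.Pl t) = AC.Pl (\<lambda>n. evE (t n))"
  and D_Pl: "EC.Cy t \<Longrightarrow> D (EC.Pl t) = AC.Pl (\<lambda>n. dvE (t n))"
  unfolding \<Theta>_def D_def
  using completion_map_lim[OF EC.abelian_group_axioms Aring_abelian evE_add]
    completion_map_lim[OF EC.abelian_group_axioms Aring_abelian dvE_hom] by auto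

lemma cauchy_images: "EC.Cy t \<Longrightarrow> AC.Cy (\<lambda>n. evE (t n))" "EC.Cy t \<Longrightarrow> AC.Cy (\<lambda>n. dvE (t n))"
  using additive_hom_cauchy[OF EC.abelian_group_axioms Aring_abelian evE_add]
    additive_hom_cauchy[OF EC.abelian_group_axioms Aring_abelian dvE_hom] by auto

lemma \<Theta>_hom: "\<Theta> \<in> ring_hom Eh Ah"
  unfolding \<Theta>_def using completion_map_hom[OF EE_cring AC.is_cring evE_hom, of p] by (simp add: Eh_eq)

lemma Eh_cases:
  assumes "y \<in> carrier Eh" obtains t where "EC.Cy t" "y = EC.Pl t"
  using assms EC.Lim_cases unfolding Eh_eq[symmetric] by blast

lemma \<Theta>_loc: "u \<in> RR \<Longrightarrow> \<Theta> (loc u) = to_completion p Aring (ev x u)"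
  and D_loc: "u \<in> RR \<Longrightarrow> D (loc u) = to_completion p Aring (ev x (dd u))"
  using \<Theta>_Pl[of "\<lambda>_. e u"] D_Pl[of "\<lambda>_. e u"]
  by (simp_all add: EE_carrier loc_eq EC.to_completion_lim AC.to_completion_lim factor_e)

text \<open>Through \<open>kahler_lift\<close> this yields a functional on forms with values in the
  completion of A, which has no p-torsion by \<open>Ah_torsion_free\<close>.\<close>

lemma semilinear: "semilinear_derivation Eh Ah (regular_module Ah) base \<Theta> D"
proof (intro semilinear_derivation.intro semilinear_derivation_axioms.intro)
  show "cring Eh" by (rule E.cring_axioms)
  show "module Ah (regular_module Ah)" by (rule AC.C.regular_module)
  show "base \<subseteq> carrier Eh" by (rule base_closed)
  show "\<Theta> \<in> ring_hom Eh Ah" by (rule \<Theta>_hom)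
  fix g assume "g \<in> carrier Eh"
  then obtain t where t: "EC.Cy t" "g = EC.Pl t" by (rule Eh_cases)
  show "D g \<in> carrier (regular_module Ah)"
    unfolding regular_module_simps t(2) D_Pl[OF t(1)] by (rule AC.Lim_closed[OF cauchy_images(2)[OF t(1)]])
  fix h assume "h \<in> carrier Eh"
  then obtain s where s: "EC.Cy s" "h = EC.Pl s" by (rule Eh_cases)
  note tc = EC.cauchyD[OF t(1)] and sc = EC.cauchyD[OF s(1)]
  have "D (g \<oplus>\<^bsub>Eh\<^esub> h) = AC.Pl (\<lambda>n. dvE (t n) + dvE (s n))"
    unfolding t(2) s(2) Eh_eq[symmetric] EC.Lim_add[OF t(1) s(1)] D_Pl[OF EC.cauchy_add[OF t(1) s(1)]]
    using dvE_hom tc sc by (simp add: hom_def)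
  then show "D (g \<oplus>\<^bsub>Eh\<^esub> h) = D g \<oplus>\<^bsub>regular_module Ah\<^esub> D h"
    using AC.Lim_add[OF cauchy_images(2)[OF t(1)] cauchy_images(2)[OF s(1)]]
    by (simp add: regular_module_simps t(2) s(2) D_Pl t(1) s(1))
  have "D (g \<otimes>\<^bsub>Eh\<^esub> h) = AC.Pl (\<lambda>n. evE (t n) * dvE (s n) + evE (s n) * dvE (t n))"
    unfolding t(2) s(2) Eh_eq[symmetric] EC.Lim_mult[OF t(1) s(1)] D_Pl[OF EC.cauchy_mult[OF t(1) s(1)]]
    using tc sc by (simp add: dvE_mult)
  moreover have "\<Theta> g \<otimes>\<^bsub>Ah\<^esub> D h \<oplus>\<^bsub>Ah\<^esub> \<Theta> h \<otimes>\<^bsub>Ah\<^esub> D g = AC.Pl (\<lambda>n. evE (t n) * dvE (s n) + evE (s n) * dvE (t n))"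
    unfolding t(2) s(2) D_Pl[OF t(1)] D_Pl[OF s(1)] \<Theta>_Pl[OF t(1)] \<Theta>_Pl[OF s(1)]
      AC.Lim_mult[OF cauchy_images(1)[OF t(1)] cauchy_images(2)[OF s(1)]]
      AC.Lim_mult[OF cauchy_images(1)[OF s(1)] cauchy_images(2)[OF t(1)]]
      AC.Lim_add[OF AC.cauchy_mult[OF cauchy_images(1)[OF t(1)] cauchy_images(2)[OF s(1)]]
        AC.cauchy_mult[OF cauchy_images(1)[OF s(1)] cauchy_images(2)[OF t(1)]]]
    by simp
  ultimately show "D (g \<otimes>\<^bsub>Eh\<^esub> h) = \<Theta> g \<odot>\<^bsub>regular_module Ah\<^esub> D h \<oplus>\<^bsub>regular_module Ah\<^esub> \<Theta> h \<odot>\<^bsub>regular_module Ah\<^esub> D g"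
    by (simp add: regular_module_simps)
next
  fix s assume "s \<in> base"
  then show "D s = \<zero>\<^bsub>regular_module Ah\<^esub>"
    by (auto simp: base_eq D_loc regular_module_simps AC.to_completion_lim AC.Lim_zero ev_simps(1)[OF x_Q RR_1])
qed

lemma Ah_torsion_free: "y \<in> carrier Ah \<Longrightarrow> [p] \<cdot>\<^bsub>Ah\<^esub> y = \<zero>\<^bsub>Ah\<^esub> \<Longrightarrow> y = \<zero>\<^bsub>Ah\<^esub>"
  by (rule AC.completion_torsion_free) (use pi_nz in \<open>auto simp: \<pi>_def\<close>)

text \<open>The form $\omega$ evaluates to 1 at the point.\<close>

lemma flow_condition_point:
  assumes fc: flow_condition and r: "r \<in> RR" and \<delta>r: "\<delta> (\<iota> X3) \<ominus>\<^bsub>S\<^esub> \<iota> r \<in> multiples S p"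
  shows "\<pi> dvd ev x (dd r - flow_rhs)"
proof -
  define v where "v = dd r - flow_rhs"
  have v: "v \<in> RR" using dd_RR[OF r] flow_rhs_RR by (simp add: v_def RR_diff)
  define g where "g = b3inv ^ p * (X3 ^ (p - 1) * b3 + dd r)"
  have g: "g \<in> RR" using b3inv dd_RR[OF r] by (simp add: g_def RR_add RR_mult RR_power)
  have gv: "g - AHinv = b3inv ^ p * v" using flow_rhs_b3[of v] by (simp add: g_def v_def)
  define k where "k = to_completion p Aring"
  have kc: "k c \<in> carrier Ah" for c unfolding k_def using ring_hom_closed[OF AC.to_completion_hom] by simp
  have k_mult: "k (c * d) = k c \<otimes>\<^bsub>Ah\<^esub> k d" and k_diff: "k (c - d) = k c \<ominus>\<^bsub>Ah\<^esub> k d" for c d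
    unfolding k_def using ring_hom_mult[OF AC.to_completion_hom, of c d]
      ring_hom_simps(2)[OF AC.ring_axioms AC.C.ring_axioms AC.to_completion_hom, of c d] by simp_all
  have k1: "k 1 = \<one>\<^bsub>Ah\<^esub>" unfolding k_def using ring_hom_one[OF AC.to_completion_hom] by simp
  have "\<Theta> bi \<otimes>\<^bsub>Ah\<^esub> D x3 = k (ev x (b3inv * b3))"
    using b3inv(2) by (simp add: \<Theta>_loc D_loc dd_X3 ev_rules k_mult[symmetric] k_def[symmetric])
  also have "\<dots> = \<one>\<^bsub>Ah\<^esub>" using b3inv(1) by (simp add: mult.commute k1 ev_simps(2)[OF x_Q RR_1])
  finally have z: "\<Theta> bi \<otimes>\<^bsub>Ah\<^esub> D x3 = \<one>\<^bsub>Ah\<^esub>" .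
  have tf: "y = \<zero>\<^bsub>regular_module Ah\<^esub>"
    if "y \<in> carrier (regular_module Ah)" "[p] \<cdot>\<^bsub>regular_module Ah\<^esub> y = \<zero>\<^bsub>regular_module Ah\<^esub>" for y
    using that Ah_torsion_free[of y] by (simp add: regular_module_simps AC.C.regular_module_add_pow)
  have "\<Theta> (loc g) \<otimes>\<^bsub>Ah\<^esub> \<one>\<^bsub>Ah\<^esub> \<ominus>\<^bsub>regular_module Ah\<^esub> \<Theta> (loc AHinv) \<otimes>\<^bsub>Ah\<^esub> \<one>\<^bsub>Ah\<^esub> \<in> multiples (regular_module Ah) p"
    using flow_condition_lift[OF fc semilinear tf r \<delta>r]
    unfolding regular_module_simps z g_def[symmetric] by simp
  then have "k (ev x g) \<ominus>\<^bsub>Ah\<^esub> k (ev x AHinv) \<in> multiples Ah p"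
    using g AHinv(2) kc
    by (simp add: \<Theta>_loc AC.C.regular_module_multiples AC.C.regular_module_minus k_def[symmetric])
  then have "k (ev x (g - AHinv)) \<in> multiples Ah p" using g AHinv(2) by (simp add: ev_rules k_diff)
  then have "\<pi> dvd ev x (b3inv ^ p * v)"
    unfolding gv k_def using AC.multiples_lim_p by (simp add: type_algebra_multiples \<pi>_def)
  \<comment> \<open>Multiplying by the value of b^p removes the factor b^{-p} in front of v.\<close>
  then have "\<pi> dvd ev x (b3 ^ p) * ev x (b3inv ^ p * v)" by (rule dvd_mult)
  also have "\<dots> = ev x ((b3 * b3inv) ^ p * v)"
    using b3inv(2) v by (simp add: ev_rules RR_mult RR_power power_mult_distrib mult.assoc)
  finally show ?thesis using b3inv(1) by (simp add: v_def)
qed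

end

section \<open>The torsor of flows\<close>

context euler_setting
begin

text \<open>Condition (2) for a single c, stated without the assumptions that the locale of level
  sets makes on c, so that c can be quantified over.\<close>

definition level_condition :: "'a \<Rightarrow> 'a \<Rightarrow> ('a X_hat \<Rightarrow> 'a X_hat) \<Rightarrow> bool"
  where "level_condition c1 c2 \<delta> \<longleftrightarrow>
    (\<exists>\<eta> \<in> carrier (Omega_E p a c1 c2).
      [p] \<cdot>\<^bsub>Omega_E p a c1 c2\<^esub> \<eta> =
        pullback_E p a c1 c2 (phi_E p a c1 c2 (frob p S \<delta>)) (omega_E p a c1 c2) \<and>
      cong_mod p (Omega_E p a c1 c2) \<eta>
        (in_Ehat p a c1 c2 (cst (inv\<^bsub>ring_of_type_algebra\<^esub> eval2 id (hasse p a) c1 c2))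
           \<odot>\<^bsub>Omega_E p a c1 c2\<^esub> omega_E p a c1 c2))"

end

lemma (in level_flow) level_condition_iff: "level_condition c1 c2 \<delta> \<longleftrightarrow> flow_condition"
  by (simp add: level_condition_def flow_condition_def \<phi>_def)

lemmas (in level_flow) level_conditionI = flow_conditionI[folded level_condition_iff]

lemmas (in level_point) level_condition_point = flow_condition_point[folded level_condition_iff]

context euler_setting
begin

lemma arithmetic_euler_flow_iff:
  "arithmetic_euler_flow p a \<delta> \<longleftrightarrow> p_flow \<delta> \<and> (\<forall>c1 c2. level_set p \<pi> a c1 c2 \<longrightarrow> level_condition c1 c2 \<delta>)"
proof -
  have "level_set p \<pi> a c1 c2 \<longleftrightarrow> the_p_derivation p c1 = 0 \<and> the_p_derivation p c2 = 0 \<and>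
      \<not> of_nat p dvd eval2 id (N_poly a) c1 c2 * eval2 id (hasse p a) c1 c2" for c1 c2
    using euler_setting_axioms by (auto simp: level_set_def level_set_axioms_def \<pi>_def)
  then show ?thesis
    unfolding arithmetic_euler_flow_def p_flow_def level_condition_def by auto
qed

definition red :: "('a X_hat \<Rightarrow> 'a X_hat) \<Rightarrow> 'a poly poly poly fract set"
  where "red \<delta> = reduction (\<delta> (\<iota> X3))"

lemma p_flow_X3: "p_flow \<delta> \<Longrightarrow> \<delta> (\<iota> X3) \<in> carrier S"
  by (rule p_flowD(2)) (simp_all add: \<iota>_simps)

lemma reduction_exists:
  assumes "K \<in> carrier S"
  shows "\<exists>r\<in>RR. K \<ominus>\<^bsub>S\<^esub> \<iota> r \<in> multiples S p \<and> reduction K = cls r"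
proof -
  obtain r where r: "r \<in> RR" "K \<ominus>\<^bsub>S\<^esub> \<iota> r \<in> multiples S (p ^ 1)" using S_approx[OF assms] by blast
  then have "reduction K = reduction (\<iota> r)" using reduction_eq_iff[OF assms, of "\<iota> r"] by (simp add: \<iota>_simps)
  with r show ?thesis by (auto simp: reduction_\<iota>)
qed

lemma reduction_add:
  assumes "K \<in> carrier S" "L \<in> carrier S"
  shows "reduction (K \<oplus>\<^bsub>S\<^esub> L) = reduction K \<oplus>\<^bsub>Xbar\<^esub> reduction L"
proof -
  obtain u v where uv: "u \<in> RR" "K \<ominus>\<^bsub>S\<^esub> \<iota> u \<in> multiples S p" "reduction K = cls u"
    "v \<in> RR" "L \<ominus>\<^bsub>S\<^esub> \<iota> v \<in> multiples S p" "reduction L = cls v"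
    using reduction_exists[OF assms(1)] reduction_exists[OF assms(2)] by blast
  have "(K \<oplus>\<^bsub>S\<^esub> L) \<ominus>\<^bsub>S\<^esub> (\<iota> u \<oplus>\<^bsub>S\<^esub> \<iota> v) \<in> multiples S p"
    using uv assms by (intro S.multiples_cong_add) (simp_all add: \<iota>_simps)
  then have "reduction (K \<oplus>\<^bsub>S\<^esub> L) = reduction (\<iota> (u + v))"
    using uv assms by (simp add: reduction_eq_iff \<iota>_simps)
  then show ?thesis using uv by (simp add: reduction_\<iota> cls_simps)
qed

text \<open>With \<delta> x_3 represented by a fraction r, everything turns on whether
  \<open>dd r - flow_rhs\<close> vanishes modulo p. If it does, \<open>flow_conditionI\<close> gives
  the condition on all level sets. Conversely the condition yields its vanishing at points, and
  \<open>density\<close> concludes.\<close>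

lemma arithmetic_euler_flow_red:
  "arithmetic_euler_flow p a \<delta> \<longleftrightarrow> p_flow \<delta> \<and> delta_cl p a (red \<delta>) = cls flow_rhs"
proof (cases "p_flow \<delta>")
  case True
  obtain r where r: "r \<in> RR" "\<delta> (\<iota> X3) \<ominus>\<^bsub>S\<^esub> \<iota> r \<in> multiples S p" "red \<delta> = cls r"
    using reduction_exists[OF p_flow_X3[OF True]] unfolding red_def by blast
  have rhs: "dd r - flow_rhs \<in> RR" using dd_RR[OF r(1)] flow_rhs_RR by (rule RR_diff)
  have "delta_cl p a (red \<delta>) = cls flow_rhs \<longleftrightarrow> dd r - flow_rhs \<in> multiples R p"
    using r dd_RR[OF r(1)] flow_rhs_RR by (simp add: delta_cl_cos cls_eq_iff)
  also have "\<dots> \<longleftrightarrow> (\<forall>c1 c2. level_set p \<pi> a c1 c2 \<longrightarrow> level_condition c1 c2 \<delta>)"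
  proof (intro iffI allI impI)
    fix c1 c2 assume eq: "dd r - flow_rhs \<in> multiples R p" and "level_set p \<pi> a c1 c2"
    then have "level_flow p \<pi> a c1 c2 \<delta>" using True by (intro level_flow.intro level_flow_axioms.intro)
    from level_flow.level_conditionI[OF this r(1,2) eq] show "level_condition c1 c2 \<delta>" .
  next
    assume cond: "\<forall>c1 c2. level_set p \<pi> a c1 c2 \<longrightarrow> level_condition c1 c2 \<delta>"
    show "dd r - flow_rhs \<in> multiples R p"
    proof (rule density[OF rhs])
      fix x assume x: "\<not> \<pi> dvd poly3_eval x Q"
      \<comment> \<open>The point x need not lie on a level set of p-constants. A congruent point y
        does, and by \<open>ev_cong\<close> the value at x is congruent to that at y.\<close>
      obtain y where y: "\<And>i. i \<in> {1, 2, 3} \<Longrightarrow> \<pi> dvd x i - y i" "\<not> \<pi> dvd poly3_eval y Q"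
          "the_p_derivation p (poly3_eval y (H1 a)) = 0" "the_p_derivation p (poly3_eval y H2) = 0"
        using constant_point_lift[OF x] by blast
      define c1 c2 where "c1 = poly3_eval y (H1 a)" and "c2 = poly3_eval y H2"
      \<comment> \<open>N and the Hasse invariant, evaluated at (H_1, H_2), are factors of Q, which
        does not vanish modulo \<pi> at y.\<close>
      have "\<not> \<pi> dvd eval2 id (N_poly a) c1 c2 * eval2 id (hasse p a) c1 c2"
        using y(2) unfolding poly3_eval_Q c1_def[symmetric] c2_def[symmetric] by (metis dvd_mult mult.assoc)
      then have ls: "level_set p \<pi> a c1 c2"
        using y(3,4) euler_setting_axioms unfolding c1_def c2_def
        by (intro level_set.intro level_set_axioms.intro)
      then have lp: "level_point p \<pi> a c1 c2 \<delta> y"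
        using True y(2)
        by (intro level_point.intro level_flow.intro level_flow_axioms.intro level_point_axioms.intro)
          (simp_all add: c1_def c2_def)
      have "\<pi> dvd ev y (dd r - flow_rhs)"
        using level_point.level_condition_point[OF lp _ r(1,2)] cond ls by blast
      moreover have "\<pi> dvd ev x (dd r - flow_rhs) - ev y (dd r - flow_rhs)"
        by (rule ev_cong[OF x y(2,1) rhs])
      ultimately show "\<pi> dvd ev x (dd r - flow_rhs)" by (metis diff_add_cancel dvd_add)
    qed
  qed
  finally show ?thesis using True by (simp add: arithmetic_euler_flow_iff)
qed (simp add: arithmetic_euler_flow_iff)

section \<open>Classes of flows as solutions of the flow equation\<close>

abbreviation "flows \<equiv> euler_flows p a"

definition solutions :: "'a poly poly poly fract set set"
  where "solutions = {K \<in> carrier Xbar. delta_cl p a K = cls flow_rhs}"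

lemma red_closed: "p_flow \<delta> \<Longrightarrow> red \<delta> \<in> carrier Xbar"
  using reduction_exists[OF p_flow_X3, of \<delta>] by (auto simp: red_def cls_simps)

lemma flowsD: "\<delta> \<in> flows \<Longrightarrow> p_flow \<delta>" "\<delta> \<in> flows \<Longrightarrow> red \<delta> \<in> solutions"
  by (auto simp: euler_flows_def arithmetic_euler_flow_red solutions_def red_closed)

lemma flows_surj: assumes "K \<in> solutions" shows "\<exists>\<delta>\<in>flows. red \<delta> = K"
proof -
  obtain f where f: "f \<in> RR" "K = cls f" using assms by (auto simp: solutions_def Xbar_carrier)
  obtain \<delta> where "p_flow \<delta>" "\<delta> (in_Xhat p a (var 3)) = \<iota> f"
    using p_flow_exists[of "\<iota> f"] f(1) by (auto simp: \<iota>_simps)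
  then have "p_flow \<delta>" "red \<delta> = K" by (simp_all add: red_def in_Xhat_eq reduction_\<iota> f)
  with assms show ?thesis
    by (intro bexI[of _ \<delta>]) (simp_all add: euler_flows_def arithmetic_euler_flow_red solutions_def)
qed

lemma solutions_nonempty: "solutions \<noteq> {}"
proof -
  obtain f where "f \<in> RR" "dd f = flow_rhs" using flow_equation_solvable by blast
  then have "cls f \<in> solutions" by (simp add: solutions_def cls_simps delta_cl_cos)
  then show ?thesis by blast
qed

text \<open>By \<open>p_flow_unique\<close> congruence is decided on x_3, so classes are told apart
  by \<open>red\<close> alone.\<close>

lemma flow_cong_iff: "(\<delta>, \<delta>') \<in> flow_cong p a \<longleftrightarrow> \<delta> \<in> flows \<and> \<delta>' \<in> flows \<and> red \<delta> = red \<delta>'"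
proof (cases "\<delta> \<in> flows \<and> \<delta>' \<in> flows")
  case True
  then have f: "p_flow \<delta>" "p_flow \<delta>'" by (auto dest: flowsD)
  have "red \<delta> = red \<delta>' \<longleftrightarrow> \<delta> (\<iota> X3) \<ominus>\<^bsub>S\<^esub> \<delta>' (\<iota> X3) \<in> multiples S p"
    unfolding red_def using f by (intro reduction_eq_iff p_flow_X3)
  also have "\<dots> \<longleftrightarrow> (\<forall>K\<in>carrier S. \<delta> K \<ominus>\<^bsub>S\<^esub> \<delta>' K \<in> multiples S p)"
    using p_flow_unique[OF f] by (auto simp: in_Xhat_eq \<iota>_simps)
  finally show ?thesis using True by (simp add: flow_cong_def cong_mod_def)
qed (auto simp: flow_cong_def)

definition fiber :: "'a poly poly poly fract set \<Rightarrow> ('a X_hat \<Rightarrow> 'a X_hat) set"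
  where "fiber K = {\<delta> \<in> flows. red \<delta> = K}"

text \<open>Every solution is a value of \<open>red\<close>, by lifting it to the completed ring and
  prescribing it as \<delta> x_3; so no fibre over a solution is empty.\<close>

lemma flow_classes_eq: "flow_classes p a = fiber ` solutions"
proof -
  have "flow_cong p a `` {\<delta>} = fiber (red \<delta>)" if "\<delta> \<in> flows" for \<delta>
    using that by (auto simp: flow_cong_iff fiber_def)
  then have "flow_classes p a = (\<lambda>\<delta>. fiber (red \<delta>)) ` flows"
    by (auto simp: flow_classes_def quotient_def)
  also have "\<dots> = fiber ` (red ` flows)" by (simp add: image_image)
  also have "red ` flows = solutions" using flowsD(2) flows_surj by blast
  finally show ?thesis .
qed

lemma fiber_inj: "K \<in> solutions \<Longrightarrow> fiber K = fiber L \<Longrightarrow> K = L"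
  using flows_surj[of K] by (auto simp: fiber_def)

abbreviation "kern \<equiv> {K \<in> carrier Xbar. delta_cl p a K = \<zero>\<^bsub>Xbar\<^esub>}"

lemma delta_cl_hom:
  assumes "K \<in> carrier Xbar" "L \<in> carrier Xbar"
  shows "delta_cl p a (K \<oplus>\<^bsub>Xbar\<^esub> L) = delta_cl p a K \<oplus>\<^bsub>Xbar\<^esub> delta_cl p a L"
    "delta_cl p a K \<in> carrier Xbar"
  using assms by (auto simp: Xbar_carrier cls_simps(2) RR_add delta_cl_cos dd dd_RR)

lemma delta_cl_zero: "delta_cl p a \<zero>\<^bsub>Xbar\<^esub> = \<zero>\<^bsub>Xbar\<^esub>"
  by (simp add: cls_simps(4) delta_cl_cos dd)

lemma delta_cl_minus:
  assumes K: "K \<in> carrier Xbar" and L: "L \<in> carrier Xbar"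
  shows "delta_cl p a (K \<ominus>\<^bsub>Xbar\<^esub> L) = delta_cl p a K \<ominus>\<^bsub>Xbar\<^esub> delta_cl p a L"
proof -
  have KL: "K \<ominus>\<^bsub>Xbar\<^esub> L \<in> carrier Xbar" using assms by simp
  have "delta_cl p a K = delta_cl p a L \<oplus>\<^bsub>Xbar\<^esub> delta_cl p a (K \<ominus>\<^bsub>Xbar\<^esub> L)"
    unfolding delta_cl_hom(1)[OF L KL, symmetric] using assms by simp
  then show ?thesis
    using Xbar.add_minus_cancel_left[OF delta_cl_hom(2)[OF L L] delta_cl_hom(2)[OF KL KL]] by simp
qed

lemma kern_subgroup: "subgroup kern (add_monoid Xbar)"
proof (rule Xbar.add.subgroupI)
  fix K assume K: "K \<in> kern"
  then have Kc: "K \<in> carrier Xbar" "delta_cl p a K = \<zero>\<^bsub>Xbar\<^esub>" by auto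
  have "delta_cl p a (\<zero>\<^bsub>Xbar\<^esub> \<ominus>\<^bsub>Xbar\<^esub> K) = \<zero>\<^bsub>Xbar\<^esub>"
    unfolding delta_cl_minus[OF Xbar.zero_closed Kc(1)] delta_cl_zero Kc(2) by simp
  then have "delta_cl p a (\<ominus>\<^bsub>Xbar\<^esub> K) = \<zero>\<^bsub>Xbar\<^esub>" using Kc(1) by (simp add: Xbar.minus_eq)
  then show "\<ominus>\<^bsub>Xbar\<^esub> K \<in> kern" using Kc(1) by simp
qed (auto simp: delta_cl_zero delta_cl_hom intro!: exI[of _ "\<zero>\<^bsub>Xbar\<^esub>"])

lemma solutions_kern:
  "t \<in> solutions \<Longrightarrow> K \<in> kern \<Longrightarrow> t \<oplus>\<^bsub>Xbar\<^esub> K \<in> solutions"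
  "t \<in> solutions \<Longrightarrow> t' \<in> solutions \<Longrightarrow> t' \<ominus>\<^bsub>Xbar\<^esub> t \<in> kern"
  using flow_rhs_RR by (auto simp: solutions_def delta_cl_hom delta_cl_minus cls_simps(1))

text \<open>Through \<open>red\<close> the action becomes translation by K in the set of solutions.
  The choice of a lift of K does not matter, since congruence modulo p only sees its reduction, and
  a lift exists.\<close>

lemma flow_action_fiber:
  assumes t: "t \<in> solutions" and K: "K \<in> kern"
  shows "flow_action p a K (fiber t) = fiber (t \<oplus>\<^bsub>Xbar\<^esub> K)"
proof -
  obtain k where k: "k \<in> RR" "K = cls k" using K by (auto simp: Xbar_carrier)
  have iff: "(\<exists>K'\<in>carrier S. reduction K' = K \<and> cong_mod p S (\<delta>' (\<iota> X3)) (\<delta> (\<iota> X3) \<oplus>\<^bsub>S\<^esub> K')) \<longleftrightarrow>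
      red \<delta>' = red \<delta> \<oplus>\<^bsub>Xbar\<^esub> K" if "\<delta> \<in> flows" "\<delta>' \<in> flows" for \<delta> \<delta>'
  proof -
    have c: "\<delta> (\<iota> X3) \<in> carrier S" "\<delta>' (\<iota> X3) \<in> carrier S" using that by (auto intro: p_flow_X3 flowsD)
    have "cong_mod p S (\<delta>' (\<iota> X3)) (\<delta> (\<iota> X3) \<oplus>\<^bsub>S\<^esub> K') \<longleftrightarrow> red \<delta>' = red \<delta> \<oplus>\<^bsub>Xbar\<^esub> reduction K'"
      if "K' \<in> carrier S" for K'
      unfolding cong_mod_def red_def reduction_add[OF c(1) that, symmetric]
      using c that by (intro reduction_eq_iff[symmetric]) simp_all
    moreover have "\<iota> k \<in> carrier S" "reduction (\<iota> k) = K" using k by (simp_all add: \<iota>_simps reduction_\<iota>)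
    ultimately show ?thesis by blast
  qed
  obtain \<delta> where \<delta>: "\<delta> \<in> fiber t" using flows_surj[OF t] by (auto simp: fiber_def)
  have "fiber t \<in> flow_classes p a" using t by (simp add: flow_classes_eq)
  then have "flow_action p a K (fiber t) = {\<delta>' \<in> flows. \<exists>\<delta>\<in>fiber t. red \<delta>' = red \<delta> \<oplus>\<^bsub>Xbar\<^esub> K}"
    unfolding flow_action_def in_Xhat_eq using iff by (auto simp: fiber_def)
  also have "\<dots> = fiber (t \<oplus>\<^bsub>Xbar\<^esub> K)" using \<delta> by (auto simp: fiber_def)
  finally show ?thesis .
qed

text \<open>Fibres of \<open>red\<close> correspond bijectively to solutions by
  \<open>fiber_inj\<close>, so the translation action on solutions carries over; two classes are
  connected by the difference of their solutions.\<close>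

lemma flows_torsor:
  "principal_homogeneous_space (delta_cl_kernel p a) (flow_classes p a) (flow_action p a)"
proof -
  define G where "G = delta_cl_kernel p a"
  define E where "E = flow_classes p a"
  have G_simps: "carrier G = kern" "x \<otimes>\<^bsub>G\<^esub> y = x \<oplus>\<^bsub>Xbar\<^esub> y" for x y
    by (simp_all add: G_def delta_cl_kernel_def)
  have group: "group G"
    unfolding G_def delta_cl_kernel_def
    by (rule subgroup.subgroup_is_group[OF kern_subgroup Xbar.add.is_group])
  have E: "E = fiber ` solutions" by (simp add: E_def flow_classes_eq)
  have kc: "K \<in> carrier Xbar" if "K \<in> kern" for K using that by simp
  have sc: "t \<in> carrier Xbar" if "t \<in> solutions" for t using that by (simp add: solutions_def)
  have neg: "\<ominus>\<^bsub>Xbar\<^esub> K \<in> kern" if "K \<in> kern" for K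
    using subgroup.m_inv_closed[OF kern_subgroup that] by (simp add: a_inv_def)
  have act: "flow_action p a K C \<in> E" if KC: "K \<in> kern" "C \<in> E" for K C
  proof -
    obtain t where t: "t \<in> solutions" "C = fiber t" using KC(2) E by blast
    show ?thesis
      unfolding t(2) flow_action_fiber[OF t(1) KC(1)] E using solutions_kern(1)[OF t(1) KC(1)] by (rule imageI)
  qed
  have add: "flow_action p a (K \<oplus>\<^bsub>Xbar\<^esub> L) C = flow_action p a K (flow_action p a L C)"
    if KLC: "K \<in> kern" "L \<in> kern" "C \<in> E" for K L C
  proof -
    obtain t where t: "t \<in> solutions" "C = fiber t" using KLC(3) E by blast
    have KL: "K \<oplus>\<^bsub>Xbar\<^esub> L \<in> kern" using subgroup.m_closed[OF kern_subgroup KLC(1,2)] by simp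
    show ?thesis
      unfolding t(2) flow_action_fiber[OF t(1) KL] flow_action_fiber[OF t(1) KLC(2)]
        flow_action_fiber[OF solutions_kern(1)[OF t(1) KLC(2)] KLC(1)]
      using kc[OF KLC(1)] kc[OF KLC(2)] sc[OF t(1)] by (simp add: Xbar.a_ac)
  qed
  have zero: "flow_action p a \<zero>\<^bsub>Xbar\<^esub> C = C" if C: "C \<in> E" for C
  proof -
    obtain t where t: "t \<in> solutions" "C = fiber t" using C E by blast
    have "\<zero>\<^bsub>Xbar\<^esub> \<in> kern" by (simp add: delta_cl_zero)
    then show ?thesis unfolding t(2) flow_action_fiber[OF t(1) \<open>\<zero>\<^bsub>Xbar\<^esub> \<in> kern\<close>] using sc[OF t(1)] by simp
  qed
  have inv: "flow_action p a (\<ominus>\<^bsub>Xbar\<^esub> K) (flow_action p a K C) = C"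
      "flow_action p a K (flow_action p a (\<ominus>\<^bsub>Xbar\<^esub> K) C) = C" if "K \<in> kern" "C \<in> E" for K C
    unfolding add[OF neg[OF that(1)] that(1,2), symmetric] add[OF that(1) neg[OF that(1)] that(2), symmetric]
    using kc[OF that(1)] zero[OF that(2)] by (simp_all add: Xbar.l_neg Xbar.r_neg)
  have Bij: "flow_action p a K \<in> Bij E" if "K \<in> kern" for K
  proof -
    have "bij_betw (flow_action p a K) E E"
      by (rule bij_betwI[of _ _ _ "flow_action p a (\<ominus>\<^bsub>Xbar\<^esub> K)"];
        intro funcsetI act[OF that] act[OF neg[OF that]] inv[OF that])
    \<comment> \<open>Elements of \<open>BijGroup\<close> are extensional functions; this is why
      \<open>flow_action\<close> is restricted to the classes.\<close>
    moreover have "flow_action p a K \<in> extensional E" by (simp add: flow_action_def E_def)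
    ultimately show ?thesis by (simp add: Bij_def)
  qed
  have "group_hom G (BijGroup E) (flow_action p a)"
  proof (intro group_hom.intro group_hom_axioms.intro group group_BijGroup homI)
    fix K L assume KL: "K \<in> carrier G" "L \<in> carrier G"
    then have k: "K \<in> kern" "L \<in> kern" by (simp_all only: G_simps)
    show "flow_action p a K \<in> carrier (BijGroup E)" using Bij[OF k(1)] by (simp add: BijGroup_def)
    have KL': "K \<oplus>\<^bsub>Xbar\<^esub> L \<in> kern" using subgroup.m_closed[OF kern_subgroup k] by simp
    have "flow_action p a (K \<oplus>\<^bsub>Xbar\<^esub> L) = compose E (flow_action p a K) (flow_action p a L)"
    proof (rule extensionalityI[of _ E])
      show "flow_action p a (K \<oplus>\<^bsub>Xbar\<^esub> L) \<in> extensional E" by (simp add: flow_action_def E_def)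
      show "compose E (flow_action p a K) (flow_action p a L) \<in> extensional E" by (rule compose_extensional)
      show "flow_action p a (K \<oplus>\<^bsub>Xbar\<^esub> L) C = compose E (flow_action p a K) (flow_action p a L) C"
        if "C \<in> E" for C using add[OF k that] that by (simp add: compose_def)
    qed
    then show "flow_action p a (K \<otimes>\<^bsub>G\<^esub> L) = flow_action p a K \<otimes>\<^bsub>BijGroup E\<^esub> flow_action p a L"
      using Bij[OF k(1)] Bij[OF k(2)] by (simp add: G_simps BijGroup_def)
  qed
  then have "group_action G E (flow_action p a)" by (rule group_action.intro)
  moreover have "E \<noteq> {}" using solutions_nonempty by (simp add: E)
  moreover have "\<exists>!g. g \<in> carrier G \<and> flow_action p a g C = C'" if CC: "C \<in> E" "C' \<in> E" for C C'
  proof -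
    obtain t t' where t: "t \<in> solutions" "C = fiber t" "t' \<in> solutions" "C' = fiber t'" using CC E by blast
    show ?thesis
    proof (rule ex1I[of _ "t' \<ominus>\<^bsub>Xbar\<^esub> t"])
      have d: "t' \<ominus>\<^bsub>Xbar\<^esub> t \<in> kern" by (rule solutions_kern(2)[OF t(1,3)])
      show "t' \<ominus>\<^bsub>Xbar\<^esub> t \<in> carrier G \<and> flow_action p a (t' \<ominus>\<^bsub>Xbar\<^esub> t) C = C'"
        unfolding G_simps t(2,4) flow_action_fiber[OF t(1) d] using d sc[OF t(1)] sc[OF t(3)] by simp
      fix g assume "g \<in> carrier G \<and> flow_action p a g C = C'"
      then have g: "g \<in> kern" "fiber (t \<oplus>\<^bsub>Xbar\<^esub> g) = fiber t'"
        unfolding G_simps t(2,4) by (auto simp: flow_action_fiber[OF t(1)])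
      have "t \<oplus>\<^bsub>Xbar\<^esub> g = t'" using solutions_kern(1)[OF t(1) g(1)] g(2) by (rule fiber_inj)
      then show "g = t' \<ominus>\<^bsub>Xbar\<^esub> t" using Xbar.add_minus_cancel_left[OF sc[OF t(1)] kc[OF g(1)]] by simp
    qed
  qed
  ultimately show ?thesis by (simp add: principal_homogeneous_space_def G_def E_def)
qed

end

text \<open>Finitely many elements of A meet only finitely many residue classes.\<close>

lemma infinite_residues_type_algebra:
  assumes inf: "infinite (carrier (residue_field p (ring_of_type_algebra :: 'a::idom ring)))"
    and Z: "finite Z"
  shows "\<exists>x::'a. \<forall>y\<in>Z. \<not> of_nat p dvd x - y"
proof -
  let ?T = "ring_of_type_algebra :: 'a ring"
  interpret T: cring ?T by (rule cring_from_type_algebra)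
  define M where "M = PIdl\<^bsub>?T\<^esub> ([p] \<cdot>\<^bsub>?T\<^esub> \<one>\<^bsub>?T\<^esub>)"
  have M: "M = {x. of_nat p dvd x}" by (auto simp: M_def cgenideal_def dvd_def mult.commute)
  interpret M: ideal M ?T unfolding M_def by (rule T.cgenideal_ideal) simp
  have car: "carrier (residue_field p ?T) = range (\<lambda>x. M +>\<^bsub>?T\<^esub> x)"
    by (auto simp: FactRing_def A_RCOSETS_def' M_def)
  have "\<not> range (\<lambda>x. M +>\<^bsub>?T\<^esub> x) \<subseteq> (\<lambda>x. M +>\<^bsub>?T\<^esub> x) ` Z"
    using inf Z unfolding car by (meson finite_imageI finite_subset)
  then obtain x where x: "M +>\<^bsub>?T\<^esub> x \<notin> (\<lambda>x. M +>\<^bsub>?T\<^esub> x) ` Z" by blast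
  have neg: "\<ominus>\<^bsub>?T\<^esub> y = - y" for y by (rule T.minus_equality) simp_all
  have "\<not> of_nat p dvd x - y" if "y \<in> Z" for y
  proof
    assume "of_nat p dvd x - y"
    then have "M +>\<^bsub>?T\<^esub> x = M +>\<^bsub>?T\<^esub> y" by (subst M.coset_eq_iff) (simp_all add: M T.minus_eq neg)
    with x that show False by blast
  qed
  then show ?thesis by blast
qed

theorem theorem1p2:
  fixes p :: nat and a :: "nat \<Rightarrow> 'a::idom"
  assumes "Factorial_Ring.prime p" and "odd p"
    and "complete_dvr p (ring_of_type_algebra :: 'a ring)"
    and "algebraic_over_prime_field (residue_field p (ring_of_type_algebra :: 'a ring))"
    and "infinite (carrier (residue_field p (ring_of_type_algebra :: 'a ring)))"
    and "(a 1 - a 2) * (a 2 - a 3) * (a 3 - a 1) dvd 1"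
  shows "principal_homogeneous_space (delta_cl_kernel p a) (flow_classes p a) (flow_action p a)"
proof -
  have "euler_setting p (of_nat p) a"
    by (intro euler_setting.intro infinite_residue_dvr.intro infinite_residue_dvr_axioms.intro
        euler_setting_axioms.intro complete_dvr_unramified infinite_residues_type_algebra assms)
  then show ?thesis by (rule euler_setting.flows_torsor)
qed

end
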